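(* Let $s,t\geq 1$ be integers, $r,r'\in\mathbb{Z}_2$ and $\eta\in\mathbb{P}^1(k)$. The following isomorphisms of $D_4$-modules hold. (1) If $s$ is odd, then $M_t(r,\eta)\otimes\Omega^{-s}V(r')\cong stP(r+r'+1)\oplus M_t(r+r'+1,\eta)$. (2) If $s$ is even, then $M_t(r,\eta)\otimes\Omega^{-s}V(r')\cong stP(r+r')\oplus M_t(r+r',\eta)$.
   Context: Let $k$ be an algebraically closed field with $\mathrm{char}(k)\neq 2$. All modules are finite-dimensional left modules; $\otimes=\otimes_k$; $\mathbb{Z}_2=\mathbb{Z}/2\mathbb{Z}$; $nM$ denotes the direct sum of $n$ copies of $M$; $\mathbb{P}^1(k)$ is identified with $k\cup\{\infty\}$; $l(M)$ is the length of $M$. $D_4$ is the $k$-algebra generated by $a,b,c,d$ subject to $ba=-ab$, $db=-bd$, $ca=-ac$, $dc=-cd$, $bc=cb$, $a^2=0$, $b^2=1$, $c^2=1$, $d^2=0$, $da+ad=1-bc$. It is a $16$-dimensional Hopf algebra (isomorphic to the Drinfeld double of Sweedler's 4-dimensional Hopf algebra) with comultiplication $\Delta(a)=a\otimes b+1\otimes a$, $\Delta(b)=b\otimes b$, $\Delta(c)=c\otimes c$, $\Delta(d)=d\otimes c+1\otimes d$, counit $\varepsilon(a)=\varepsilon(d)=0$, $\varepsilon(b)=\varepsilon(c)=1$, antipode $S(a)=-ab$, $S(b)=b$, $S(c)=c$, $S(d)=-dc$. Tensor products of $D_4$-modules are $D_4$-modules via $\Delta$. For $r\in\mathbb{Z}_2$,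 $V(r)$ is the one-dimensional simple module on which $a,d$ act as $0$ and $b,c$ act as $(-1)^r$, and $P(r)$ is the projective cover of $V(r)$. For a module $M$, $\Omega^{-1}M$ is the cokernel of an injective envelope $M\to I(M)$, and $\Omega^{-s}$ is the $s$-fold iterate of $\Omega^{-1}$. For $r\in\mathbb{Z}_2$, $\eta\in\mathbb{P}^1(k)$, $M_1(r,\eta)$ is the module with basis $v_1,v_2$ where $b,c$ act on $v_1$ as $(-1)^{r+1}$ and on $v_2$ as $(-1)^r$, $av_2=dv_2=0$, and $av_1=v_2$, $dv_1=-\eta v_2$ if $\eta\in k$, while $av_1=0$, $dv_1=v_2$ if $\eta=\infty$. An indecomposable module $M$ of Loewy length $2$ is of $(s,t)$-type if $l(M/\mathrm{soc}(M))=s$ and $l(\mathrm{soc}(M))=t$. For $s\geq1$, $M_s(r,\eta)$ denotes the (known to be unique up to isomorphism) indecomposable module of $(s,s)$-type containing a submodule isomorphic to $M_1(r,\eta)$. *)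

theory Defs
  imports
    "HOL-Library.Z2"
    "HOL-Computational_Algebra.Polynomial"
    "Jordan_Normal_Form.Matrix_Kernel"
begin

section \<open>Finite-dimensional left modules over \<open>D\<^sub>4\<close>\<close>

text \<open>
  \<open>D\<^sub>4\<close> is given by generators and relations, so a finite-dimensional left module is a
  finite-dimensional vector space with four endomorphisms satisfying the relations.  Every such
  module is isomorphic to one with underlying space \<open>k\<^sup>n = carrier_vec n\<close>, and these are the
  modules considered here; the generators act on column vectors by \<open>*\<^sub>v\<close>.  Quantification
  over all modules is thus quantification over all \<open>n\<close> and all quadruples of matrices.
\<close>

record 'k d4_rep =
  rdim :: nat
  act_a :: "'k mat"
  act_b :: "'k mat"
  act_c :: "'k mat"
  act_d :: "'k mat"

definition d4_module :: "('k :: field) d4_rep \<Rightarrow> bool" where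
  "d4_module M \<longleftrightarrow>
     (let n = rdim M; a = act_a M; b = act_b M; c = act_c M; d = act_d M in
        a \<in> carrier_mat n n \<and> b \<in> carrier_mat n n \<and> c \<in> carrier_mat n n \<and> d \<in> carrier_mat n n \<and>
        b * a = - (a * b) \<and> d * b = - (b * d) \<and> c * a = - (a * c) \<and> d * c = - (c * d) \<and>
        b * c = c * b \<and>
        a * a = 0\<^sub>m n n \<and> b * b = 1\<^sub>m n \<and> c * c = 1\<^sub>m n \<and> d * d = 0\<^sub>m n n \<and>
        d * a + a * d = 1\<^sub>m n - b * c)"

abbreviation space :: "('k :: field) d4_rep \<Rightarrow> 'k vec set" where
  "space M \<equiv> carrier_vec (rdim M)"

abbreviation zero_sub :: "('k :: field) d4_rep \<Rightarrow> 'k vec set" where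
  "zero_sub M \<equiv> {0\<^sub>v (rdim M)}"

subsection \<open>Homomorphisms\<close>

definition is_hom :: "('k :: field) d4_rep \<Rightarrow> 'k d4_rep \<Rightarrow> 'k mat \<Rightarrow> bool" where
  "is_hom M N F \<longleftrightarrow>
     F \<in> carrier_mat (rdim N) (rdim M) \<and>
     F * act_a M = act_a N * F \<and> F * act_b M = act_b N * F \<and>
     F * act_c M = act_c N * F \<and> F * act_d M = act_d N * F"

definition is_mono :: "('k :: field) d4_rep \<Rightarrow> 'k d4_rep \<Rightarrow> 'k mat \<Rightarrow> bool" where
  "is_mono M N F \<longleftrightarrow> is_hom M N F \<and> inj_on ((*\<^sub>v) F) (space M)"

definition is_epi :: "('k :: field) d4_rep \<Rightarrow> 'k d4_rep \<Rightarrow> 'k mat \<Rightarrow> bool" where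
  "is_epi M N F \<longleftrightarrow> is_hom M N F \<and> (*\<^sub>v) F ` space M = space N"

definition d4_iso :: "('k :: field) d4_rep \<Rightarrow> 'k d4_rep \<Rightarrow> bool" (infix \<open>\<cong>\<^sub>D\<close> 50) where
  "M \<cong>\<^sub>D N \<longleftrightarrow> (\<exists>F. is_hom M N F \<and> bij_betw ((*\<^sub>v) F) (space M) (space N))"

subsection \<open>Direct sums and tensor products\<close>

definition block_diag :: "('k :: field) mat \<Rightarrow> 'k mat \<Rightarrow> 'k mat" where
  "block_diag A B =
     four_block_mat A (0\<^sub>m (dim_row A) (dim_col B)) (0\<^sub>m (dim_row B) (dim_col A)) B"

definition d4_sum :: "('k :: field) d4_rep \<Rightarrow> 'k d4_rep \<Rightarrow> 'k d4_rep" (infixr \<open>\<oplus>\<^sub>D\<close> 65) where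
  "M \<oplus>\<^sub>D N =
     \<lparr> rdim = rdim M + rdim N,
       act_a = block_diag (act_a M) (act_a N),
       act_b = block_diag (act_b M) (act_b N),
       act_c = block_diag (act_c M) (act_c N),
       act_d = block_diag (act_d M) (act_d N) \<rparr>"

definition zero_rep :: "('k :: field) d4_rep" where
  "zero_rep = \<lparr> rdim = 0, act_a = 0\<^sub>m 0 0, act_b = 0\<^sub>m 0 0, act_c = 0\<^sub>m 0 0, act_d = 0\<^sub>m 0 0 \<rparr>"

primrec copies :: "nat \<Rightarrow> ('k :: field) d4_rep \<Rightarrow> 'k d4_rep" where
  "copies 0 M = zero_rep"
| "copies (Suc n) M = M \<oplus>\<^sub>D copies n M"

text \<open>
  Kronecker product: the matrix of \<open>A \<otimes> B\<close> with respect to the product basis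
  \<open>e\<^sub>i \<otimes> f\<^sub>j\<close>, which has index \<open>i * m + j\<close>, where \<open>m\<close> is the dimension of the second factor.
\<close>

definition kron :: "('k :: field) mat \<Rightarrow> 'k mat \<Rightarrow> 'k mat" where
  "kron A B =
     mat (dim_row A * dim_row B) (dim_col A * dim_col B)
       (\<lambda>(i, j). A $$ (i div dim_row B, j div dim_col B) * B $$ (i mod dim_row B, j mod dim_col B))"

text \<open>
  The action on the tensor product comes from
  \<open>\<Delta>(a) = a \<otimes> b + 1 \<otimes> a\<close>, \<open>\<Delta>(b) = b \<otimes> b\<close>, \<open>\<Delta>(c) = c \<otimes> c\<close>, \<open>\<Delta>(d) = d \<otimes> c + 1 \<otimes> d\<close>.
\<close>

definition d4_tensor :: "('k :: field) d4_rep \<Rightarrow> 'k d4_rep \<Rightarrow> 'k d4_rep" (infixr \<open>\<otimes>\<^sub>D\<close> 70) where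
  "M \<otimes>\<^sub>D N =
     \<lparr> rdim = rdim M * rdim N,
       act_a = kron (act_a M) (act_b N) + kron (1\<^sub>m (rdim M)) (act_a N),
       act_b = kron (act_b M) (act_b N),
       act_c = kron (act_c M) (act_c N),
       act_d = kron (act_d M) (act_c N) + kron (1\<^sub>m (rdim M)) (act_d N) \<rparr>"

subsection \<open>Submodules, quotients, socle, length\<close>

definition is_submodule :: "('k :: field) d4_rep \<Rightarrow> 'k vec set \<Rightarrow> bool" where
  "is_submodule M U \<longleftrightarrow>
     VectorSpace.subspace class_ring U (module_vec TYPE('k) (rdim M)) \<and>
     (\<forall>u\<in>U. act_a M *\<^sub>v u \<in> U \<and> act_b M *\<^sub>v u \<in> U \<and> act_c M *\<^sub>v u \<in> U \<and> act_d M *\<^sub>v u \<in> U)"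

definition is_simple_submodule :: "('k :: field) d4_rep \<Rightarrow> 'k vec set \<Rightarrow> bool" where
  "is_simple_submodule M S \<longleftrightarrow>
     is_submodule M S \<and> S \<noteq> zero_sub M \<and>
     (\<forall>U. is_submodule M U \<and> U \<subseteq> S \<longrightarrow> U = zero_sub M \<or> U = S)"

definition soc :: "('k :: field) d4_rep \<Rightarrow> 'k vec set" where
  "soc M = LinearCombinations.module.span class_ring (module_vec TYPE('k) (rdim M))
             (\<Union>{S. is_simple_submodule M S})"

text \<open>
  \<open>is_sub_rep M U S\<close> and \<open>is_quotient M U Q\<close>: the submodule \<open>U\<close> of \<open>M\<close>, respectively the
  quotient \<open>M/U\<close>, written in coordinates as the module \<open>S\<close>, respectively \<open>Q\<close>.
\<close>

definition is_sub_rep :: "('k :: field) d4_rep \<Rightarrow> 'k vec set \<Rightarrow> 'k d4_rep \<Rightarrow> bool" where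
  "is_sub_rep M U S \<longleftrightarrow> d4_module S \<and> (\<exists>F. is_mono S M F \<and> (*\<^sub>v) F ` space S = U)"

definition is_quotient :: "('k :: field) d4_rep \<Rightarrow> 'k vec set \<Rightarrow> 'k d4_rep \<Rightarrow> bool" where
  "is_quotient M U Q \<longleftrightarrow> d4_module Q \<and> (\<exists>F. is_epi M Q F \<and> mat_kernel F = U)"

text \<open>A composition series with \<open>n\<close> factors exists; by Jordan-Hoelder this determines \<open>n = l(M)\<close>.\<close>

definition has_length :: "('k :: field) d4_rep \<Rightarrow> nat \<Rightarrow> bool" where
  "has_length M n \<longleftrightarrow>
     (\<exists>U :: nat \<Rightarrow> 'k vec set.
        U 0 = zero_sub M \<and> U n = space M \<and>
        (\<forall>i\<le>n. is_submodule M (U i)) \<and>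
        (\<forall>i<n. U i \<subset> U (Suc i) \<and>
           \<not> (\<exists>W. is_submodule M W \<and> U i \<subset> W \<and> W \<subset> U (Suc i))))"

text \<open>The Loewy length, as the length of the socle series.\<close>

primrec has_loewy_length :: "nat \<Rightarrow> ('k :: field) d4_rep \<Rightarrow> bool" where
  "has_loewy_length 0 M \<longleftrightarrow> rdim M = 0"
| "has_loewy_length (Suc n) M \<longleftrightarrow>
     rdim M \<noteq> 0 \<and> (\<exists>Q. is_quotient M (soc M) Q \<and> has_loewy_length n Q)"

definition indecomposable :: "('k :: field) d4_rep \<Rightarrow> bool" where
  "indecomposable M \<longleftrightarrow>
     d4_module M \<and> rdim M \<noteq> 0 \<and>
     (\<forall>X Y. d4_module X \<and> d4_module Y \<and> M \<cong>\<^sub>D X \<oplus>\<^sub>D Y \<longrightarrow> rdim X = 0 \<or> rdim Y = 0)"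

definition has_type :: "nat \<Rightarrow> nat \<Rightarrow> ('k :: field) d4_rep \<Rightarrow> bool" where
  "has_type s t M \<longleftrightarrow>
     indecomposable M \<and> has_loewy_length 2 M \<and>
     (\<exists>Q. is_quotient M (soc M) Q \<and> has_length Q s) \<and>
     (\<exists>S. is_sub_rep M (soc M) S \<and> has_length S t)"

subsection \<open>Projective covers, injective envelopes and \<open>\<Omega>\<^sup>-\<^sup>s\<close>\<close>

definition is_projective :: "('k :: field) d4_rep \<Rightarrow> bool" where
  "is_projective P \<longleftrightarrow>
     d4_module P \<and>
     (\<forall>X Y f g. d4_module X \<and> d4_module Y \<and> is_epi X Y f \<and> is_hom P Y g \<longrightarrow>
        (\<exists>h. is_hom P X h \<and> f * h = g))"

definition is_injective :: "('k :: field) d4_rep \<Rightarrow> bool" where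
  "is_injective I \<longleftrightarrow>
     d4_module I \<and>
     (\<forall>X Y f g. d4_module X \<and> d4_module Y \<and> is_mono X Y f \<and> is_hom X I g \<longrightarrow>
        (\<exists>h. is_hom Y I h \<and> h * f = g))"

text \<open>
  \<open>projective_cover M P\<close>: \<open>P\<close> is a projective cover of \<open>M\<close>, i.e. projective with an epimorphism
  onto \<open>M\<close> that maps no proper submodule of \<open>P\<close> onto \<open>M\<close>.
\<close>

definition projective_cover :: "('k :: field) d4_rep \<Rightarrow> 'k d4_rep \<Rightarrow> bool" where
  "projective_cover M P \<longleftrightarrow>
     is_projective P \<and>
     (\<exists>p. is_epi P M p \<and>
        (\<forall>U. is_submodule P U \<and> (*\<^sub>v) p ` U = space M \<longrightarrow> U = space P))"

definition injective_envelope :: "('k :: field) d4_rep \<Rightarrow> 'k d4_rep \<Rightarrow> 'k mat \<Rightarrow> bool" where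
  "injective_envelope M I i \<longleftrightarrow>
     is_injective I \<and> is_mono M I i \<and>
     (\<forall>U. is_submodule I U \<and> U \<inter> (*\<^sub>v) i ` space M = zero_sub I \<longrightarrow> U = zero_sub I)"

definition cosyzygy :: "('k :: field) d4_rep \<Rightarrow> 'k d4_rep \<Rightarrow> bool" where
  "cosyzygy M C \<longleftrightarrow>
     (\<exists>I i. injective_envelope M I i \<and> is_quotient I ((*\<^sub>v) i ` space M) C)"

text \<open>\<open>cosyzygy_pow s M C\<close>: the module \<open>C\<close> represents \<open>\<Omega>\<^sup>-\<^sup>s M\<close>.\<close>

primrec cosyzygy_pow :: "nat \<Rightarrow> ('k :: field) d4_rep \<Rightarrow> 'k d4_rep \<Rightarrow> bool" where
  "cosyzygy_pow 0 M C \<longleftrightarrow> C = M"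
| "cosyzygy_pow (Suc s) M C \<longleftrightarrow> (\<exists>X. cosyzygy_pow s M X \<and> cosyzygy X C)"

section \<open>The modules \<open>V(r)\<close> and \<open>M\<^sub>s(r, \<eta>)\<close>\<close>

text \<open>Elements of \<open>\<int>/2\<close> are modelled by \<^typ>\<open>bit\<close>; \<open>bsign r\<close> is \<open>(-1)\<^sup>r\<close>.\<close>

definition bsign :: "bit \<Rightarrow> 'k :: field" where
  "bsign r = (if r = 0 then 1 else - 1)"

datatype 'k proj_line = Fin 'k | Infty

definition rep_V :: "bit \<Rightarrow> ('k :: field) d4_rep" where
  "rep_V r = \<lparr> rdim = 1, act_a = 0\<^sub>m 1 1, act_b = bsign r \<cdot>\<^sub>m 1\<^sub>m 1, act_c = bsign r \<cdot>\<^sub>m 1\<^sub>m 1, act_d = 0\<^sub>m 1 1 \<rparr>"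

text \<open>The basis \<open>v\<^sub>1, v\<^sub>2\<close> consists of the standard unit vectors with index \<open>0\<close> and \<open>1\<close>.\<close>

definition rep_M1 :: "bit \<Rightarrow> ('k :: field) proj_line \<Rightarrow> 'k d4_rep" where
  "rep_M1 r \<eta> =
     (let g = mat_of_rows_list 2 [[bsign (r + 1), 0], [0, bsign r]];
          x = (case \<eta> of Fin e \<Rightarrow> 1 | Infty \<Rightarrow> 0);
          y = (case \<eta> of Fin e \<Rightarrow> - e | Infty \<Rightarrow> 1)
      in \<lparr> rdim = 2,
           act_a = mat_of_rows_list 2 [[0, 0], [x, 0]],
           act_b = g,
           act_c = g,
           act_d = mat_of_rows_list 2 [[0, 0], [y, 0]] \<rparr>)"

text \<open>
  \<open>is_rep_M s r \<eta> M\<close>: the module \<open>M\<close> represents the isomorphism class \<open>M\<^sub>s(r, \<eta>)\<close>.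
\<close>

definition is_rep_M :: "nat \<Rightarrow> bit \<Rightarrow> ('k :: field) proj_line \<Rightarrow> 'k d4_rep \<Rightarrow> bool" where
  "is_rep_M s r \<eta> M \<longleftrightarrow>
     has_type s s M \<and>
     (\<exists>U S. is_submodule M U \<and> is_sub_rep M U S \<and> S \<cong>\<^sub>D rep_M1 r \<eta>)"

end

theory Submission
  imports Defs
begin

text \<open>
  All modules involved lie in the block on which the central element \<open>bc\<close> acts as \<open>1\<close>: there \<open>a\<close>
  and \<open>d\<close> anticommute and square to zero, and \<open>b\<close> is a grading that they reverse.

  The cosyzygy \<open>W = \<Omega>\<^sup>-\<^sup>sV(r')\<close> is a zigzag \<open>w\<^sub>0, u\<^sub>0, w\<^sub>1, \<dots>, u\<^sub>s\<^sub>-\<^sub>1, w\<^sub>s\<close> with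
  \<open>a u\<^sub>j = w\<^sub>j\<close> and \<open>d u\<^sub>j = w\<^sub>j\<^sub>+\<^sub>1\<close>.  On \<open>M\<^sub>t(r, \<eta>)\<close> the elements \<open>a\<close> and \<open>d\<close> form a square matrix
  pencil from the top to the socle; indecomposability and the submodule \<open>M\<^sub>1(r, \<eta>)\<close> force it to be one
  Jordan block with eigenvalue \<open>\<eta>\<close>, with basis \<open>x\<^sub>i\<close> of the top and \<open>y\<^sub>i\<close> of the socle.

  In \<open>M\<^sub>t(r, \<eta>) \<otimes> W\<close> the vectors \<open>x\<^sub>i \<otimes> u\<^sub>j\<close> define a map from \<open>st\<close> copies of the projective module,
  and \<open>M\<^sub>t(r, \<eta>) \<otimes> w\<close> is again a module of type \<open>M\<^sub>t\<close>, where \<open>w\<close> is \<open>w\<^sub>0\<close> if \<open>\<eta>\<close> is finite and \<open>w\<^sub>s\<close>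
  if \<open>\<eta> = \<infinity>\<close>.  Walking along the zigzag from that end, one sees that together they generate everything;
  the dimensions \<open>4st + 2t = 2t(2s + 1)\<close> agree, so the resulting surjection is an isomorphism.
\<close>

section \<open>Linear algebra in coordinates\<close>

text \<open>\<open>W\<close>, \<open>P\<close> and \<open>Mt\<close> are known only through
  universal properties, lengths and indecomposability, so each is reduced to a basis with an
  explicit action: \<open>omega_chain\<close>, \<open>free_generator\<close>,
  \<open>jordan_basis\<close>. These data determine the module, hence the uniqueness of M_t(r,
  \<eta>) comes out of the argument and does not enter it. Since 2 is invertible, b and bc split
  every module into eigenspaces, and idempotent endomorphisms of an indecomposable module are 0 or
  1. The obstacle is that a square pencil may be singular, so that there is no operator whose Jordan
  form could be taken; its kernel vectors over k[T], the closed chains, have to be excluded. The end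
  of the zigzag from which the walk starts is dictated by \<eta>: passing from x_i \<otimes> w_j to
  y_i \<otimes> u_j uses an operator that sends x_i to y_i, up to a scalar. This is a for finite
  \<eta> and d for \<eta> = \<infinity>. The shift of r + r' by 1 for odd s is the sign of b on the
  lower row of the zigzag, which each cosyzygy reverses.\<close>

definition subsp :: "nat \<Rightarrow> ('k :: field) vec set \<Rightarrow> bool" where
  "subsp n U \<longleftrightarrow> U \<subseteq> carrier_vec n \<and> 0\<^sub>v n \<in> U \<and>
     (\<forall>u\<in>U. \<forall>v\<in>U. u + v \<in> U) \<and> (\<forall>c. \<forall>u\<in>U. c \<cdot>\<^sub>v u \<in> U)"

lemma subspD:
  assumes "subsp n U"
  shows "U \<subseteq> carrier_vec n" "0\<^sub>v n \<in> U" "\<And>u v. u \<in> U \<Longrightarrow> v \<in> U \<Longrightarrow> u + v \<in> U"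
    "\<And>c u. u \<in> U \<Longrightarrow> c \<cdot>\<^sub>v u \<in> U" "\<And>u. u \<in> U \<Longrightarrow> u \<in> carrier_vec n"
  using assms by (auto simp: subsp_def)

lemma minus_eq_add_smult_vec:
  assumes "u \<in> carrier_vec n" "v \<in> carrier_vec n"
  shows "u - v = u + (- 1 :: 'k :: field) \<cdot>\<^sub>v v"
  using assms by (intro eq_vecI) auto

lemma subsp_minus:
  assumes "subsp n U" "u \<in> U" "v \<in> U"
  shows "u - v \<in> U"
  using assms minus_eq_add_smult_vec[of u n v] subspD[OF assms(1)] by metis

lemma subsp_smult_cancel:
  assumes "subsp n U" "c \<noteq> 0" "c \<cdot>\<^sub>v u \<in> U"
  shows "u \<in> U"
proof -
  have "inverse c \<cdot>\<^sub>v (c \<cdot>\<^sub>v u) = u"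
    using assms(2) by (simp add: smult_smult_assoc)
  then show ?thesis using subspD(4)[OF assms(1,3), of "inverse c"] by simp
qed

lemma subsp_add_cancel:
  assumes "subsp n U" "u \<in> U" "v \<in> carrier_vec n" "u + v \<in> U"
  shows "v \<in> U"
proof -
  have "v = (u + v) - u"
    using assms(3) subspD(5)[OF assms(1,2)] by (intro eq_vecI) auto
  then show ?thesis using subsp_minus[OF assms(1,4,2)] by simp
qed

lemma subsp_carrier: "subsp n (carrier_vec n)"
  by (auto simp: subsp_def)

lemma subsp_zero: "subsp n {0\<^sub>v n}"
  by (auto simp: subsp_def)

text \<open>Bridge from the locale predicate inside \<open>is_submodule\<close> to bare closure
  conditions; later arguments about submodules stay on the side of \<open>subsp\<close>.\<close>

lemma subspace_iff_subsp:
  "VectorSpace.subspace class_ring U (module_vec TYPE('k :: field) n) \<longleftrightarrow> subsp n U"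
proof -
  interpret vec_space "TYPE('k)" n .
  show ?thesis
    unfolding subspace_def submodule_def subsp_def
    using vectorspace_axioms module_axioms
    by (auto simp: module_vec_simps class_ring_simps)
qed

lemma mult_mat_zero_vec:
  assumes "(A :: 'k :: field mat) \<in> carrier_mat n k"
  shows "A *\<^sub>v 0\<^sub>v k = 0\<^sub>v n"
  using assms by (intro eq_vecI) auto

lemma mult_mat_smult_vec:
  assumes "(A :: 'k :: field mat) \<in> carrier_mat n k" "v \<in> carrier_vec k"
  shows "A *\<^sub>v (c \<cdot>\<^sub>v v) = c \<cdot>\<^sub>v (A *\<^sub>v v)"
  using assms by (intro eq_vecI) auto

lemma mult_mat_minus_vec:
  assumes "(A :: 'k :: field mat) \<in> carrier_mat n k" "u \<in> carrier_vec k" "v \<in> carrier_vec k"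
  shows "A *\<^sub>v (u - v) = A *\<^sub>v u - A *\<^sub>v v"
  using assms by (intro eq_vecI) (auto simp: scalar_prod_minus_distrib[of _ k])

lemma mult_inverse_vec:
  assumes "(A :: 'k :: field mat) \<in> carrier_mat n k" "L \<in> carrier_mat k n" "L * A = 1\<^sub>m k" "v \<in> carrier_vec k"
  shows "L *\<^sub>v (A *\<^sub>v v) = v"
proof -
  have "L *\<^sub>v (A *\<^sub>v v) = (L * A) *\<^sub>v v" using assms(1,2,4) by simp
  also have "\<dots> = v" unfolding assms(3) using assms(4) by simp
  finally show ?thesis .
qed

lemma subsp_image:
  assumes A: "A \<in> carrier_mat n k" and U: "subsp k U"
  shows "subsp n ((*\<^sub>v) A ` U)"
proof -
  note D = subspD[OF U]
  have add: "A *\<^sub>v u + A *\<^sub>v v \<in> (*\<^sub>v) A ` U" if "u \<in> U" "v \<in> U" for u v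
    using D(3,5) that mult_add_distrib_mat_vec[OF A] by (intro image_eqI[of _ _ "u + v"]) auto
  have sm: "c \<cdot>\<^sub>v (A *\<^sub>v u) \<in> (*\<^sub>v) A ` U" if "u \<in> U" for c u
    using D(4,5) that mult_mat_smult_vec[OF A] by (intro image_eqI[of _ _ "c \<cdot>\<^sub>v u"]) auto
  have z: "0\<^sub>v n \<in> (*\<^sub>v) A ` U"
    using D(2) mult_mat_zero_vec[OF A] by (intro image_eqI[of _ _ "0\<^sub>v k"]) auto
  show ?thesis unfolding subsp_def using add sm z A D(5) by auto
qed

lemma subsp_vimage:
  assumes A: "A \<in> carrier_mat n k" and U: "subsp n U"
  shows "subsp k {v \<in> carrier_vec k. A *\<^sub>v v \<in> U}"
  unfolding subsp_def using subspD[OF U] A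
  by (auto simp: mult_mat_zero_vec[OF A] mult_mat_smult_vec[OF A] mult_add_distrib_mat_vec[OF A])

lemma subsp_eq_image:
  assumes "A \<in> carrier_mat n k" "B \<in> carrier_mat n k"
  shows "subsp k {v \<in> carrier_vec k. A *\<^sub>v v = B *\<^sub>v v}"
  unfolding subsp_def using assms
  by (auto simp: mult_mat_zero_vec[of _ n k] mult_mat_smult_vec[of _ n k] mult_add_distrib_mat_vec[of _ n k])

lemma subsp_kernel:
  assumes "A \<in> carrier_mat n k"
  shows "subsp k {v \<in> carrier_vec k. A *\<^sub>v v = 0\<^sub>v n}"
  using subsp_vimage[OF assms subsp_zero] by simp

lemma subsp_Int:
  assumes "subsp n U" "subsp n V"
  shows "subsp n (U \<inter> V)"
  using assms by (auto simp: subsp_def)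

lemma subsp_line:
  assumes "v \<in> carrier_vec n"
  shows "subsp n {c \<cdot>\<^sub>v v | c. True}"
proof -
  have "\<exists>c. 0\<^sub>v n = c \<cdot>\<^sub>v v" using assms by (intro exI[of _ 0]) auto
  moreover have "\<exists>e. c \<cdot>\<^sub>v v + d \<cdot>\<^sub>v v = e \<cdot>\<^sub>v v" for c d
    by (intro exI[of _ "c + d"]) (simp add: add_smult_distrib_vec)
  moreover have "\<exists>e. c \<cdot>\<^sub>v (d \<cdot>\<^sub>v v) = e \<cdot>\<^sub>v v" for c d
    by (intro exI[of _ "c * d"]) (simp add: smult_smult_assoc)
  ultimately show ?thesis using assms unfolding subsp_def by auto
qed

text \<open>Spanning is phrased as an induction principle: whatever holds on X and cuts out a
  subspace holds everywhere. Relations, homomorphisms and pure tensors can then be tested on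
  generators without writing out combinations.\<close>

definition spans :: "nat \<Rightarrow> ('k :: field) vec set \<Rightarrow> bool" where
  "spans n X \<longleftrightarrow> X \<subseteq> carrier_vec n \<and> (\<forall>U. subsp n U \<and> X \<subseteq> U \<longrightarrow> carrier_vec n \<subseteq> U)"

lemma spansD:
  assumes "spans n X" "subsp n U" "X \<subseteq> U" "v \<in> carrier_vec n"
  shows "v \<in> U"
  using assms by (auto simp: spans_def)

lemma spans_unit_vecs: "spans n ((unit_vec n :: nat \<Rightarrow> 'k :: field vec) ` {..<n})"
  unfolding spans_def
proof (intro conjI allI impI subsetI)
  fix U :: "'k vec set" and v :: "'k vec"
  assume U: "subsp n U \<and> unit_vec n ` {..<n} \<subseteq> U" and v: "v \<in> carrier_vec n"
  \<comment> \<open>The truncations of v to its first m coordinates are built up one unit vector at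
    a time.\<close>
  have "vec n (\<lambda>i. if i < m then v $ i else 0) \<in> U" if "m \<le> n" for m
    using that
  proof (induction m)
    case 0
    have "vec n (\<lambda>i. if i < 0 then v $ i else 0) = 0\<^sub>v n" by (intro eq_vecI) auto
    then show ?case using subspD(2)[of n U] U by simp
  next
    case (Suc m)
    have "vec n (\<lambda>i. if i < Suc m then v $ i else 0) =
        vec n (\<lambda>i. if i < m then v $ i else 0) + v $ m \<cdot>\<^sub>v unit_vec n m"
      using Suc.prems v by (intro eq_vecI) (auto simp: less_Suc_eq)
    moreover have "unit_vec n m \<in> U" using U Suc.prems by auto
    moreover have "vec n (\<lambda>i. if i < m then v $ i else 0) \<in> U" using Suc by simp
    ultimately show ?case using subspD(3,4)[of n U] U by simp
  qed
  from this[of n] have "vec n (\<lambda>i. if i < n then v $ i else 0) \<in> U" by simp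
  moreover have "vec n (\<lambda>i. if i < n then v $ i else 0) = v" using v by (intro eq_vecI) auto
  ultimately show "v \<in> U" by simp
qed auto

text \<open>The vectors on which two matrices agree form a subspace, and agreement on the unit
  vectors is agreement of the columns.\<close>

lemma mat_eqI_spans:
  assumes X: "spans k X" and A: "A \<in> carrier_mat n k" and B: "B \<in> carrier_mat n k"
    and eq: "\<And>v. v \<in> X \<Longrightarrow> A *\<^sub>v v = B *\<^sub>v v"
  shows "A = B"
proof -
  have "X \<subseteq> carrier_vec k" using X by (simp add: spans_def)
  then have *: "v \<in> {v \<in> carrier_vec k. A *\<^sub>v v = B *\<^sub>v v}" if "v \<in> carrier_vec k" for v
    using spansD[OF X subsp_eq_image[OF A B] _ that] eq by blast
  show ?thesis
  proof (rule eq_matI)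
    fix i j assume ij: "i < dim_row B" "j < dim_col B"
    then have "A *\<^sub>v unit_vec k j = B *\<^sub>v unit_vec k j" using *[of "unit_vec k j"] by auto
    then have "(A *\<^sub>v unit_vec k j) $ i = (B *\<^sub>v unit_vec k j) $ i" by simp
    then show "A $$ (i, j) = B $$ (i, j)" using ij A B
      by (auto simp: scalar_prod_right_unit)
  qed (use A B in auto)
qed

lemma mat_eqI_vec:
  fixes A :: "'k :: field mat"
  assumes "A \<in> carrier_mat n k" "B \<in> carrier_mat n k"
    and "\<And>v. v \<in> carrier_vec k \<Longrightarrow> A *\<^sub>v v = B *\<^sub>v v"
  shows "A = B"
proof (rule mat_eqI_spans[OF _ assms(1,2)])
  show "spans k (carrier_vec k)" by (simp add: spans_def)
qed (rule assms(3))

lemma ex_mat_cols: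
  fixes f :: "nat \<Rightarrow> 'k :: field vec"
  assumes "\<And>j. j < k \<Longrightarrow> f j \<in> carrier_vec n"
  obtains A where "A \<in> carrier_mat n k" "\<And>j. j < k \<Longrightarrow> A *\<^sub>v unit_vec k j = f j"
proof
  let ?A = "mat n k (\<lambda>(i, j). f j $ i)"
  show "?A \<in> carrier_mat n k" by simp
  show "?A *\<^sub>v unit_vec k j = f j" if "j < k" for j
    using assms[OF that] that by (intro eq_vecI) (auto simp: scalar_prod_right_unit)
qed

section \<open>One-sided inverses, bases and dimension\<close>

lemma right_inverse_of_surj:
  fixes A :: "'k :: field mat"
  assumes A: "A \<in> carrier_mat n k" and s: "carrier_vec n \<subseteq> (*\<^sub>v) A ` carrier_vec k"
  obtains G where "G \<in> carrier_mat k n" "A * G = 1\<^sub>m n"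
proof -
  have "\<forall>j. \<exists>v. v \<in> carrier_vec k \<and> A *\<^sub>v v = unit_vec n j"
  proof
    fix j
    have "unit_vec n j \<in> (*\<^sub>v) A ` carrier_vec k" using s by auto
    then show "\<exists>v. v \<in> carrier_vec k \<and> A *\<^sub>v v = unit_vec n j" by force
  qed
  then obtain f where f: "\<And>j. f j \<in> carrier_vec k" "\<And>j. A *\<^sub>v f j = unit_vec n j" by metis
  obtain G where G: "G \<in> carrier_mat k n" "\<And>j. j < n \<Longrightarrow> G *\<^sub>v unit_vec n j = f j"
    using ex_mat_cols[of n f k] f by blast
  have "A * G = 1\<^sub>m n"
    using A G f by (intro mat_eqI_spans[OF spans_unit_vecs[of n]]) auto
  then show ?thesis using that G by blast
qed

lemma inj_onI_kernel:
  fixes A :: "'k :: field mat"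
  assumes A: "A \<in> carrier_mat n k" and "\<And>v. v \<in> carrier_vec k \<Longrightarrow> A *\<^sub>v v = 0\<^sub>v n \<Longrightarrow> v = 0\<^sub>v k"
  shows "inj_on ((*\<^sub>v) A) (carrier_vec k)"
proof (rule inj_onI)
  fix u v assume uv: "u \<in> carrier_vec k" "v \<in> carrier_vec k" "A *\<^sub>v u = A *\<^sub>v v"
  have "A *\<^sub>v (u - v) = A *\<^sub>v u - A *\<^sub>v v" using mult_mat_minus_vec[OF A] uv by blast
  also have "\<dots> = 0\<^sub>v n" unfolding uv(3) using A uv(2) by simp
  finally have "A *\<^sub>v (u - v) = 0\<^sub>v n" .
  then have "u - v = 0\<^sub>v k" using assms(2) uv by simp
  then have "\<forall>i<k. (u - v) $ i = 0" by simp
  then show "u = v" using uv by (intro eq_vecI) auto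
qed

lemma inj_on_kernelD:
  fixes A :: "'k :: field mat"
  assumes "A \<in> carrier_mat n k" "inj_on ((*\<^sub>v) A) (carrier_vec k)" "v \<in> carrier_vec k" "A *\<^sub>v v = 0\<^sub>v n"
  shows "v = 0\<^sub>v k"
  using inj_onD[OF assms(2), of v "0\<^sub>v k"] assms mult_mat_zero_vec[OF assms(1)] by auto

text \<open>For n < k the matrix can be padded with zero rows to a square one. This has determinant
  zero and hence a nonzero kernel vector, and the padding does not change the kernel.\<close>

lemma inj_dim_le:
  fixes A :: "'k :: field mat"
  assumes A: "A \<in> carrier_mat n k" and inj: "inj_on ((*\<^sub>v) A) (carrier_vec k)"
  shows "k \<le> n"
proof (rule ccontr)
  assume "\<not> k \<le> n"
  then have nk: "n < k" by simp
  define B where "B = mat k k (\<lambda>(i, j). if i < n then A $$ (i, j) else 0)"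
  have B: "B \<in> carrier_mat k k" by (simp add: B_def)
  \<comment> \<open>Row n is the first of the added zero rows.\<close>
  have "transpose_mat B *\<^sub>v unit_vec k n = 0\<^sub>v k"
    using nk B by (intro eq_vecI) (auto simp: B_def)
  then have "det (transpose_mat B) = 0"
    using nk B by (subst det_0_iff_vec_prod_zero_field[of _ k]) (auto intro!: exI[of _ "unit_vec k n"])
  then have "det B = 0" using det_transpose[OF B] by simp
  then obtain v where v: "v \<in> carrier_vec k" "v \<noteq> 0\<^sub>v k" "B *\<^sub>v v = 0\<^sub>v k"
    using det_0_iff_vec_prod_zero_field[OF B] by blast
  have "A *\<^sub>v v = 0\<^sub>v n"
  proof (rule eq_vecI)
    fix i assume i: "i < dim_vec (0\<^sub>v n)"
    then have "row B i = row A i" using A nk by (intro eq_vecI) (auto simp: B_def)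
    moreover have "(B *\<^sub>v v) $ i = 0" using v i nk by simp
    ultimately show "(A *\<^sub>v v) $ i = 0\<^sub>v n $ i" using i nk A B by auto
  qed (use A in auto)
  then show False using inj_on_kernelD[OF A inj v(1)] v by blast
qed

lemma left_inverse_inj:
  fixes A :: "'k :: field mat"
  assumes "A \<in> carrier_mat n k" "L \<in> carrier_mat k n" "L * A = 1\<^sub>m k"
  shows "inj_on ((*\<^sub>v) A) (carrier_vec k)"
proof (rule inj_onI)
  fix u v assume uv: "u \<in> carrier_vec k" "v \<in> carrier_vec k" "A *\<^sub>v u = A *\<^sub>v v"
  have "(L * A) *\<^sub>v u = (L * A) *\<^sub>v v"
    using assms(1,2) uv by simp
  then show "u = v" using assms(3) uv by simp
qed

lemma surj_dim_ge:
  fixes A :: "'k :: field mat"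
  assumes A: "A \<in> carrier_mat n k" and s: "carrier_vec n \<subseteq> (*\<^sub>v) A ` carrier_vec k"
  shows "n \<le> k"
proof -
  obtain G where G: "G \<in> carrier_mat k n" "A * G = 1\<^sub>m n" by (rule right_inverse_of_surj[OF A s])
  then show ?thesis using inj_dim_le[OF G(1) left_inverse_inj[OF G(1) A G(2)]] by simp
qed

lemma surj_square_invertible:
  fixes A :: "'k :: field mat"
  assumes A: "A \<in> carrier_mat n n" and s: "carrier_vec n \<subseteq> (*\<^sub>v) A ` carrier_vec n"
  obtains G where "G \<in> carrier_mat n n" "A * G = 1\<^sub>m n" "G * A = 1\<^sub>m n"
proof -
  obtain G where G: "G \<in> carrier_mat n n" "A * G = 1\<^sub>m n" by (rule right_inverse_of_surj[OF A s])
  then show ?thesis using that mat_mult_left_right_inverse[OF A] by blast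
qed

text \<open>The exchange step: a vector u outside the image is appended as a last column. It
  enlarges independent families here and along composition series.\<close>

definition snoc_col :: "'k :: field mat \<Rightarrow> 'k vec \<Rightarrow> 'k mat" where
  "snoc_col A u = mat (dim_row A) (Suc (dim_col A)) (\<lambda>(i, j). if j < dim_col A then A $$ (i, j) else u $ i)"

lemma snoc_col_carrier: "A \<in> carrier_mat n k \<Longrightarrow> snoc_col A u \<in> carrier_mat n (Suc k)"
  by (auto simp: snoc_col_def)

lemma snoc_col_mult:
  assumes "A \<in> carrier_mat n k" "u \<in> carrier_vec n" "v \<in> carrier_vec (Suc k)"
  shows "snoc_col A u *\<^sub>v v = A *\<^sub>v vec_first v k + v $ k \<cdot>\<^sub>v u"
  using assms by (intro eq_vecI) (auto simp: snoc_col_def scalar_prod_def vec_first_def)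

lemma snoc_col_inj:
  fixes A :: "'k :: field mat"
  assumes A: "A \<in> carrier_mat n k" and inj: "inj_on ((*\<^sub>v) A) (carrier_vec k)"
    and u: "u \<in> carrier_vec n" "u \<notin> (*\<^sub>v) A ` carrier_vec k"
  shows "inj_on ((*\<^sub>v) (snoc_col A u)) (carrier_vec (Suc k))"
proof (rule inj_onI_kernel[OF snoc_col_carrier[OF A]])
  fix v assume v: "v \<in> carrier_vec (Suc k)" "snoc_col A u *\<^sub>v v = 0\<^sub>v n"
  have f: "vec_first v k \<in> carrier_vec k" by simp
  have eq: "A *\<^sub>v vec_first v k + v $ k \<cdot>\<^sub>v u = 0\<^sub>v n"
    using v snoc_col_mult[OF A u(1) v(1)] by simp
  have im: "subsp n ((*\<^sub>v) A ` carrier_vec k)" using subsp_image[OF A subsp_carrier] .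
  have "v $ k = 0"
  proof (rule ccontr)
    assume "v $ k \<noteq> 0"
    moreover have "v $ k \<cdot>\<^sub>v u \<in> (*\<^sub>v) A ` carrier_vec k"
      using subsp_add_cancel[OF im, of "A *\<^sub>v vec_first v k" "v $ k \<cdot>\<^sub>v u"] f u(1) eq subspD(2)[OF im] by auto
    ultimately show False using u(2) subsp_smult_cancel[OF im] by blast
  qed
  moreover have "vec_first v k = 0\<^sub>v k"
  proof -
    have "v $ k \<cdot>\<^sub>v u = 0\<^sub>v n" using \<open>v $ k = 0\<close> u(1) by (intro eq_vecI) auto
    then have "A *\<^sub>v vec_first v k = 0\<^sub>v n" using eq A by (simp add: mult_mat_vec_carrier[OF A f])
    then show ?thesis using inj_on_kernelD[OF A inj f] by blast
  qed
  ultimately show "v = 0\<^sub>v (Suc k)"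
  proof (intro eq_vecI)
    fix i assume i: "i < dim_vec (0\<^sub>v (Suc k))"
    show "v $ i = 0\<^sub>v (Suc k) $ i"
    proof (cases "i < k")
      case True
      then have "v $ i = vec_first v k $ i" using v by (simp add: vec_first_def)
      then show ?thesis using \<open>vec_first v k = 0\<^sub>v k\<close> True by simp
    next
      case False
      then show ?thesis using i \<open>v $ k = 0\<close> by (simp add: less_Suc_eq)
    qed
  qed (use v in auto)
qed

lemma snoc_col_image:
  fixes A :: "'k :: field mat"
  assumes A: "A \<in> carrier_mat n k" and U: "subsp n U" "(*\<^sub>v) A ` carrier_vec k \<subseteq> U" "u \<in> U"
  shows "(*\<^sub>v) (snoc_col A u) ` carrier_vec (Suc k) \<subseteq> U"
  using snoc_col_mult[OF A] subspD[OF U(1)] U by (auto simp: image_subset_iff)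

text \<open>An injective matrix with image U stands for a basis of U. Among the injective matrices
  with image inside U one has the most columns, as \<open>inj_dim_le\<close> bounds their number; a
  vector of U missing from its image could still be appended.\<close>

lemma subsp_basis:
  fixes U :: "'k :: field vec set"
  assumes U: "subsp n U"
  obtains k A where "A \<in> carrier_mat n k" "inj_on ((*\<^sub>v) A) (carrier_vec k)" "(*\<^sub>v) A ` carrier_vec k = U"
proof -
  define P where "P k \<longleftrightarrow>
    (\<exists>A. A \<in> carrier_mat n k \<and> inj_on ((*\<^sub>v) A) (carrier_vec k) \<and> (*\<^sub>v) A ` carrier_vec k \<subseteq> U)" for k
  have P0: "P 0"
    unfolding P_def
  proof (intro exI conjI)
    show "0\<^sub>m n 0 \<in> carrier_mat n 0" by simp
    show "inj_on ((*\<^sub>v) (0\<^sub>m n 0 :: 'k mat)) (carrier_vec 0)"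
      by (auto intro!: inj_onI eq_vecI)
    show "(*\<^sub>v) (0\<^sub>m n 0) ` carrier_vec 0 \<subseteq> U"
    proof (rule image_subsetI)
      fix v :: "'k vec" assume "v \<in> carrier_vec 0"
      then have "0\<^sub>m n 0 *\<^sub>v v = 0\<^sub>v n" by (intro eq_vecI) (auto simp: scalar_prod_def)
      then show "0\<^sub>m n 0 *\<^sub>v v \<in> U" using subspD(2)[OF U] by simp
    qed
  qed
  have le: "k \<le> n" if "P k" for k using that inj_dim_le unfolding P_def by blast
  have k: "P (Greatest P)" "\<And>l. P l \<Longrightarrow> l \<le> Greatest P"
    using GreatestI_nat[of P, OF P0 le] Greatest_le_nat[of P _ n] le by blast+
  define k where "k = Greatest P"
  note k = k[folded k_def]
  then obtain A where A: "A \<in> carrier_mat n k" "inj_on ((*\<^sub>v) A) (carrier_vec k)" "(*\<^sub>v) A ` carrier_vec k \<subseteq> U"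
    unfolding P_def by blast
  have "U \<subseteq> (*\<^sub>v) A ` carrier_vec k"
  proof (rule ccontr)
    assume "\<not> U \<subseteq> (*\<^sub>v) A ` carrier_vec k"
    then obtain u where u: "u \<in> U" "u \<notin> (*\<^sub>v) A ` carrier_vec k" by blast
    then have "P (Suc k)"
      unfolding P_def
      using snoc_col_carrier[OF A(1), of u] snoc_col_inj[OF A(1,2) subspD(5)[OF U u(1)] u(2)]
        snoc_col_image[OF A(1) U A(3) u(1)] by blast
    then show False using k(2) by fastforce
  qed
  then show ?thesis using that A by blast
qed

text \<open>Columns are appended until the matrix is square, where surjectivity gives an inverse;
  induction runs on the number of missing columns.\<close>

lemma left_inverse_of_inj:
  fixes A :: "'k :: field mat"
  assumes "A \<in> carrier_mat n k" "inj_on ((*\<^sub>v) A) (carrier_vec k)"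
  obtains L where "L \<in> carrier_mat k n" "L * A = 1\<^sub>m k"
proof -
  have "\<exists>L. L \<in> carrier_mat k n \<and> L * A = 1\<^sub>m k"
    using assms
  proof (induction "n - k" arbitrary: k A rule: less_induct)
    case less
    show ?case
    proof (cases "carrier_vec n \<subseteq> (*\<^sub>v) A ` carrier_vec k")
      case True
      then have "n = k" using surj_dim_ge[OF less.prems(1)] inj_dim_le[OF less.prems] by simp
      then have A: "A \<in> carrier_mat n n" "carrier_vec n \<subseteq> (*\<^sub>v) A ` carrier_vec n"
        using less.prems(1) True by simp_all
      obtain L where "L \<in> carrier_mat n n" "L * A = 1\<^sub>m n" by (rule surj_square_invertible[OF A])
      then show ?thesis using \<open>n = k\<close> by blast
    next
      case False
      then obtain u where u: "u \<in> carrier_vec n" "u \<notin> (*\<^sub>v) A ` carrier_vec k" by blast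
      note c = snoc_col_carrier[OF less.prems(1), of u] and i = snoc_col_inj[OF less.prems u]
      have "n - Suc k < n - k" using inj_dim_le[OF c i] by simp
      from less.hyps[OF this c i] obtain L where
        L: "L \<in> carrier_mat (Suc k) n" "L * snoc_col A u = 1\<^sub>m (Suc k)" by blast
      \<comment> \<open>The rows of L that belong to the columns of A; the last row belongs to the
        appended column.\<close>
      define L' where "L' = mat k n (\<lambda>(i, j). L $$ (i, j))"
      have "L' * A = 1\<^sub>m k"
      proof (rule eq_matI)
        fix i j assume ij: "i < dim_row (1\<^sub>m k :: 'k mat)" "j < dim_col (1\<^sub>m k :: 'k mat)"
        have r: "row L' i = row L i" using L ij by (intro eq_vecI) (auto simp: L'_def)
        have cc: "col (snoc_col A u) j = col A j" using less.prems ij by (intro eq_vecI) (auto simp: snoc_col_def)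
        have "(L * snoc_col A u) $$ (i, j) = row L i \<bullet> col (snoc_col A u) j"
          using ij L c by (intro index_mult_mat) auto
        moreover have "(L' * A) $$ (i, j) = row L' i \<bullet> col A j"
          using ij L c less.prems by (intro index_mult_mat) (auto simp: L'_def)
        ultimately show "(L' * A) $$ (i, j) = 1\<^sub>m k $$ (i, j)" using r cc L(2) ij by auto
      qed (use less.prems in \<open>auto simp: L'_def\<close>)
      moreover have "L' \<in> carrier_mat k n" by (simp add: L'_def)
      ultimately show ?thesis by blast
    qed
  qed
  then show ?thesis using that by blast
qed

lemma inj_surj_dim_eq:
  fixes A :: "'k :: field mat"
  assumes "A \<in> carrier_mat n k" "inj_on ((*\<^sub>v) A) (carrier_vec k)" "carrier_vec n \<subseteq> (*\<^sub>v) A ` carrier_vec k"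
  shows "n = k"
  using surj_dim_ge[OF assms(1,3)] inj_dim_le[OF assms(1,2)] by simp

section \<open>Factoring and extending linear maps\<close>

lemma surj_factor:
  fixes C :: "'k :: field mat"
  assumes A: "A \<in> carrier_mat n k" and C: "C \<in> carrier_mat n m"
    and im: "(*\<^sub>v) C ` carrier_vec m \<subseteq> (*\<^sub>v) A ` carrier_vec k"
  obtains B where "B \<in> carrier_mat k m" "C = A * B"
proof -
  have "\<forall>j. \<exists>v. v \<in> carrier_vec k \<and> A *\<^sub>v v = C *\<^sub>v unit_vec m j"
  proof
    fix j
    have "C *\<^sub>v unit_vec m j \<in> (*\<^sub>v) A ` carrier_vec k" using im by auto
    then show "\<exists>v. v \<in> carrier_vec k \<and> A *\<^sub>v v = C *\<^sub>v unit_vec m j" by force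
  qed
  then obtain f where f: "\<And>j. f j \<in> carrier_vec k" "\<And>j. A *\<^sub>v f j = C *\<^sub>v unit_vec m j" by metis
  obtain B where B: "B \<in> carrier_mat k m" "\<And>j. j < m \<Longrightarrow> B *\<^sub>v unit_vec m j = f j"
    using ex_mat_cols[of m f k] f by blast
  have "C = A * B"
    using A B C f by (intro mat_eqI_spans[OF spans_unit_vecs[of m]]) auto
  then show ?thesis using that B by blast
qed

text \<open>A is a basis of the image of C, and B expresses the columns of C in that basis.\<close>

lemma rank_factorization:
  fixes C :: "'k :: field mat"
  assumes C: "C \<in> carrier_mat n m"
  obtains k A B where "A \<in> carrier_mat n k" "B \<in> carrier_mat k m" "C = A * B"
    "inj_on ((*\<^sub>v) A) (carrier_vec k)" "carrier_vec k \<subseteq> (*\<^sub>v) B ` carrier_vec m"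
proof -
  obtain k A where A: "A \<in> carrier_mat n k" "inj_on ((*\<^sub>v) A) (carrier_vec k)"
    "(*\<^sub>v) A ` carrier_vec k = (*\<^sub>v) C ` carrier_vec m"
    by (rule subsp_basis[OF subsp_image[OF C subsp_carrier]])
  obtain B where B: "B \<in> carrier_mat k m" "C = A * B"
    using surj_factor[OF A(1) C] A(3) by auto
  have "carrier_vec k \<subseteq> (*\<^sub>v) B ` carrier_vec m"
  proof
    fix w :: "'k vec" assume w: "w \<in> carrier_vec k"
    then obtain v where v: "v \<in> carrier_vec m" "A *\<^sub>v w = C *\<^sub>v v" using A(3) by blast
    then have "A *\<^sub>v w = A *\<^sub>v (B *\<^sub>v v)" using A B by simp
    then have "w = B *\<^sub>v v" using inj_onD[OF A(2)] w B v by auto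
    then show "w \<in> (*\<^sub>v) B ` carrier_vec m" using v by blast
  qed
  then show ?thesis using that A B by blast
qed

text \<open>With C = A B, one-sided inverses L of A and R of B give the candidate p R L. It works
  because v - R B v lies in the kernel of C, where p vanishes.\<close>

lemma functional_factor:
  fixes C :: "'k :: field mat"
  assumes C: "C \<in> carrier_mat n m" and p: "p \<in> carrier_mat l m"
    and ker: "\<And>v. v \<in> carrier_vec m \<Longrightarrow> C *\<^sub>v v = 0\<^sub>v n \<Longrightarrow> p *\<^sub>v v = 0\<^sub>v l"
  obtains g where "g \<in> carrier_mat l n" "g * C = p"
proof -
  obtain k A B where AB: "A \<in> carrier_mat n k" "B \<in> carrier_mat k m" "C = A * B"
    "inj_on ((*\<^sub>v) A) (carrier_vec k)" "carrier_vec k \<subseteq> (*\<^sub>v) B ` carrier_vec m"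
    by (rule rank_factorization[OF C])
  obtain L where L: "L \<in> carrier_mat k n" "L * A = 1\<^sub>m k" by (rule left_inverse_of_inj[OF AB(1,4)])
  obtain R where R: "R \<in> carrier_mat m k" "B * R = 1\<^sub>m k" by (rule right_inverse_of_surj[OF AB(2,5)])
  have "p * R * L * C = p"
  proof (rule mat_eqI_vec)
    fix v :: "'k vec" assume v: "v \<in> carrier_vec m"
    have LC: "L *\<^sub>v (C *\<^sub>v v) = B *\<^sub>v v"
      using mult_inverse_vec[OF AB(1) L, of "B *\<^sub>v v"] AB v by simp
    define w where "w = v - R *\<^sub>v (B *\<^sub>v v)"
    have w: "w \<in> carrier_vec m" using v R AB by (simp add: w_def)
    have BR: "B *\<^sub>v (R *\<^sub>v (B *\<^sub>v v)) = B *\<^sub>v v"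
      using mult_inverse_vec[OF R(1) AB(2) R(2), of "B *\<^sub>v v"] AB v by simp
    have "B *\<^sub>v w = 0\<^sub>v k" unfolding w_def using v R AB BR
      by (subst mult_mat_minus_vec[OF AB(2)]) auto
    then have "C *\<^sub>v w = 0\<^sub>v n" using AB w mult_mat_zero_vec[OF AB(1)] by simp
    then have "p *\<^sub>v w = 0\<^sub>v l" using ker w by blast
    then have "p *\<^sub>v v - p *\<^sub>v (R *\<^sub>v (B *\<^sub>v v)) = 0\<^sub>v l" unfolding w_def using v R AB
      by (subst (asm) mult_mat_minus_vec[OF p]) auto
    then have e: "\<forall>i<l. (p *\<^sub>v v - p *\<^sub>v (R *\<^sub>v (B *\<^sub>v v))) $ i = 0" by simp
    have "p *\<^sub>v v = p *\<^sub>v (R *\<^sub>v (B *\<^sub>v v))"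
      by (rule eq_vecI) (use p e in auto)
    moreover have "p * R * L * C *\<^sub>v v = p *\<^sub>v (R *\<^sub>v (L *\<^sub>v (C *\<^sub>v v)))"
      using p R(1) L(1) C v by (simp add: assoc_mult_mat_vec[of "p * (R * L)" l n C m v] assoc_mult_mat_vec[of p l m "R * L" n] assoc_mult_mat_vec[of R m k L n])
    ultimately show "p * R * L * C *\<^sub>v v = p *\<^sub>v v" using LC by simp
  qed (use p R L C in auto)
  moreover have "p * R * L \<in> carrier_mat l n" using p R L by simp
  ultimately show ?thesis using that by blast
qed

text \<open>This is \<open>functional_factor\<close> on the quotient by Z, which is realised by the
  projection Q = 1 - B L with kernel Z: p factors through Q A as soon as it vanishes on the preimage
  of Z. It is what produces chains of functionals dual to chains of vectors.\<close>

lemma functional_extension: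
  fixes A :: "'k :: field mat"
  assumes A: "A \<in> carrier_mat n m" and p: "p \<in> carrier_mat 1 m" and Z: "subsp n Z"
    and ker: "\<And>v. v \<in> carrier_vec m \<Longrightarrow> A *\<^sub>v v \<in> Z \<Longrightarrow> p *\<^sub>v v = 0\<^sub>v 1"
  shows "\<exists>g. g \<in> carrier_mat 1 n \<and> g * A = p \<and> (\<forall>z\<in>Z. g *\<^sub>v z = 0\<^sub>v 1)"
proof -
  obtain k B where B: "B \<in> carrier_mat n k" "inj_on ((*\<^sub>v) B) (carrier_vec k)" "(*\<^sub>v) B ` carrier_vec k = Z"
    by (rule subsp_basis[OF Z])
  obtain L where L: "L \<in> carrier_mat k n" "L * B = 1\<^sub>m k" by (rule left_inverse_of_inj[OF B(1,2)])
  define Q where "Q = 1\<^sub>m n - B * L"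
  have BL: "B * L \<in> carrier_mat n n" using B L by simp
  have Q: "Q \<in> carrier_mat n n" by (simp add: Q_def minus_carrier_mat[OF BL])
  have Qv: "Q *\<^sub>v v = v - B *\<^sub>v (L *\<^sub>v v)" if v: "v \<in> carrier_vec n" for v
    unfolding Q_def using B L v by (subst minus_mult_distrib_mat_vec[of _ n n]) auto
  have QZ: "Q *\<^sub>v z = 0\<^sub>v n" if "z \<in> Z" for z
  proof -
    obtain w where w: "w \<in> carrier_vec k" "z = B *\<^sub>v w" using \<open>z \<in> Z\<close> B(3) by blast
    have "L *\<^sub>v (B *\<^sub>v w) = w" by (rule mult_inverse_vec[OF B(1) L w(1)])
    then show ?thesis using Qv[of z] w B by simp
  qed
  have QA: "Q * A \<in> carrier_mat n m" using Q A by simp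
  have "p *\<^sub>v v = 0\<^sub>v 1" if v: "v \<in> carrier_vec m" "(Q * A) *\<^sub>v v = 0\<^sub>v n" for v
  proof -
    have "Q *\<^sub>v (A *\<^sub>v v) = 0\<^sub>v n" using v Q A by simp
    then have "A *\<^sub>v v - B *\<^sub>v (L *\<^sub>v (A *\<^sub>v v)) = 0\<^sub>v n" using Qv[of "A *\<^sub>v v"] v A by simp
    then have e: "\<forall>i<n. (A *\<^sub>v v - B *\<^sub>v (L *\<^sub>v (A *\<^sub>v v))) $ i = 0" by simp
    have "A *\<^sub>v v = B *\<^sub>v (L *\<^sub>v (A *\<^sub>v v))" by (rule eq_vecI) (use A B e in auto)
    moreover have "L *\<^sub>v (A *\<^sub>v v) \<in> carrier_vec k" using L A v by simp
    ultimately have "A *\<^sub>v v \<in> Z" using B(3) by blast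
    then show ?thesis using ker v by blast
  qed
  then obtain h where h: "h \<in> carrier_mat 1 n" "h * (Q * A) = p"
    by (rule functional_factor[OF QA p])
  show ?thesis
  proof (intro exI conjI ballI)
    show "h * Q \<in> carrier_mat 1 n" using h Q by simp
    show "h * Q * A = p" using h Q A by (simp add: assoc_mult_mat[of _ 1 n _ n])
    fix z assume z: "z \<in> Z"
    then show "h * Q *\<^sub>v z = 0\<^sub>v 1"
      using QZ[OF z] subspD(5)[OF Z z] h Q mult_mat_zero_vec[OF h(1)] by simp
  qed
qed

section \<open>Block matrices and rank-nullity\<close>

definition hcat :: "'k :: field mat \<Rightarrow> 'k mat \<Rightarrow> 'k mat" where
  "hcat A B = mat (dim_row A) (dim_col A + dim_col B)
     (\<lambda>(i, j). if j < dim_col A then A $$ (i, j) else B $$ (i, j - dim_col A))"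

lemma hcat_carrier: "A \<in> carrier_mat n k \<Longrightarrow> B \<in> carrier_mat n l \<Longrightarrow> hcat A B \<in> carrier_mat n (k + l)"
  by (auto simp: hcat_def)

lemma hcat_mult:
  assumes A: "A \<in> carrier_mat n k" and B: "B \<in> carrier_mat n l"
    and "a \<in> carrier_vec k" "b \<in> carrier_vec l"
  shows "hcat A B *\<^sub>v (a @\<^sub>v b) = A *\<^sub>v a + B *\<^sub>v b"
proof (rule eq_vecI)
  fix i assume "i < dim_vec (A *\<^sub>v a + B *\<^sub>v b)"
  then have i: "i < n" using B by simp
  have "row (hcat A B) i = row A i @\<^sub>v row B i" using i A B by (intro eq_vecI) (auto simp: hcat_def)
  then show "(hcat A B *\<^sub>v (a @\<^sub>v b)) $ i = (A *\<^sub>v a + B *\<^sub>v b) $ i"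
    using i A B hcat_carrier[OF A B] assms(3,4) scalar_prod_append[of "row A i" k "row B i" l a b] by auto
qed (use assms hcat_carrier[OF A B] in auto)

definition vcat :: "'k :: field mat \<Rightarrow> 'k mat \<Rightarrow> 'k mat" where
  "vcat A B = mat (dim_row A + dim_row B) (dim_col A)
     (\<lambda>(i, j). if i < dim_row A then A $$ (i, j) else B $$ (i - dim_row A, j))"

lemma vcat_carrier: "A \<in> carrier_mat k n \<Longrightarrow> B \<in> carrier_mat l n \<Longrightarrow> vcat A B \<in> carrier_mat (k + l) n"
  by (auto simp: vcat_def)

lemma vcat_mult:
  assumes A: "A \<in> carrier_mat k n" and B: "B \<in> carrier_mat l n"
  shows "vcat A B *\<^sub>v v = A *\<^sub>v v @\<^sub>v B *\<^sub>v v"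
proof (rule eq_vecI)
  fix i assume "i < dim_vec (A *\<^sub>v v @\<^sub>v B *\<^sub>v v)"
  then have i: "i < k + l" using A B by simp
  have "row (vcat A B) i = (if i < k then row A i else row B (i - k))"
    using i A B by (intro eq_vecI) (auto simp: vcat_def)
  then show "(vcat A B *\<^sub>v v) $ i = (A *\<^sub>v v @\<^sub>v B *\<^sub>v v) $ i"
    using i A B vcat_carrier[OF A B] by auto
qed (use assms vcat_carrier[OF A B] in auto)

text \<open>A basis A of the kernel of F next to a section G of F forms a bijective matrix: applying
  F isolates the coordinates that belong to G.\<close>

lemma rank_nullity_dim:
  fixes A F :: "'k :: field mat"
  assumes A: "A \<in> carrier_mat n k" and iA: "inj_on ((*\<^sub>v) A) (carrier_vec k)"
    and F: "F \<in> carrier_mat q n" and sF: "carrier_vec q \<subseteq> (*\<^sub>v) F ` carrier_vec n"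
    and ex: "\<And>v. v \<in> carrier_vec n \<Longrightarrow> F *\<^sub>v v = 0\<^sub>v q \<longleftrightarrow> v \<in> (*\<^sub>v) A ` carrier_vec k"
  shows "n = k + q"
proof -
  obtain G where G: "G \<in> carrier_mat n q" "F * G = 1\<^sub>m q" by (rule right_inverse_of_surj[OF F sF])
  define H where "H = hcat A G"
  have H: "H \<in> carrier_mat n (k + q)" using hcat_carrier[OF A G(1)] by (simp add: H_def)
  note Hm = hcat_mult[OF A G(1), folded H_def]
  have FG: "F *\<^sub>v (G *\<^sub>v b) = b" if "b \<in> carrier_vec q" for b
    by (rule mult_inverse_vec[OF G(1) F G(2) that])
  have FA: "F *\<^sub>v (A *\<^sub>v a) = 0\<^sub>v q" if "a \<in> carrier_vec k" for a
    using ex[of "A *\<^sub>v a"] A that by auto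
  have "inj_on ((*\<^sub>v) H) (carrier_vec (k + q))"
  proof (rule inj_onI_kernel[OF H])
    fix v assume v: "v \<in> carrier_vec (k + q)" "H *\<^sub>v v = 0\<^sub>v n"
    define a b where "a = vec_first v k" and "b = vec_last v q"
    have ab: "a \<in> carrier_vec k" "b \<in> carrier_vec q" "v = a @\<^sub>v b"
      using v by (auto simp: a_def b_def)
    have e: "A *\<^sub>v a + G *\<^sub>v b = 0\<^sub>v n" using Hm[OF ab(1,2)] ab v by simp
    then have "F *\<^sub>v (A *\<^sub>v a + G *\<^sub>v b) = 0\<^sub>v q" using mult_mat_zero_vec[OF F] by simp
    then have b: "b = 0\<^sub>v q" using ab A G FA FG by (simp add: mult_add_distrib_mat_vec[OF F])
    then have "A *\<^sub>v a = 0\<^sub>v n" using e A G ab mult_mat_zero_vec[OF G(1)] by simp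
    then have "a = 0\<^sub>v k" using inj_on_kernelD[OF A iA ab(1)] by blast
    then show "v = 0\<^sub>v (k + q)" using b ab by (intro eq_vecI) auto
  qed
  moreover have "carrier_vec n \<subseteq> (*\<^sub>v) H ` carrier_vec (k + q)"
  proof
    fix v :: "'k vec" assume v: "v \<in> carrier_vec n"
    define b where "b = F *\<^sub>v v"
    have b: "b \<in> carrier_vec q" using F v by (simp add: b_def)
    have "F *\<^sub>v (v - G *\<^sub>v b) = 0\<^sub>v q" using v G b FG[OF b]
      by (simp add: mult_mat_minus_vec[OF F]) (simp add: b_def)
    then obtain a where a: "a \<in> carrier_vec k" "v - G *\<^sub>v b = A *\<^sub>v a" using ex[of "v - G *\<^sub>v b"] v G b by auto
    then have e: "\<forall>i<n. (v - G *\<^sub>v b) $ i = (A *\<^sub>v a) $ i" by simp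
    have "v = A *\<^sub>v a + G *\<^sub>v b"
      by (rule eq_vecI) (use v G A e in \<open>auto simp: algebra_simps\<close>)
    then have "v = H *\<^sub>v (a @\<^sub>v b)" using Hm[OF a(1) b] by simp
    then show "v \<in> (*\<^sub>v) H ` carrier_vec (k + q)" using a b by (intro image_eqI[of _ _ "a @\<^sub>v b"]) auto
  qed
  ultimately show ?thesis using inj_surj_dim_eq[OF H] by blast
qed

section \<open>Modules given by matrices\<close>

definition well_formed :: "('k :: field) d4_rep \<Rightarrow> bool" where
  "well_formed M \<longleftrightarrow> act_a M \<in> carrier_mat (rdim M) (rdim M) \<and> act_b M \<in> carrier_mat (rdim M) (rdim M) \<and>
     act_c M \<in> carrier_mat (rdim M) (rdim M) \<and> act_d M \<in> carrier_mat (rdim M) (rdim M)"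

lemma well_formedD:
  assumes "well_formed M"
  shows "act_a M \<in> carrier_mat (rdim M) (rdim M)" "act_b M \<in> carrier_mat (rdim M) (rdim M)"
    "act_c M \<in> carrier_mat (rdim M) (rdim M)" "act_d M \<in> carrier_mat (rdim M) (rdim M)"
  using assms by (auto simp: well_formed_def)

lemma smult_minus_one_mult_mat_vec:
  assumes "(A :: 'k :: field mat) \<in> carrier_mat n k" "v \<in> carrier_vec k"
  shows "(- A) *\<^sub>v v = (- 1) \<cdot>\<^sub>v (A *\<^sub>v v)"
  using assms by (intro eq_vecI) auto

lemma zero_mat_mult_vec: "v \<in> carrier_vec k \<Longrightarrow> 0\<^sub>m n k *\<^sub>v v = (0\<^sub>v n :: 'k :: field vec)"
  by (intro eq_vecI) auto

text \<open>The defining relations in pointwise form. As equations between vectors they can be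
  checked on a spanning set and pulled back along injective homomorphisms.\<close>

definition d4_laws :: "('k :: field) d4_rep \<Rightarrow> 'k vec \<Rightarrow> bool" where
  "d4_laws M v \<longleftrightarrow>
     act_b M *\<^sub>v (act_a M *\<^sub>v v) = (- 1) \<cdot>\<^sub>v (act_a M *\<^sub>v (act_b M *\<^sub>v v)) \<and>
     act_d M *\<^sub>v (act_b M *\<^sub>v v) = (- 1) \<cdot>\<^sub>v (act_b M *\<^sub>v (act_d M *\<^sub>v v)) \<and>
     act_c M *\<^sub>v (act_a M *\<^sub>v v) = (- 1) \<cdot>\<^sub>v (act_a M *\<^sub>v (act_c M *\<^sub>v v)) \<and>
     act_d M *\<^sub>v (act_c M *\<^sub>v v) = (- 1) \<cdot>\<^sub>v (act_c M *\<^sub>v (act_d M *\<^sub>v v)) \<and>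
     act_b M *\<^sub>v (act_c M *\<^sub>v v) = act_c M *\<^sub>v (act_b M *\<^sub>v v) \<and>
     act_a M *\<^sub>v (act_a M *\<^sub>v v) = 0\<^sub>v (rdim M) \<and>
     act_b M *\<^sub>v (act_b M *\<^sub>v v) = v \<and>
     act_c M *\<^sub>v (act_c M *\<^sub>v v) = v \<and>
     act_d M *\<^sub>v (act_d M *\<^sub>v v) = 0\<^sub>v (rdim M) \<and>
     act_d M *\<^sub>v (act_a M *\<^sub>v v) + act_a M *\<^sub>v (act_d M *\<^sub>v v) = v - act_b M *\<^sub>v (act_c M *\<^sub>v v)"

lemma d4_module_spansI:
  assumes wf: "well_formed M" and X: "spans (rdim M) X" and l: "\<And>v. v \<in> X \<Longrightarrow> d4_laws M v"
  shows "d4_module M"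
proof -
  define n a b c d where "n = rdim M" and "a = act_a M" and "b = act_b M" and "c = act_c M" and "d = act_d M"
  have car: "a \<in> carrier_mat n n" "b \<in> carrier_mat n n" "c \<in> carrier_mat n n" "d \<in> carrier_mat n n"
    using well_formedD[OF wf] by (simp_all add: n_def a_def b_def c_def d_def)
  have Xc: "v \<in> carrier_vec n" if "v \<in> X" for v using X that by (auto simp: spans_def n_def)
  note L = l[unfolded d4_laws_def, folded n_def a_def b_def c_def d_def]
  note eqI = mat_eqI_spans[OF X, folded n_def]
  have pc: "x * y \<in> carrier_mat n n" "- (x * y) \<in> carrier_mat n n"
    if "x \<in> carrier_mat n n" "y \<in> carrier_mat n n" for x y :: "'a mat"
    using that by auto
  have neg: "(- (x * y)) *\<^sub>v v = (- 1) \<cdot>\<^sub>v (x *\<^sub>v (y *\<^sub>v v))"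
    if "x \<in> carrier_mat n n" "y \<in> carrier_mat n n" "v \<in> X" for x y v
    using that smult_minus_one_mult_mat_vec[OF pc(1)[OF that(1,2)] Xc[OF that(3)]] Xc by simp
  have "b * a = - (a * b)" by (rule eqI) (use car pc neg L Xc in auto)
  moreover have "d * b = - (b * d)" by (rule eqI) (use car pc neg L Xc in auto)
  moreover have "c * a = - (a * c)" by (rule eqI) (use car pc neg L Xc in auto)
  moreover have "d * c = - (c * d)" by (rule eqI) (use car pc neg L Xc in auto)
  moreover have "b * c = c * b" by (rule eqI) (use car pc L Xc in auto)
  moreover have "a * a = 0\<^sub>m n n" by (rule eqI) (use car pc L Xc in auto)
  moreover have "b * b = 1\<^sub>m n" by (rule eqI) (use car pc L Xc in auto)
  moreover have "c * c = 1\<^sub>m n" by (rule eqI) (use car pc L Xc in auto)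
  moreover have "d * d = 0\<^sub>m n n" by (rule eqI) (use car pc L Xc in auto)
  moreover have "d * a + a * d = 1\<^sub>m n - b * c"
  proof (rule eqI)
    fix v assume v: "v \<in> X"
    have "(d * a + a * d) *\<^sub>v v = d *\<^sub>v (a *\<^sub>v v) + a *\<^sub>v (d *\<^sub>v v)"
      using car pc Xc[OF v] by (simp add: add_mult_distrib_mat_vec[of _ n n])
    moreover have "(1\<^sub>m n - b * c) *\<^sub>v v = v - b *\<^sub>v (c *\<^sub>v v)"
      using car pc Xc[OF v] by (simp add: minus_mult_distrib_mat_vec[of _ n n])
    ultimately show "(d * a + a * d) *\<^sub>v v = (1\<^sub>m n - b * c) *\<^sub>v v" using L[OF v] by simp
  qed (use car in \<open>auto intro: minus_carrier_mat\<close>)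
  ultimately show ?thesis
    unfolding d4_module_def Let_def using car unfolding n_def a_def b_def c_def d_def by blast
qed

lemma d4_moduleD:
  assumes M: "d4_module M"
  shows "well_formed M" "v \<in> space M \<Longrightarrow> d4_laws M v"
proof -
  define n a b c d where "n = rdim M" and "a = act_a M" and "b = act_b M" and "c = act_c M" and "d = act_d M"
  have car: "a \<in> carrier_mat n n" "b \<in> carrier_mat n n" "c \<in> carrier_mat n n" "d \<in> carrier_mat n n"
    and R: "b * a = - (a * b)" "d * b = - (b * d)" "c * a = - (a * c)" "d * c = - (c * d)"
        "b * c = c * b" "a * a = 0\<^sub>m n n" "b * b = 1\<^sub>m n" "c * c = 1\<^sub>m n" "d * d = 0\<^sub>m n n"
        "d * a + a * d = 1\<^sub>m n - b * c"
    using M by (simp_all add: d4_module_def Let_def n_def a_def b_def c_def d_def)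
  show "well_formed M" using car by (simp add: well_formed_def n_def a_def b_def c_def d_def)
  assume v: "v \<in> space M"
  then have v: "v \<in> carrier_vec n" by (simp add: n_def)
  have m: "x *\<^sub>v (y *\<^sub>v v) = (x * y) *\<^sub>v v" if "x \<in> carrier_mat n n" "y \<in> carrier_mat n n" for x y
    using that v by simp
  have neg: "(- (x * y)) *\<^sub>v v = (- 1) \<cdot>\<^sub>v ((x * y) *\<^sub>v v)"
    if "x \<in> carrier_mat n n" "y \<in> carrier_mat n n" for x y
    using smult_minus_one_mult_mat_vec[of "x * y" n n v] v that by simp
  have "d *\<^sub>v (a *\<^sub>v v) + a *\<^sub>v (d *\<^sub>v v) = (d * a + a * d) *\<^sub>v v"
    using car v by (simp add: add_mult_distrib_mat_vec[of _ n n])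
  also have "\<dots> = v - b *\<^sub>v (c *\<^sub>v v)"
    unfolding R(10) using car v by (simp add: minus_mult_distrib_mat_vec[of _ n n])
  finally have l10: "d *\<^sub>v (a *\<^sub>v v) + a *\<^sub>v (d *\<^sub>v v) = v - b *\<^sub>v (c *\<^sub>v v)" .
  show "d4_laws M v"
    unfolding d4_laws_def n_def[symmetric] a_def[symmetric] b_def[symmetric] c_def[symmetric] d_def[symmetric]
  proof (intro conjI)
    show "b *\<^sub>v (a *\<^sub>v v) = (- 1) \<cdot>\<^sub>v (a *\<^sub>v (b *\<^sub>v v))" using m[OF car(2,1)] m[OF car(1,2)] neg[OF car(1,2)] R(1) by simp
    show "d *\<^sub>v (b *\<^sub>v v) = (- 1) \<cdot>\<^sub>v (b *\<^sub>v (d *\<^sub>v v))" using m[OF car(4,2)] m[OF car(2,4)] neg[OF car(2,4)] R(2) by simp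
    show "c *\<^sub>v (a *\<^sub>v v) = (- 1) \<cdot>\<^sub>v (a *\<^sub>v (c *\<^sub>v v))" using m[OF car(3,1)] m[OF car(1,3)] neg[OF car(1,3)] R(3) by simp
    show "d *\<^sub>v (c *\<^sub>v v) = (- 1) \<cdot>\<^sub>v (c *\<^sub>v (d *\<^sub>v v))" using m[OF car(4,3)] m[OF car(3,4)] neg[OF car(3,4)] R(4) by simp
    show "b *\<^sub>v (c *\<^sub>v v) = c *\<^sub>v (b *\<^sub>v v)" using m[OF car(2,3)] m[OF car(3,2)] R(5) by simp
    show "a *\<^sub>v (a *\<^sub>v v) = 0\<^sub>v n" using m[OF car(1,1)] R(6) zero_mat_mult_vec[OF v] by simp
    show "b *\<^sub>v (b *\<^sub>v v) = v" using m[OF car(2,2)] R(7) v by simp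
    show "c *\<^sub>v (c *\<^sub>v v) = v" using m[OF car(3,3)] R(8) v by simp
    show "d *\<^sub>v (d *\<^sub>v v) = 0\<^sub>v n" using m[OF car(4,4)] R(9) zero_mat_mult_vec[OF v] by simp
    show "d *\<^sub>v (a *\<^sub>v v) + a *\<^sub>v (d *\<^sub>v v) = v - b *\<^sub>v (c *\<^sub>v v)" by (rule l10)
  qed
qed

lemma act_closed:
  assumes "well_formed M" "v \<in> space M"
  shows "act_a M *\<^sub>v v \<in> space M" "act_b M *\<^sub>v v \<in> space M" "act_c M *\<^sub>v v \<in> space M" "act_d M *\<^sub>v v \<in> space M"
  using well_formedD[OF assms(1)] assms(2) by auto

lemma is_homD:
  assumes "is_hom M N F" "well_formed M" "well_formed N" "v \<in> space M"
  shows "F \<in> carrier_mat (rdim N) (rdim M)" "F *\<^sub>v v \<in> space N"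
    "F *\<^sub>v (act_a M *\<^sub>v v) = act_a N *\<^sub>v (F *\<^sub>v v)" "F *\<^sub>v (act_b M *\<^sub>v v) = act_b N *\<^sub>v (F *\<^sub>v v)"
    "F *\<^sub>v (act_c M *\<^sub>v v) = act_c N *\<^sub>v (F *\<^sub>v v)" "F *\<^sub>v (act_d M *\<^sub>v v) = act_d N *\<^sub>v (F *\<^sub>v v)"
proof -
  note F = assms(1)[unfolded is_hom_def]
  show "F \<in> carrier_mat (rdim N) (rdim M)" using F by blast
  then show "F *\<^sub>v v \<in> space N" using assms(4) by simp
  have *: "F *\<^sub>v (x *\<^sub>v v) = y *\<^sub>v (F *\<^sub>v v)"
    if "x \<in> carrier_mat (rdim M) (rdim M)" "y \<in> carrier_mat (rdim N) (rdim N)" "F * x = y * F" for x y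
  proof -
    have "F *\<^sub>v (x *\<^sub>v v) = (F * x) *\<^sub>v v"
      using F assoc_mult_mat_vec[OF _ that(1) assms(4)] by metis
    also have "\<dots> = y *\<^sub>v (F *\<^sub>v v)" unfolding that(3) using F assoc_mult_mat_vec[OF that(2) _ assms(4)] by blast
    finally show ?thesis .
  qed
  show "F *\<^sub>v (act_a M *\<^sub>v v) = act_a N *\<^sub>v (F *\<^sub>v v)" "F *\<^sub>v (act_b M *\<^sub>v v) = act_b N *\<^sub>v (F *\<^sub>v v)"
    "F *\<^sub>v (act_c M *\<^sub>v v) = act_c N *\<^sub>v (F *\<^sub>v v)" "F *\<^sub>v (act_d M *\<^sub>v v) = act_d N *\<^sub>v (F *\<^sub>v v)"
    using * well_formedD[OF assms(2)] well_formedD[OF assms(3)] F by blast+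
qed

lemma is_homI_spans:
  assumes wf: "well_formed M" "well_formed N" and F: "F \<in> carrier_mat (rdim N) (rdim M)"
    and X: "spans (rdim M) X"
    and "\<And>v. v \<in> X \<Longrightarrow> F *\<^sub>v (act_a M *\<^sub>v v) = act_a N *\<^sub>v (F *\<^sub>v v) \<and> F *\<^sub>v (act_b M *\<^sub>v v) = act_b N *\<^sub>v (F *\<^sub>v v) \<and>
      F *\<^sub>v (act_c M *\<^sub>v v) = act_c N *\<^sub>v (F *\<^sub>v v) \<and> F *\<^sub>v (act_d M *\<^sub>v v) = act_d N *\<^sub>v (F *\<^sub>v v)"
  shows "is_hom M N F"
proof -
  have Xc: "v \<in> carrier_vec (rdim M)" if "v \<in> X" for v using X that by (auto simp: spans_def)
  have *: "F * x = y * F" if "x \<in> carrier_mat (rdim M) (rdim M)" "y \<in> carrier_mat (rdim N) (rdim N)"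
    "\<And>v. v \<in> X \<Longrightarrow> F *\<^sub>v (x *\<^sub>v v) = y *\<^sub>v (F *\<^sub>v v)" for x y
  proof (rule mat_eqI_spans[OF X])
    fix v assume v: "v \<in> X"
    have "F * x *\<^sub>v v = F *\<^sub>v (x *\<^sub>v v)" using F that(1) Xc[OF v] by simp
    moreover have "y * F *\<^sub>v v = y *\<^sub>v (F *\<^sub>v v)" using F that(2) Xc[OF v] by simp
    ultimately show "F * x *\<^sub>v v = y * F *\<^sub>v v" using that(3)[OF v] by simp
  qed (use F that in auto)
  show ?thesis unfolding is_hom_def
    using * well_formedD[OF wf(1)] well_formedD[OF wf(2)] F assms(5) by blast
qed

lemma spans_carrier: "spans n (carrier_vec n)"
  by (simp add: spans_def)

text \<open>The map carries each relation at v to the same relation at its image, where it holds;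
  injectivity brings it back.\<close>

lemma d4_module_of_inj_hom:
  assumes M: "d4_module M" and wf: "well_formed X" and A: "is_hom X M A"
    and inj: "inj_on ((*\<^sub>v) A) (space X)"
  shows "d4_module X"
proof (rule d4_module_spansI[OF wf spans_carrier])
  fix v assume v: "v \<in> space X"
  note wM = d4_moduleD(1)[OF M]
  note H = is_homD[OF A wf wM]
  have Ac: "A \<in> carrier_mat (rdim M) (rdim X)" using H v by blast
  note cl = act_closed[OF wf]
  have L: "d4_laws M (A *\<^sub>v v)" using d4_moduleD(2)[OF M] H(2)[OF v] by blast
  have inj': "u = w" if "u \<in> space X" "w \<in> space X" "A *\<^sub>v u = A *\<^sub>v w" for u w
    using inj_onD[OF inj] that by blast
  show "d4_laws X v"
    unfolding d4_laws_def
    apply (intro conjI; rule inj')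
    using v L unfolding d4_laws_def
    by (simp_all add: H cl mult_mat_smult_vec[OF Ac] mult_mat_minus_vec[OF Ac] mult_add_distrib_mat_vec[OF Ac]
        mult_mat_zero_vec[OF Ac])
qed

section \<open>Direct sums, copies and isomorphisms\<close>

lemma block_diag_mult:
  assumes "A \<in> carrier_mat n k" "B \<in> carrier_mat m l" "u \<in> carrier_vec k" "w \<in> carrier_vec l"
  shows "block_diag A B *\<^sub>v (u @\<^sub>v w) = A *\<^sub>v u @\<^sub>v B *\<^sub>v w"
proof -
  have "block_diag A B = four_block_mat A (0\<^sub>m n l) (0\<^sub>m m k) B" using assms by (auto simp: block_diag_def)
  then show ?thesis
    using four_block_mat_mult_vec[OF assms(1) _ _ assms(2,3,4), of "0\<^sub>m n l" "0\<^sub>m m k"] assms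
    by (simp add: zero_mat_mult_vec)
qed

lemma well_formed_sum:
  assumes "well_formed M" "well_formed N"
  shows "well_formed (M \<oplus>\<^sub>D N)"
  using well_formedD[OF assms(1)] well_formedD[OF assms(2)]
  by (auto simp: well_formed_def d4_sum_def block_diag_def)

lemma well_formed_copies: "well_formed M \<Longrightarrow> well_formed (copies n M)"
proof (induction n)
  case 0
  show ?case by (auto simp: well_formed_def zero_rep_def)
qed (simp add: well_formed_sum)

lemma rdim_copies: "rdim (copies n M) = n * rdim M"
  by (induction n) (simp_all add: d4_sum_def zero_rep_def)

lemma is_hom_hcat:
  assumes wf: "well_formed M" "well_formed N" "well_formed Q" and F: "is_hom M Q F" and G: "is_hom N Q G"
  shows "is_hom (M \<oplus>\<^sub>D N) Q (hcat F G)"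
    "(*\<^sub>v) F ` space M \<union> (*\<^sub>v) G ` space N \<subseteq> (*\<^sub>v) (hcat F G) ` space (M \<oplus>\<^sub>D N)"
proof -
  have Fc: "F \<in> carrier_mat (rdim Q) (rdim M)" and Gc: "G \<in> carrier_mat (rdim Q) (rdim N)"
    using F G by (auto simp: is_hom_def)
  have rd: "rdim (M \<oplus>\<^sub>D N) = rdim M + rdim N" by (simp add: d4_sum_def)
  note wM = well_formedD[OF wf(1)] and wN = well_formedD[OF wf(2)] and wQ = well_formedD[OF wf(3)]
  note hF = is_homD[OF F wf(1,3)] and hG = is_homD[OF G wf(2,3)]
  show "is_hom (M \<oplus>\<^sub>D N) Q (hcat F G)"
  proof (rule is_homI_spans[OF well_formed_sum[OF wf(1,2)] wf(3) _ spans_carrier], goal_cases)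
    case 1
    show ?case using hcat_carrier[OF Fc Gc] rd by simp
  next
    case (2 v)
    then obtain u w where uw: "u \<in> space M" "w \<in> space N" "v = u @\<^sub>v w"
      using rd by (metis vec_first_carrier vec_last_carrier vec_first_last_append)
    have ext: "hcat F G *\<^sub>v (x @\<^sub>v y) = F *\<^sub>v x + G *\<^sub>v y" if "x \<in> space M" "y \<in> space N" for x y
      using hcat_mult[OF Fc Gc that] .
    show ?case
      unfolding uw(3) d4_sum_def using uw(1,2)
      by (simp add: block_diag_mult[OF wM(1) wN(1)] block_diag_mult[OF wM(2) wN(2)]
          block_diag_mult[OF wM(3) wN(3)] block_diag_mult[OF wM(4) wN(4)] ext
          act_closed[OF wf(1)] act_closed[OF wf(2)] hF hG
          mult_add_distrib_mat_vec[OF wQ(1)] mult_add_distrib_mat_vec[OF wQ(2)]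
          mult_add_distrib_mat_vec[OF wQ(3)] mult_add_distrib_mat_vec[OF wQ(4)])
  qed
  have "F *\<^sub>v u \<in> (*\<^sub>v) (hcat F G) ` space (M \<oplus>\<^sub>D N)" if u: "u \<in> space M" for u
  proof (rule image_eqI)
    show "F *\<^sub>v u = hcat F G *\<^sub>v (u @\<^sub>v 0\<^sub>v (rdim N))"
      using hcat_mult[OF Fc Gc u] Fc u by (simp add: mult_mat_zero_vec[OF Gc])
  qed (use rd u in auto)
  moreover have "G *\<^sub>v w \<in> (*\<^sub>v) (hcat F G) ` space (M \<oplus>\<^sub>D N)" if w: "w \<in> space N" for w
  proof (rule image_eqI)
    show "G *\<^sub>v w = hcat F G *\<^sub>v (0\<^sub>v (rdim M) @\<^sub>v w)"
      using hcat_mult[OF Fc Gc _ w, of "0\<^sub>v (rdim M)"] Gc w by (simp add: mult_mat_zero_vec[OF Fc])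
  qed (use rd w in auto)
  ultimately show "(*\<^sub>v) F ` space M \<union> (*\<^sub>v) G ` space N \<subseteq> (*\<^sub>v) (hcat F G) ` space (M \<oplus>\<^sub>D N)" by blast
qed

text \<open>A family of homomorphisms is glued column by column. Only the images are recorded,
  because the glued map enters a surjectivity argument followed by a count of dimensions.\<close>

lemma is_hom_copies:
  assumes wf: "well_formed M" "well_formed Q" and "\<And>j. j < n \<Longrightarrow> is_hom M Q (F j)"
  obtains H where "is_hom (copies n M) Q H"
    "\<And>j. j < n \<Longrightarrow> (*\<^sub>v) (F j) ` space M \<subseteq> (*\<^sub>v) H ` space (copies n M)"
proof -
  have "\<exists>H. is_hom (copies n M) Q H \<and> (\<forall>j<n. (*\<^sub>v) (F j) ` space M \<subseteq> (*\<^sub>v) H ` space (copies n M))"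
    using assms(3)
  proof (induction n)
    case 0
    have "is_hom (copies 0 M) Q (0\<^sub>m (rdim Q) 0)"
      using well_formedD[OF wf(2)] by (auto simp: is_hom_def zero_rep_def)
    then show ?case by blast
  next
    case (Suc n)
    then obtain H where H: "is_hom (copies n M) Q H"
      "\<And>j. j < n \<Longrightarrow> (*\<^sub>v) (F j) ` space M \<subseteq> (*\<^sub>v) H ` space (copies n M)"
      by (meson less_Suc_eq)
    note h = is_hom_hcat[OF wf(1) well_formed_copies[OF wf(1)] wf(2) Suc.prems[of n] H(1)]
    show ?case
    proof (intro exI[of _ "hcat (F n) H"] conjI allI impI)
      show "is_hom (copies (Suc n) M) Q (hcat (F n) H)" using h(1) by simp
      fix j assume "j < Suc n"
      then show "(*\<^sub>v) (F j) ` space M \<subseteq> (*\<^sub>v) (hcat (F n) H) ` space (copies (Suc n) M)"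
        using h(2) H(2)[of j] by (cases "j = n") (auto 0 3)
    qed
  qed
  then show ?thesis using that by blast
qed

text \<open>In equal dimensions a surjection is invertible, and its inverse commutes with the
  action. The isomorphism is stated backwards because the surjection will go from the direct sum
  onto the tensor product.\<close>

lemma d4_iso_of_surj_hom:
  assumes F: "is_hom M N F" and s: "space N \<subseteq> (*\<^sub>v) F ` space M" and d: "rdim M = rdim N"
    and wf: "well_formed M" "well_formed N"
  shows "N \<cong>\<^sub>D M"
proof -
  define n where "n = rdim N"
  have Fc: "F \<in> carrier_mat n n" using F d by (simp add: is_hom_def n_def)
  have "carrier_vec n \<subseteq> (*\<^sub>v) F ` carrier_vec n" using s d n_def by simp
  then obtain G where G: "G \<in> carrier_mat n n" "F * G = 1\<^sub>m n" "G * F = 1\<^sub>m n"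
    using surj_square_invertible[OF Fc] by blast
  have FG: "F *\<^sub>v (G *\<^sub>v v) = v" if "v \<in> carrier_vec n" for v
    using mult_inverse_vec[OF G(1) Fc G(2) that] .
  have GF: "G *\<^sub>v (F *\<^sub>v v) = v" if "v \<in> carrier_vec n" for v
    using mult_inverse_vec[OF Fc G(1) G(3) that] .
  have hom: "is_hom N M G"
  proof (rule is_homI_spans[OF wf(2,1) _ spans_carrier])
    show "G \<in> carrier_mat (rdim M) (rdim N)" using G d n_def by simp
    fix v assume v: "v \<in> space N"
    define u where "u = G *\<^sub>v v"
    have u: "u \<in> space M" "v = F *\<^sub>v u" using FG[of v] v G d n_def by (auto simp: u_def)
    note h = is_homD[OF F wf u(1)]
    show "G *\<^sub>v (act_a N *\<^sub>v v) = act_a M *\<^sub>v (G *\<^sub>v v) \<and> G *\<^sub>v (act_b N *\<^sub>v v) = act_b M *\<^sub>v (G *\<^sub>v v) \<and>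
        G *\<^sub>v (act_c N *\<^sub>v v) = act_c M *\<^sub>v (G *\<^sub>v v) \<and> G *\<^sub>v (act_d N *\<^sub>v v) = act_d M *\<^sub>v (G *\<^sub>v v)"
      unfolding u(2) h(3-6)[symmetric] using GF act_closed[OF wf(1) u(1)] u(1) d n_def by simp
  qed
  have "bij_betw ((*\<^sub>v) G) (space N) (space M)"
    by (rule bij_betw_byWitness[where f' = "(*\<^sub>v) F"]) (use FG GF G(1) Fc d n_def in auto)
  then show ?thesis unfolding d4_iso_def using hom by blast
qed

text \<open>The image of E becomes a module in the coordinates given by A and B: x acts as B x A. As
  E = A B commutes with the action, A embeds this module into M and B projects onto it.\<close>

lemma restrict_along_idempotent:
  assumes M: "d4_module M" and E: "is_hom M M E" and AB: "A \<in> carrier_mat (rdim M) k" "B \<in> carrier_mat k (rdim M)"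
    "E = A * B" "B * A = 1\<^sub>m k"
  obtains X where "d4_module X" "rdim X = k" "is_hom M X B"
proof -
  define X where "X = \<lparr> rdim = k, act_a = B * act_a M * A, act_b = B * act_b M * A,
    act_c = B * act_c M * A, act_d = B * act_d M * A \<rparr>"
  note wM = d4_moduleD(1)[OF M]
  note car = well_formedD[OF wM]
  have wX: "well_formed X" using AB car by (auto simp: well_formed_def X_def)
  have EM: "E * act_a M = act_a M * E" "E * act_b M = act_b M * E" "E * act_c M = act_c M * E" "E * act_d M = act_d M * E"
    using E by (auto simp: is_hom_def)
  let ?n = "rdim M"
  have A: "A * (B * x * A) = x * A" if x: "x \<in> carrier_mat ?n ?n" "E * x = x * E" for x
  proof -
    have "A * (B * x * A) = E * x * A"
      using AB(1,2,3) x(1) assoc_mult_mat[of A ?n k "B * x" ?n A k] assoc_mult_mat[of A ?n k B ?n x ?n] by simp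
    also have "\<dots> = x * A * (B * A)"
      unfolding x(2) using AB(1,2,3) x(1) assoc_mult_mat[of x ?n ?n "A * B" ?n A k] assoc_mult_mat[of A ?n k B ?n A k]
        assoc_mult_mat[of x ?n ?n A k "B * A" k] by simp
    finally show ?thesis using AB(1,4) x(1) by simp
  qed
  have B: "B * x = B * x * A * B" if x: "x \<in> carrier_mat ?n ?n" "E * x = x * E" for x
  proof -
    have "B * x * A * B = B * (E * x)"
      unfolding x(2) using AB(1,2,3) x(1) assoc_mult_mat[of "B * x" k ?n A k B ?n] assoc_mult_mat[of B k ?n x ?n "A * B" ?n] by simp
    also have "\<dots> = B * A * (B * x)"
      using AB(1,2,3) x(1) assoc_mult_mat[of A ?n k B ?n x ?n] assoc_mult_mat[of B k ?n A k "B * x" ?n] by simp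
    finally show ?thesis using AB(2,4) x(1) by simp
  qed
  have "is_hom X M A" unfolding is_hom_def using A car EM AB(1) by (simp add: X_def)
  then have "d4_module X"
    using d4_module_of_inj_hom[OF M wX] left_inverse_inj[OF AB(1,2,4)] by (simp add: X_def)
  moreover have "is_hom M X B" unfolding is_hom_def using B car EM AB(2) by (simp add: X_def)
  ultimately show ?thesis using that[of X] by (simp add: X_def)
qed

text \<open>From E E = E one gets A (B A) B = A B, where the injective A and the surjective B can be
  cancelled.\<close>

lemma rank_factorization_idempotent:
  fixes E :: "'k :: field mat"
  assumes E: "E \<in> carrier_mat n n" "E * E = E"
  obtains k A B where "A \<in> carrier_mat n k" "B \<in> carrier_mat k n" "E = A * B" "B * A = 1\<^sub>m k"
proof -
  obtain k A B where AB: "A \<in> carrier_mat n k" "B \<in> carrier_mat k n" "E = A * B"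
    "inj_on ((*\<^sub>v) A) (carrier_vec k)" "carrier_vec k \<subseteq> (*\<^sub>v) B ` carrier_vec n"
    by (rule rank_factorization[OF E(1)])
  have "B * A = 1\<^sub>m k"
  proof (rule mat_eqI_vec)
    fix w :: "'k vec" assume "w \<in> carrier_vec k"
    then obtain v where v: "v \<in> carrier_vec n" "w = B *\<^sub>v v" using AB(5) by blast
    have "A *\<^sub>v (B *\<^sub>v (A *\<^sub>v (B *\<^sub>v v))) = (E * E) *\<^sub>v v"
      using AB(1,2,3) v(1) E(1) assoc_mult_mat_vec[OF E(1) E(1) v(1)]
        assoc_mult_mat_vec[OF AB(1,2), of v] assoc_mult_mat_vec[OF AB(1,2), of "E *\<^sub>v v"] by simp
    also have "\<dots> = A *\<^sub>v (B *\<^sub>v v)" unfolding E(2) unfolding AB(3) using AB(1,2) v(1) by simp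
    finally have "B *\<^sub>v (A *\<^sub>v (B *\<^sub>v v)) = B *\<^sub>v v"
      using inj_onD[OF AB(4)] AB(1,2) v(1) by simp
    then show "B * A *\<^sub>v w = 1\<^sub>m k *\<^sub>v w" using AB(1,2) v by simp
  qed (use AB in auto)
  then show ?thesis using that AB by blast
qed

text \<open>M is the direct sum of the images of E and 1 - E, so one of the two images is zero.
  Splittings of M are excluded below only through this dichotomy.\<close>

lemma indecomposable_idempotent:
  fixes M :: "'k :: field d4_rep"
  assumes M: "indecomposable M" and E: "is_hom M M E" "E * E = E"
  shows "E = 0\<^sub>m (rdim M) (rdim M) \<or> E = 1\<^sub>m (rdim M)"
proof -
  define n where "n = rdim M"
  have dM: "d4_module M" using M by (simp add: indecomposable_def)
  note wM = d4_moduleD(1)[OF dM]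
  note car = well_formedD[OF wM, folded n_def]
  have Ec: "E \<in> carrier_mat n n" using E(1) by (simp add: is_hom_def n_def)
  define E' where "E' = 1\<^sub>m n - E"
  have E'c: "E' \<in> carrier_mat n n" unfolding E'_def by (rule minus_carrier_mat[OF Ec])
  have E'x: "E' * x = x - E * x" "x * E' = x - x * E" if "x \<in> carrier_mat n n" for x
    unfolding E'_def using that Ec
    by (simp_all add: minus_mult_distrib_mat[of _ n n _ _ n] mult_minus_distrib_mat[of _ n n _ n])
  have "E' * E' = E'"
    using E'x(1)[OF E'c] E'x(2)[OF Ec] E(2) E'c Ec by (intro eq_matI) auto
  moreover have "is_hom M M E'"
    using E(1) E'x car E'c by (simp add: is_hom_def n_def)
  moreover obtain k A B where AB: "A \<in> carrier_mat n k" "B \<in> carrier_mat k n" "E = A * B" "B * A = 1\<^sub>m k"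
    by (rule rank_factorization_idempotent[OF Ec E(2)])
  moreover obtain X where X: "d4_module X" "rdim X = k" "is_hom M X B"
    by (rule restrict_along_idempotent[OF dM E(1) AB(1)[unfolded n_def] AB(2)[unfolded n_def] AB(3,4)])
  moreover obtain l C D where CD: "C \<in> carrier_mat n l" "D \<in> carrier_mat l n" "E' = C * D" "D * C = 1\<^sub>m l"
    by (rule rank_factorization_idempotent[OF E'c \<open>E' * E' = E'\<close>])
  moreover obtain Y where Y: "d4_module Y" "rdim Y = l" "is_hom M Y D"
    by (rule restrict_along_idempotent[OF dM \<open>is_hom M M E'\<close> CD(1)[unfolded n_def] CD(2)[unfolded n_def] CD(3,4)])
  note wX = d4_moduleD(1)[OF X(1)] and wY = d4_moduleD(1)[OF Y(1)]
  have sumv: "A *\<^sub>v (B *\<^sub>v v) + C *\<^sub>v (D *\<^sub>v v) = v" if v: "v \<in> carrier_vec n" for v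
  proof -
    have "A *\<^sub>v (B *\<^sub>v v) = E *\<^sub>v v" unfolding AB(3) using AB(1,2) v by simp
    moreover have "C *\<^sub>v (D *\<^sub>v v) = E' *\<^sub>v v" unfolding CD(3) using CD(1,2) v by simp
    moreover have "E' *\<^sub>v v = v - E *\<^sub>v v" unfolding E'_def using Ec v
      by (simp add: minus_mult_distrib_mat_vec[of _ n n])
    ultimately show ?thesis using Ec v by (intro eq_vecI) auto
  qed
  let ?F = "vcat B D"
  have Fc: "?F \<in> carrier_mat (k + l) n" using vcat_carrier[OF AB(2) CD(2)] .
  have Fv: "?F *\<^sub>v v = B *\<^sub>v v @\<^sub>v D *\<^sub>v v" for v using vcat_mult[OF AB(2) CD(2)] .
  have "M \<cong>\<^sub>D X \<oplus>\<^sub>D Y"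
    unfolding d4_iso_def
  proof (intro exI conjI)
    show "is_hom M (X \<oplus>\<^sub>D Y) ?F"
    proof (rule is_homI_spans[OF wM well_formed_sum[OF wX wY] _ spans_carrier], goal_cases)
      case 1
      show ?case using Fc X(2) Y(2) n_def by (simp add: d4_sum_def)
    next
      case (2 v)
      note hB = is_homD[OF X(3) wM wX 2] and hD = is_homD[OF Y(3) wM wY 2]
      show ?case
        unfolding Fv hB hD d4_sum_def
        using hB(2) hD(2) well_formedD[OF wX] well_formedD[OF wY]
        by (simp add: block_diag_mult)
    qed
    have "inj_on ((*\<^sub>v) ?F) (space M)"
    proof (rule inj_onI)
      fix u v assume uv: "u \<in> space M" "v \<in> space M" "?F *\<^sub>v u = ?F *\<^sub>v v"
      have "B *\<^sub>v u = B *\<^sub>v v \<and> D *\<^sub>v u = D *\<^sub>v v"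
        using append_vec_eq[of "B *\<^sub>v u" k "B *\<^sub>v v"] uv(3)[unfolded Fv] uv(1,2) AB(2)
          mult_mat_vec_carrier[OF AB(2)] n_def by metis
      then show "u = v" using sumv[of u] sumv[of v] uv(1,2) n_def by metis
    qed
    \<comment> \<open>The kernel of D, the projection to the image of 1 - E, is the image of E. With
      this count the injective map \<open>?F\<close> becomes bijective.\<close>
    moreover have nkl: "n = k + l"
    proof (rule rank_nullity_dim[OF AB(1) left_inverse_inj[OF AB(1,2,4)] CD(2)])
      show "carrier_vec l \<subseteq> (*\<^sub>v) D ` carrier_vec n"
      proof
        fix w :: "'k vec" assume "w \<in> carrier_vec l"
        then have "D *\<^sub>v (C *\<^sub>v w) = w" using mult_inverse_vec[OF CD(1,2,4)] by blast
        then show "w \<in> (*\<^sub>v) D ` carrier_vec n" using CD(1) \<open>w \<in> carrier_vec l\<close> by (intro image_eqI[of _ _ "C *\<^sub>v w"]) auto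
      qed
      fix v :: "'k vec" assume v: "v \<in> carrier_vec n"
      have Ev: "E *\<^sub>v v = A *\<^sub>v (B *\<^sub>v v)" unfolding AB(3) using AB(1,2) v by simp
      have E'v: "E' *\<^sub>v v = v - E *\<^sub>v v" if "v \<in> carrier_vec n" for v unfolding E'_def using Ec that
        by (simp add: minus_mult_distrib_mat_vec[of _ n n])
      show "D *\<^sub>v v = 0\<^sub>v l \<longleftrightarrow> v \<in> (*\<^sub>v) A ` carrier_vec k"
      proof
        assume "D *\<^sub>v v = 0\<^sub>v l"
        then have "v = A *\<^sub>v (B *\<^sub>v v)" using sumv[OF v] AB(1,2) v mult_mat_zero_vec[OF CD(1)] by simp
        then show "v \<in> (*\<^sub>v) A ` carrier_vec k" using AB(2) v by (intro image_eqI[of _ _ "B *\<^sub>v v"]) auto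
      next
        assume "v \<in> (*\<^sub>v) A ` carrier_vec k"
        then obtain w where w: "w \<in> carrier_vec k" "v = A *\<^sub>v w" by blast
        then have "B *\<^sub>v v = w" using mult_inverse_vec[OF AB(1,2,4)] by blast
        then have "A *\<^sub>v (B *\<^sub>v v) = v" using w by simp
        have "C *\<^sub>v (D *\<^sub>v v) = E' *\<^sub>v v" unfolding CD(3) using CD(1,2) v by simp
        also have "\<dots> = 0\<^sub>v n" unfolding E'v[OF v] Ev \<open>A *\<^sub>v (B *\<^sub>v v) = v\<close> using v by simp
        finally have "C *\<^sub>v (D *\<^sub>v v) = 0\<^sub>v n" .
        then show "D *\<^sub>v v = 0\<^sub>v l"
          using inj_on_kernelD[OF CD(1) left_inverse_inj[OF CD(1,2,4)], of "D *\<^sub>v v"] CD(2) v by simp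
      qed
    qed
    moreover have "space (X \<oplus>\<^sub>D Y) \<subseteq> (*\<^sub>v) ?F ` space M"
    proof -
      have Fc': "?F \<in> carrier_mat n n" using Fc nkl by simp
      have i: "inj_on ((*\<^sub>v) ?F) (carrier_vec n)" using calculation(1) n_def by simp
      obtain G where G: "G \<in> carrier_mat n n" "G * ?F = 1\<^sub>m n"
        by (rule left_inverse_of_inj[OF Fc' i])
      have "?F * G = 1\<^sub>m n" using mat_mult_left_right_inverse[OF G(1) Fc' G(2)] .
      then have "?F *\<^sub>v (G *\<^sub>v w) = w" if "w \<in> carrier_vec n" for w
        using mult_inverse_vec[OF G(1) Fc'] that by blast
      then have "w \<in> (*\<^sub>v) ?F ` carrier_vec n" if "w \<in> carrier_vec n" for w
        using that G(1) by (intro image_eqI[of _ _ "G *\<^sub>v w"]) auto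
      then show ?thesis using nkl X(2) Y(2) n_def by (auto simp: d4_sum_def)
    qed
    moreover have "(*\<^sub>v) ?F ` space M \<subseteq> space (X \<oplus>\<^sub>D Y)"
      using Fc X(2) Y(2) n_def by (auto simp: d4_sum_def)
    ultimately show "bij_betw ((*\<^sub>v) ?F) (space M) (space (X \<oplus>\<^sub>D Y))"
      by (simp add: bij_betw_def)
  qed
  moreover have "\<forall>X Y. d4_module X \<and> d4_module Y \<and> M \<cong>\<^sub>D X \<oplus>\<^sub>D Y \<longrightarrow> rdim X = 0 \<or> rdim Y = 0"
    using M by (simp add: indecomposable_def)
  ultimately have "k = 0 \<or> l = 0" using X(1) Y(1) unfolding X(2) Y(2) by (metis X(2) Y(2))
  then show ?thesis
  proof
    assume "k = 0"
    then have "E = 0\<^sub>m n n" unfolding AB(3) using AB(1,2) by (intro eq_matI) (auto simp: scalar_prod_def)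
    then show ?thesis by (simp add: n_def)
  next
    assume "l = 0"
    then have "E' = 0\<^sub>m n n" unfolding CD(3) using CD(1,2) by (intro eq_matI) (auto simp: scalar_prod_def)
    have "E = 1\<^sub>m n"
    proof (rule eq_matI)
      fix i j assume ij: "i < dim_row (1\<^sub>m n :: 'k mat)" "j < dim_col (1\<^sub>m n :: 'k mat)"
      then have "E' $$ (i, j) = 0" unfolding \<open>E' = 0\<^sub>m n n\<close> by simp
      then show "E $$ (i, j) = 1\<^sub>m n $$ (i, j)" unfolding E'_def using ij Ec by simp
    qed (use Ec in auto)
    then show ?thesis by (simp add: n_def)
  qed
qed

section \<open>Matrix pencils\<close>

text \<open>Linear combinations are formed coordinatewise, so the result lies in
  \<open>carrier_vec n\<close> whatever the family V is.\<close>

definition lc :: "nat \<Rightarrow> (nat \<Rightarrow> 'k :: field) \<Rightarrow> (nat \<Rightarrow> 'k vec) \<Rightarrow> nat \<Rightarrow> 'k vec" where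
  "lc n f V k = vec n (\<lambda>l. \<Sum>i<k. f i * V i $ l)"

lemma lc_carrier [simp]: "lc n f V k \<in> carrier_vec n"
  by (simp add: lc_def)

lemma mult_lc:
  assumes "A \<in> carrier_mat m n" "\<And>i. i < k \<Longrightarrow> V i \<in> carrier_vec n"
  shows "A *\<^sub>v lc n f V k = lc m f (\<lambda>i. A *\<^sub>v V i) k"
proof (rule eq_vecI)
  fix l assume "l < dim_vec (lc m f (\<lambda>i. A *\<^sub>v V i) k)"
  then have l: "l < m" by (simp add: lc_def)
  have "(A *\<^sub>v lc n f V k) $ l = (\<Sum>j<n. A $$ (l, j) * (\<Sum>i<k. f i * V i $ j))"
    using assms(1) l by (simp add: scalar_prod_def lc_def lessThan_atLeast0)
  also have "\<dots> = (\<Sum>j<n. \<Sum>i<k. f i * (A $$ (l, j) * V i $ j))"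
    by (simp add: sum_distrib_left algebra_simps)
  also have "\<dots> = (\<Sum>i<k. f i * (\<Sum>j<n. A $$ (l, j) * V i $ j))"
    by (subst sum.swap) (simp add: sum_distrib_left)
  also have "\<dots> = (\<Sum>i<k. f i * (A *\<^sub>v V i) $ l)"
    using assms(1) l carrier_vecD[OF assms(2)]
    by (intro sum.cong refl) (simp add: scalar_prod_def lessThan_atLeast0)
  finally show "(A *\<^sub>v lc n f V k) $ l = lc m f (\<lambda>i. A *\<^sub>v V i) k $ l" using l by (simp add: lc_def)
qed (use assms in \<open>auto simp: lc_def\<close>)

definition cols_mat :: "nat \<Rightarrow> nat \<Rightarrow> (nat \<Rightarrow> 'k :: field vec) \<Rightarrow> 'k mat" where
  "cols_mat n k V = mat n k (\<lambda>(i, j). V j $ i)"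

lemma cols_mat_carrier [simp]: "cols_mat n k V \<in> carrier_mat n k"
  by (simp add: cols_mat_def)

lemma cols_mat_unit:
  "j < k \<Longrightarrow> V j \<in> carrier_vec n \<Longrightarrow> cols_mat n k V *\<^sub>v unit_vec k j = V j"
  by (intro eq_vecI) (auto simp: cols_mat_def)

lemma cols_mat_mult:
  assumes "v \<in> carrier_vec k"
  shows "cols_mat n k V *\<^sub>v v = lc n (\<lambda>i. v $ i) V k"
  using assms by (intro eq_vecI) (auto simp: cols_mat_def lc_def scalar_prod_def lessThan_atLeast0 mult.commute)

lemma lc_cong:
  "(\<And>i. i < k \<Longrightarrow> f i = g i) \<Longrightarrow> (\<And>i. i < k \<Longrightarrow> V i = W i) \<Longrightarrow> lc n f V k = lc n g W k"
  by (auto simp: lc_def intro!: sum.cong)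

lemma lc_Suc_shift:
  assumes "V 0 = 0\<^sub>v n"
  shows "lc n f V (Suc k) = lc n (\<lambda>i. f (Suc i)) (\<lambda>i. V (Suc i)) k"
  unfolding lc_def by (intro eq_vecI) (simp_all only: sum.lessThan_Suc_shift assms index_vec, simp_all add: assms)

text \<open>The linear relation \<open>B A\<^sup>-\<^sup>1\<close>, iterated \<open>q\<close> times on the subspace \<open>Z\<close>.\<close>

primrec rel_iter :: "'k :: field mat \<Rightarrow> 'k mat \<Rightarrow> nat \<Rightarrow> 'k vec set \<Rightarrow> nat \<Rightarrow> 'k vec set" where
  "rel_iter A B t Z 0 = Z"
| "rel_iter A B t Z (Suc q) = (*\<^sub>v) B ` {v \<in> carrier_vec t. A *\<^sub>v v \<in> rel_iter A B t Z q}"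

lemma subsp_rel_iter:
  assumes "A \<in> carrier_mat s t" "B \<in> carrier_mat s t" "subsp s Z"
  shows "subsp s (rel_iter A B t Z q)"
  by (induction q) (use assms in \<open>auto intro!: subsp_image subsp_vimage\<close>)

text \<open>Unrolls the iterated relation into witnesses T. Placed behind a vector x_0 with A x_0 =
  y they continue a chain of the pencil, which is how minimality or maximality of a chain gets
  contradicted.\<close>

lemma rel_iter_sequence:
  assumes "y \<in> rel_iter A B t Z q"
  shows "\<exists>T z. z 0 = y \<and> z q \<in> Z \<and> (\<forall>i<q. T i \<in> carrier_vec t \<and> z i = B *\<^sub>v T i \<and> z (Suc i) = A *\<^sub>v T i)"
  using assms
  proof (induction q arbitrary: y)
    case 0
    then show ?case by (intro exI[of _ "\<lambda>_. y"]) auto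
  next
    case (Suc q)
    then obtain v where v: "v \<in> carrier_vec t" "y = B *\<^sub>v v" "A *\<^sub>v v \<in> rel_iter A B t Z q" by auto
    from Suc.IH[OF v(3)] obtain T z where Tz: "z 0 = A *\<^sub>v v" "z q \<in> Z"
      "\<forall>i<q. T i \<in> carrier_vec t \<and> z i = B *\<^sub>v T i \<and> z (Suc i) = A *\<^sub>v T i" by blast
    show ?case
    proof (intro exI conjI allI impI)
      fix i assume i: "i < Suc q"
      show "case_nat v T i \<in> carrier_vec t" "case_nat y z i = B *\<^sub>v case_nat v T i"
        "case_nat y z (Suc i) = A *\<^sub>v case_nat v T i"
        using i v Tz by (auto split: nat.splits)
    qed (use Tz in auto)
  qed

text \<open>Dual to \<open>rel_iter_sequence\<close>: g B vanishes on the vectors that A sends into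
  the iterate one step earlier, so \<open>functional_extension\<close> rewrites it as h A with h
  vanishing on that iterate.\<close>

lemma functional_sequence:
  fixes A B :: "'k :: field mat"
  assumes A: "A \<in> carrier_mat s t" and B: "B \<in> carrier_mat s t" and Z: "subsp s Z"
    and g: "g \<in> carrier_mat 1 s" "\<forall>z \<in> rel_iter A B t Z q. g *\<^sub>v z = 0\<^sub>v 1"
  shows "\<exists>G. G 0 = g \<and> (\<forall>j\<le>q. G j \<in> carrier_mat 1 s) \<and> (\<forall>j<q. G j * B = G (Suc j) * A) \<and>
      (\<forall>z\<in>Z. G q *\<^sub>v z = 0\<^sub>v 1)"
  using g
  proof (induction q arbitrary: g)
    case 0
    then show ?case by (intro exI[of _ "\<lambda>_. g"]) auto
  next
    case (Suc q)
    have gB: "g * B \<in> carrier_mat 1 t" using Suc.prems(1) B by simp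
    have "g * B *\<^sub>v v = 0\<^sub>v 1" if "v \<in> carrier_vec t" "A *\<^sub>v v \<in> rel_iter A B t Z q" for v
    proof -
      have "B *\<^sub>v v \<in> rel_iter A B t Z (Suc q)" using that by auto
      then have "g *\<^sub>v (B *\<^sub>v v) = 0\<^sub>v 1" using Suc.prems(2) by blast
      then show ?thesis using Suc.prems(1) that(1) B by simp
    qed
    from functional_extension[OF A gB subsp_rel_iter[OF A B Z] this]
    obtain h where h: "h \<in> carrier_mat 1 s" "h * A = g * B" "\<forall>z \<in> rel_iter A B t Z q. h *\<^sub>v z = 0\<^sub>v 1"
      by blast
    from Suc.IH[OF h(1,3)] obtain G where G: "G 0 = h" "\<forall>j\<le>q. G j \<in> carrier_mat 1 s"
      "\<forall>j<q. G j * B = G (Suc j) * A" "\<forall>z\<in>Z. G q *\<^sub>v z = 0\<^sub>v 1" by blast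
    show ?case
    proof (intro exI[of _ "case_nat g G"] conjI allI impI)
      fix j assume "j < Suc q"
      then show "case_nat g G j * B = case_nat g G (Suc j) * A"
        using G h by (auto split: nat.splits)
    next
      fix j assume "j \<le> Suc q"
      then show "case_nat g G j \<in> carrier_mat 1 s"
        using G Suc.prems(1) by (auto split: nat.splits)
    qed (use G in auto)
  qed

text \<open>The functional with value 1 at y on the line through y extends by zero on Z. Scalars are
  vectors of length 1 here, so the value 1 reads \<open>unit_vec 1 0\<close>.\<close>

lemma separating_functional:
  fixes y :: "'k :: field vec"
  assumes y: "y \<in> carrier_vec s" and Z: "subsp s Z" and "y \<notin> Z"
  shows "\<exists>g. g \<in> carrier_mat 1 s \<and> g *\<^sub>v y = unit_vec 1 0 \<and> (\<forall>z\<in>Z. g *\<^sub>v z = 0\<^sub>v 1)"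
proof -
  let ?A = "cols_mat s 1 (\<lambda>_. y)"
  have Av: "?A *\<^sub>v v = v $ 0 \<cdot>\<^sub>v y" if "v \<in> carrier_vec 1" for v
    using that y by (intro eq_vecI) (auto simp: cols_mat_def scalar_prod_def)
  have "1\<^sub>m 1 *\<^sub>v v = 0\<^sub>v 1" if v: "v \<in> carrier_vec 1" "?A *\<^sub>v v \<in> Z" for v
  proof -
    have "v $ 0 = 0" using v Av subsp_smult_cancel[OF Z] \<open>y \<notin> Z\<close> by fastforce
    then show ?thesis using v by (intro eq_vecI) auto
  qed
  from functional_extension[OF cols_mat_carrier one_carrier_mat Z this]
  obtain g where g: "g \<in> carrier_mat 1 s" "g * ?A = 1\<^sub>m 1" "\<forall>z\<in>Z. g *\<^sub>v z = 0\<^sub>v 1" by blast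
  have "g *\<^sub>v y = (g * ?A) *\<^sub>v unit_vec 1 0"
    using g(1) y cols_mat_unit[of 0 1 "\<lambda>_. y" s] by (simp add: assoc_mult_mat_vec[of _ 1 s _ 1])
  then show ?thesis using g by (intro exI[of _ g]) simp
qed

text \<open>A pair (E, F) as below is an endomorphism of A, B as a representation of the Kronecker
  quiver. The condition thus says that this representation is zero or indecomposable.\<close>

definition only_trivial_idempotents :: "'k :: field mat \<Rightarrow> 'k mat \<Rightarrow> nat \<Rightarrow> nat \<Rightarrow> bool" where
  "only_trivial_idempotents A B s t \<longleftrightarrow>
     (\<forall>E F. E \<in> carrier_mat t t \<longrightarrow> F \<in> carrier_mat s s \<longrightarrow> E * E = E \<longrightarrow> F * F = F \<longrightarrow>
        A * E = F * A \<longrightarrow> B * E = F * B \<longrightarrow> (E = 0\<^sub>m t t \<and> F = 0\<^sub>m s s) \<or> (E = 1\<^sub>m t \<and> F = 1\<^sub>m s))"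

lemma left_right_inverse_dim_eq:
  fixes X :: "'k :: field mat"
  assumes "X \<in> carrier_mat t m" "H \<in> carrier_mat m t" "H * X = 1\<^sub>m m" "X * H = 1\<^sub>m t"
  shows "m = t"
  using inj_dim_le[OF assms(1) left_inverse_inj[OF assms(1,2,3)]]
    inj_dim_le[OF assms(2) left_inverse_inj[OF assms(2,1,4)]] by simp

text \<open>X and Y embed the pencil K, L into A, B, while H and G retract it back, so (X H, Y G) is
  an idempotent pair of the ambient pencil. Its target part is nonzero as p > 0; hence both parts
  are identities and the embedding is bijective.\<close>

lemma retract_of_trivial_idempotents:
  fixes A B :: "'k :: field mat"
  assumes triv: "only_trivial_idempotents A B s t"
    and A: "A \<in> carrier_mat s t" and B: "B \<in> carrier_mat s t"
    and X: "X \<in> carrier_mat t m" and H: "H \<in> carrier_mat m t" and Y: "Y \<in> carrier_mat s p" and G: "G \<in> carrier_mat p s"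
    and K: "K \<in> carrier_mat p m" "L \<in> carrier_mat p m"
    and HX: "H * X = 1\<^sub>m m" and GY: "G * Y = 1\<^sub>m p"
    and AX: "A * X = Y * K" and BX: "B * X = Y * L" and GA: "G * A = K * H" and GB: "G * B = L * H"
    and p: "0 < p"
  shows "m = t" "p = s" "X * H = 1\<^sub>m t" "Y * G = 1\<^sub>m s"
proof -
  have E: "X * H * (X * H) = X * H"
    using X H HX assoc_mult_mat[of X t m H t "X * H" t] assoc_mult_mat[of H m t X m H t] by simp
  have F: "Y * G * (Y * G) = Y * G"
    using Y G GY assoc_mult_mat[of Y s p G s "Y * G" s] assoc_mult_mat[of G p s Y p G s] by simp
  have *: "C * (X * H) = Y * G * C" if C: "C \<in> carrier_mat s t" "J \<in> carrier_mat p m" "C * X = Y * J" "G * C = J * H" for C J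
  proof -
    have "C * (X * H) = Y * J * H" using C X H assoc_mult_mat[of C s t X m H t] by simp
    also have "\<dots> = Y * (G * C)" unfolding C(4) using C(2) Y H by simp
    finally show ?thesis using C(1) Y G by simp
  qed
  have "Y * G \<noteq> 0\<^sub>m s s"
  proof
    assume "Y * G = 0\<^sub>m s s"
    then have "Y * G * Y = 0\<^sub>m s p" using Y by simp
    moreover have "Y * G * Y = Y" using Y G GY by simp
    ultimately have "G * Y = 0\<^sub>m p p" using G by simp
    then have "(1\<^sub>m p :: 'k mat) $$ (0, 0) = 0" using GY p by simp
    then show False using p by simp
  qed
  then have "X * H = 1\<^sub>m t \<and> Y * G = 1\<^sub>m s"
    using triv E F *[OF A K(1) AX GA] *[OF B K(2) BX GB] X H Y G
    unfolding only_trivial_idempotents_def by (metis mult_carrier_mat)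
  then show XH: "X * H = 1\<^sub>m t" and YG: "Y * G = 1\<^sub>m s" by auto
  show "m = t" "p = s"
    using left_right_inverse_dim_eq[OF X H HX XH] left_right_inverse_dim_eq[OF Y G GY YG] by auto
qed

text \<open>With m = p + 1, \<open>incl_mat\<close> and \<open>shift_mat\<close> are the two maps of
  Kronecker's singular block; with m = p the shift is the nilpotent Jordan block.\<close>

definition shift_mat :: "nat \<Rightarrow> nat \<Rightarrow> 'k :: field mat" where
  "shift_mat p m = mat p m (\<lambda>(i, j). if j = Suc i then 1 else 0)"

definition incl_mat :: "nat \<Rightarrow> nat \<Rightarrow> 'k :: field mat" where
  "incl_mat p m = mat p m (\<lambda>(i, j). if j = i then 1 else 0)"

text \<open>For x(T) = x_0 + x_1 T + ... + x_p T^p the conditions say that (B - T A) x(T) = 0 and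
  x(0) is nonzero: a kernel vector of the pencil over k[T]. The index p is a degree, so there are p
  + 1 vectors. An \<open>open_chain\<close> solves the equation only modulo T^(p+1).\<close>

definition closed_chain :: "'k :: field mat \<Rightarrow> 'k mat \<Rightarrow> nat \<Rightarrow> (nat \<Rightarrow> 'k vec) \<Rightarrow> nat \<Rightarrow> bool" where
  "closed_chain A B t x p \<longleftrightarrow> (\<forall>i\<le>p. x i \<in> carrier_vec t) \<and> x 0 \<noteq> 0\<^sub>v t \<and> B *\<^sub>v x 0 = 0\<^sub>v (dim_row B) \<and>
     (\<forall>i<p. B *\<^sub>v x (Suc i) = A *\<^sub>v x i) \<and> A *\<^sub>v x p = 0\<^sub>v (dim_row A)"

definition open_chain :: "'k :: field mat \<Rightarrow> 'k mat \<Rightarrow> nat \<Rightarrow> (nat \<Rightarrow> 'k vec) \<Rightarrow> nat \<Rightarrow> bool" where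
  "open_chain A B t x p \<longleftrightarrow> (\<forall>i\<le>p. x i \<in> carrier_vec t) \<and> x 0 \<noteq> 0\<^sub>v t \<and> B *\<^sub>v x 0 = 0\<^sub>v (dim_row B) \<and>
     (\<forall>i<p. B *\<^sub>v x (Suc i) = A *\<^sub>v x i)"

text \<open>The t + 1 vectors of length t are dependent. Multiplying x(T) by the reversed polynomial
  of a dependency makes one coefficient of the product zero, and the coefficients before it form a
  closed chain.\<close>

lemma closed_chain_of_long_chain:
  fixes A B :: "'k :: field mat"
  assumes A: "A \<in> carrier_mat s t" and B: "B \<in> carrier_mat s t" and x: "open_chain A B t x t"
  obtains z p where "closed_chain A B t z p"
proof -
  have xc: "x i \<in> carrier_vec t" if "i \<le> t" for i using x that by (auto simp: open_chain_def)
  let ?X = "cols_mat t (Suc t) x"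
  have "\<not> inj_on ((*\<^sub>v) ?X) (carrier_vec (Suc t))" using inj_dim_le[of ?X t "Suc t"] by auto
  then obtain v where v: "v \<in> carrier_vec (Suc t)" "?X *\<^sub>v v = 0\<^sub>v t" "v \<noteq> 0\<^sub>v (Suc t)"
    using inj_onI_kernel[OF cols_mat_carrier] by blast
  have ex: "\<exists>i. i < Suc t \<and> v $ i \<noteq> 0"
  proof (rule ccontr)
    assume "\<not> ?thesis"
    then have "v = 0\<^sub>v (Suc t)" using v(1) by (intro eq_vecI) auto
    then show False using v(3) by simp
  qed
  define K where "K = (GREATEST i. i < Suc t \<and> v $ i \<noteq> 0)"
  have K: "K < Suc t" "v $ K \<noteq> 0"
    using GreatestI_ex_nat[OF ex, of t] unfolding K_def by auto
  have Kmax: "v $ i = 0" if "i < Suc t" "K < i" for i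
    using Greatest_le_nat[of "\<lambda>i. i < Suc t \<and> v $ i \<noteq> 0" i t] that unfolding K_def by fastforce
  \<comment> \<open>z_m is, for m up to K, the coefficient of T^m in x(T) times the polynomial with
    coefficients v_K, v_(K-1), ..., v_0. So z_0 is a nonzero multiple of x_0, and z_K is the
    dependency itself.\<close>
  define z where "z m = lc t (\<lambda>i. v $ (K - m + i)) x (Suc m)" for m
  have z0: "z 0 = v $ K \<cdot>\<^sub>v x 0"
    using xc[of 0] by (intro eq_vecI) (auto simp: z_def lc_def)
  have zK: "z K = 0\<^sub>v t"
  proof -
    have "z K = lc t (\<lambda>i. v $ i) x (Suc t)"
    proof (rule eq_vecI)
      fix l assume "l < dim_vec (lc t (\<lambda>i. v $ i) x (Suc t))"
      then have l: "l < t" by (simp add: lc_def)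
      have "(\<Sum>i<Suc K. v $ i * x i $ l) = (\<Sum>i<Suc t. v $ i * x i $ l)"
        using K(1) Kmax by (intro sum.mono_neutral_left) auto
      then show "z K $ l = lc t (\<lambda>i. v $ i) x (Suc t) $ l" using l by (simp add: z_def lc_def del: sum.lessThan_Suc)
    qed (simp add: z_def lc_def)
    then show ?thesis using v(2) cols_mat_mult[OF v(1), of t x] by simp
  qed
  have step: "B *\<^sub>v z (Suc m) = A *\<^sub>v z m" if m: "m < K" for m
  proof -
    have "B *\<^sub>v z (Suc m) = lc s (\<lambda>i. v $ (K - Suc m + i)) (\<lambda>i. B *\<^sub>v x i) (Suc (Suc m))"
      unfolding z_def using xc m K by (intro mult_lc[OF B]) auto
    also have "\<dots> = lc s (\<lambda>i. v $ (K - Suc m + Suc i)) (\<lambda>i. B *\<^sub>v x (Suc i)) (Suc m)"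
      using x B by (intro lc_Suc_shift) (simp add: open_chain_def)
    also have "\<dots> = lc s (\<lambda>i. v $ (K - m + i)) (\<lambda>i. A *\<^sub>v x i) (Suc m)"
    proof (rule lc_cong)
      fix i assume "i < Suc m"
      then show "v $ (K - Suc m + Suc i) = v $ (K - m + i)"
        using m by (simp add: Suc_diff_Suc flip: add_Suc)
      show "B *\<^sub>v x (Suc i) = A *\<^sub>v x i" using x \<open>i < Suc m\<close> m K by (simp add: open_chain_def)
    qed
    also have "\<dots> = A *\<^sub>v z m"
      unfolding z_def using xc m K by (intro mult_lc[OF A, symmetric]) auto
    finally show ?thesis .
  qed
  have x0: "x 0 \<noteq> 0\<^sub>v t" using x by (simp add: open_chain_def)
  have z0n: "z 0 \<noteq> 0\<^sub>v t"
  proof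
    assume "z 0 = 0\<^sub>v t"
    then have "v $ K \<cdot>\<^sub>v x 0 \<in> {0\<^sub>v t}" using z0 by simp
    then show False using subsp_smult_cancel[OF subsp_zero K(2)] x0 by blast
  qed
  have "K \<noteq> 0" using z0n zK by auto
  then obtain p where p: "K = Suc p" by (cases K) auto
  have "closed_chain A B t z p"
    unfolding closed_chain_def
  proof (intro conjI allI impI)
    show "B *\<^sub>v z 0 = 0\<^sub>v (dim_row B)"
      using z0 x B xc[of 0] by (auto simp: mult_mat_smult_vec[OF B] open_chain_def)
    show "A *\<^sub>v z p = 0\<^sub>v (dim_row A)"
      using step[of p] p zK A mult_mat_zero_vec[OF B] by simp
  qed (use z0n step p in \<open>auto simp: z_def\<close>)
  then show ?thesis using that by blast
qed

text \<open>
  A closed chain of minimal length spans a direct summand of the pencil with one more dimension in the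
  source than in the target; the complement is cut out by functionals \<open>g\<^sub>j\<close> with \<open>g\<^sub>j B = g\<^sub>j\<^sub>+\<^sub>1 A\<close>.
  A square pencil without nontrivial idempotents has no such summand.
\<close>

lemma no_closed_chain:
  fixes A B :: "'k :: field mat"
  assumes A: "A \<in> carrier_mat n n" and B: "B \<in> carrier_mat n n"
    and triv: "only_trivial_idempotents A B n n"
    and ker: "\<And>v. v \<in> carrier_vec n \<Longrightarrow> A *\<^sub>v v = 0\<^sub>v n \<Longrightarrow> B *\<^sub>v v = 0\<^sub>v n \<Longrightarrow> v = 0\<^sub>v n"
  shows "\<not> closed_chain A B n x p"
proof
  assume "closed_chain A B n x p"
  then have ex: "\<exists>p x. closed_chain A B n x p" by blast
  define p where "p = (LEAST p. \<exists>x. closed_chain A B n x p)"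
  obtain x where x: "closed_chain A B n x p" using LeastI_ex[OF ex] unfolding p_def by blast
  have min: "\<not> closed_chain A B n z q" if "q < p" for z q
    using not_less_Least[of q "\<lambda>p. \<exists>x. closed_chain A B n x p"] that unfolding p_def by blast
  have xc: "x i \<in> carrier_vec n" if "i \<le> p" for i using x that by (simp add: closed_chain_def)
  have x0: "x 0 \<noteq> 0\<^sub>v n" "B *\<^sub>v x 0 = 0\<^sub>v n" and Bx: "\<And>i. i < p \<Longrightarrow> B *\<^sub>v x (Suc i) = A *\<^sub>v x i" and Ax: "A *\<^sub>v x p = 0\<^sub>v n"
    using x A B by (auto simp: closed_chain_def)
  \<comment> \<open>A closed chain of degree 0 would be a common kernel vector of A and B.\<close>
  have "p \<noteq> 0" using ker[OF xc[of 0]] x0 Ax by auto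
  then obtain q where q: "p = Suc q" by (cases p) auto
  define y where "y i = A *\<^sub>v x i" for i
  have yc: "y i \<in> carrier_vec n" if "i \<le> p" for i using xc[OF that] A by (simp add: y_def)
  \<comment> \<open>Otherwise the witnesses of the relation, placed behind x_0, form a closed chain
    of degree q < p.\<close>
  have "y 0 \<notin> rel_iter A B n {0\<^sub>v n} q"
  proof
    assume "y 0 \<in> rel_iter A B n {0\<^sub>v n} q"
    from rel_iter_sequence[OF this] obtain z T where Tz: "z 0 = y 0" "z q \<in> {0\<^sub>v n}" "\<And>i. i < q \<Longrightarrow> T i \<in> carrier_vec n"
      "\<And>i. i < q \<Longrightarrow> z i = B *\<^sub>v T i" "\<And>i. i < q \<Longrightarrow> z (Suc i) = A *\<^sub>v T i" by blast
    have Az: "A *\<^sub>v case_nat (x 0) T i = z i" if "i \<le> q" for i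
      using that Tz y_def by (cases i) auto
    have "closed_chain A B n (case_nat (x 0) T) q"
      unfolding closed_chain_def
    proof (intro conjI allI impI)
      fix i assume "i \<le> q" then show "case_nat (x 0) T i \<in> carrier_vec n"
        using Tz xc[of 0] by (cases i) auto
    next
      fix i assume "i < q" then show "B *\<^sub>v case_nat (x 0) T (Suc i) = A *\<^sub>v case_nat (x 0) T i"
        using Az[of i] Tz(4) by simp
    qed (use x0 A B Az[of q] Tz(2) in auto)
    then show False using min q by blast
  qed
  then obtain g where g: "g \<in> carrier_mat 1 n" "g *\<^sub>v y 0 = unit_vec 1 0"
    "\<forall>z \<in> rel_iter A B n {0\<^sub>v n} q. g *\<^sub>v z = 0\<^sub>v 1"
    using separating_functional[OF yc[of 0] subsp_rel_iter[OF A B subsp_zero]] by blast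
  obtain G where G0: "G 0 = g" and Gc: "\<And>j. j \<le> q \<Longrightarrow> G j \<in> carrier_mat 1 n"
    and GBA: "\<And>j. j < q \<Longrightarrow> G j * B = G (Suc j) * A"
    using functional_sequence[OF A B subsp_zero g(1) g(3)] by blast
  have GB: "G j *\<^sub>v (B *\<^sub>v v) = G (Suc j) *\<^sub>v (A *\<^sub>v v)" if "j < q" "v \<in> carrier_vec n" for j v
  proof -
    have "G j *\<^sub>v (B *\<^sub>v v) = (G j * B) *\<^sub>v v" using Gc[of j] B that by simp
    then show ?thesis using Gc[of "Suc j"] A that GBA[of j] by simp
  qed
  \<comment> \<open>The values G_j y_i are constant along diagonals. They vanish for i < j because B
    x_0 = 0 and for i > j because y_p = 0, and g makes them 1 for i = j: the functionals are dual to
    y_0, ..., y_q.\<close>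
  have d1: "G (Suc j) *\<^sub>v y (Suc i) = G j *\<^sub>v y i" if "j < q" "i < p" for i j
    using GB[OF that(1) xc[of "Suc i"]] Bx[of i] that by (simp add: y_def)
  have d0: "G (Suc j) *\<^sub>v y 0 = 0\<^sub>v 1" if "j < q" for j
    using GB[OF that xc[of 0]] x0(2) mult_mat_zero_vec[OF Gc[of j]] that by (simp add: y_def)
  have yp: "y p = 0\<^sub>v n" using Ax by (simp add: y_def)
  have below: "G j *\<^sub>v y i = 0\<^sub>v 1" if "i < j" "j \<le> q" for i j
    using that
  proof (induction i arbitrary: j)
    case 0
    then show ?case using d0 by (cases j) auto
  next
    case (Suc i)
    then obtain j' where "j = Suc j'" by (cases j) auto
    then show ?case using Suc d1[of j' i] q by simp
  qed
  have diag: "G j *\<^sub>v y j = unit_vec 1 0" if "j \<le> q" for j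
    using that by (induction j) (use d1 g G0 q in auto)
  have above: "G j *\<^sub>v y i = 0\<^sub>v 1" if "j < i" "i \<le> p" for i j
    using that
  proof (induction "p - i" arbitrary: i j)
    case 0
    then show ?case using yp mult_mat_zero_vec[OF Gc[of j]] q by simp
  next
    case (Suc d)
    then have "G j *\<^sub>v y i = G (Suc j) *\<^sub>v y (Suc i)" using d1[of j i] q by simp
    then show ?case using Suc by simp
  qed
  define Gm where "Gm = mat p n (\<lambda>(i, j). G i $$ (0, j))"
  have Gm: "Gm \<in> carrier_mat p n" by (simp add: Gm_def)
  have Gmv: "(Gm *\<^sub>v v) $ j = (G j *\<^sub>v v) $ 0" if "j < p" "v \<in> carrier_vec n" for j v
  proof -
    have "row Gm j = row (G j) 0" using that(1) Gc[of j] q by (intro eq_vecI) (auto simp: Gm_def)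
    then show ?thesis using that Gc[of j] Gm q by simp
  qed
  define X where "X = cols_mat n (Suc p) x"
  define Y where "Y = cols_mat n p y"
  define K where "K = (incl_mat p (Suc p) :: 'k mat)"
  define L where "L = (shift_mat p (Suc p) :: 'k mat)"
  have X: "X \<in> carrier_mat n (Suc p)" and Y: "Y \<in> carrier_mat n p" and K: "K \<in> carrier_mat p (Suc p)" and L: "L \<in> carrier_mat p (Suc p)"
    by (auto simp: X_def Y_def K_def L_def shift_mat_def incl_mat_def)
  have Xu: "X *\<^sub>v unit_vec (Suc p) j = x j" if "j \<le> p" for j
    using that xc unfolding X_def by (intro cols_mat_unit) auto
  have Yu: "Y *\<^sub>v unit_vec p j = y j" if "j < p" for j
    using that yc unfolding Y_def by (intro cols_mat_unit) auto
  have Ku: "K *\<^sub>v unit_vec (Suc p) j = (if j < p then unit_vec p j else 0\<^sub>v p)" if "j \<le> p" for j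
    using that by (intro eq_vecI) (auto simp: K_def incl_mat_def)
  have Lu: "L *\<^sub>v unit_vec (Suc p) j = (if j = 0 then 0\<^sub>v p else unit_vec p (j - 1))" if "j \<le> p" for j
    using that by (intro eq_vecI) (auto simp: L_def shift_mat_def)
  have GY: "Gm * Y = 1\<^sub>m p"
  proof (rule mat_eqI_spans[OF spans_unit_vecs[of p]])
    fix v :: "'k vec" assume "v \<in> unit_vec p ` {..<p}"
    then obtain j where j: "j < p" "v = unit_vec p j" by auto
    have "Gm *\<^sub>v y j = unit_vec p j"
    proof (rule eq_vecI)
      fix i assume "i < dim_vec (unit_vec p j :: 'k vec)"
      then have i: "i < p" by simp
      then have "(Gm *\<^sub>v y j) $ i = (G i *\<^sub>v y j) $ 0" using Gmv yc j by simp
      also have "\<dots> = unit_vec p j $ i"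
        using below[of j i] above[of i j] diag[of j] i j q by (cases i j rule: linorder_cases) auto
      finally show "(Gm *\<^sub>v y j) $ i = unit_vec p j $ i" .
    qed (use Gm in auto)
    then show "Gm * Y *\<^sub>v v = 1\<^sub>m p *\<^sub>v v" using j Gm Y Yu by simp
  qed (use Gm Y in auto)
  have AX: "A * X = Y * K"
  proof (rule mat_eqI_spans[OF spans_unit_vecs[of "Suc p"]])
    fix v :: "'k vec" assume "v \<in> unit_vec (Suc p) ` {..<Suc p}"
    then obtain j where j: "j \<le> p" "v = unit_vec (Suc p) j" by auto
    then show "A * X *\<^sub>v v = Y * K *\<^sub>v v"
      using A X Y K Xu[of j] Ku[of j] Yu[of j] Ax mult_mat_zero_vec[OF Y] by (cases "j = p") (auto simp: y_def)
  qed (use A X Y K in auto)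
  have BX: "B * X = Y * L"
  proof (rule mat_eqI_spans[OF spans_unit_vecs[of "Suc p"]])
    fix v :: "'k vec" assume "v \<in> unit_vec (Suc p) ` {..<Suc p}"
    then obtain j where j: "j \<le> p" "v = unit_vec (Suc p) j" by auto
    then show "B * X *\<^sub>v v = Y * L *\<^sub>v v"
      using B X Y L Xu[of j] Lu[of j] Yu[of "j - 1"] Bx[of "j - 1"] x0 mult_mat_zero_vec[OF Y] by (cases j) (auto simp: y_def)
  qed (use B X Y L in auto)
  \<comment> \<open>Forced by \<open>Gm * A = K * H\<close> and \<open>Gm * B = L * H\<close>: row j
    has to be G_j A for j < p, and row p has to be G_q B. On rows 1, ..., q both equations prescribe
    something, and they agree because G_j B = G_(j+1) A.\<close>
  define H where "H = vcat (Gm * A) (mat 1 n (\<lambda>(i, j). (Gm * B) $$ (q, j)))"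
  have H: "H \<in> carrier_mat (Suc p) n" using vcat_carrier[of "Gm * A" p n _ 1] Gm A by (simp add: H_def)
  have H_low: "row H i = row (Gm * A) i" if "i < p" for i
    using that Gm A H by (intro eq_vecI) (auto simp: H_def vcat_def)
  have H_high: "row H p = row (Gm * B) q"
    using Gm A B H q by (intro eq_vecI) (auto simp: H_def vcat_def)
  have GAH: "Gm * A = K * H"
  proof (rule eq_matI)
    fix i j assume ij: "i < dim_row (K * H)" "j < dim_col (K * H)"
    then have ij: "i < p" "j < n" using K H by auto
    have "row K i = unit_vec (Suc p) i" using ij by (intro eq_vecI) (auto simp: K_def incl_mat_def)
    then have "(K * H) $$ (i, j) = row H i $ j" using ij K H by simp
    then show "(Gm * A) $$ (i, j) = (K * H) $$ (i, j)" using H_low ij Gm A by simp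
  qed (use Gm A K H in auto)
  have GBH: "Gm * B = L * H"
  proof (rule eq_matI)
    fix i j assume ij: "i < dim_row (L * H)" "j < dim_col (L * H)"
    then have ij: "i < p" "j < n" using L H by auto
    have "row L i = unit_vec (Suc p) (Suc i)" using ij by (intro eq_vecI) (auto simp: L_def shift_mat_def)
    then have LH: "(L * H) $$ (i, j) = row H (Suc i) $ j" using ij L H by simp
    show "(Gm * B) $$ (i, j) = (L * H) $$ (i, j)"
    proof (cases "i = q")
      case True
      then show ?thesis using LH H_high q ij Gm B by simp
    next
      case False
      then have iq: "i < q" using ij q by simp
      have "(Gm * B) $$ (i, j) = (G i * B) $$ (0, j)"
        using ij iq Gm B Gc[of i] by (auto simp: Gm_def scalar_prod_def)
      also have "\<dots> = (Gm * A) $$ (Suc i, j)"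
        using ij iq Gm A Gc[of "Suc i"] q unfolding GBA[OF iq] by (auto simp: Gm_def scalar_prod_def)
      finally show ?thesis using LH H_low[of "Suc i"] iq q ij Gm A by simp
    qed
  qed (use Gm B L H in auto)
  have HX: "H * X = 1\<^sub>m (Suc p)"
  proof (rule eq_matI)
    fix i j assume "i < dim_row (1\<^sub>m (Suc p) :: 'k mat)" "j < dim_col (1\<^sub>m (Suc p) :: 'k mat)"
    then have ij: "i \<le> p" "j \<le> p" by auto
    have GAX: "Gm * A * X = K"
    proof -
      have "Gm * A * X = Gm * (Y * K)" using Gm A X AX by simp
      also have "\<dots> = Gm * Y * K" using Gm Y K by (simp add: assoc_mult_mat[of Gm p n Y p K])
      finally show ?thesis using GY K by simp
    qed
    have GBX: "Gm * B * X = L"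
    proof -
      have "Gm * B * X = Gm * (Y * L)" using Gm B X BX by simp
      also have "\<dots> = Gm * Y * L" using Gm Y L by (simp add: assoc_mult_mat[of Gm p n Y p L])
      finally show ?thesis using GY L by simp
    qed
    have HXij: "(H * X) $$ (i, j) = row H i \<bullet> col X j" using ij H X by simp
    show "(H * X) $$ (i, j) = 1\<^sub>m (Suc p) $$ (i, j)"
    proof (cases "i < p")
      case True
      have "(Gm * A * X) $$ (i, j) = row (Gm * A) i \<bullet> col X j"
        by (rule index_mult_mat(1)) (use True ij Gm A X in auto)
      then have "(H * X) $$ (i, j) = (Gm * A * X) $$ (i, j)" unfolding HXij H_low[OF True] by (rule sym)
      then show ?thesis unfolding GAX using True ij by (auto simp: K_def incl_mat_def)
    next
      case False
      then have "i = p" using ij by simp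
      have "(Gm * B * X) $$ (q, j) = row (Gm * B) q \<bullet> col X j"
        by (rule index_mult_mat(1)) (use ij Gm B X q in auto)
      then have "(H * X) $$ (i, j) = (Gm * B * X) $$ (q, j)" unfolding HXij unfolding \<open>i = p\<close> H_high by (rule sym)
      then show ?thesis unfolding GBX using \<open>i = p\<close> ij q by (auto simp: L_def shift_mat_def)
    qed
  qed (use H X in auto)
  \<comment> \<open>The block would have to be the whole pencil, but it is not square.\<close>
  have "Suc p = n" "p = n"
    using retract_of_trivial_idempotents[OF triv A B X H Y Gm K L HX GY AX BX GAH GBH] q by auto
  then show False by simp
qed

lemma unit_upper_triangular_invertible:
  fixes U :: "'k :: field mat"
  assumes U: "U \<in> carrier_mat n n" and "\<And>i j. i < n \<Longrightarrow> j < i \<Longrightarrow> U $$ (i, j) = 0" and "\<And>i. i < n \<Longrightarrow> U $$ (i, i) = 1"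
  obtains V where "V \<in> carrier_mat n n" "V * U = 1\<^sub>m n" "U * V = 1\<^sub>m n"
proof -
  have "upper_triangular U" using U assms(2) by auto
  then have "det U = prod_list (diag_mat U)" by (rule det_upper_triangular[OF _ U])
  also have "diag_mat U = map (\<lambda>_. 1) [0..<n]" using U assms(3) by (auto simp: diag_mat_def)
  also have "prod_list \<dots> = (1 :: 'k)" by (induction n) auto
  finally have "det U \<noteq> 0" by simp
  then have "inj_on ((*\<^sub>v) U) (carrier_vec n)"
    using det_0_iff_vec_prod_zero_field[OF U] by (intro inj_onI_kernel[OF U]) blast
  then obtain V where V: "V \<in> carrier_mat n n" "V * U = 1\<^sub>m n"
    using left_inverse_of_inj[OF U] by blast
  then show ?thesis using that mat_mult_left_right_inverse[OF V(1) U V(2)] by blast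
qed

text \<open>
  Without closed chains, the lengths of open chains are bounded.  A longest one spans a direct summand,
  hence everything.
\<close>

lemma kronecker_jordan_form:
  fixes A B :: "'k :: field mat"
  assumes A: "A \<in> carrier_mat n n" and B: "B \<in> carrier_mat n n"
    and triv: "only_trivial_idempotents A B n n"
    and ker: "\<And>v. v \<in> carrier_vec n \<Longrightarrow> A *\<^sub>v v = 0\<^sub>v n \<Longrightarrow> B *\<^sub>v v = 0\<^sub>v n \<Longrightarrow> v = 0\<^sub>v n"
    and v0: "v0 \<in> carrier_vec n" "v0 \<noteq> 0\<^sub>v n" "B *\<^sub>v v0 = 0\<^sub>v n"
  obtains x X Y where "\<And>i. i < n \<Longrightarrow> x i \<in> carrier_vec n" "B *\<^sub>v x 0 = 0\<^sub>v n"
    "\<And>i. Suc i < n \<Longrightarrow> B *\<^sub>v x (Suc i) = A *\<^sub>v x i"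
    "X \<in> carrier_mat n n" "cols_mat n n x * X = 1\<^sub>m n"
    "Y \<in> carrier_mat n n" "cols_mat n n (\<lambda>i. A *\<^sub>v x i) * Y = 1\<^sub>m n"
proof -
  let ?P = "\<lambda>p. \<exists>x. open_chain A B n x p"
  have P0: "?P 0" using v0 B by (intro exI[of _ "\<lambda>_. v0"]) (auto simp: open_chain_def)
  \<comment> \<open>A longer chain would contain an open chain of degree n, and this would produce a
    closed one.\<close>
  have bound: "p \<le> n" if p: "?P p" for p
  proof (rule ccontr)
    assume "\<not> p \<le> n"
    moreover obtain x where "open_chain A B n x p" using p by blast
    ultimately have "open_chain A B n x n" by (auto simp: open_chain_def)
    then show False using closed_chain_of_long_chain[OF A B] no_closed_chain[OF A B triv ker] by blast
  qed
  define q where "q = (GREATEST p. ?P p)"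
  obtain x where x: "open_chain A B n x q"
    using GreatestI_nat[of ?P, OF P0 bound] unfolding q_def by blast
  have max: "\<not> open_chain A B n z r" if "q < r" for z r
    using Greatest_le_nat[of ?P r n] bound that unfolding q_def by fastforce
  \<comment> \<open>From here on p counts the vectors of the chain, one more than its degree
    q.\<close>
  define p where "p = Suc q"
  have xc: "x i \<in> carrier_vec n" if "i < p" for i using x that by (simp add: open_chain_def p_def)
  have x0: "x 0 \<noteq> 0\<^sub>v n" "B *\<^sub>v x 0 = 0\<^sub>v n" and Bx: "\<And>i. Suc i < p \<Longrightarrow> B *\<^sub>v x (Suc i) = A *\<^sub>v x i"
    using x A B by (auto simp: open_chain_def p_def)
  define y where "y i = A *\<^sub>v x i" for i
  have yc: "y i \<in> carrier_vec n" if "i < p" for i using xc[OF that] A by (simp add: y_def)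
  have y0: "y 0 \<in> carrier_vec n" by (rule yc) (simp add: p_def)
  \<comment> \<open>Membership would prolong the longest chain by one vector. The relation is
    iterated on the whole space, so the last functional G_p below vanishes identically.\<close>
  have y0Z: "y 0 \<notin> rel_iter A B n (carrier_vec n) p"
  proof
    assume "y 0 \<in> rel_iter A B n (carrier_vec n) p"
    from rel_iter_sequence[OF this] obtain z T where Tz: "z 0 = y 0" "\<And>i. i < p \<Longrightarrow> T i \<in> carrier_vec n"
      "\<And>i. i < p \<Longrightarrow> z i = B *\<^sub>v T i" "\<And>i. i < p \<Longrightarrow> z (Suc i) = A *\<^sub>v T i" by blast
    have Az: "A *\<^sub>v case_nat (x 0) T i = z i" if "i \<le> p" for i
      using that Tz y_def by (cases i) auto
    have "open_chain A B n (case_nat (x 0) T) p"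
      unfolding open_chain_def
    proof (intro conjI allI impI)
      fix i assume "i \<le> p" then show "case_nat (x 0) T i \<in> carrier_vec n"
        using Tz xc[of 0] p_def by (cases i) auto
    next
      fix i assume "i < p" then show "B *\<^sub>v case_nat (x 0) T (Suc i) = A *\<^sub>v case_nat (x 0) T i"
        using Az[of i] Tz(3) by simp
    qed (use x0 B in auto)
    then show False using max p_def by blast
  qed
  obtain g where g: "g \<in> carrier_mat 1 n" "g *\<^sub>v y 0 = unit_vec 1 0"
    "\<forall>z \<in> rel_iter A B n (carrier_vec n) p. g *\<^sub>v z = 0\<^sub>v 1"
    using separating_functional[OF y0 subsp_rel_iter[OF A B subsp_carrier] y0Z] by blast
  from functional_sequence[OF A B subsp_carrier g(1) g(3)] obtain G where G:
    "G 0 = g \<and> (\<forall>j\<le>p. G j \<in> carrier_mat 1 n) \<and> (\<forall>j<p. G j * B = G (Suc j) * A) \<and>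
      (\<forall>z\<in>carrier_vec n. G p *\<^sub>v z = 0\<^sub>v 1)" by (elim exE)
  then have G0: "G 0 = g" and Gc: "\<And>j. j \<le> p \<Longrightarrow> G j \<in> carrier_mat 1 n"
    and GBA: "\<And>j. j < p \<Longrightarrow> G j * B = G (Suc j) * A" and Gp: "\<And>z. z \<in> carrier_vec n \<Longrightarrow> G p *\<^sub>v z = 0\<^sub>v 1"
    by simp_all
  have GB: "G j *\<^sub>v (B *\<^sub>v v) = G (Suc j) *\<^sub>v (A *\<^sub>v v)" if "j < p" "v \<in> carrier_vec n" for j v
  proof -
    have "G j *\<^sub>v (B *\<^sub>v v) = (G j * B) *\<^sub>v v" using Gc[of j] B that by simp
    then show ?thesis using Gc[of "Suc j"] A that GBA[of j] by simp
  qed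
  \<comment> \<open>Again the values G_j y_i are constant along diagonals. But the chain does not
    close, so nothing makes the entries with i > j vanish; the matrix of values is only
    unitriangular and has to be inverted.\<close>
  have d1: "G (Suc j) *\<^sub>v y (Suc i) = G j *\<^sub>v y i" if "j < p" "Suc i < p" for i j
    using GB[OF that(1) xc[of "Suc i"]] Bx[of i] that by (simp add: y_def)
  have d0: "G (Suc j) *\<^sub>v y 0 = 0\<^sub>v 1" if "j < p" for j
    using GB[OF that xc[of 0]] x0(2) mult_mat_zero_vec[OF Gc[of j]] that p_def by (simp add: y_def)
  have below: "G j *\<^sub>v y i = 0\<^sub>v 1" if "i < j" "j < p" for i j
    using that
  proof (induction i arbitrary: j)
    case 0
    then show ?case using d0 by (cases j) auto
  next
    case (Suc i)
    then obtain j' where "j = Suc j'" by (cases j) auto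
    then show ?case using Suc d1[of j' i] by simp
  qed
  have diag: "G j *\<^sub>v y j = unit_vec 1 0" if "j < p" for j
    using that by (induction j) (use d1 g G0 in auto)
  define Gm where "Gm = mat p n (\<lambda>(i, j). G i $$ (0, j))"
  have Gm: "Gm \<in> carrier_mat p n" by (simp add: Gm_def)
  define X where "X = cols_mat n p x"
  define Y where "Y = cols_mat n p y"
  define N where "N = (shift_mat p p :: 'k mat)"
  have X: "X \<in> carrier_mat n p" and Y: "Y \<in> carrier_mat n p" and N: "N \<in> carrier_mat p p"
    by (auto simp: X_def Y_def N_def shift_mat_def)
  have Xu: "X *\<^sub>v unit_vec p j = x j" if "j < p" for j
    using that xc unfolding X_def by (intro cols_mat_unit) auto
  have Yu: "Y *\<^sub>v unit_vec p j = y j" if "j < p" for j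
    using that yc unfolding Y_def by (intro cols_mat_unit) auto
  have Nu: "N *\<^sub>v unit_vec p j = (if j = 0 then 0\<^sub>v p else unit_vec p (j - 1))" if "j < p" for j
    using that by (intro eq_vecI) (auto simp: N_def shift_mat_def)
  have AX: "A * X = Y"
  proof (rule mat_eqI_spans[OF spans_unit_vecs[of p]])
    fix v :: "'k vec" assume "v \<in> unit_vec p ` {..<p}"
    then show "A * X *\<^sub>v v = Y *\<^sub>v v" using A X Xu Yu by (auto simp: y_def)
  qed (use A X Y in auto)
  have BX: "B * X = Y * N"
  proof (rule mat_eqI_spans[OF spans_unit_vecs[of p]])
    fix v :: "'k vec" assume "v \<in> unit_vec p ` {..<p}"
    then obtain j where j: "j < p" "v = unit_vec p j" by auto
    then show "B * X *\<^sub>v v = Y * N *\<^sub>v v"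
      using B X Y N Xu[of j] Nu[of j] Yu[of "j - 1"] Bx[of "j - 1"] x0 mult_mat_zero_vec[OF Y] by (cases j) (auto simp: y_def)
  qed (use B X Y N in auto)
  \<comment> \<open>Row i of N selects row i + 1; the zero last row of N matches the vanishing of
    G_p.\<close>
  have GBm: "Gm * B = N * (Gm * A)"
  proof (rule eq_matI)
    fix i j assume "i < dim_row (N * (Gm * A))" "j < dim_col (N * (Gm * A))"
    then have ij: "i < p" "j < n" using N A by auto
    have l: "(Gm * B) $$ (i, j) = (G (Suc i) * A) $$ (0, j)"
      using ij Gm B Gc[of i] unfolding GBA[OF ij(1), symmetric] by (auto simp: Gm_def scalar_prod_def)
    show "(Gm * B) $$ (i, j) = (N * (Gm * A)) $$ (i, j)"
    proof (cases "Suc i < p")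
      case True
      have "row N i = unit_vec p (Suc i)" using ij True by (intro eq_vecI) (auto simp: N_def shift_mat_def)
      then have "(N * (Gm * A)) $$ (i, j) = (Gm * A) $$ (Suc i, j)" using ij True N Gm A by simp
      then show ?thesis using l ij True Gm A Gc[of "Suc i"] by (auto simp: Gm_def scalar_prod_def)
    next
      case False
      then have "Suc i = p" using ij by simp
      have "G p *\<^sub>v col A j = 0\<^sub>v 1" using Gp ij A by auto
      then have "(G p *\<^sub>v col A j) $ 0 = 0" by simp
      then have "(G p * A) $$ (0, j) = 0" using ij A Gc[of p] by simp
      moreover have "row N i = 0\<^sub>v p" using ij \<open>Suc i = p\<close> by (intro eq_vecI) (auto simp: N_def shift_mat_def)
      moreover have "(N * (Gm * A)) $$ (i, j) = row N i \<bullet> col (Gm * A) j" using ij N Gm A by simp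
      moreover have "col (Gm * A) j \<in> carrier_vec p" using Gm A ij by auto
      ultimately show ?thesis using l \<open>Suc i = p\<close> by simp
    qed
  qed (use Gm B N A in auto)
  have GYij: "(Gm * Y) $$ (i, j) = (G i *\<^sub>v y j) $ 0" if "i < p" "j < p" for i j
  proof -
    have "col Y j = y j" using that(2) carrier_vecD[OF yc[OF that(2)]]
      by (intro eq_vecI) (simp_all add: Y_def cols_mat_def)
    moreover have "row Gm i = row (G i) 0" using that Gc[of i] by (intro eq_vecI) (auto simp: Gm_def)
    ultimately show ?thesis using that Gm Y Gc[of i] by simp
  qed
  define U where "U = Gm * Y"
  have U: "U \<in> carrier_mat p p" using Gm Y by (simp add: U_def)
  obtain V where V: "V \<in> carrier_mat p p" "V * U = 1\<^sub>m p" "U * V = 1\<^sub>m p"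
    using unit_upper_triangular_invertible[OF U] GYij below diag by (auto simp: U_def)
  \<comment> \<open>Both sides equal Gm B X. Hence the inverse V commutes with N as well, and
    correcting Gm to V Gm preserves the relation between its composites with A and B.\<close>
  have UN: "U * N = N * U"
  proof -
    have "U * N = Gm * (B * X)" unfolding BX U_def using Gm Y N by simp
    also have "\<dots> = N * (Gm * A) * X" unfolding GBm[symmetric] using Gm B X by simp
    also have "\<dots> = N * U" unfolding U_def AX[symmetric] using N Gm A X
      by (simp add: assoc_mult_mat[of N p p "Gm * A" n X p])
    finally show ?thesis .
  qed
  have VN: "V * N = N * V"
  proof -
    have "V * N = V * (N * U) * V" using V U N
      by (simp add: assoc_mult_mat[of V p p "N * U" p V p] assoc_mult_mat[of N p p U p V p])
    also have "\<dots> = N * V" unfolding UN[symmetric] using V U N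
      by (simp add: assoc_mult_mat[of V p p U p N p, symmetric])
    finally show ?thesis .
  qed
  define G' where "G' = V * Gm"
  have G': "G' \<in> carrier_mat p n" using V Gm by (simp add: G'_def)
  have G'Y: "G' * Y = 1\<^sub>m p" using V Gm Y by (simp add: G'_def U_def)
  have G'B: "G' * B = N * (G' * A)"
  proof -
    have "G' * B = V * (N * (Gm * A))" unfolding G'_def GBm[symmetric] using V Gm B by simp
    also have "\<dots> = V * N * (Gm * A)" using V N Gm A by (simp add: assoc_mult_mat[of V p p N p "Gm * A" n])
    also have "\<dots> = N * (G' * A)" unfolding VN G'_def using V N Gm A
      by (simp add: assoc_mult_mat[of N p p V p "Gm * A" n])
    finally show ?thesis .
  qed
  \<comment> \<open>The retract is the pencil (1, N), so its source functionals are the target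
    functionals composed with A.\<close>
  have HX: "(G' * A) * X = 1\<^sub>m p" using G' A X G'Y AX by simp
  note R = retract_of_trivial_idempotents[OF triv A B X _ Y G' one_carrier_mat N HX G'Y _ BX _ G'B]
  have R: "p = n" "X * (G' * A) = 1\<^sub>m n" "Y * G' = 1\<^sub>m n"
    using R[of] G' A AX Y p_def by auto
  show ?thesis
  proof (rule that[of x])
    show "cols_mat n n x * (G' * A) = 1\<^sub>m n" using R by (simp add: X_def)
    show "cols_mat n n (\<lambda>i. A *\<^sub>v x i) * G' = 1\<^sub>m n" using R by (simp add: Y_def y_def[abs_def])
  qed (use xc x0 Bx G' A R(1) in auto)
qed

section \<open>The block on which \<open>bc\<close> acts trivially\<close>

lemma two_neq_zero: "CHAR('k :: field) \<noteq> 2 \<Longrightarrow> (2 :: 'k) \<noteq> 0"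
proof
  assume c: "CHAR('k) \<noteq> 2" and "(2 :: 'k) = 0"
  then have "of_nat 2 = (0 :: 'k)" by simp
  then have "CHAR('k) dvd 2" by (simp only: of_nat_eq_0_iff_char_dvd)
  then have "CHAR('k) \<le> 2" "CHAR('k) \<noteq> 0"
    using dvd_imp_le[of "CHAR('k)" 2] by (simp, metis dvd_0_left_iff zero_neq_numeral)
  then have "CHAR('k) = 1" using c by linarith
  then have "of_nat 1 = (0 :: 'k)" by (simp only: of_nat_eq_0_iff_char_dvd dvd_refl)
  then show False by simp
qed

text \<open>As b b = 1, equality of b and c means that bc acts as 1. The last defining relation then
  says that a and d anticommute.\<close>

definition bc_trivial :: "('k :: field) d4_rep \<Rightarrow> bool" where
  "bc_trivial M \<longleftrightarrow> d4_module M \<and> (\<forall>v\<in>space M. act_c M *\<^sub>v v = act_b M *\<^sub>v v)"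

lemma bc_trivialD:
  assumes M: "bc_trivial M" and v: "v \<in> space M"
  shows "act_c M *\<^sub>v v = act_b M *\<^sub>v v"
    "act_b M *\<^sub>v (act_b M *\<^sub>v v) = v"
    "act_b M *\<^sub>v (act_a M *\<^sub>v v) = (- 1) \<cdot>\<^sub>v (act_a M *\<^sub>v (act_b M *\<^sub>v v))"
    "act_b M *\<^sub>v (act_d M *\<^sub>v v) = (- 1) \<cdot>\<^sub>v (act_d M *\<^sub>v (act_b M *\<^sub>v v))"
    "act_a M *\<^sub>v (act_a M *\<^sub>v v) = 0\<^sub>v (rdim M)"
    "act_d M *\<^sub>v (act_d M *\<^sub>v v) = 0\<^sub>v (rdim M)"
    "act_d M *\<^sub>v (act_a M *\<^sub>v v) = (- 1) \<cdot>\<^sub>v (act_a M *\<^sub>v (act_d M *\<^sub>v v))"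
proof -
  have dM: "d4_module M" using M by (simp add: bc_trivial_def)
  note wM = d4_moduleD(1)[OF dM]
  have L: "d4_laws M v" using d4_moduleD(2)[OF dM v] .
  have c: "act_c M *\<^sub>v u = act_b M *\<^sub>v u" if "u \<in> space M" for u using M that by (simp add: bc_trivial_def)
  show "act_c M *\<^sub>v v = act_b M *\<^sub>v v" using c v .
  show bb: "act_b M *\<^sub>v (act_b M *\<^sub>v v) = v" using L by (simp add: d4_laws_def)
  show "act_b M *\<^sub>v (act_a M *\<^sub>v v) = (- 1) \<cdot>\<^sub>v (act_a M *\<^sub>v (act_b M *\<^sub>v v))" using L by (simp add: d4_laws_def)
  have "act_d M *\<^sub>v (act_b M *\<^sub>v v) = (- 1) \<cdot>\<^sub>v (act_b M *\<^sub>v (act_d M *\<^sub>v v))" using L by (simp add: d4_laws_def)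
  then show "act_b M *\<^sub>v (act_d M *\<^sub>v v) = (- 1) \<cdot>\<^sub>v (act_d M *\<^sub>v (act_b M *\<^sub>v v))"
    by (simp add: smult_smult_assoc)
  show "act_a M *\<^sub>v (act_a M *\<^sub>v v) = 0\<^sub>v (rdim M)" "act_d M *\<^sub>v (act_d M *\<^sub>v v) = 0\<^sub>v (rdim M)"
    using L by (auto simp: d4_laws_def)
  have e: "act_d M *\<^sub>v (act_a M *\<^sub>v v) + act_a M *\<^sub>v (act_d M *\<^sub>v v) = 0\<^sub>v (rdim M)"
    using L c[OF v] bb v by (simp add: d4_laws_def)
  show "act_d M *\<^sub>v (act_a M *\<^sub>v v) = (- 1) \<cdot>\<^sub>v (act_a M *\<^sub>v (act_d M *\<^sub>v v))"
  proof (rule eq_vecI)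
    fix i assume "i < dim_vec ((- 1) \<cdot>\<^sub>v (act_a M *\<^sub>v (act_d M *\<^sub>v v)))"
    then have i: "i < rdim M" using well_formedD[OF wM] by simp
    then have "(act_d M *\<^sub>v (act_a M *\<^sub>v v) + act_a M *\<^sub>v (act_d M *\<^sub>v v)) $ i = 0" using e by simp
    moreover have "dim_vec (act_d M *\<^sub>v (act_a M *\<^sub>v v)) = rdim M" "dim_vec (act_a M *\<^sub>v (act_d M *\<^sub>v v)) = rdim M"
      using well_formedD[OF wM] by auto
    ultimately show "(act_d M *\<^sub>v (act_a M *\<^sub>v v)) $ i = ((- 1) \<cdot>\<^sub>v (act_a M *\<^sub>v (act_d M *\<^sub>v v))) $ i"
      using i by (simp add: eq_neg_iff_add_eq_0 del: index_mult_mat_vec)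
  qed (use well_formedD[OF wM] in auto)
qed

lemma bc_trivial_well_formed: "bc_trivial M \<Longrightarrow> well_formed M"
  using d4_moduleD(1) by (auto simp: bc_trivial_def)

text \<open>For an involution b and e e = 1 this is the projection onto the e-eigenspace along the
  other eigenspace.\<close>

definition eigen_proj :: "'k :: field \<Rightarrow> 'k mat \<Rightarrow> 'k mat" where
  "eigen_proj e b = inverse 2 \<cdot>\<^sub>m (1\<^sub>m (dim_row b) + e \<cdot>\<^sub>m b)"

lemma smult_mat_mult_vec:
  assumes "(A :: 'k :: field mat) \<in> carrier_mat n k" "v \<in> carrier_vec k"
  shows "(c \<cdot>\<^sub>m A) *\<^sub>v v = c \<cdot>\<^sub>v (A *\<^sub>v v)"
  using assms by (intro eq_vecI) auto

lemma eigen_proj_carrier: "b \<in> carrier_mat n n \<Longrightarrow> eigen_proj e b \<in> carrier_mat n n"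
  by (auto simp: eigen_proj_def)

lemma eigen_proj_mult:
  assumes "b \<in> carrier_mat n n" "v \<in> carrier_vec n"
  shows "eigen_proj e b *\<^sub>v v = inverse 2 \<cdot>\<^sub>v (v + e \<cdot>\<^sub>v (b *\<^sub>v v))"
  unfolding eigen_proj_def using assms
  by (simp add: smult_mat_mult_vec[of _ n n] add_mult_distrib_mat_vec[of _ n n])

lemma eigen_proj_fix:
  fixes v :: "'k :: field vec"
  assumes "(2 :: 'k) \<noteq> 0" "b \<in> carrier_mat n n" "v \<in> carrier_vec n" "b *\<^sub>v v = e \<cdot>\<^sub>v v" "e * e = 1"
  shows "eigen_proj e b *\<^sub>v v = v"
proof (rule eq_vecI)
  fix i assume "i < dim_vec v"
  then have "(eigen_proj e b *\<^sub>v v) $ i = inverse 2 * (v $ i + e * (e * v $ i))"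
    using assms(3,4) by (simp add: eigen_proj_mult[OF assms(2,3)])
  also have "e * (e * v $ i) = v $ i" using assms(5) by (simp flip: mult.assoc)
  finally show "(eigen_proj e b *\<^sub>v v) $ i = v $ i" using assms(1) by (simp add: field_simps)
qed (use assms eigen_proj_carrier[OF assms(2)] in auto)

lemma eigen_proj_kill:
  fixes v :: "'k :: field vec"
  assumes "b \<in> carrier_mat n n" "v \<in> carrier_vec n" "b *\<^sub>v v = (- e) \<cdot>\<^sub>v v" "e * e = 1"
  shows "eigen_proj e b *\<^sub>v v = 0\<^sub>v n"
proof (rule eq_vecI)
  fix i assume i: "i < dim_vec (0\<^sub>v n :: 'k vec)"
  then have "(eigen_proj e b *\<^sub>v v) $ i = inverse 2 * (v $ i + e * (- e * v $ i))"
    using assms(2,3) by (simp add: eigen_proj_mult[OF assms(1,2)])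
  also have "e * (- e * v $ i) = - v $ i" using assms(4) by (simp flip: mult.assoc)
  finally show "(eigen_proj e b *\<^sub>v v) $ i = 0\<^sub>v n $ i" using i by simp
qed (use assms eigen_proj_carrier[OF assms(1)] in auto)

text \<open>With w = b v and h = 1/2 this is the eigenvector equation for the projection (1 + e b)/2
  of v.\<close>

lemma smult_involution:
  fixes v :: "'k :: field vec"
  assumes w: "w \<in> carrier_vec n" and v: "v \<in> carrier_vec n" and e: "e * e = 1"
  shows "h \<cdot>\<^sub>v (w + e \<cdot>\<^sub>v v) = e \<cdot>\<^sub>v (h \<cdot>\<^sub>v (v + e \<cdot>\<^sub>v w))"
proof (rule eq_vecI)
  fix i assume "i < dim_vec (e \<cdot>\<^sub>v (h \<cdot>\<^sub>v (v + e \<cdot>\<^sub>v w)))"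
  then have i: "i < n" using w by simp
  have "e * (h * (v $ i + e * w $ i)) = h * (e * v $ i + (e * e) * w $ i)"
    by (simp add: algebra_simps)
  also have "\<dots> = h * (w $ i + e * v $ i)" unfolding e by simp
  finally show "(h \<cdot>\<^sub>v (w + e \<cdot>\<^sub>v v)) $ i = (e \<cdot>\<^sub>v (h \<cdot>\<^sub>v (v + e \<cdot>\<^sub>v w))) $ i"
    using i w v by (simp, metis)
qed (use w v in auto)

lemma eigen_proj_eigen:
  assumes b: "b \<in> carrier_mat n n" and v: "v \<in> carrier_vec n" and bb: "b *\<^sub>v (b *\<^sub>v v) = v" and e: "e * e = (1 :: 'k :: field)"
  shows "b *\<^sub>v (eigen_proj e b *\<^sub>v v) = e \<cdot>\<^sub>v (eigen_proj e b *\<^sub>v v)"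
proof -
  have "b *\<^sub>v (eigen_proj e b *\<^sub>v v) = inverse 2 \<cdot>\<^sub>v (b *\<^sub>v v + e \<cdot>\<^sub>v v)"
    using b v bb by (simp add: eigen_proj_mult[OF b v] mult_mat_smult_vec[OF b] mult_add_distrib_mat_vec[OF b])
  also have "\<dots> = e \<cdot>\<^sub>v (inverse 2 \<cdot>\<^sub>v (v + e \<cdot>\<^sub>v (b *\<^sub>v v)))"
    by (rule smult_involution[OF _ v e]) (use b v in simp)
  finally show ?thesis by (simp add: eigen_proj_mult[OF b v])
qed

lemma eigen_proj_sum:
  fixes v :: "'k :: field vec"
  assumes "(2 :: 'k) \<noteq> 0" "b \<in> carrier_mat n n" "v \<in> carrier_vec n"
  shows "eigen_proj e b *\<^sub>v v + eigen_proj (- e) b *\<^sub>v v = v"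
proof (rule eq_vecI)
  fix i assume i: "i < dim_vec v"
  have "inverse 2 * (x + y) + inverse 2 * (x + - y) = x" for x y :: 'k
    using assms(1) by (simp add: field_simps)
  then show "(eigen_proj e b *\<^sub>v v + eigen_proj (- e) b *\<^sub>v v) $ i = v $ i"
    using assms(2,3) i by (simp add: eigen_proj_mult[OF assms(2,3)] del: index_mult_mat_vec)
qed (use assms eigen_proj_carrier[OF assms(2)] in auto)

text \<open>Both a and d anticommute with b and with c, so two signs cancel.\<close>

lemma bc_central:
  assumes M: "d4_module M" and v: "v \<in> space M"
  shows "act_b M *\<^sub>v (act_c M *\<^sub>v (act_a M *\<^sub>v v)) = act_a M *\<^sub>v (act_b M *\<^sub>v (act_c M *\<^sub>v v))"
    "act_b M *\<^sub>v (act_c M *\<^sub>v (act_d M *\<^sub>v v)) = act_d M *\<^sub>v (act_b M *\<^sub>v (act_c M *\<^sub>v v))"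
    "act_b M *\<^sub>v (act_c M *\<^sub>v (act_b M *\<^sub>v v)) = act_b M *\<^sub>v (act_b M *\<^sub>v (act_c M *\<^sub>v v))"
    "act_b M *\<^sub>v (act_c M *\<^sub>v (act_c M *\<^sub>v v)) = act_c M *\<^sub>v (act_b M *\<^sub>v (act_c M *\<^sub>v v))"
proof -
  define n a b c d where "n = rdim M" and "a = act_a M" and "b = act_b M" and "c = act_c M" and "d = act_d M"
  note wM = d4_moduleD(1)[OF M]
  note car = well_formedD[OF wM, folded n_def a_def b_def c_def d_def]
  have L: "d4_laws M u" if "u \<in> carrier_vec n" for u using d4_moduleD(2)[OF M] that by (simp add: n_def)
  note L' = L[unfolded d4_laws_def, folded n_def a_def b_def c_def d_def]
  have u: "v \<in> carrier_vec n" using v by (simp add: n_def)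
  have "b *\<^sub>v (c *\<^sub>v (a *\<^sub>v v)) = a *\<^sub>v (b *\<^sub>v (c *\<^sub>v v))"
    using L'[OF u] L'[of "c *\<^sub>v v"] u car by (simp add: mult_mat_smult_vec[OF car(2)] smult_smult_assoc)
  moreover have "b *\<^sub>v (c *\<^sub>v (d *\<^sub>v v)) = d *\<^sub>v (b *\<^sub>v (c *\<^sub>v v))"
  proof -
    have "c *\<^sub>v (d *\<^sub>v v) = (- 1) \<cdot>\<^sub>v (d *\<^sub>v (c *\<^sub>v v))" using L'[OF u] by (simp add: smult_smult_assoc)
    moreover have "b *\<^sub>v (d *\<^sub>v (c *\<^sub>v v)) = (- 1) \<cdot>\<^sub>v (d *\<^sub>v (b *\<^sub>v (c *\<^sub>v v)))"
      using L'[of "c *\<^sub>v v"] u car by (simp add: smult_smult_assoc)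
    ultimately show ?thesis using u car by (simp add: mult_mat_smult_vec[OF car(2)] smult_smult_assoc)
  qed
  moreover have "b *\<^sub>v (c *\<^sub>v (b *\<^sub>v v)) = b *\<^sub>v (b *\<^sub>v (c *\<^sub>v v))" using L'[OF u] by simp
  moreover have "b *\<^sub>v (c *\<^sub>v (c *\<^sub>v v)) = c *\<^sub>v (b *\<^sub>v (c *\<^sub>v v))" using L'[of "c *\<^sub>v v"] u car by simp
  ultimately show "act_b M *\<^sub>v (act_c M *\<^sub>v (act_a M *\<^sub>v v)) = act_a M *\<^sub>v (act_b M *\<^sub>v (act_c M *\<^sub>v v))"
    "act_b M *\<^sub>v (act_c M *\<^sub>v (act_d M *\<^sub>v v)) = act_d M *\<^sub>v (act_b M *\<^sub>v (act_c M *\<^sub>v v))"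
    "act_b M *\<^sub>v (act_c M *\<^sub>v (act_b M *\<^sub>v v)) = act_b M *\<^sub>v (act_b M *\<^sub>v (act_c M *\<^sub>v v))"
    "act_b M *\<^sub>v (act_c M *\<^sub>v (act_c M *\<^sub>v v)) = act_c M *\<^sub>v (act_b M *\<^sub>v (act_c M *\<^sub>v v))"
    by (simp_all add: a_def b_def c_def d_def)
qed

text \<open>The action of (1 + bc)/2 is an idempotent endomorphism because bc is central with square
  1. It fixes the nonzero vector v, so it is the identity.\<close>

lemma indecomposable_bc_trivial:
  assumes two: "(2 :: 'k :: field) \<noteq> 0" and M: "indecomposable (M :: 'k d4_rep)"
    and v: "v \<in> space M" "v \<noteq> 0\<^sub>v (rdim M)" "act_b M *\<^sub>v (act_c M *\<^sub>v v) = v"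
  shows "bc_trivial M"
proof -
  define n a b c d where "n = rdim M" and "a = act_a M" and "b = act_b M" and "c = act_c M" and "d = act_d M"
  have dM: "d4_module M" using M by (simp add: indecomposable_def)
  note wM = d4_moduleD(1)[OF dM]
  note car = well_formedD[OF wM, folded n_def a_def b_def c_def d_def]
  have L: "d4_laws M u" if "u \<in> carrier_vec n" for u using d4_moduleD(2)[OF dM] that by (simp add: n_def)
  note L' = L[unfolded d4_laws_def, folded n_def a_def b_def c_def d_def]
  have bc: "b * c \<in> carrier_mat n n" using car by simp
  define E where "E = eigen_proj 1 (b * c)"
  have Ec: "E \<in> carrier_mat n n" using eigen_proj_carrier[OF bc] by (simp add: E_def)
  have Ev: "E *\<^sub>v u = inverse 2 \<cdot>\<^sub>v (u + b *\<^sub>v (c *\<^sub>v u))" if "u \<in> carrier_vec n" for u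
    using that car by (simp add: E_def eigen_proj_mult[OF bc that])
  have bcbc: "(b * c) *\<^sub>v ((b * c) *\<^sub>v u) = u" if u: "u \<in> carrier_vec n" for u
  proof -
    have "c *\<^sub>v (b *\<^sub>v (c *\<^sub>v u)) = b *\<^sub>v u"
      using L'[of "c *\<^sub>v u"] L'[OF u] u car by simp
    then show ?thesis using L'[OF u] u car by simp
  qed
  have "E * E = E"
  proof (rule mat_eqI_vec)
    fix u :: "'k vec" assume u: "u \<in> carrier_vec n"
    have "(b * c) *\<^sub>v (E *\<^sub>v u) = 1 \<cdot>\<^sub>v (E *\<^sub>v u)"
      unfolding E_def by (rule eigen_proj_eigen[OF bc u bcbc[OF u]]) simp
    then have "E *\<^sub>v (E *\<^sub>v u) = E *\<^sub>v u"
      using eigen_proj_fix[OF two bc, of "E *\<^sub>v u" 1] Ec u by (simp add: E_def)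
    then show "E * E *\<^sub>v u = E *\<^sub>v u" using Ec u by simp
  qed (use Ec in auto)
  moreover have "is_hom M M E"
  proof (rule is_homI_spans[OF wM wM _ spans_carrier], goal_cases)
    case 1
    show ?case using Ec n_def by simp
  next
    case (2 u)
    then have u: "u \<in> carrier_vec n" by (simp add: n_def)
    have key: "E *\<^sub>v (x *\<^sub>v u) = x *\<^sub>v (E *\<^sub>v u)"
      if "x \<in> carrier_mat n n" "b *\<^sub>v (c *\<^sub>v (x *\<^sub>v u)) = x *\<^sub>v (b *\<^sub>v (c *\<^sub>v u))" for x
      using that u car Ev by (simp add: mult_mat_smult_vec[OF that(1)] mult_add_distrib_mat_vec[OF that(1)])
    show ?case
      using key car bc_central[OF dM 2] by (simp add: a_def b_def c_def d_def)
  qed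
  ultimately have "E = 0\<^sub>m n n \<or> E = 1\<^sub>m n" using indecomposable_idempotent[OF M] n_def by blast
  moreover have "E *\<^sub>v v = v"
    unfolding E_def by (rule eigen_proj_fix[OF two bc]) (use v car in \<open>auto simp: n_def b_def c_def\<close>)
  ultimately have E1: "E = 1\<^sub>m n" using zero_mat_mult_vec[of v n n] v by (auto simp: n_def)
  have "c *\<^sub>v u = b *\<^sub>v u" if u: "u \<in> carrier_vec n" for u
  proof -
    have "(b * c) *\<^sub>v u = 1 \<cdot>\<^sub>v u"
      using eigen_proj_eigen[OF bc u bcbc[OF u], of 1] u E1 by (simp add: E_def)
    then have "b *\<^sub>v (b *\<^sub>v (c *\<^sub>v u)) = b *\<^sub>v u" using u car by simp
    then show ?thesis using L'[of "c *\<^sub>v u"] u car by simp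
  qed
  then show ?thesis using dM by (simp add: bc_trivial_def n_def b_def c_def)
qed

section \<open>Socle, length and Loewy length on the block\<close>

lemma span_smallest:
  fixes X :: "'k :: field vec set"
  assumes X: "X \<subseteq> carrier_vec n"
  defines "S \<equiv> LinearCombinations.module.span class_ring (module_vec TYPE('k) n) X"
  shows "subsp n S" "X \<subseteq> S" "subsp n U \<Longrightarrow> X \<subseteq> U \<Longrightarrow> S \<subseteq> U"
proof -
  interpret vec_space "TYPE('k)" n .
  show "subsp n S" unfolding S_def using span_is_subspace[OF X] by (simp add: subspace_iff_subsp)
  show "X \<subseteq> S" unfolding S_def using in_own_span[OF X] .
  assume "subsp n U" "X \<subseteq> U"
  then show "S \<subseteq> U" unfolding S_def
    using span_is_subset[of X U] subspace_iff_subsp[of U n] is_module by blast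
qed

lemma is_submodule_iff:
  "is_submodule M U \<longleftrightarrow> subsp (rdim M) U \<and>
     (\<forall>u\<in>U. act_a M *\<^sub>v u \<in> U \<and> act_b M *\<^sub>v u \<in> U \<and> act_c M *\<^sub>v u \<in> U \<and> act_d M *\<^sub>v u \<in> U)"
  by (simp add: is_submodule_def subspace_iff_subsp)

text \<open>On the block this is the socle, by \<open>soc_eq_killed\<close>, in a form that can be
  computed with.\<close>

definition killed :: "('k :: field) d4_rep \<Rightarrow> 'k vec set" where
  "killed M = {v \<in> space M. act_a M *\<^sub>v v = 0\<^sub>v (rdim M) \<and> act_d M *\<^sub>v v = 0\<^sub>v (rdim M)}"

lemma subsp_killed:
  assumes "well_formed M"
  shows "subsp (rdim M) (killed M)"
proof -
  have "killed M = {v \<in> space M. act_a M *\<^sub>v v = 0\<^sub>v (rdim M)} \<inter> {v \<in> space M. act_d M *\<^sub>v v = 0\<^sub>v (rdim M)}"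
    by (auto simp: killed_def)
  then show ?thesis
    using subsp_Int[OF subsp_kernel[OF well_formedD(1)[OF assms]] subsp_kernel[OF well_formedD(4)[OF assms]]] by simp
qed

lemma killed_submodule:
  assumes M: "bc_trivial M"
  shows "is_submodule M (killed M)"
proof -
  note wM = bc_trivial_well_formed[OF M]
  note car = well_formedD[OF wM]
  note z = mult_mat_zero_vec
  have "act_b M *\<^sub>v v \<in> killed M" if v: "v \<in> killed M" for v
  proof -
    have vs: "v \<in> space M" and k: "act_a M *\<^sub>v v = 0\<^sub>v (rdim M)" "act_d M *\<^sub>v v = 0\<^sub>v (rdim M)"
      using v by (auto simp: killed_def)
    have "(- 1) \<cdot>\<^sub>v (act_a M *\<^sub>v (act_b M *\<^sub>v v)) = 0\<^sub>v (rdim M)"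
      "(- 1) \<cdot>\<^sub>v (act_d M *\<^sub>v (act_b M *\<^sub>v v)) = 0\<^sub>v (rdim M)"
      using bc_trivialD(3,4)[OF M vs] k z[OF car(2)] by simp_all
    then have "(- 1) \<cdot>\<^sub>v (act_a M *\<^sub>v (act_b M *\<^sub>v v)) \<in> {0\<^sub>v (rdim M)}"
      "(- 1) \<cdot>\<^sub>v (act_d M *\<^sub>v (act_b M *\<^sub>v v)) \<in> {0\<^sub>v (rdim M)}" by simp_all
    then have "act_a M *\<^sub>v (act_b M *\<^sub>v v) = 0\<^sub>v (rdim M)" "act_d M *\<^sub>v (act_b M *\<^sub>v v) = 0\<^sub>v (rdim M)"
      using subsp_smult_cancel[OF subsp_zero, of "- 1"] by fastforce+
    then show ?thesis using act_closed(2)[OF wM vs] by (simp add: killed_def)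
  qed
  moreover have "act_c M *\<^sub>v v = act_b M *\<^sub>v v" if "v \<in> killed M" for v
    using that bc_trivialD(1)[OF M] by (auto simp: killed_def)
  moreover have "0\<^sub>v (rdim M) \<in> killed M" using subspD(2)[OF subsp_killed[OF wM]] .
  ultimately show ?thesis using subsp_killed[OF wM] by (auto simp: is_submodule_iff killed_def)
qed

text \<open>Since a and d anticommute and square to zero, the earliest nonzero vector in the list a
  d v, d v, a v, v is annihilated by both.\<close>

lemma submodule_meets_killed:
  assumes M: "bc_trivial M" and U: "is_submodule M U" and v: "v \<in> U" "v \<noteq> 0\<^sub>v (rdim M)"
  obtains w where "w \<in> U" "w \<in> killed M" "w \<noteq> 0\<^sub>v (rdim M)"
proof -
  define n a d where "n = rdim M" and "a = act_a M" and "d = act_d M"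
  note wM = bc_trivial_well_formed[OF M]
  have car: "a \<in> carrier_mat n n" "d \<in> carrier_mat n n" using well_formedD[OF wM] by (auto simp: n_def a_def d_def)
  have cl: "a *\<^sub>v u \<in> U" "d *\<^sub>v u \<in> U" "u \<in> carrier_vec n" if "u \<in> U" for u
    using U that subspD(5) unfolding is_submodule_iff a_def d_def n_def by blast+
  have k: "w \<in> killed M \<longleftrightarrow> a *\<^sub>v w = 0\<^sub>v n \<and> d *\<^sub>v w = 0\<^sub>v n" if "w \<in> carrier_vec n" for w
    using that by (simp add: killed_def a_def d_def n_def)
  have r: "a *\<^sub>v (a *\<^sub>v u) = 0\<^sub>v n" "d *\<^sub>v (d *\<^sub>v u) = 0\<^sub>v n" "d *\<^sub>v (a *\<^sub>v u) = (- 1) \<cdot>\<^sub>v (a *\<^sub>v (d *\<^sub>v u))"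
    if "u \<in> carrier_vec n" for u
    using bc_trivialD(5,6,7)[OF M] that by (auto simp: a_def d_def n_def)
  have m0: "(- 1) \<cdot>\<^sub>v 0\<^sub>v n = (0\<^sub>v n :: 'a vec)" by (intro eq_vecI) auto
  have mz: "a *\<^sub>v 0\<^sub>v n = 0\<^sub>v n" "d *\<^sub>v 0\<^sub>v n = 0\<^sub>v n" using mult_mat_zero_vec car by blast+
  consider "a *\<^sub>v (d *\<^sub>v v) \<noteq> 0\<^sub>v n" | "a *\<^sub>v (d *\<^sub>v v) = 0\<^sub>v n" "d *\<^sub>v v \<noteq> 0\<^sub>v n"
    | "d *\<^sub>v v = 0\<^sub>v n" "a *\<^sub>v v \<noteq> 0\<^sub>v n" | "d *\<^sub>v v = 0\<^sub>v n" "a *\<^sub>v v = 0\<^sub>v n" by blast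
  then have "\<exists>w. w \<in> U \<and> w \<in> killed M \<and> w \<noteq> 0\<^sub>v n"
  proof cases
    case 1
    have "d *\<^sub>v (a *\<^sub>v (d *\<^sub>v v)) = 0\<^sub>v n" using r(2,3) cl v mz m0 by metis
    then show ?thesis using 1 k r(1) cl v(1) by (intro exI[of _ "a *\<^sub>v (d *\<^sub>v v)"]) blast
  next
    case 2
    then show ?thesis using k r(2) cl v(1) by (intro exI[of _ "d *\<^sub>v v"]) blast
  next
    case 3
    have "d *\<^sub>v (a *\<^sub>v v) = 0\<^sub>v n" using r(3)[OF cl(3)[OF v(1)]] 3 mz m0 by simp
    then show ?thesis using 3 k r(1) cl v(1) by (intro exI[of _ "a *\<^sub>v v"]) blast
  next
    case 4
    then show ?thesis using k cl v n_def by blast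
  qed
  then show ?thesis using that n_def by blast
qed

lemma line_submodule:
  assumes M: "bc_trivial M" and v: "v \<in> killed M" "act_b M *\<^sub>v v = e \<cdot>\<^sub>v v"
  shows "is_submodule M {x \<cdot>\<^sub>v v | x. True}"
proof -
  note wM = bc_trivial_well_formed[OF M]
  note car = well_formedD[OF wM]
  have vs: "v \<in> space M" and k: "act_a M *\<^sub>v v = 0\<^sub>v (rdim M)" "act_d M *\<^sub>v v = 0\<^sub>v (rdim M)"
    using v(1) by (auto simp: killed_def)
  have z: "x \<cdot>\<^sub>v 0\<^sub>v (rdim M) = 0 \<cdot>\<^sub>v v" for x using vs by (intro eq_vecI) auto
  have "act_a M *\<^sub>v (x \<cdot>\<^sub>v v) = 0 \<cdot>\<^sub>v v" "act_d M *\<^sub>v (x \<cdot>\<^sub>v v) = 0 \<cdot>\<^sub>v v" for x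
    using mult_mat_smult_vec[OF car(1) vs] mult_mat_smult_vec[OF car(4) vs] k z by simp_all
  moreover have "act_b M *\<^sub>v (x \<cdot>\<^sub>v v) = (x * e) \<cdot>\<^sub>v v" "act_c M *\<^sub>v (x \<cdot>\<^sub>v v) = (x * e) \<cdot>\<^sub>v v" for x
    using mult_mat_smult_vec[OF car(2) vs] mult_mat_smult_vec[OF car(3) vs] v(2) bc_trivialD(1)[OF M vs]
    by (simp_all add: smult_smult_assoc)
  ultimately show ?thesis
    using subsp_line[OF vs] unfolding is_submodule_iff by auto
qed

text \<open>A simple submodule meets the common kernel of a and d, hence lies in it. Conversely, a
  killed vector is the sum of its two b-eigencomponents, and each of these is zero or spans a simple
  line.\<close>

lemma soc_eq_killed:
  assumes two: "(2 :: 'k :: field) \<noteq> 0" and M: "bc_trivial (M :: 'k d4_rep)"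
  shows "soc M = killed M"
proof -
  define n where "n = rdim M"
  note wM = bc_trivial_well_formed[OF M]
  note car = well_formedD[OF wM]
  let ?X = "\<Union>{S. is_simple_submodule M S}"
  have Xc: "?X \<subseteq> carrier_vec n"
    using subspD(1) by (fastforce simp: is_simple_submodule_def is_submodule_iff n_def)
  have "S \<subseteq> killed M" if S: "is_simple_submodule M S" for S
  proof -
    have sub: "is_submodule M S" and "S \<noteq> {0\<^sub>v n}" using S by (auto simp: is_simple_submodule_def n_def)
    then obtain v where "v \<in> S" "v \<noteq> 0\<^sub>v n" using subspD(2) by (fastforce simp: is_submodule_iff n_def)
    then obtain w where w: "w \<in> S" "w \<in> killed M" "w \<noteq> 0\<^sub>v n"
      using submodule_meets_killed[OF M sub] n_def by blast
    have "is_submodule M (S \<inter> killed M)"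
      using sub killed_submodule[OF M] subsp_Int by (auto simp: is_submodule_iff)
    then have "S \<inter> killed M = {0\<^sub>v n} \<or> S \<inter> killed M = S" using S unfolding is_simple_submodule_def n_def by blast
    then show ?thesis using w by blast
  qed
  then have "soc M \<subseteq> killed M"
    unfolding soc_def using span_smallest(3)[OF Xc] subsp_killed[OF wM] by (simp add: n_def Sup_le_iff)
  moreover have "killed M \<subseteq> soc M"
  proof
    fix v assume v: "v \<in> killed M"
    then have vs: "v \<in> carrier_vec n" by (simp add: killed_def n_def)
    have b: "act_b M \<in> carrier_mat n n" using car n_def by simp
    have bb: "act_b M *\<^sub>v (act_b M *\<^sub>v v) = v" using bc_trivialD(2)[OF M] vs by (simp add: n_def)
    have kb: "act_b M *\<^sub>v v \<in> killed M" using killed_submodule[OF M] v by (simp add: is_submodule_iff)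
    have "eigen_proj e (act_b M) *\<^sub>v v \<in> soc M" if e: "e * e = 1" for e
    proof -
      define w where "w = eigen_proj e (act_b M) *\<^sub>v v"
      have wk: "w \<in> killed M" unfolding w_def eigen_proj_mult[OF b vs]
        using v kb subspD(3,4)[OF subsp_killed[OF wM]] by blast
      have wc: "w \<in> carrier_vec n" using wk by (simp add: killed_def n_def)
      have we: "act_b M *\<^sub>v w = e \<cdot>\<^sub>v w" unfolding w_def by (rule eigen_proj_eigen[OF b vs bb e])
      show ?thesis
      proof (cases "w = 0\<^sub>v n")
        case True
        then show ?thesis using subspD(2)[OF span_smallest(1)[OF Xc]] by (simp add: soc_def w_def n_def)
      next
        case False
        let ?L = "{x \<cdot>\<^sub>v w | x. True}"
        have wL: "w \<in> ?L" by (auto intro: exI[of _ 1])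
        have "U = {0\<^sub>v n} \<or> U = ?L" if U: "is_submodule M U" "U \<subseteq> ?L" for U
        proof (cases "U \<subseteq> {0\<^sub>v n}")
          case True
          then show ?thesis using U(1) subspD(2) by (auto simp: is_submodule_iff n_def)
        next
          case False
          then obtain x where x: "x \<cdot>\<^sub>v w \<in> U" "x \<cdot>\<^sub>v w \<noteq> 0\<^sub>v n" using U(2) by blast
          have sU: "subsp n U" using U(1) by (simp add: is_submodule_iff n_def)
          have "x \<noteq> 0" using x(2) wc by auto
          then have "w \<in> U" using subsp_smult_cancel[OF sU _ x(1)] by blast
          then show ?thesis using subspD(4)[OF sU] U(2) by blast
        qed
        moreover have "?L \<noteq> {0\<^sub>v n}" using wL False by blast
        ultimately have "is_simple_submodule M ?L"
          unfolding is_simple_submodule_def using line_submodule[OF M wk we] n_def by blast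
        then have "w \<in> ?X" using wL by blast
        then show ?thesis using span_smallest(2)[OF Xc] by (auto simp: soc_def w_def n_def)
      qed
    qed
    from this[of 1] this[of "- 1"]
    have "eigen_proj 1 (act_b M) *\<^sub>v v + eigen_proj (- 1) (act_b M) *\<^sub>v v \<in> soc M"
      using subspD(3)[OF span_smallest(1)[OF Xc]] by (simp add: soc_def n_def)
    then show "v \<in> soc M" using eigen_proj_sum[OF two b vs, of 1] by simp
  qed
  ultimately show ?thesis by blast
qed

text \<open>Where a and d act as zero, submodules are the b-stable subspaces. As b is
  diagonalisable, each step of a composition series adds a single b-eigenvector, so the i-th term
  has dimension i.\<close>

lemma length_eq_dim_of_killed:
  fixes S :: "'k :: field d4_rep"
  assumes two: "(2 :: 'k) \<noteq> 0" and S: "bc_trivial S" and kill: "space S \<subseteq> killed S" and len: "has_length S m"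
  shows "rdim S = m"
proof -
  define n where "n = rdim S"
  note wS = bc_trivial_well_formed[OF S]
  have b: "act_b S \<in> carrier_mat n n" using well_formedD[OF wS] by (simp add: n_def)
  from len obtain U where len: "U 0 = {0\<^sub>v n} \<and> U m = carrier_vec n \<and> (\<forall>i\<le>m. is_submodule S (U i)) \<and>
      (\<forall>i<m. U i \<subset> U (Suc i) \<and> \<not> (\<exists>W. is_submodule S W \<and> U i \<subset> W \<and> W \<subset> U (Suc i)))"
    unfolding has_length_def n_def by (elim exE)
  then have U: "U 0 = {0\<^sub>v n}" "U m = carrier_vec n" and sub: "\<And>i. i \<le> m \<Longrightarrow> is_submodule S (U i)"
    and step: "\<And>i. i < m \<Longrightarrow> U i \<subset> U (Suc i)" by auto
  have min: "\<not> W \<subset> U (Suc i)" if "i < m" "is_submodule S W" "U i \<subset> W" for i W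
    using len that by blast
  have subU: "subsp n (U i)" if "i \<le> m" for i using sub[OF that] by (simp add: is_submodule_iff n_def)
  have "\<exists>A. A \<in> carrier_mat n i \<and> inj_on ((*\<^sub>v) A) (carrier_vec i) \<and> (*\<^sub>v) A ` carrier_vec i = U i" if "i \<le> m" for i
    using that
  proof (induction i)
    case 0
    have z: "0\<^sub>m n 0 *\<^sub>v v = 0\<^sub>v n" if "v \<in> carrier_vec 0" for v :: "'k vec" using zero_mat_mult_vec[OF that] .
    have "(*\<^sub>v) (0\<^sub>m n 0) ` carrier_vec 0 = U 0"
      unfolding U(1) using z by (auto intro!: image_eqI[of _ _ "0\<^sub>v 0"])
    moreover have "inj_on ((*\<^sub>v) (0\<^sub>m n 0 :: 'k mat)) (carrier_vec 0)" by (intro inj_onI eq_vecI) auto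
    ultimately show ?case by (intro exI[of _ "0\<^sub>m n 0"]) simp
  next
    case (Suc i)
    then obtain A where A: "A \<in> carrier_mat n i" "inj_on ((*\<^sub>v) A) (carrier_vec i)" "(*\<^sub>v) A ` carrier_vec i = U i" by auto
    note sU = subU[of i] and sU' = subU[OF Suc.prems]
    have im: "i < m" using Suc.prems by simp
    obtain v where v: "v \<in> U (Suc i)" "v \<notin> U i" using step[OF im] by blast
    have vc: "v \<in> carrier_vec n" using subspD(5)[OF sU' v(1)] .
    have bb: "act_b S *\<^sub>v (act_b S *\<^sub>v v) = v" using bc_trivialD(2)[OF S] vc n_def by simp
    \<comment> \<open>The vector v is the sum of its eigencomponents, so one of them lies outside
      \<open>U i\<close>.\<close>
    have "\<exists>e. e * e = 1 \<and> eigen_proj e (act_b S) *\<^sub>v v \<notin> U i"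
    proof (rule ccontr)
      assume "\<not> ?thesis"
      then have "eigen_proj 1 (act_b S) *\<^sub>v v \<in> U i" "eigen_proj (- 1) (act_b S) *\<^sub>v v \<in> U i" by auto
      then have "eigen_proj 1 (act_b S) *\<^sub>v v + eigen_proj (- 1) (act_b S) *\<^sub>v v \<in> U i"
        using subspD(3)[OF sU] im by simp
      then show False using eigen_proj_sum[OF two b vc, of 1] v(2) by simp
    qed
    then obtain e where e: "e * e = 1" "eigen_proj e (act_b S) *\<^sub>v v \<notin> U i" by blast
    define w where "w = eigen_proj e (act_b S) *\<^sub>v v"
    have wU: "w \<in> U (Suc i)"
      unfolding w_def eigen_proj_mult[OF b vc] using subspD(3,4)[OF sU'] v(1) sub[OF Suc.prems]
      by (simp add: is_submodule_iff)
    have wc: "w \<in> carrier_vec n" using subspD(5)[OF sU' wU] .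
    have bw: "act_b S *\<^sub>v w = e \<cdot>\<^sub>v w" unfolding w_def by (rule eigen_proj_eigen[OF b vc bb e(1)])
    define A' where "A' = snoc_col A w"
    have A': "A' \<in> carrier_mat n (Suc i)" "inj_on ((*\<^sub>v) A') (carrier_vec (Suc i))"
      using snoc_col_carrier[OF A(1)] snoc_col_inj[OF A(1,2) wc] e(2) A(3) by (auto simp: A'_def w_def)
    let ?W = "(*\<^sub>v) A' ` carrier_vec (Suc i)"
    have W: "subsp n ?W" by (rule subsp_image[OF A'(1) subsp_carrier])
    have WU: "?W \<subseteq> U (Suc i)"
      unfolding A'_def using step[OF im] by (intro snoc_col_image[OF A(1) sU' _ wU]) (auto simp: A(3))
    have UW: "U i \<subseteq> ?W"
    proof
      fix u assume "u \<in> U i"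
      then obtain x where x: "x \<in> carrier_vec i" "u = A *\<^sub>v x" using A(3) by blast
      have xc: "x @\<^sub>v 0\<^sub>v 1 \<in> carrier_vec (Suc i)" using append_carrier_vec[OF x(1), of "0\<^sub>v 1" 1] by simp
      have "vec_first (x @\<^sub>v 0\<^sub>v 1) i = x" using x(1) by (intro eq_vecI) (auto simp: vec_first_def)
      moreover have "(x @\<^sub>v 0\<^sub>v 1) $ i \<cdot>\<^sub>v w = 0\<^sub>v n" using x(1) wc by (intro eq_vecI) auto
      ultimately have "A' *\<^sub>v (x @\<^sub>v 0\<^sub>v 1) = u"
        unfolding A'_def snoc_col_mult[OF A(1) wc xc] using x A(1) by simp
      then show "u \<in> ?W" using xc by (intro image_eqI[of _ _ "x @\<^sub>v 0\<^sub>v 1"]) auto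
    qed
    have wW: "w \<in> ?W"
    proof -
      have "A' *\<^sub>v unit_vec (Suc i) i = w"
        using A(1) wc by (intro eq_vecI) (auto simp: A'_def snoc_col_def)
      then show ?thesis by (intro image_eqI[of _ _ "unit_vec (Suc i) i"]) auto
    qed
    have elem: "x \<in> ?W \<Longrightarrow> \<exists>u c. u \<in> U i \<and> x = u + c \<cdot>\<^sub>v w" for x
    proof -
      assume "x \<in> ?W"
      then obtain y where y: "y \<in> carrier_vec (Suc i)" "x = A' *\<^sub>v y" by blast
      then have "x = A *\<^sub>v vec_first y i + y $ i \<cdot>\<^sub>v w" using snoc_col_mult[OF A(1) wc] by (simp add: A'_def)
      moreover have "A *\<^sub>v vec_first y i \<in> U i" using A(3) by auto
      ultimately show ?thesis by blast
    qed
    have "is_submodule S ?W"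
      unfolding is_submodule_iff
    proof (intro conjI ballI)
      show "subsp (rdim S) ?W" using W n_def by simp
      fix x assume x: "x \<in> ?W"
      have xs: "x \<in> space S" using subspD(5)[OF W x] n_def by simp
      then have "act_a S *\<^sub>v x = 0\<^sub>v n" "act_d S *\<^sub>v x = 0\<^sub>v n" using kill by (auto simp: killed_def n_def)
      then show "act_a S *\<^sub>v x \<in> ?W" "act_d S *\<^sub>v x \<in> ?W" using subspD(2)[OF W] by auto
      obtain u c where uc: "u \<in> U i" "x = u + c \<cdot>\<^sub>v w" using elem[OF x] by blast
      have uc': "u \<in> carrier_vec n" using subspD(5)[OF sU uc(1)] im by simp
      have "act_b S *\<^sub>v x = act_b S *\<^sub>v u + (c * e) \<cdot>\<^sub>v w"
        using uc' wc bw by (simp add: uc(2) mult_add_distrib_mat_vec[OF b] mult_mat_smult_vec[OF b] smult_smult_assoc)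
      moreover have "act_b S *\<^sub>v u \<in> ?W" using sub[of i] im uc(1) UW by (auto simp: is_submodule_iff)
      ultimately show "act_b S *\<^sub>v x \<in> ?W" using subspD(3,4)[OF W] wW by simp
      then show "act_c S *\<^sub>v x \<in> ?W" using bc_trivialD(1)[OF S xs] by simp
    qed
    moreover have "U i \<subset> ?W" using wW e(2) unfolding w_def[symmetric] by (intro psubsetI[OF UW]) metis
    moreover have "W = U (Suc i)" if "is_submodule S W" "U i \<subset> W" "W \<subseteq> U (Suc i)" for W
      using min[OF im] that by blast
    \<comment> \<open>The enlarged space is a submodule strictly above \<open>U i\<close>, and there
      is none strictly between \<open>U i\<close> and \<open>U (Suc i)\<close>.\<close>
    ultimately have "?W = U (Suc i)" using WU by metis
    then show ?case using A' by blast
  qed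
  from this[OF order_refl] obtain A where A: "A \<in> carrier_mat n m" "inj_on ((*\<^sub>v) A) (carrier_vec m)"
    "(*\<^sub>v) A ` carrier_vec m = U m" by (elim exE conjE)
  have "carrier_vec n \<subseteq> (*\<^sub>v) A ` carrier_vec m" unfolding A(3) U(2) ..
  then show ?thesis using inj_surj_dim_eq[OF A(1,2)] n_def by simp
qed

lemma bc_trivial_quotient:
  assumes M: "bc_trivial M" and Q: "d4_module Q" and F: "is_epi M Q F"
  shows "bc_trivial Q"
proof -
  have h: "is_hom M Q F" and s: "(*\<^sub>v) F ` space M = space Q" using F by (auto simp: is_epi_def)
  note H = is_homD[OF h bc_trivial_well_formed[OF M] d4_moduleD(1)[OF Q]]
  have "act_c Q *\<^sub>v v = act_b Q *\<^sub>v v" if v: "v \<in> space Q" for v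
  proof -
    obtain u where u: "u \<in> space M" "v = F *\<^sub>v u" using v s by blast
    show ?thesis unfolding u(2) H(4,5)[OF u(1), symmetric] bc_trivialD(1)[OF M u(1)] ..
  qed
  then show ?thesis using Q by (simp add: bc_trivial_def)
qed

lemma bc_trivial_sub:
  assumes M: "bc_trivial M" and S: "d4_module S" and F: "is_mono S M F"
  shows "bc_trivial S"
proof -
  have h: "is_hom S M F" and i: "inj_on ((*\<^sub>v) F) (space S)" using F by (auto simp: is_mono_def)
  note wS = d4_moduleD(1)[OF S]
  note H = is_homD[OF h wS bc_trivial_well_formed[OF M]]
  have "act_c S *\<^sub>v v = act_b S *\<^sub>v v" if v: "v \<in> space S" for v
  proof (rule inj_onD[OF i])
    show "F *\<^sub>v (act_c S *\<^sub>v v) = F *\<^sub>v (act_b S *\<^sub>v v)"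
      unfolding H(4,5)[OF v] using bc_trivialD(1)[OF M H(2)[OF v]] .
  qed (use act_closed[OF wS v] in auto)
  then show ?thesis using S by (simp add: bc_trivial_def)
qed

text \<open>The socle of Q = M/soc M is all of Q, so a and d act as zero on Q. Hence they map M into
  the kernel of F, which is the socle of M.\<close>

lemma loewy_length_two_radical:
  fixes M :: "'k :: field d4_rep"
  assumes two: "(2 :: 'k) \<noteq> 0" and M: "bc_trivial M" and l: "has_loewy_length 2 M" and v: "v \<in> space M"
  shows "act_a M *\<^sub>v v \<in> killed M" "act_d M *\<^sub>v v \<in> killed M"
proof -
  from l obtain Q Q' where Q: "is_quotient M (soc M) Q" and Q': "is_quotient Q (soc Q) Q'" "rdim Q' = 0"
    by (auto simp: numeral_2_eq_2)
  obtain F where dQ: "d4_module Q" and F: "is_epi M Q F" "mat_kernel F = soc M" using Q by (auto simp: is_quotient_def)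
  obtain F' where F': "is_epi Q Q' F'" "mat_kernel F' = soc Q" using Q' by (auto simp: is_quotient_def)
  have Qt: "bc_trivial Q" using bc_trivial_quotient[OF M dQ F(1)] .
  have h: "is_hom M Q F" using F(1) by (auto simp: is_epi_def)
  note wM = bc_trivial_well_formed[OF M] and wQ = d4_moduleD(1)[OF dQ]
  note H = is_homD[OF h wM wQ]
  have F'c: "F' \<in> carrier_mat 0 (rdim Q)" using F'(1) Q'(2) by (auto simp: is_epi_def is_hom_def)
  have Qk: "u \<in> killed Q" if u: "u \<in> space Q" for u
  proof -
    \<comment> \<open>\<open>F'\<close> has no rows, so its kernel, which is the socle of Q, is
      everything.\<close>
    have "F' *\<^sub>v u = 0\<^sub>v 0" using F'c by (intro eq_vecI) auto
    then have "u \<in> soc Q" unfolding F'(2)[symmetric] using F'c u by (simp add: mat_kernel_def)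
    then show ?thesis using soc_eq_killed[OF two Qt] by simp
  qed
  have *: "x \<in> killed M" if x: "x \<in> space M" "F *\<^sub>v x = 0\<^sub>v (rdim Q)" for x
  proof -
    have "x \<in> mat_kernel F" using H(1)[OF v] x by (simp add: mat_kernel_def)
    then show ?thesis unfolding F(2) soc_eq_killed[OF two M] .
  qed
  show "act_a M *\<^sub>v v \<in> killed M" "act_d M *\<^sub>v v \<in> killed M"
    using * act_closed[OF wM v] H(3,6)[OF v] Qk[OF H(2)[OF v]] by (auto simp: killed_def)
qed

text \<open>On soc M and on M/soc M both a and d act as zero, so the two lengths in the type are
  dimensions.\<close>

lemma type_dimensions:
  fixes M :: "'k :: field d4_rep"
  assumes two: "(2 :: 'k) \<noteq> 0" and M: "bc_trivial M" and ty: "has_type s t M"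
  shows "rdim M = t + s"
    "\<exists>Y. Y \<in> carrier_mat (rdim M) t \<and> inj_on ((*\<^sub>v) Y) (carrier_vec t) \<and> (*\<^sub>v) Y ` carrier_vec t = killed M"
proof -
  have l: "has_loewy_length 2 M" using ty by (simp add: has_type_def)
  obtain Q where Q: "is_quotient M (soc M) Q" "has_length Q s" using ty by (auto simp: has_type_def)
  obtain S where S: "is_sub_rep M (soc M) S" "has_length S t" using ty by (auto simp: has_type_def)
  note soc = soc_eq_killed[OF two M]
  note wM = bc_trivial_well_formed[OF M]
  obtain F where dQ: "d4_module Q" and F: "is_epi M Q F" "mat_kernel F = killed M"
    using Q soc by (auto simp: is_quotient_def)
  obtain Y where dS: "d4_module S" and Y: "is_mono S M Y" "(*\<^sub>v) Y ` space S = killed M"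
    using S soc by (auto simp: is_sub_rep_def)
  have Qt: "bc_trivial Q" using bc_trivial_quotient[OF M dQ F(1)] .
  have St: "bc_trivial S" using bc_trivial_sub[OF M dS Y(1)] .
  have hF: "is_hom M Q F" and sF: "(*\<^sub>v) F ` space M = space Q" using F(1) by (auto simp: is_epi_def)
  have hY: "is_hom S M Y" and iY: "inj_on ((*\<^sub>v) Y) (space S)" using Y(1) by (auto simp: is_mono_def)
  note wQ = d4_moduleD(1)[OF dQ] and wS = d4_moduleD(1)[OF dS]
  note HF = is_homD[OF hF wM wQ] and HY = is_homD[OF hY wS wM]
  have Fc: "F \<in> carrier_mat (rdim Q) (rdim M)" and Yc: "Y \<in> carrier_mat (rdim M) (rdim S)"
    using hF hY by (auto simp: is_hom_def)
  have "u \<in> killed Q" if u: "u \<in> space Q" for u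
  proof -
    obtain v where v: "v \<in> space M" "u = F *\<^sub>v v" using u sF by blast
    have "act_a M *\<^sub>v v \<in> mat_kernel F" "act_d M *\<^sub>v v \<in> mat_kernel F"
      unfolding F(2) using loewy_length_two_radical[OF two M l v(1)] by auto
    then have "F *\<^sub>v (act_a M *\<^sub>v v) = 0\<^sub>v (rdim Q)" "F *\<^sub>v (act_d M *\<^sub>v v) = 0\<^sub>v (rdim Q)"
      using Fc by (auto simp: mat_kernel_def)
    then show ?thesis using HF(3,6)[OF v(1)] u v(2) by (simp add: killed_def)
  qed
  then have dimQ: "rdim Q = s" by (intro length_eq_dim_of_killed[OF two Qt _ Q(2)]) blast
  have "u \<in> killed S" if u: "u \<in> space S" for u
  proof -
    have "Y *\<^sub>v u \<in> killed M" using u Y(2) by blast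
    then have "Y *\<^sub>v (act_a S *\<^sub>v u) = 0\<^sub>v (rdim M)" "Y *\<^sub>v (act_d S *\<^sub>v u) = 0\<^sub>v (rdim M)"
      using HY(3,6)[OF u] by (auto simp: killed_def)
    then have "act_a S *\<^sub>v u = 0\<^sub>v (rdim S)" "act_d S *\<^sub>v u = 0\<^sub>v (rdim S)"
      using inj_on_kernelD[OF Yc iY] act_closed[OF wS u] by blast+
    then show ?thesis using u by (simp add: killed_def)
  qed
  then have dimS: "rdim S = t" by (intro length_eq_dim_of_killed[OF two St _ S(2)]) blast
  show "\<exists>Y. Y \<in> carrier_mat (rdim M) t \<and> inj_on ((*\<^sub>v) Y) (carrier_vec t) \<and> (*\<^sub>v) Y ` carrier_vec t = killed M"
    using Yc iY Y(2) dimS by blast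
  show "rdim M = t + s"
  proof (rule rank_nullity_dim)
    show "Y \<in> carrier_mat (rdim M) t" "inj_on ((*\<^sub>v) Y) (carrier_vec t)" using Yc iY dimS by auto
    show "F \<in> carrier_mat s (rdim M)" "carrier_vec s \<subseteq> (*\<^sub>v) F ` space M" using Fc sF dimQ by auto
    fix v assume "v \<in> space M"
    then have "F *\<^sub>v v = 0\<^sub>v s \<longleftrightarrow> v \<in> mat_kernel F" using Fc dimQ by (auto simp: mat_kernel_def)
    then show "F *\<^sub>v v = 0\<^sub>v s \<longleftrightarrow> v \<in> (*\<^sub>v) Y ` carrier_vec t" using F(2) Y(2) dimS by simp
  qed
qed

lemma smult_minus_distrib_vec:
  assumes "u \<in> carrier_vec n" "v \<in> carrier_vec n"
  shows "(c :: 'k :: field) \<cdot>\<^sub>v (u - v) = c \<cdot>\<^sub>v u - c \<cdot>\<^sub>v v"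
  using assms by (intro eq_vecI) (auto simp: algebra_simps)

text \<open>
  Let \<open>R\<close> be a projection onto the socle and \<open>p\<close>, \<open>q\<close> the projections onto the eigenspaces of \<open>b\<close> for \<open>e\<close>
  and \<open>- e\<close>.  Then \<open>p R p + (q - q R q)\<close> is an idempotent endomorphism that fixes \<open>u\<close>, hence the identity.
\<close>

lemma soc_parity:
  fixes M :: "'k :: field d4_rep"
  assumes two: "(2 :: 'k) \<noteq> 0" and M: "bc_trivial M" and ind: "indecomposable M"
    and rad: "\<And>v. v \<in> space M \<Longrightarrow> act_a M *\<^sub>v v \<in> killed M \<and> act_d M *\<^sub>v v \<in> killed M"
    and u: "u \<in> killed M" "u \<noteq> 0\<^sub>v (rdim M)" "act_b M *\<^sub>v u = e \<cdot>\<^sub>v u" and ee: "e * e = 1"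
  shows "killed M = {v \<in> space M. act_b M *\<^sub>v v = e \<cdot>\<^sub>v v}"
proof -
  define n a b d where "n = rdim M" and "a = act_a M" and "b = act_b M" and "d = act_d M"
  define K where "K = killed M"
  note wM = bc_trivial_well_formed[OF M]
  note car = well_formedD[OF wM, folded n_def a_def b_def d_def]
  have sK: "subsp n K" using subsp_killed[OF wM] by (simp add: K_def n_def)
  note D = subspD[OF sK]
  have Kc: "k \<in> carrier_vec n" if "k \<in> K" for k using D(5) that .
  have Kz: "a *\<^sub>v k = 0\<^sub>v n" "d *\<^sub>v k = 0\<^sub>v n" if "k \<in> K" for k
    using that by (auto simp: K_def killed_def a_def d_def n_def)
  have bK: "b *\<^sub>v k \<in> K" if "k \<in> K" for k
    using killed_submodule[OF M] that by (simp add: is_submodule_iff K_def b_def)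
  define p q where "p = eigen_proj e b" and "q = eigen_proj (- e) b"
  have pc: "p \<in> carrier_mat n n" and qc: "q \<in> carrier_mat n n"
    using eigen_proj_carrier[OF car(2)] by (auto simp: p_def q_def)
  have bb: "b *\<^sub>v (b *\<^sub>v v) = v" if "v \<in> carrier_vec n" for v
    using bc_trivialD(2)[OF M] that by (simp add: b_def n_def)
  have ee': "- e * - e = 1" using ee by simp
  have bp: "b *\<^sub>v (p *\<^sub>v v) = e \<cdot>\<^sub>v (p *\<^sub>v v)" if "v \<in> carrier_vec n" for v
    unfolding p_def by (rule eigen_proj_eigen[OF car(2) that bb[OF that] ee])
  have bq: "b *\<^sub>v (q *\<^sub>v v) = (- e) \<cdot>\<^sub>v (q *\<^sub>v v)" if "v \<in> carrier_vec n" for v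
    unfolding q_def by (rule eigen_proj_eigen[OF car(2) that bb[OF that] ee'])
  have pfix: "p *\<^sub>v v = v" if "v \<in> carrier_vec n" "b *\<^sub>v v = e \<cdot>\<^sub>v v" for v
    unfolding p_def by (rule eigen_proj_fix[OF two car(2) that ee])
  have qfix: "q *\<^sub>v v = v" if "v \<in> carrier_vec n" "b *\<^sub>v v = (- e) \<cdot>\<^sub>v v" for v
    unfolding q_def by (rule eigen_proj_fix[OF two car(2) that ee'])
  have pkill: "p *\<^sub>v v = 0\<^sub>v n" if "v \<in> carrier_vec n" "b *\<^sub>v v = (- e) \<cdot>\<^sub>v v" for v
    unfolding p_def by (rule eigen_proj_kill[OF car(2) that ee])
  have qkill: "q *\<^sub>v v = 0\<^sub>v n" if "v \<in> carrier_vec n" "b *\<^sub>v v = e \<cdot>\<^sub>v v" for v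
    unfolding q_def by (rule eigen_proj_kill[OF car(2) that(1) _ ee']) (use that(2) in simp)
  have pK: "p *\<^sub>v k \<in> K" "q *\<^sub>v k \<in> K" if "k \<in> K" for k
    using D(3,4) that bK Kc[OF that] by (simp_all add: p_def q_def eigen_proj_mult[OF car(2)])
  obtain t Y where Y: "Y \<in> carrier_mat n t" "inj_on ((*\<^sub>v) Y) (carrier_vec t)" "(*\<^sub>v) Y ` carrier_vec t = K"
    by (rule subsp_basis[OF sK])
  obtain L where L: "L \<in> carrier_mat t n" "L * Y = 1\<^sub>m t" by (rule left_inverse_of_inj[OF Y(1,2)])
  define R where "R = Y * L"
  have Rc: "R \<in> carrier_mat n n" using Y L by (simp add: R_def)
  have RK: "R *\<^sub>v v \<in> K" if "v \<in> carrier_vec n" for v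
  proof -
    have "R *\<^sub>v v = Y *\<^sub>v (L *\<^sub>v v)" using Y(1) L(1) that by (simp add: R_def)
    moreover have "L *\<^sub>v v \<in> carrier_vec t" using L(1) that by simp
    ultimately show ?thesis using Y(3) by blast
  qed
  have Rfix: "R *\<^sub>v k = k" if k: "k \<in> K" for k
  proof -
    obtain w where w: "w \<in> carrier_vec t" "k = Y *\<^sub>v w" using k Y(3) by blast
    have "R *\<^sub>v k = Y *\<^sub>v (L *\<^sub>v k)" using Y(1) L(1) Kc[OF k] by (simp add: R_def)
    then show ?thesis using mult_inverse_vec[OF Y(1) L w(1)] w(2) by simp
  qed
  define E where "E = p * (R * p) + (q - q * (R * q))"
  have prp: "p * (R * p) \<in> carrier_mat n n" "q * (R * q) \<in> carrier_mat n n" "q - q * (R * q) \<in> carrier_mat n n"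
    using pc qc Rc by (auto intro!: minus_carrier_mat)
  have Ec: "E \<in> carrier_mat n n" using prp by (simp add: E_def)
  define f g where "f v = p *\<^sub>v (R *\<^sub>v (p *\<^sub>v v))" and "g v = q *\<^sub>v v - q *\<^sub>v (R *\<^sub>v (q *\<^sub>v v))" for v
  have tri: "x * (R * x) *\<^sub>v v = x *\<^sub>v (R *\<^sub>v (x *\<^sub>v v))" if "x \<in> carrier_mat n n" "v \<in> carrier_vec n" for x v
    using that Rc assoc_mult_mat_vec[OF that(1) mult_carrier_mat[OF Rc that(1)] that(2)] by simp
  have Ev: "E *\<^sub>v v = f v + g v" if v: "v \<in> carrier_vec n" for v
    unfolding E_def f_def g_def add_mult_distrib_mat_vec[OF prp(1,3) v]
      minus_mult_distrib_mat_vec[OF qc prp(2) v] tri[OF pc v] tri[OF qc v] ..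
  have fK: "f v \<in> K" "b *\<^sub>v f v = e \<cdot>\<^sub>v f v" and fc: "f v \<in> carrier_vec n" if v: "v \<in> carrier_vec n" for v
  proof -
    have "p *\<^sub>v v \<in> carrier_vec n" using pc v by simp
    then have k: "R *\<^sub>v (p *\<^sub>v v) \<in> K" by (rule RK)
    show "f v \<in> K" "b *\<^sub>v f v = e \<cdot>\<^sub>v f v" unfolding f_def by (rule pK(1)[OF k], rule bp[OF Kc[OF k]])
    then show "f v \<in> carrier_vec n" using Kc by blast
  qed
  have rq: "q *\<^sub>v (R *\<^sub>v (q *\<^sub>v v)) \<in> K" if v: "v \<in> carrier_vec n" for v
    using pK(2)[OF RK[of "q *\<^sub>v v"]] qc v by simp
  have qv: "q *\<^sub>v v \<in> carrier_vec n" if "v \<in> carrier_vec n" for v using qc that by simp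
  have gc: "g v \<in> carrier_vec n" if v: "v \<in> carrier_vec n" for v
    using Kc[OF rq[OF v]] qv[OF v] by (simp add: g_def)
  have bg: "b *\<^sub>v g v = (- e) \<cdot>\<^sub>v g v" if v: "v \<in> carrier_vec n" for v
  proof -
    have 1: "R *\<^sub>v (q *\<^sub>v v) \<in> carrier_vec n" using Kc[OF RK[OF qv[OF v]]] .
    show ?thesis unfolding g_def
      using bq[OF v] bq[OF 1] qv[OF v] qv[OF 1] by (simp add: mult_mat_minus_vec[OF car(2)] smult_minus_distrib_vec[of _ n])
  qed
  have qidem: "q *\<^sub>v (q *\<^sub>v v) = q *\<^sub>v v" if v: "v \<in> carrier_vec n" for v
    using qfix[OF qv[OF v] bq[OF v]] .
  have z0: "x *\<^sub>v 0\<^sub>v n = 0\<^sub>v n" if "x \<in> carrier_mat n n" for x :: "'k mat" using mult_mat_zero_vec[OF that] .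
  \<comment> \<open>On socle vectors R is the identity, so the two summands of E reduce to p and to
    q - q q = 0.\<close>
  have Ef: "E *\<^sub>v k = p *\<^sub>v k" if k: "k \<in> K" for k
  proof -
    have "f k = p *\<^sub>v k"
      unfolding f_def Rfix[OF pK(1)[OF k]] using pfix[OF _ bp[OF Kc[OF k]]] Kc[OF pK(1)[OF k]] by simp
    moreover have "g k = 0\<^sub>v n"
      unfolding g_def Rfix[OF pK(2)[OF k]] qidem[OF Kc[OF k]] using qv[OF Kc[OF k]] by simp
    ultimately show ?thesis using Ev[OF Kc[OF k]] Kc[OF pK(1)[OF k]] by simp
  qed
  have Eg: "E *\<^sub>v g v = g v" if v: "v \<in> carrier_vec n" for v
  proof -
    have "f (g v) = 0\<^sub>v n" unfolding f_def pkill[OF gc[OF v] bg[OF v]] using z0 Rc pc by simp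
    moreover have "g (g v) = g v"
    proof -
      have 1: "q *\<^sub>v g v = g v" using qfix[OF gc[OF v] bg[OF v]] .
      have "R *\<^sub>v g v = R *\<^sub>v (q *\<^sub>v v) - q *\<^sub>v (R *\<^sub>v (q *\<^sub>v v))"
        unfolding g_def using qv[OF v] Kc[OF rq[OF v]] Rfix[OF rq[OF v]]
        by (simp add: mult_mat_minus_vec[OF Rc])
      then have "q *\<^sub>v (R *\<^sub>v g v) = 0\<^sub>v n"
        using Kc[OF RK[OF qv[OF v]]] qv qidem by (simp add: mult_mat_minus_vec[OF qc])
      then show ?thesis unfolding g_def[of "g v"] 1 using gc[OF v] by simp
    qed
    ultimately show ?thesis using Ev[OF gc[OF v]] gc[OF v] by simp
  qed
  have "E * E = E"
  proof (rule mat_eqI_vec)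
    fix v :: "'k vec" assume v: "v \<in> carrier_vec n"
    have "E *\<^sub>v f v = f v" using Ef[OF fK(1)[OF v]] pfix[OF fc[OF v] fK(2)[OF v]] by simp
    then have "E *\<^sub>v (E *\<^sub>v v) = E *\<^sub>v v"
      using Ev[OF v] Eg[OF v] fc[OF v] gc[OF v] by (simp add: mult_add_distrib_mat_vec[OF Ec])
    then show "E * E *\<^sub>v v = E *\<^sub>v v" using Ec v by simp
  qed (use Ec in auto)
  moreover have "is_hom M M E"
  proof (rule is_homI_spans[OF wM wM _ spans_carrier], goal_cases)
    case 1
    show ?case using Ec n_def by simp
  next
    case (2 v)
    then have v: "v \<in> carrier_vec n" by (simp add: n_def)
    \<comment> \<open>For x = a and x = d: x lands in the socle, where E is p, and p x = x q because
      x reverses the sign of b. On the other side x kills the socle vectors among the terms of E v,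
      and only x q v remains.\<close>
    have key: "E *\<^sub>v (x *\<^sub>v v) = x *\<^sub>v (E *\<^sub>v v)"
      if x: "x \<in> carrier_mat n n" "x *\<^sub>v v \<in> K" "\<And>k. k \<in> K \<Longrightarrow> x *\<^sub>v k = 0\<^sub>v n"
        "\<And>v. v \<in> carrier_vec n \<Longrightarrow> b *\<^sub>v (x *\<^sub>v v) = (- 1) \<cdot>\<^sub>v (x *\<^sub>v (b *\<^sub>v v))" for x
    proof -
      have bxv: "p *\<^sub>v (x *\<^sub>v v) = x *\<^sub>v (q *\<^sub>v v)"
        unfolding p_def q_def using x(1) x(4)[OF v] v car(2)
        by (simp add: eigen_proj_mult[OF car(2)] mult_mat_smult_vec[OF x(1)] mult_add_distrib_mat_vec[OF x(1)] smult_smult_assoc)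
      have "x *\<^sub>v (E *\<^sub>v v) = x *\<^sub>v f v + (x *\<^sub>v (q *\<^sub>v v) - x *\<^sub>v (q *\<^sub>v (R *\<^sub>v (q *\<^sub>v v))))"
        unfolding Ev[OF v] g_def using fc[OF v] qv[OF v] Kc[OF rq[OF v]]
        by (simp add: mult_add_distrib_mat_vec[OF x(1)] mult_mat_minus_vec[OF x(1)])
      also have "\<dots> = x *\<^sub>v (q *\<^sub>v v)"
        using x(3)[OF fK(1)[OF v]] x(3)[OF rq[OF v]] x(1) qv[OF v] by simp
      finally show ?thesis using Ef[OF x(2)] bxv by simp
    qed
    have "E *\<^sub>v (a *\<^sub>v v) = a *\<^sub>v (E *\<^sub>v v)"
      using bc_trivialD(3)[OF M] rad[of v] Kz v car(1) by (intro key) (auto simp: a_def b_def n_def K_def)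
    moreover have "E *\<^sub>v (d *\<^sub>v v) = d *\<^sub>v (E *\<^sub>v v)"
      using bc_trivialD(4)[OF M] rad[of v] Kz v car(4) by (intro key) (auto simp: d_def b_def n_def K_def)
    moreover have "E *\<^sub>v (b *\<^sub>v v) = b *\<^sub>v (E *\<^sub>v v)"
    proof -
      have bvc: "b *\<^sub>v v \<in> carrier_vec n" using car(2) v by simp
      have eq: "h \<cdot>\<^sub>v (b *\<^sub>v v + e \<cdot>\<^sub>v v) = e \<cdot>\<^sub>v (h \<cdot>\<^sub>v (v + e \<cdot>\<^sub>v (b *\<^sub>v v)))" if "e * e = 1" for e h
        by (rule smult_involution[OF bvc v that])
      have pb: "p *\<^sub>v (b *\<^sub>v v) = e \<cdot>\<^sub>v (p *\<^sub>v v)"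
        unfolding p_def eigen_proj_mult[OF car(2) v] eigen_proj_mult[OF car(2) bvc] bb[OF v] eq[OF ee] ..
      have qb: "q *\<^sub>v (b *\<^sub>v v) = (- e) \<cdot>\<^sub>v (q *\<^sub>v v)"
        unfolding q_def eigen_proj_mult[OF car(2) v] eigen_proj_mult[OF car(2) bvc] bb[OF v] eq[OF ee'] ..
      have pv: "p *\<^sub>v v \<in> carrier_vec n" using pc v by simp
      have "f (b *\<^sub>v v) = e \<cdot>\<^sub>v f v"
        unfolding f_def pb mult_mat_smult_vec[OF Rc pv]
        by (rule mult_mat_smult_vec[OF pc]) (use Rc pv in simp)
      moreover have "g (b *\<^sub>v v) = (- e) \<cdot>\<^sub>v g v"
        unfolding g_def qb mult_mat_smult_vec[OF Rc qv[OF v]]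
        using mult_mat_smult_vec[OF qc, of "R *\<^sub>v (q *\<^sub>v v)" "- e"] Rc qv[OF v] Kc[OF rq[OF v]]
        by (simp add: smult_minus_distrib_vec[of _ n])
      ultimately show ?thesis
        unfolding Ev[OF v] Ev[OF bvc] using fK(2)[OF v] bg[OF v] fc[OF v] gc[OF v]
        by (simp add: mult_add_distrib_mat_vec[OF car(2)])
    qed
    moreover have "act_c M *\<^sub>v v = b *\<^sub>v v" "act_c M *\<^sub>v (E *\<^sub>v v) = b *\<^sub>v (E *\<^sub>v v)"
      using bc_trivialD(1)[OF M] v Ec by (auto simp: b_def n_def)
    ultimately show ?case by (simp add: a_def b_def d_def)
  qed
  ultimately have "E = 0\<^sub>m n n \<or> E = 1\<^sub>m n" using indecomposable_idempotent[OF ind] n_def by blast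
  moreover have "E *\<^sub>v u = u"
    using Ef[of u] pfix[of u] u Kc[of u] by (simp add: K_def b_def)
  ultimately have E1: "E = 1\<^sub>m n" using zero_mat_mult_vec[of u n n] u Kc[of u] by (auto simp: n_def K_def)
  \<comment> \<open>E = 1 makes p the identity on the socle, so the socle has sign e. Conversely,
    for v of sign e the term g v vanishes and v = f v is a socle vector.\<close>
  have "v \<in> K \<longleftrightarrow> b *\<^sub>v v = e \<cdot>\<^sub>v v" if v: "v \<in> carrier_vec n" for v
  proof
    assume "v \<in> K"
    then show "b *\<^sub>v v = e \<cdot>\<^sub>v v" using Ef[of v] bp[OF v] E1 v by simp
  next
    assume bv: "b *\<^sub>v v = e \<cdot>\<^sub>v v"
    have "g v = 0\<^sub>v n" unfolding g_def qkill[OF v bv] using z0 Rc qc by simp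
    then have "v = f v" using Ev[OF v] E1 v fc[OF v] by simp
    then show "v \<in> K" using fK(1)[OF v] by simp
  qed
  then show ?thesis using Kc by (auto simp: K_def b_def n_def killed_def)
qed

section \<open>The modules \<open>M\<^sub>t(r, \<eta>)\<close>\<close>

lemma spans_of_right_inverse:
  fixes V :: "nat \<Rightarrow> 'k :: field vec"
  assumes V: "\<And>i. i < k \<Longrightarrow> V i \<in> carrier_vec n" and G: "G \<in> carrier_mat k n" "cols_mat n k V * G = 1\<^sub>m n"
  shows "spans n (V ` {..<k})"
  unfolding spans_def
proof (intro conjI allI impI subsetI)
  fix U and v :: "'k vec"
  assume U: "subsp n U \<and> V ` {..<k} \<subseteq> U" and v: "v \<in> carrier_vec n"
  let ?C = "cols_mat n k V"
  have s: "subsp k {c \<in> carrier_vec k. ?C *\<^sub>v c \<in> U}" using subsp_vimage[OF cols_mat_carrier] U by blast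
  have "G *\<^sub>v v \<in> {c \<in> carrier_vec k. ?C *\<^sub>v c \<in> U}"
    by (rule spansD[OF spans_unit_vecs s]) (use U V cols_mat_unit[of _ k V n] G v in auto)
  moreover have "?C *\<^sub>v (G *\<^sub>v v) = v" using mult_inverse_vec[OF G(1) cols_mat_carrier G(2) v] .
  ultimately show "v \<in> U" by simp
qed (use V in auto)

definition prev :: "nat \<Rightarrow> (nat \<Rightarrow> 'k :: field vec) \<Rightarrow> nat \<Rightarrow> 'k vec" where
  "prev n y i = (if i = 0 then 0\<^sub>v n else y (i - 1))"

text \<open>
  In a Jordan basis, \<open>a\<close> is the identity and \<open>d\<close> is \<open>- \<eta>\<close> plus a nilpotent shift for finite \<open>\<eta>\<close>;
  for \<open>\<eta> = \<infinity>\<close>, \<open>d\<close> is the identity and \<open>a\<close> the shift.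
\<close>

fun coeff_a :: "('k :: field) proj_line \<Rightarrow> 'k" where
  "coeff_a (Fin e) = 1" | "coeff_a Infty = 0"

fun coeff_a' :: "('k :: field) proj_line \<Rightarrow> 'k" where
  "coeff_a' (Fin e) = 0" | "coeff_a' Infty = 1"

fun coeff_d :: "('k :: field) proj_line \<Rightarrow> 'k" where
  "coeff_d (Fin e) = - e" | "coeff_d Infty = 1"

fun coeff_d' :: "('k :: field) proj_line \<Rightarrow> 'k" where
  "coeff_d' (Fin e) = 1" | "coeff_d' Infty = 0"

text \<open>The parameter e is the sign of b on the socle, so the lifts x_i of the top have sign -e.
  Spanning is enough for a basis, as 2t vectors span a space of dimension 2t.\<close>

definition jordan_basis :: "('k :: field) d4_rep \<Rightarrow> nat \<Rightarrow> 'k \<Rightarrow> 'k proj_line \<Rightarrow> (nat \<Rightarrow> 'k vec) \<Rightarrow> (nat \<Rightarrow> 'k vec) \<Rightarrow> bool" where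
  "jordan_basis M t e \<eta> x y \<longleftrightarrow> bc_trivial M \<and> rdim M = t + t \<and>
     (\<forall>i<t. x i \<in> space M \<and> y i \<in> space M \<and>
        act_b M *\<^sub>v x i = (- e) \<cdot>\<^sub>v x i \<and> act_b M *\<^sub>v y i = e \<cdot>\<^sub>v y i \<and>
        act_a M *\<^sub>v y i = 0\<^sub>v (rdim M) \<and> act_d M *\<^sub>v y i = 0\<^sub>v (rdim M) \<and>
        act_a M *\<^sub>v x i = coeff_a \<eta> \<cdot>\<^sub>v y i + coeff_a' \<eta> \<cdot>\<^sub>v prev (rdim M) y i \<and>
        act_d M *\<^sub>v x i = coeff_d \<eta> \<cdot>\<^sub>v y i + coeff_d' \<eta> \<cdot>\<^sub>v prev (rdim M) y i) \<and>
     spans (rdim M) (x ` {..<t} \<union> y ` {..<t})"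

text \<open>The pencil is reparametrised so that \<eta> moves to 0: \<open>al\<close> is to become
  invertible from the top to the socle, and \<open>be\<close> kills v1. An idempotent pair of the
  pencil extends to an idempotent endomorphism of M and is therefore trivial, so
  \<open>kronecker_jordan_form\<close> applies.\<close>

lemma pencil_jordan_basis:
  fixes M :: "'k :: field d4_rep"
  assumes two: "(2 :: 'k) \<noteq> 0" and M: "bc_trivial M" and ind: "indecomposable M" and ee: "e * e = 1"
    and K: "killed M = {v \<in> space M. act_b M *\<^sub>v v = e \<cdot>\<^sub>v v}"
    and Y: "Y \<in> carrier_mat (rdim M) t" "inj_on ((*\<^sub>v) Y) (carrier_vec t)" "(*\<^sub>v) Y ` carrier_vec t = killed M"
    and dim: "rdim M = t + t"
    and al: "al \<in> carrier_mat (rdim M) (rdim M)" and be: "be \<in> carrier_mat (rdim M) (rdim M)"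
    and alK: "\<And>v. v \<in> space M \<Longrightarrow> al *\<^sub>v v \<in> killed M \<and> be *\<^sub>v v \<in> killed M"
    and Kal: "\<And>v. v \<in> killed M \<Longrightarrow> al *\<^sub>v v = 0\<^sub>v (rdim M) \<and> be *\<^sub>v v = 0\<^sub>v (rdim M)"
    and ad: "\<And>v. v \<in> space M \<Longrightarrow> act_a M *\<^sub>v v = coeff_a \<eta> \<cdot>\<^sub>v (al *\<^sub>v v) + coeff_a' \<eta> \<cdot>\<^sub>v (be *\<^sub>v v) \<and>
        act_d M *\<^sub>v v = coeff_d \<eta> \<cdot>\<^sub>v (al *\<^sub>v v) + coeff_d' \<eta> \<cdot>\<^sub>v (be *\<^sub>v v)"
    and v1: "v1 \<in> space M" "act_b M *\<^sub>v v1 = (- e) \<cdot>\<^sub>v v1" "v1 \<noteq> 0\<^sub>v (rdim M)" "be *\<^sub>v v1 = 0\<^sub>v (rdim M)"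
  shows "\<exists>x y. jordan_basis M t e \<eta> x y"
proof -
  define n b where "n = rdim M" and "b = act_b M"
  note wM = bc_trivial_well_formed[OF M]
  have b: "b \<in> carrier_mat n n" using well_formedD[OF wM] by (simp add: n_def b_def)
  note Y = Y[folded n_def] and al = al[folded n_def] and be = be[folded n_def]
    and alK = alK[folded n_def] and Kal = Kal[folded n_def] and v1 = v1[folded n_def b_def]
    and ad = ad[folded n_def] and dim = dim[folded n_def]
  have KD: "v \<in> carrier_vec n" "b *\<^sub>v v = e \<cdot>\<^sub>v v" if "v \<in> killed M" for v
    using that K by (auto simp: n_def b_def)
  have KI: "v \<in> killed M" if "v \<in> carrier_vec n" "b *\<^sub>v v = e \<cdot>\<^sub>v v" for v
    using that K by (auto simp: n_def b_def)
  have bb: "b *\<^sub>v (b *\<^sub>v v) = v" if "v \<in> carrier_vec n" for v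
    using bc_trivialD(2)[OF M] that by (simp add: b_def n_def)
  have ee': "- e * - e = 1" using ee by simp
  define p q where "p = eigen_proj e b" and "q = eigen_proj (- e) b"
  have pc: "p \<in> carrier_mat n n" and qc: "q \<in> carrier_mat n n"
    using eigen_proj_carrier[OF b] by (auto simp: p_def q_def)
  let ?T = "{v \<in> carrier_vec n. b *\<^sub>v v = (- e) \<cdot>\<^sub>v v}"
  have "subsp n ?T"
  proof -
    have "((- e) \<cdot>\<^sub>m 1\<^sub>m n) *\<^sub>v v = (- e) \<cdot>\<^sub>v v" if "v \<in> carrier_vec n" for v
      using that by (simp add: smult_mat_mult_vec[of _ n n])
    then have "?T = {v \<in> carrier_vec n. b *\<^sub>v v = ((- e) \<cdot>\<^sub>m 1\<^sub>m n) *\<^sub>v v}" by auto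
    then show ?thesis using subsp_eq_image[OF b, of "(- e) \<cdot>\<^sub>m 1\<^sub>m n"] by simp
  qed
  then obtain m X where X: "X \<in> carrier_mat n m" "inj_on ((*\<^sub>v) X) (carrier_vec m)" "(*\<^sub>v) X ` carrier_vec m = ?T"
    by (rule subsp_basis)
  obtain LX where LX: "LX \<in> carrier_mat m n" "LX * X = 1\<^sub>m m" by (rule left_inverse_of_inj[OF X(1,2)])
  obtain LY where LY: "LY \<in> carrier_mat t n" "LY * Y = 1\<^sub>m t" by (rule left_inverse_of_inj[OF Y(1,2)])
  have XT: "X *\<^sub>v w \<in> carrier_vec n" "b *\<^sub>v (X *\<^sub>v w) = (- e) \<cdot>\<^sub>v (X *\<^sub>v w)" if "w \<in> carrier_vec m" for w
    using X(3) that by blast+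
  have YK: "Y *\<^sub>v z \<in> killed M" if "z \<in> carrier_vec t" for z using Y(3) that by blast
  note YT = KD[OF YK]
  \<comment> \<open>Coordinates of the two b-eigencomponents of v in the bases X and Y.\<close>
  define X' Y' where "X' v = LX *\<^sub>v (q *\<^sub>v v)" and "Y' v = LY *\<^sub>v (p *\<^sub>v v)" for v
  have X'c: "X' v \<in> carrier_vec m" and Y'c: "Y' v \<in> carrier_vec t" if "v \<in> carrier_vec n" for v
    using that pc qc LX LY by (auto simp: X'_def Y'_def)
  have X'X: "X' (X *\<^sub>v w) = w" if w: "w \<in> carrier_vec m" for w
    unfolding X'_def q_def eigen_proj_fix[OF two b XT[OF w] ee'] by (rule mult_inverse_vec[OF X(1) LX w])
  have Y'Y: "Y' (Y *\<^sub>v z) = z" if z: "z \<in> carrier_vec t" for z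
    unfolding Y'_def p_def eigen_proj_fix[OF two b YT[OF z] ee] by (rule mult_inverse_vec[OF Y(1) LY z])
  have X'Y: "X' (Y *\<^sub>v z) = 0\<^sub>v m" if z: "z \<in> carrier_vec t" for z
  proof -
    have "b *\<^sub>v (Y *\<^sub>v z) = (- (- e)) \<cdot>\<^sub>v (Y *\<^sub>v z)" using YT(2)[OF z] by simp
    then show ?thesis unfolding X'_def q_def using eigen_proj_kill[OF b YT(1)[OF z] _ ee'] mult_mat_zero_vec[OF LX(1)] by simp
  qed
  have Y'X: "Y' (X *\<^sub>v w) = 0\<^sub>v t" if w: "w \<in> carrier_vec m" for w
    unfolding Y'_def p_def eigen_proj_kill[OF b XT[OF w] ee] by (rule mult_mat_zero_vec[OF LY(1)])
  have XX': "X *\<^sub>v X' v = q *\<^sub>v v" if v: "v \<in> carrier_vec n" for v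
  proof -
    have "q *\<^sub>v v \<in> ?T"
      using eigen_proj_eigen[OF b v bb[OF v] ee'] mult_mat_vec_carrier[OF qc v] by (simp add: q_def)
    then obtain w where w: "w \<in> carrier_vec m" "q *\<^sub>v v = X *\<^sub>v w" using X(3) by blast
    then show ?thesis unfolding X'_def using mult_inverse_vec[OF X(1) LX w(1)] by simp
  qed
  have YY': "Y *\<^sub>v Y' v = p *\<^sub>v v" if v: "v \<in> carrier_vec n" for v
  proof -
    have "p *\<^sub>v v \<in> killed M"
      using eigen_proj_eigen[OF b v bb[OF v] ee] mult_mat_vec_carrier[OF pc v] by (intro KI) (simp_all add: p_def)
    then obtain w where w: "w \<in> carrier_vec t" "p *\<^sub>v v = Y *\<^sub>v w" using Y(3) by blast
    then show ?thesis unfolding Y'_def using mult_inverse_vec[OF Y(1) LY w(1)] by simp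
  qed
  have dec: "v = X *\<^sub>v X' v + Y *\<^sub>v Y' v" if v: "v \<in> carrier_vec n" for v
    using eigen_proj_sum[OF two b v, of "- e"] XX'[OF v] YY'[OF v] by (simp add: p_def q_def)
  have XY: "hcat X Y \<in> carrier_mat n (m + t)" using hcat_carrier[OF X(1) Y(1)] .
  \<comment> \<open>The eigenspaces are complementary. Together with n = 2t this makes the pencil
    square.\<close>
  have "n = m + t"
  proof (rule inj_surj_dim_eq[OF XY])
    show "inj_on ((*\<^sub>v) (hcat X Y)) (carrier_vec (m + t))"
    proof (rule inj_onI_kernel[OF XY])
      fix v assume v: "v \<in> carrier_vec (m + t)" "hcat X Y *\<^sub>v v = 0\<^sub>v n"
      define w z where "w = vec_first v m" and "z = vec_last v t"
      have wz: "w \<in> carrier_vec m" "z \<in> carrier_vec t" "v = w @\<^sub>v z" using v(1) by (auto simp: w_def z_def)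
      have s: "X *\<^sub>v w + Y *\<^sub>v z = 0\<^sub>v n" using hcat_mult[OF X(1) Y(1) wz(1,2)] wz(3) v(2) by simp
      have c: "X *\<^sub>v w \<in> carrier_vec n" "Y *\<^sub>v z \<in> carrier_vec n" using XT(1)[OF wz(1)] YT(1)[OF wz(2)] .
      have "X' (X *\<^sub>v w + Y *\<^sub>v z) = w"
        unfolding X'_def using c qc X'X[OF wz(1)] X'Y[OF wz(2)] wz(1)
        by (simp add: mult_add_distrib_mat_vec[OF qc] mult_add_distrib_mat_vec[OF LX(1)] X'_def)
      then have w0: "w = 0\<^sub>v m" unfolding s X'_def mult_mat_zero_vec[OF qc] mult_mat_zero_vec[OF LX(1)] by simp
      have "Y' (X *\<^sub>v w + Y *\<^sub>v z) = z"
        unfolding Y'_def using c pc Y'X[OF wz(1)] Y'Y[OF wz(2)] wz(2)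
        by (simp add: mult_add_distrib_mat_vec[OF pc] mult_add_distrib_mat_vec[OF LY(1)] Y'_def)
      then have z0: "z = 0\<^sub>v t" unfolding s Y'_def mult_mat_zero_vec[OF pc] mult_mat_zero_vec[OF LY(1)] by simp
      show "v = 0\<^sub>v (m + t)" unfolding wz(3) w0 z0 by (intro eq_vecI) auto
    qed
    show "carrier_vec n \<subseteq> (*\<^sub>v) (hcat X Y) ` carrier_vec (m + t)"
    proof
      fix v :: "'k vec" assume v: "v \<in> carrier_vec n"
      then show "v \<in> (*\<^sub>v) (hcat X Y) ` carrier_vec (m + t)"
        using hcat_mult[OF X(1) Y(1) X'c[OF v] Y'c[OF v]] dec[OF v] X'c[OF v] Y'c[OF v]
        by (intro image_eqI[of _ _ "X' v @\<^sub>v Y' v"]) auto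
    qed
  qed
  then have mt: "m = t" using dim by simp
  note X = X[unfolded mt] and LX = LX[unfolded mt] and XT = XT[unfolded mt] and X'c = X'c[unfolded mt]
    and X'X = X'X[unfolded mt] and X'Y = X'Y[unfolded mt] and Y'X = Y'X[unfolded mt]
  \<comment> \<open>The matrices of \<open>al\<close> and \<open>be\<close> from the (-e)-eigenspace
    to the socle, in the bases X and Y.\<close>
  define A B where "A = LY * (al * X)" and "B = LY * (be * X)"
  have A: "A \<in> carrier_mat t t" and B: "B \<in> carrier_mat t t" using LY(1) al be X(1) by (auto simp: A_def B_def)
  have YLY: "Y *\<^sub>v (LY *\<^sub>v k) = k" if k: "k \<in> killed M" for k
  proof -
    obtain w where w: "w \<in> carrier_vec t" "k = Y *\<^sub>v w" using k Y(3) by blast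
    then show ?thesis using mult_inverse_vec[OF Y(1) LY w(1)] by simp
  qed
  have YA: "Y *\<^sub>v (A *\<^sub>v w) = al *\<^sub>v (X *\<^sub>v w)" and YB: "Y *\<^sub>v (B *\<^sub>v w) = be *\<^sub>v (X *\<^sub>v w)" if w: "w \<in> carrier_vec t" for w
  proof -
    have "A *\<^sub>v w = LY *\<^sub>v (al *\<^sub>v (X *\<^sub>v w))" "B *\<^sub>v w = LY *\<^sub>v (be *\<^sub>v (X *\<^sub>v w))"
      using LY(1) al be X(1) w by (simp_all add: A_def B_def assoc_mult_mat_vec[of LY t n _ t])
    then show "Y *\<^sub>v (A *\<^sub>v w) = al *\<^sub>v (X *\<^sub>v w)" "Y *\<^sub>v (B *\<^sub>v w) = be *\<^sub>v (X *\<^sub>v w)"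
      using YLY alK XT(1)[OF w] by (simp_all add: n_def)
  qed
  have Yinj: "w = w'" if "w \<in> carrier_vec t" "w' \<in> carrier_vec t" "Y *\<^sub>v w = Y *\<^sub>v w'" for w w'
    using inj_onD[OF Y(2) that(3,1,2)] .
  have triv: "only_trivial_idempotents A B t t"
    unfolding only_trivial_idempotents_def
  proof (intro allI impI)
    fix E F :: "'k mat"
    assume E: "E \<in> carrier_mat t t" and F: "F \<in> carrier_mat t t" and EE: "E * E = E" and FF: "F * F = F"
      and AE: "A * E = F * A" and BE: "B * E = F * B"
    \<comment> \<open>Acts as E on the coordinates of sign -e and as F on the socle
      coordinates.\<close>
    define H where "H = X * (E * (LX * q)) + Y * (F * (LY * p))"
    have hc: "X * (E * (LX * q)) \<in> carrier_mat n n" "Y * (F * (LY * p)) \<in> carrier_mat n n"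
      using X(1) Y(1) E F LX(1) LY(1) pc qc by auto
    have Hc: "H \<in> carrier_mat n n" using hc by (simp add: H_def)
    have quad: "P * (Q * (R * S)) *\<^sub>v v = P *\<^sub>v (Q *\<^sub>v (R *\<^sub>v (S *\<^sub>v v)))"
      if "P \<in> carrier_mat n t" "Q \<in> carrier_mat t t" "R \<in> carrier_mat t n" "S \<in> carrier_mat n n" "v \<in> carrier_vec n"
      for P Q R S v
      using that assoc_mult_mat_vec[OF that(1) mult_carrier_mat[OF that(2) mult_carrier_mat[OF that(3,4)]] that(5)]
        assoc_mult_mat_vec[OF that(2) mult_carrier_mat[OF that(3,4)] that(5)] by simp
    have Hv: "H *\<^sub>v v = X *\<^sub>v (E *\<^sub>v X' v) + Y *\<^sub>v (F *\<^sub>v Y' v)" if v: "v \<in> carrier_vec n" for v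
      unfolding H_def X'_def Y'_def add_mult_distrib_mat_vec[OF hc v]
        quad[OF X(1) E LX(1) qc v] quad[OF Y(1) F LY(1) pc v] ..
    have HX: "H *\<^sub>v (X *\<^sub>v w) = X *\<^sub>v (E *\<^sub>v w)" if w: "w \<in> carrier_vec t" for w
      using Hv[OF XT(1)[OF w]] X'X[OF w] Y'X[OF w] mult_mat_zero_vec[OF F] mult_mat_zero_vec[OF Y(1)] X(1) E w by simp
    have HY: "H *\<^sub>v (Y *\<^sub>v w) = Y *\<^sub>v (F *\<^sub>v w)" if w: "w \<in> carrier_vec t" for w
      using Hv[OF YT(1)[OF w]] X'Y[OF w] Y'Y[OF w] mult_mat_zero_vec[OF E] mult_mat_zero_vec[OF X(1)] Y(1) F w by simp
    have sp: "spans n ((*\<^sub>v) X ` carrier_vec t \<union> (*\<^sub>v) Y ` carrier_vec t)"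
      unfolding spans_def
    proof (intro conjI allI impI subsetI)
      fix U and v :: "'k vec"
      assume U: "subsp n U \<and> (*\<^sub>v) X ` carrier_vec t \<union> (*\<^sub>v) Y ` carrier_vec t \<subseteq> U" and v: "v \<in> carrier_vec n"
      then show "v \<in> U" using dec[OF v] X'c[OF v] Y'c[OF v] subspD(3)[of n U] by (metis Un_iff image_eqI subsetD)
    qed (use XT(1) YT(1) in auto)
    have Ec: "E *\<^sub>v w \<in> carrier_vec t" "F *\<^sub>v w \<in> carrier_vec t" if "w \<in> carrier_vec t" for w using E F that by auto
    have HH: "H * H = H"
    proof (rule mat_eqI_spans[OF sp])
      have EEv: "E *\<^sub>v (E *\<^sub>v w) = E *\<^sub>v w" "F *\<^sub>v (F *\<^sub>v w) = F *\<^sub>v w" if "w \<in> carrier_vec t" for w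
        using assoc_mult_mat_vec[OF E E that] assoc_mult_mat_vec[OF F F that] EE FF by simp_all
      fix v assume "v \<in> (*\<^sub>v) X ` carrier_vec t \<union> (*\<^sub>v) Y ` carrier_vec t"
      then obtain w where w: "w \<in> carrier_vec t" "v = X *\<^sub>v w \<or> v = Y *\<^sub>v w" by blast
      then have vc: "v \<in> carrier_vec n" using XT(1) YT(1) by blast
      show "H * H *\<^sub>v v = H *\<^sub>v v"
        unfolding assoc_mult_mat_vec[OF Hc Hc vc] using w HX HY Ec EEv by auto
    qed (use Hc in auto)
    have comm: "H *\<^sub>v (x *\<^sub>v v) = x *\<^sub>v (H *\<^sub>v v)" if "x = al \<or> x = be" "v \<in> carrier_vec n" for x v
    proof -
      have x: "x \<in> carrier_mat n n" using that(1) al be by blast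
      have 1: "H *\<^sub>v (x *\<^sub>v (X *\<^sub>v w)) = x *\<^sub>v (H *\<^sub>v (X *\<^sub>v w))" if w: "w \<in> carrier_vec t" for w
      proof -
        have "H *\<^sub>v (Y *\<^sub>v (C *\<^sub>v w)) = Y *\<^sub>v (C *\<^sub>v (E *\<^sub>v w))" if "C \<in> carrier_mat t t" "C * E = F * C" for C
        proof -
          have "F *\<^sub>v (C *\<^sub>v w) = C *\<^sub>v (E *\<^sub>v w)"
            using assoc_mult_mat_vec[OF F that(1) w] assoc_mult_mat_vec[OF that(1) E w] that(2) by simp
          then show ?thesis using HY[of "C *\<^sub>v w"] that(1) w by simp
        qed
        then show ?thesis
          using \<open>x = al \<or> x = be\<close> YA[OF w] YB[OF w] YA[OF Ec(1)[OF w]] YB[OF Ec(1)[OF w]] HX[OF w] A B AE BE by metis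
      qed
      have 2: "H *\<^sub>v (x *\<^sub>v (Y *\<^sub>v w)) = x *\<^sub>v (H *\<^sub>v (Y *\<^sub>v w))" if w: "w \<in> carrier_vec t" for w
      proof -
        have "x *\<^sub>v k = 0\<^sub>v n" if "k \<in> killed M" for k using Kal[OF that] \<open>x = al \<or> x = be\<close> by blast
        then show ?thesis using HY[OF w] YK[OF w] YK[OF Ec(2)[OF w]] mult_mat_zero_vec[OF Hc] by simp
      qed
      have Hx: "H * x \<in> carrier_mat n n" "x * H \<in> carrier_mat n n" using Hc x by auto
      have "v \<in> {v \<in> carrier_vec n. H * x *\<^sub>v v = x * H *\<^sub>v v}"
      proof (rule spansD[OF sp subsp_eq_image[OF Hx] _ that(2)], rule subsetI)
        fix u assume "u \<in> (*\<^sub>v) X ` carrier_vec t \<union> (*\<^sub>v) Y ` carrier_vec t"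
        then obtain w where w: "w \<in> carrier_vec t" "u = X *\<^sub>v w \<or> u = Y *\<^sub>v w" by blast
        then have uc: "u \<in> carrier_vec n" using XT(1) YT(1) by blast
        show "u \<in> {v \<in> carrier_vec n. H * x *\<^sub>v v = x * H *\<^sub>v v}"
          using w 1 2 uc assoc_mult_mat_vec[OF Hc x uc] assoc_mult_mat_vec[OF x Hc uc] by auto
      qed
      then show ?thesis using assoc_mult_mat_vec[OF Hc x that(2)] assoc_mult_mat_vec[OF x Hc that(2)] by simp
    qed
    have "is_hom M M H"
    proof (rule is_homI_spans[OF wM wM _ spans_carrier], goal_cases)
      case 1
      show ?case using Hc n_def by simp
    next
      case (2 v)
      then have v: "v \<in> carrier_vec n" by (simp add: n_def)
      have Hvc: "H *\<^sub>v v \<in> carrier_vec n" using Hc v by simp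
      have ac: "al *\<^sub>v v \<in> carrier_vec n" "be *\<^sub>v v \<in> carrier_vec n" using al be v by auto
      have sm: "H *\<^sub>v (x \<cdot>\<^sub>v (al *\<^sub>v v) + x' \<cdot>\<^sub>v (be *\<^sub>v v)) = x \<cdot>\<^sub>v (al *\<^sub>v (H *\<^sub>v v)) + x' \<cdot>\<^sub>v (be *\<^sub>v (H *\<^sub>v v))" for x x'
        using ac comm[OF _ v] by (simp add: mult_add_distrib_mat_vec[OF Hc] mult_mat_smult_vec[OF Hc])
      have "H *\<^sub>v (act_a M *\<^sub>v v) = act_a M *\<^sub>v (H *\<^sub>v v)" "H *\<^sub>v (act_d M *\<^sub>v v) = act_d M *\<^sub>v (H *\<^sub>v v)"
        using ad[of v] ad[of "H *\<^sub>v v"] v Hvc sm by (simp_all add: n_def)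
      moreover have "H *\<^sub>v (b *\<^sub>v v) = b *\<^sub>v (H *\<^sub>v v)"
      proof -
        have d: "v = X *\<^sub>v X' v + Y *\<^sub>v Y' v" using dec[OF v] .
        define w z where "w = X' v" and "z = Y' v"
        have wz: "w \<in> carrier_vec t" "z \<in> carrier_vec t" using X'c[OF v] Y'c[OF v] by (auto simp: w_def z_def)
        note c = XT(1)[OF wz(1)] YT(1)[OF wz(2)] XT(1)[OF Ec(1)[OF wz(1)]] YT(1)[OF Ec(2)[OF wz(2)]]
        have d: "v = X *\<^sub>v w + Y *\<^sub>v z" using dec[OF v] by (simp add: w_def z_def)
        show ?thesis unfolding d
          using c XT(2)[OF wz(1)] YT(2)[OF wz(2)] XT(2)[OF Ec(1)[OF wz(1)]] YT(2)[OF Ec(2)[OF wz(2)]] HX[OF wz(1)] HY[OF wz(2)]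
          by (simp add: mult_add_distrib_mat_vec[OF Hc] mult_add_distrib_mat_vec[OF b] mult_mat_smult_vec[OF Hc])
      qed
      moreover have "act_c M *\<^sub>v v = b *\<^sub>v v" "act_c M *\<^sub>v (H *\<^sub>v v) = b *\<^sub>v (H *\<^sub>v v)"
        using bc_trivialD(1)[OF M] v Hvc by (auto simp: b_def n_def)
      ultimately show ?case by (simp add: b_def)
    qed
    then have "H = 0\<^sub>m n n \<or> H = 1\<^sub>m n" using indecomposable_idempotent[OF ind _ HH] n_def by blast
    then show "(E = 0\<^sub>m t t \<and> F = 0\<^sub>m t t) \<or> (E = 1\<^sub>m t \<and> F = 1\<^sub>m t)"
    proof
      assume H0: "H = 0\<^sub>m n n"
      have Ew: "E *\<^sub>v w = 0\<^sub>v t" "F *\<^sub>v w = 0\<^sub>v t" if w: "w \<in> carrier_vec t" for w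
      proof -
        have "X *\<^sub>v (E *\<^sub>v w) = 0\<^sub>v n" "Y *\<^sub>v (F *\<^sub>v w) = 0\<^sub>v n"
          using HX[OF w] HY[OF w] zero_mat_mult_vec[OF XT(1)[OF w]] zero_mat_mult_vec[OF YT(1)[OF w]] unfolding H0 by simp_all
        then show "E *\<^sub>v w = 0\<^sub>v t" "F *\<^sub>v w = 0\<^sub>v t"
          using inj_on_kernelD[OF X(1,2) Ec(1)[OF w]] inj_on_kernelD[OF Y(1,2) Ec(2)[OF w]] by auto
      qed
      have "E = 0\<^sub>m t t" by (rule mat_eqI_vec[OF E zero_carrier_mat]) (simp add: Ew zero_mat_mult_vec)
      moreover have "F = 0\<^sub>m t t" by (rule mat_eqI_vec[OF F zero_carrier_mat]) (simp add: Ew zero_mat_mult_vec)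
      ultimately show ?thesis by blast
    next
      assume H1: "H = 1\<^sub>m n"
      have Ew: "E *\<^sub>v w = w" "F *\<^sub>v w = w" if w: "w \<in> carrier_vec t" for w
      proof -
        have "X *\<^sub>v (E *\<^sub>v w) = X *\<^sub>v w" "Y *\<^sub>v (F *\<^sub>v w) = Y *\<^sub>v w"
          using HX[OF w] HY[OF w] XT(1)[OF w] YT(1)[OF w] unfolding H1 by simp_all
        then show "E *\<^sub>v w = w" "F *\<^sub>v w = w"
          using inj_onD[OF X(2) _ Ec(1)[OF w] w] Yinj[OF Ec(2)[OF w] w] by auto
      qed
      have "E = 1\<^sub>m t" by (rule mat_eqI_vec[OF E one_carrier_mat]) (simp add: Ew)
      moreover have "F = 1\<^sub>m t" by (rule mat_eqI_vec[OF F one_carrier_mat]) (simp add: Ew)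
      ultimately show ?thesis by blast
    qed
  qed
  \<comment> \<open>A vector X w annihilated by \<open>al\<close> and \<open>be\<close> is
    annihilated by a and d, so it lies in the socle, which has sign e. Having sign -e as well, it is
    zero.\<close>
  have ker: "w = 0\<^sub>v t" if w: "w \<in> carrier_vec t" "A *\<^sub>v w = 0\<^sub>v t" "B *\<^sub>v w = 0\<^sub>v t" for w
  proof -
    have "al *\<^sub>v (X *\<^sub>v w) = 0\<^sub>v n" "be *\<^sub>v (X *\<^sub>v w) = 0\<^sub>v n"
      using YA[OF w(1)] YB[OF w(1)] w(2,3) mult_mat_zero_vec[OF Y(1)] by simp_all
    moreover have "x \<cdot>\<^sub>v 0\<^sub>v n + y \<cdot>\<^sub>v 0\<^sub>v n = (0\<^sub>v n :: 'k vec)" for x y by (intro eq_vecI) auto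
    ultimately have "X *\<^sub>v w \<in> killed M"
      using ad[of "X *\<^sub>v w"] XT(1)[OF w(1)] by (simp add: killed_def n_def)
    then have "Y' (X *\<^sub>v w) = LY *\<^sub>v (X *\<^sub>v w)"
      unfolding Y'_def p_def using eigen_proj_fix[OF two b KD ee] by simp
    then have "X *\<^sub>v w = 0\<^sub>v n"
      using Y'X[OF w(1)] YLY[OF \<open>X *\<^sub>v w \<in> killed M\<close>] mult_mat_zero_vec[OF Y(1)] by simp
    then show ?thesis using inj_on_kernelD[OF X(1,2) w(1)] by simp
  qed
  \<comment> \<open>v1 yields a nonzero kernel vector of B, so open chains exist.\<close>
  define v0 where "v0 = X' v1"
  have v0: "v0 \<in> carrier_vec t" "X *\<^sub>v v0 = v1"
    using X'c v1 XX' eigen_proj_fix[OF two b _ _ ee', of v1] by (auto simp: v0_def n_def q_def)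
  have v0n: "v0 \<noteq> 0\<^sub>v t" using v0(2) v1(3) mult_mat_zero_vec[OF X(1)] by auto
  have "Y *\<^sub>v (B *\<^sub>v v0) = 0\<^sub>v n" using YB[OF v0(1)] v0(2) v1(4) by simp
  then have Bv0: "B *\<^sub>v v0 = 0\<^sub>v t" using inj_on_kernelD[OF Y(1,2)] B v0(1) by auto
  obtain x P Q where x: "\<And>i. i < t \<Longrightarrow> x i \<in> carrier_vec t" "B *\<^sub>v x 0 = 0\<^sub>v t"
    "\<And>i. Suc i < t \<Longrightarrow> B *\<^sub>v x (Suc i) = A *\<^sub>v x i"
    "P \<in> carrier_mat t t" "cols_mat t t x * P = 1\<^sub>m t"
    "Q \<in> carrier_mat t t" "cols_mat t t (\<lambda>i. A *\<^sub>v x i) * Q = 1\<^sub>m t"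
  proof (rule kronecker_jordan_form[OF A B triv ker v0(1) v0n Bv0], goal_cases)
    case (4 x P Q)
    show ?case by (rule that[OF 4(2-8)])
  qed
  have Axc: "A *\<^sub>v x i \<in> carrier_vec t" if "i < t" for i using A x(1)[OF that] by simp
  have sx: "spans t (x ` {..<t})" by (rule spans_of_right_inverse[OF x(1,4,5)])
  have sy: "spans t ((\<lambda>i. A *\<^sub>v x i) ` {..<t})" by (rule spans_of_right_inverse[OF Axc x(6,7)])
  define xx yy where "xx i = X *\<^sub>v x i" and "yy i = Y *\<^sub>v (A *\<^sub>v x i)" for i
  have "jordan_basis M t e \<eta> xx yy"
    unfolding jordan_basis_def
  proof (intro conjI allI impI, goal_cases)
    case 1 show ?case by (rule M)
  next
    case 2 show ?case using dim n_def by simp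
  next
    case (3 i) then show ?case using XT(1) x(1) by (simp add: xx_def n_def)
  next
    case (4 i) then show ?case using YT(1) Axc by (simp add: yy_def n_def)
  next
    case (5 i) then show ?case using XT(2) x(1) by (simp add: xx_def b_def)
  next
    case (6 i) then show ?case using YT(2) Axc by (simp add: yy_def b_def)
  next
    case (7 i) then show ?case using YK[OF Axc[of i]] by (simp add: yy_def killed_def)
  next
    case (8 i) then show ?case using YK[OF Axc[of i]] by (simp add: yy_def killed_def)
  next
    case (9 i)
    have "be *\<^sub>v xx i = prev n yy i"
      using YB[OF x(1)[OF 9]] x(2) x(3)[of "i - 1"] 9 mult_mat_zero_vec[OF Y(1)] by (cases i) (auto simp: prev_def xx_def yy_def)
    then show ?case using ad[of "xx i"] YA[OF x(1)[OF 9]] XT(1)[OF x(1)[OF 9]] by (simp add: xx_def yy_def n_def)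
  next
    case (10 i)
    have "be *\<^sub>v xx i = prev n yy i"
      using YB[OF x(1)[OF 10]] x(2) x(3)[of "i - 1"] 10 mult_mat_zero_vec[OF Y(1)] by (cases i) (auto simp: prev_def xx_def yy_def)
    then show ?case using ad[of "xx i"] YA[OF x(1)[OF 10]] XT(1)[OF x(1)[OF 10]] by (simp add: xx_def yy_def n_def)
  next
    case 11
    show ?case unfolding spans_def
    proof (intro conjI allI impI subsetI)
      fix v assume "v \<in> xx ` {..<t} \<union> yy ` {..<t}"
      then show "v \<in> space M" using XT(1) YT(1) x(1) Axc by (auto simp: xx_def yy_def n_def)
    next
      fix U and v :: "'k vec"
      assume U: "subsp (rdim M) U \<and> xx ` {..<t} \<union> yy ` {..<t} \<subseteq> U" and v: "v \<in> space M"
      then have sU: "subsp n U" and v: "v \<in> carrier_vec n" by (auto simp: n_def)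
      have "X' v \<in> {w \<in> carrier_vec t. X *\<^sub>v w \<in> U}"
        by (rule spansD[OF sx subsp_vimage[OF X(1) sU] _ X'c[OF v]]) (use U x(1) in \<open>auto simp: xx_def\<close>)
      moreover have "Y' v \<in> {w \<in> carrier_vec t. Y *\<^sub>v w \<in> U}"
        by (rule spansD[OF sy subsp_vimage[OF Y(1) sU] _ Y'c[OF v]]) (use U Axc in \<open>auto simp: yy_def\<close>)
      ultimately have "X *\<^sub>v X' v + Y *\<^sub>v Y' v \<in> U" using subspD(3)[OF sU] by blast
      then show "v \<in> U" using dec[OF v] by metis
    qed
  qed
  then show ?thesis by blast
qed

lemma smult_zero_vec: "c \<cdot>\<^sub>v 0\<^sub>v n = (0\<^sub>v n :: 'k :: field vec)"
  by (intro eq_vecI) auto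

lemma bsign_mult: "bsign (r + r') = (bsign r * bsign r' :: 'k :: field)"
  by (cases r; cases r') (simp_all add: bsign_def)

lemma bsign_square: "bsign r * bsign r = (1 :: 'k :: field)"
  by (simp add: bsign_def)

lemma bsign_add_one: "bsign (r + 1) = (- bsign r :: 'k :: field)"
  by (cases r) (simp_all add: bsign_def)

lemma rep_M1_basis:
  fixes r :: bit and \<eta> :: "'k :: field proj_line"
  defines "R \<equiv> rep_M1 r \<eta>" and "e\<^sub>0 \<equiv> unit_vec 2 0" and "e\<^sub>1 \<equiv> unit_vec 2 1"
  shows "well_formed R" "rdim R = 2"
    "act_a R *\<^sub>v e\<^sub>0 = coeff_a \<eta> \<cdot>\<^sub>v e\<^sub>1" "act_d R *\<^sub>v e\<^sub>0 = coeff_d \<eta> \<cdot>\<^sub>v e\<^sub>1"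
    "act_a R *\<^sub>v e\<^sub>1 = 0\<^sub>v 2" "act_d R *\<^sub>v e\<^sub>1 = 0\<^sub>v 2"
    "act_b R *\<^sub>v e\<^sub>0 = (- bsign r) \<cdot>\<^sub>v e\<^sub>0" "act_b R *\<^sub>v e\<^sub>1 = bsign r \<cdot>\<^sub>v e\<^sub>1"
    "act_c R *\<^sub>v e\<^sub>0 = (- bsign r) \<cdot>\<^sub>v e\<^sub>0" "act_c R *\<^sub>v e\<^sub>1 = bsign r \<cdot>\<^sub>v e\<^sub>1"
proof -
  have m: "mat_of_rows_list 2 [[p, q], [p', q']] *\<^sub>v unit_vec 2 0 = vec_of_list [p, p'] \<and>
      mat_of_rows_list 2 [[p, q], [p', q']] *\<^sub>v unit_vec 2 1 = vec_of_list [q, q']" for p q p' q' :: 'k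
    by (intro conjI eq_vecI) (auto simp: mat_of_rows_list_def less_Suc_eq vec_of_list_index)
  have v: "vec_of_list [p, p'] = p \<cdot>\<^sub>v unit_vec 2 0 + p' \<cdot>\<^sub>v unit_vec 2 1" for p p' :: 'k
    by (intro eq_vecI) (auto simp: less_2_cases_iff vec_of_list_index)
  show "well_formed R" "rdim R = 2"
    by (auto simp: R_def rep_M1_def Let_def well_formed_def mat_of_rows_list_def)
  have x: "(case \<eta> of Fin e \<Rightarrow> 1 | Infty \<Rightarrow> 0) = coeff_a \<eta>" "(case \<eta> of Fin e \<Rightarrow> - e | Infty \<Rightarrow> 1) = coeff_d \<eta>"
    by (cases \<eta>; simp)+
  have R: "act_a R = mat_of_rows_list 2 [[0, 0], [coeff_a \<eta>, 0]]" "act_d R = mat_of_rows_list 2 [[0, 0], [coeff_d \<eta>, 0]]"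
    "act_b R = mat_of_rows_list 2 [[- bsign r, 0], [0, bsign r]]" "act_c R = mat_of_rows_list 2 [[- bsign r, 0], [0, bsign r]]"
    by (cases r; simp add: R_def rep_M1_def Let_def x bsign_def)+
  have zz: "0 \<cdot>\<^sub>v unit_vec 2 i = (0\<^sub>v 2 :: 'k vec)" for i by (intro eq_vecI) auto
  show "act_a R *\<^sub>v e\<^sub>0 = coeff_a \<eta> \<cdot>\<^sub>v e\<^sub>1" "act_d R *\<^sub>v e\<^sub>0 = coeff_d \<eta> \<cdot>\<^sub>v e\<^sub>1"
    "act_a R *\<^sub>v e\<^sub>1 = 0\<^sub>v 2" "act_d R *\<^sub>v e\<^sub>1 = 0\<^sub>v 2"
    "act_b R *\<^sub>v e\<^sub>0 = (- bsign r) \<cdot>\<^sub>v e\<^sub>0" "act_b R *\<^sub>v e\<^sub>1 = bsign r \<cdot>\<^sub>v e\<^sub>1"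
    "act_c R *\<^sub>v e\<^sub>0 = (- bsign r) \<cdot>\<^sub>v e\<^sub>0" "act_c R *\<^sub>v e\<^sub>1 = bsign r \<cdot>\<^sub>v e\<^sub>1"
    unfolding R e\<^sub>0_def e\<^sub>1_def by (simp_all only: m v) (simp_all add: zz)
qed

text \<open>The abstract submodule is traded for two vectors of M, the images of the basis vectors
  of M_1(r, \<eta>) under the embedding of S.\<close>

lemma rep_M_generator:
  fixes M :: "'k :: field d4_rep"
  assumes M: "d4_module M" and S: "is_sub_rep M U S" "S \<cong>\<^sub>D rep_M1 r \<eta>"
  obtains v w where "v \<in> space M" "w \<in> space M" "v \<noteq> 0\<^sub>v (rdim M)" "w \<noteq> 0\<^sub>v (rdim M)"
    "act_a M *\<^sub>v v = coeff_a \<eta> \<cdot>\<^sub>v w" "act_d M *\<^sub>v v = coeff_d \<eta> \<cdot>\<^sub>v w"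
    "act_a M *\<^sub>v w = 0\<^sub>v (rdim M)" "act_d M *\<^sub>v w = 0\<^sub>v (rdim M)"
    "act_b M *\<^sub>v v = (- bsign r) \<cdot>\<^sub>v v" "act_b M *\<^sub>v w = bsign r \<cdot>\<^sub>v w" "act_c M *\<^sub>v w = bsign r \<cdot>\<^sub>v w"
proof -
  obtain H where dS: "d4_module S" and H: "is_hom S M H" "inj_on ((*\<^sub>v) H) (space S)"
    using S(1) by (auto simp: is_sub_rep_def is_mono_def)
  obtain F where F: "is_hom S (rep_M1 r \<eta>) F" "bij_betw ((*\<^sub>v) F) (space S) (space (rep_M1 r \<eta>))"
    using S(2) by (auto simp: d4_iso_def)
  note R = rep_M1_basis[of r \<eta>]
  note wS = d4_moduleD(1)[OF dS] and wM = d4_moduleD(1)[OF M]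
  note hF = is_homD[OF F(1) wS R(1)] and hH = is_homD[OF H(1) wS wM]
  have iF: "inj_on ((*\<^sub>v) F) (space S)" using F(2) by (rule bij_betw_imp_inj_on)
  have sF: "(*\<^sub>v) F ` space S = carrier_vec 2" using bij_betw_imp_surj_on[OF F(2)] R(2) by simp
  obtain s0 where s0: "s0 \<in> space S" "F *\<^sub>v s0 = unit_vec 2 0" using sF unit_vec_carrier by (metis imageE)
  obtain s1 where s1: "s1 \<in> space S" "F *\<^sub>v s1 = unit_vec 2 1" using sF unit_vec_carrier by (metis imageE)
  have Fc: "F \<in> carrier_mat 2 (rdim S)" using hF(1)[OF s0(1)] R(2) by simp
  have Hc: "H \<in> carrier_mat (rdim M) (rdim S)" using hH(1)[OF s0(1)] .
  have eqI: "H *\<^sub>v u = H *\<^sub>v u'" if "u \<in> space S" "u' \<in> space S" "F *\<^sub>v u = F *\<^sub>v u'" for u u'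
    using inj_onD[OF iF that(3,1,2)] by simp
  have sm: "F *\<^sub>v (x \<cdot>\<^sub>v u) = x \<cdot>\<^sub>v (F *\<^sub>v u)" "H *\<^sub>v (x \<cdot>\<^sub>v u) = x \<cdot>\<^sub>v (H *\<^sub>v u)" if "u \<in> space S" for x u
    using mult_mat_smult_vec[OF Fc that] mult_mat_smult_vec[OF Hc that] by auto
  note cl0 = act_closed[OF wS s0(1)] and cl1 = act_closed[OF wS s1(1)]
  have ne: "H *\<^sub>v u \<noteq> 0\<^sub>v (rdim M)" if "u \<in> space S" "F *\<^sub>v u \<noteq> 0\<^sub>v 2" for u
    using inj_on_kernelD[OF Hc H(2) that(1)] that(2) mult_mat_zero_vec[OF Fc] by auto
  have u0: "unit_vec 2 0 \<noteq> (0\<^sub>v 2 :: 'k vec)" "unit_vec 2 1 \<noteq> (0\<^sub>v 2 :: 'k vec)" by auto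
  have z: "H *\<^sub>v u = 0\<^sub>v (rdim M)" if "u \<in> space S" "F *\<^sub>v u = 0\<^sub>v 2" for u
    using inj_on_kernelD[OF Fc iF that] mult_mat_zero_vec[OF Hc] by simp
  show ?thesis
  proof (rule that[of "H *\<^sub>v s0" "H *\<^sub>v s1"])
    show "H *\<^sub>v s0 \<in> space M" "H *\<^sub>v s1 \<in> space M" using hH(2) s0 s1 by blast+
    show "H *\<^sub>v s0 \<noteq> 0\<^sub>v (rdim M)" using ne[OF s0(1)] u0(1) unfolding s0(2) by blast
    show "H *\<^sub>v s1 \<noteq> 0\<^sub>v (rdim M)" using ne[OF s1(1)] u0(2) unfolding s1(2) by blast
    show "act_a M *\<^sub>v (H *\<^sub>v s0) = coeff_a \<eta> \<cdot>\<^sub>v (H *\<^sub>v s1)"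
      unfolding hH(3)[OF s0(1), symmetric] sm(2)[OF s1(1), symmetric]
      by (rule eqI) (use cl0 s1 s0 R hF(3) sm(1) in auto)
    show "act_d M *\<^sub>v (H *\<^sub>v s0) = coeff_d \<eta> \<cdot>\<^sub>v (H *\<^sub>v s1)"
      unfolding hH(6)[OF s0(1), symmetric] sm(2)[OF s1(1), symmetric]
      by (rule eqI) (use cl0 s1 s0 R hF(6) sm(1) in auto)
    show "act_b M *\<^sub>v (H *\<^sub>v s0) = (- bsign r) \<cdot>\<^sub>v (H *\<^sub>v s0)"
      unfolding hH(4)[OF s0(1), symmetric] sm(2)[OF s0(1), symmetric]
      by (rule eqI) (use cl0 s0 R hF(4) sm(1) in auto)
    show "act_b M *\<^sub>v (H *\<^sub>v s1) = bsign r \<cdot>\<^sub>v (H *\<^sub>v s1)"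
      unfolding hH(4)[OF s1(1), symmetric] sm(2)[OF s1(1), symmetric]
      by (rule eqI) (use cl1 s1 R hF(4) sm(1) in auto)
    show "act_c M *\<^sub>v (H *\<^sub>v s1) = bsign r \<cdot>\<^sub>v (H *\<^sub>v s1)"
      unfolding hH(5)[OF s1(1), symmetric] sm(2)[OF s1(1), symmetric]
      by (rule eqI) (use cl1 s1 R hF(5) sm(1) in auto)
    show "act_a M *\<^sub>v (H *\<^sub>v s1) = 0\<^sub>v (rdim M)"
      unfolding hH(3)[OF s1(1), symmetric] by (rule z) (use cl1 s1 R hF(3) in auto)
    show "act_d M *\<^sub>v (H *\<^sub>v s1) = 0\<^sub>v (rdim M)"
      unfolding hH(6)[OF s1(1), symmetric] by (rule z) (use cl1 s1 R hF(6) in auto)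
  qed
qed

text \<open>The copy of M_1(r, \<eta>) has three uses: w is fixed by bc, which puts M into the
  block; the sign of w fixes the sign of the socle; and v is a top vector at which the pencil
  degenerates for the parameter \<eta>.\<close>

lemma rep_M_jordan_basis:
  fixes M :: "'k :: field d4_rep"
  assumes two: "(2 :: 'k) \<noteq> 0" and r: "is_rep_M t r \<eta> M"
  shows "\<exists>x y. jordan_basis M t (bsign r) \<eta> x y"
proof -
  have ty: "has_type t t M" using r by (simp add: is_rep_M_def)
  have ind: "indecomposable M" and lo: "has_loewy_length 2 M" using ty by (auto simp: has_type_def)
  have dM: "d4_module M" using ind by (simp add: indecomposable_def)
  obtain U S where S: "is_sub_rep M U S" "S \<cong>\<^sub>D rep_M1 r \<eta>" using r by (auto simp: is_rep_M_def)
  obtain v w where v: "v \<in> space M" "w \<in> space M" "v \<noteq> 0\<^sub>v (rdim M)" "w \<noteq> 0\<^sub>v (rdim M)"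
    "act_a M *\<^sub>v v = coeff_a \<eta> \<cdot>\<^sub>v w" "act_d M *\<^sub>v v = coeff_d \<eta> \<cdot>\<^sub>v w"
    "act_a M *\<^sub>v w = 0\<^sub>v (rdim M)" "act_d M *\<^sub>v w = 0\<^sub>v (rdim M)"
    "act_b M *\<^sub>v v = (- bsign r) \<cdot>\<^sub>v v" "act_b M *\<^sub>v w = bsign r \<cdot>\<^sub>v w" "act_c M *\<^sub>v w = bsign r \<cdot>\<^sub>v w"
    by (rule rep_M_generator[OF dM S])
  note car = well_formedD[OF d4_moduleD(1)[OF dM]]
  have bcw: "act_b M *\<^sub>v (act_c M *\<^sub>v w) = w"
    using v(2,10,11) by (simp add: mult_mat_smult_vec[OF car(2)] smult_smult_assoc bsign_square)
  have M: "bc_trivial M" by (rule indecomposable_bc_trivial[OF two ind v(2,4) bcw])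
  have rad: "act_a M *\<^sub>v u \<in> killed M \<and> act_d M *\<^sub>v u \<in> killed M" if "u \<in> space M" for u
    using loewy_length_two_radical[OF two M lo that] by blast
  have wk: "w \<in> killed M" using v(2,7,8) by (simp add: killed_def)
  have K: "killed M = {v \<in> space M. act_b M *\<^sub>v v = bsign r \<cdot>\<^sub>v v}"
    by (rule soc_parity[OF two M ind rad wk v(4,10) bsign_square])
  obtain Y where Y: "Y \<in> carrier_mat (rdim M) t" "inj_on ((*\<^sub>v) Y) (carrier_vec t)" "(*\<^sub>v) Y ` carrier_vec t = killed M"
    using type_dimensions(2)[OF two M ty] by blast
  note sK = subsp_killed[OF bc_trivial_well_formed[OF M]]
  show ?thesis
  proof (cases \<eta>)
    case (Fin e)
    \<comment> \<open>On v one has a v = w and d v = - e w, so d + e a kills v.\<close>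
    define be where "be = act_d M + e \<cdot>\<^sub>m act_a M"
    have be: "be \<in> carrier_mat (rdim M) (rdim M)" using car by (simp add: be_def)
    have bev: "be *\<^sub>v u = act_d M *\<^sub>v u + e \<cdot>\<^sub>v (act_a M *\<^sub>v u)" if "u \<in> space M" for u
      using car that by (simp add: be_def add_mult_distrib_mat_vec[of _ "rdim M" "rdim M"] smult_mat_mult_vec[of _ "rdim M" "rdim M"])
    show ?thesis
    proof (rule pencil_jordan_basis[OF two M ind bsign_square K Y type_dimensions(1)[OF two M ty] car(1) be])
      fix u assume u: "u \<in> space M"
      show "act_a M *\<^sub>v u \<in> killed M \<and> be *\<^sub>v u \<in> killed M"
        unfolding bev[OF u] using rad[OF u] subspD(3,4)[OF sK] by blast
      have "act_a M *\<^sub>v u \<in> space M" "act_d M *\<^sub>v u \<in> space M" using car(1,4) u by auto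
      then show "act_a M *\<^sub>v u = coeff_a \<eta> \<cdot>\<^sub>v (act_a M *\<^sub>v u) + coeff_a' \<eta> \<cdot>\<^sub>v (be *\<^sub>v u) \<and>
          act_d M *\<^sub>v u = coeff_d \<eta> \<cdot>\<^sub>v (act_a M *\<^sub>v u) + coeff_d' \<eta> \<cdot>\<^sub>v (be *\<^sub>v u)"
        using carrier_matD[OF car(1)] carrier_matD[OF car(4)]
        unfolding bev[OF u] Fin by (intro conjI eq_vecI) (simp_all del: index_mult_mat_vec)
    next
      fix u assume u: "u \<in> killed M"
      then have "act_a M *\<^sub>v u = 0\<^sub>v (rdim M)" "act_d M *\<^sub>v u = 0\<^sub>v (rdim M)" and us: "u \<in> space M" by (auto simp: killed_def)
      then show "act_a M *\<^sub>v u = 0\<^sub>v (rdim M) \<and> be *\<^sub>v u = 0\<^sub>v (rdim M)"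
        unfolding bev[OF us] by (simp add: smult_zero_vec)
    next
      show "be *\<^sub>v v = 0\<^sub>v (rdim M)"
        unfolding bev[OF v(1)] v(5,6) Fin using v(2) by (intro eq_vecI) auto
    qed (use v in auto)
  next
    case Infty
    show ?thesis
    proof (rule pencil_jordan_basis[OF two M ind bsign_square K Y type_dimensions(1)[OF two M ty] car(4,1)])
      fix u assume u: "u \<in> space M"
      have "act_a M *\<^sub>v u \<in> space M" "act_d M *\<^sub>v u \<in> space M" using car(1,4) u by auto
      then show "act_a M *\<^sub>v u = coeff_a \<eta> \<cdot>\<^sub>v (act_d M *\<^sub>v u) + coeff_a' \<eta> \<cdot>\<^sub>v (act_a M *\<^sub>v u) \<and>
          act_d M *\<^sub>v u = coeff_d \<eta> \<cdot>\<^sub>v (act_d M *\<^sub>v u) + coeff_d' \<eta> \<cdot>\<^sub>v (act_a M *\<^sub>v u)"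
        using carrier_matD[OF car(1)] carrier_matD[OF car(4)]
        unfolding Infty by (intro conjI eq_vecI) (simp_all del: index_mult_mat_vec)
    next
      show "act_a M *\<^sub>v v = 0\<^sub>v (rdim M)"
        unfolding v(5) Infty using v(2) by (intro eq_vecI) auto
    qed (use v rad in \<open>auto simp: killed_def\<close>)
  qed
qed

section \<open>The modules \<open>\<Omega>\<^sup>-\<^sup>sV(r)\<close>\<close>

text \<open>The module with basis v, a v, d v, a d v over the exterior algebra on a and d, where b
  acts on v by (-1)^r; the entry -1 is d a v = - a d v. Its socle and its top are both V(r), and it
  serves as the test object for injectivity and for projectivity.\<close>

definition rep_P :: "bit \<Rightarrow> ('k :: field) d4_rep" where
  "rep_P r =
     (let g = mat 4 4 (\<lambda>(i, j). if i = j then (if i = 0 \<or> i = 3 then bsign r else - bsign r) else 0)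
      in \<lparr> rdim = 4,
           act_a = mat 4 4 (\<lambda>(i, j). if i = 1 \<and> j = 0 \<or> i = 3 \<and> j = 2 then 1 else 0),
           act_b = g,
           act_c = g,
           act_d = mat 4 4 (\<lambda>(i, j). if i = 2 \<and> j = 0 then 1 else if i = 3 \<and> j = 1 then - 1 else 0) \<rparr>)"

lemma rep_P_basis:
  fixes r :: bit
  defines "P \<equiv> (rep_P r :: 'k :: field d4_rep)"
  shows "well_formed P" "rdim P = 4"
    "act_a P *\<^sub>v unit_vec 4 0 = unit_vec 4 (Suc 0)" "act_a P *\<^sub>v unit_vec 4 (Suc 0) = 0\<^sub>v 4"
    "act_a P *\<^sub>v unit_vec 4 2 = unit_vec 4 3" "act_a P *\<^sub>v unit_vec 4 3 = 0\<^sub>v 4"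
    "act_d P *\<^sub>v unit_vec 4 0 = unit_vec 4 2" "act_d P *\<^sub>v unit_vec 4 (Suc 0) = (- 1) \<cdot>\<^sub>v unit_vec 4 3"
    "act_d P *\<^sub>v unit_vec 4 2 = 0\<^sub>v 4" "act_d P *\<^sub>v unit_vec 4 3 = 0\<^sub>v 4"
    "act_b P *\<^sub>v unit_vec 4 0 = bsign r \<cdot>\<^sub>v unit_vec 4 0" "act_b P *\<^sub>v unit_vec 4 (Suc 0) = (- bsign r) \<cdot>\<^sub>v unit_vec 4 (Suc 0)"
    "act_b P *\<^sub>v unit_vec 4 2 = (- bsign r) \<cdot>\<^sub>v unit_vec 4 2" "act_b P *\<^sub>v unit_vec 4 3 = bsign r \<cdot>\<^sub>v unit_vec 4 3"
    "act_c P = act_b P"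
  unfolding P_def rep_P_def Let_def
  by (auto simp: well_formed_def intro!: eq_vecI)

lemma lessThan_four: "{..<4 :: nat} = {0, 1, 2, 3}"
  by auto

lemma rep_P_module: "bc_trivial (rep_P r :: 'k :: field d4_rep)"
proof -
  let ?P = "rep_P r :: 'k d4_rep"
  note B = rep_P_basis[of r, where ?'k = 'k]
  note car = well_formedD[OF B(1), unfolded B(2)]
  have sq: "bsign r * bsign r = (1 :: 'k)" by (simp add: bsign_def)
  have z: "x *\<^sub>v 0\<^sub>v 4 = 0\<^sub>v 4" if "x \<in> carrier_mat 4 4" for x :: "'k mat" using mult_mat_zero_vec[OF that] .
  have zs: "c \<cdot>\<^sub>v 0\<^sub>v 4 = (0\<^sub>v 4 :: 'k vec)" for c by (intro eq_vecI) auto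
  have add0: "(- 1) \<cdot>\<^sub>v unit_vec 4 i + unit_vec 4 i = (0\<^sub>v 4 :: 'k vec)" for i by (intro eq_vecI) auto
  have sub0: "unit_vec 4 i - unit_vec 4 i = (0\<^sub>v 4 :: 'k vec)" for i by (intro eq_vecI) auto
  have "d4_module ?P"
  proof (rule d4_module_spansI[OF B(1)])
    show "spans (rdim ?P) (unit_vec 4 ` {..<4})" unfolding B(2) by (rule spans_unit_vecs)
    fix v :: "'k vec" assume "v \<in> unit_vec 4 ` {..<4}"
    then consider "v = unit_vec 4 0" | "v = unit_vec 4 (Suc 0)" | "v = unit_vec 4 2" | "v = unit_vec 4 3"
      unfolding lessThan_four by auto
    then show "d4_laws ?P v"
      by cases (simp_all add: d4_laws_def B(2-15) mult_mat_smult_vec[OF car(1)] mult_mat_smult_vec[OF car(2)]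
          mult_mat_smult_vec[OF car(4)] smult_smult_assoc sq z[OF car(1)] z[OF car(2)] z[OF car(4)] zs add0 sub0)
  qed
  then show ?thesis using B(15) by (simp add: bc_trivial_def)
qed

lemma rep_V_act:
  fixes r :: bit
  defines "V \<equiv> (rep_V r :: 'k :: field d4_rep)"
  shows "well_formed V" "rdim V = 1"
    "v \<in> carrier_vec 1 \<Longrightarrow> act_a V *\<^sub>v v = 0\<^sub>v 1" "v \<in> carrier_vec 1 \<Longrightarrow> act_d V *\<^sub>v v = 0\<^sub>v 1"
    "v \<in> carrier_vec 1 \<Longrightarrow> act_b V *\<^sub>v v = bsign r \<cdot>\<^sub>v v" "v \<in> carrier_vec 1 \<Longrightarrow> act_c V *\<^sub>v v = bsign r \<cdot>\<^sub>v v"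
proof -
  show "well_formed V" "rdim V = 1" by (auto simp: well_formed_def V_def rep_V_def)
  assume v: "v \<in> carrier_vec 1"
  show "act_a V *\<^sub>v v = 0\<^sub>v 1" "act_d V *\<^sub>v v = 0\<^sub>v 1"
    using zero_mat_mult_vec[OF v, of 1] by (simp_all add: V_def rep_V_def)
  show "act_b V *\<^sub>v v = bsign r \<cdot>\<^sub>v v" "act_c V *\<^sub>v v = bsign r \<cdot>\<^sub>v v"
    using v smult_mat_mult_vec[OF one_carrier_mat v] by (simp_all add: V_def rep_V_def)
qed

lemma rep_V_module: "bc_trivial (rep_V r :: 'k :: field d4_rep)"
proof -
  let ?V = "rep_V r :: 'k d4_rep"
  note act = rep_V_act[where r = r and ?'k = 'k]
  have sq: "bsign r * bsign r = (1 :: 'k)" by (simp add: bsign_def)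
  have zs: "c \<cdot>\<^sub>v 0\<^sub>v 1 = (0\<^sub>v 1 :: 'k vec)" for c by (intro eq_vecI) auto
  have "d4_laws ?V v" if "v \<in> space ?V" for v :: "'k vec"
    using that unfolding d4_laws_def act(2)
    by (simp add: act(3-)[simplified] zs[simplified] smult_smult_assoc sq)
  then have "d4_module ?V" using d4_module_spansI[OF act(1) spans_carrier] by blast
  then show ?thesis using act by (simp add: bc_trivial_def)
qed

section \<open>Linear combinations and independence\<close>

lemma lc_in_subsp:
  assumes "subsp n U" "\<And>i. i < k \<Longrightarrow> V i \<in> U"
  shows "lc n f V k \<in> U"
  using assms(2)
proof (induction k)
  case 0
  have "lc n f V 0 = 0\<^sub>v n" by (intro eq_vecI) (auto simp: lc_def)
  then show ?case using subspD(2)[OF assms(1)] by simp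
next
  case (Suc k)
  have "V k \<in> carrier_vec n" using Suc.prems subspD(5)[OF assms(1)] by blast
  then have "lc n f V (Suc k) = lc n f V k + f k \<cdot>\<^sub>v V k" by (intro eq_vecI) (auto simp: lc_def)
  then show ?case using Suc subspD(3,4)[OF assms(1)] by simp
qed

lemma lc_Suc: "V k \<in> carrier_vec n \<Longrightarrow> lc n f V (Suc k) = lc n f V k + f k \<cdot>\<^sub>v V k"
  by (intro eq_vecI) (auto simp: lc_def)

lemma lc_zero:
  assumes "\<And>i. i < k \<Longrightarrow> f i = 0 \<or> V i = 0\<^sub>v n"
  shows "lc n f V k = 0\<^sub>v n"
proof (rule eq_vecI)
  fix j assume j: "j < dim_vec (0\<^sub>v n :: 'a vec)"
  then have "f i * V i $ j = 0" if "i < k" for i using assms[OF that] by auto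
  then have "(\<Sum>i<k. f i * V i $ j) = 0" by (intro sum.neutral) auto
  then show "lc n f V k $ j = 0\<^sub>v n $ j" using j by (simp add: lc_def)
qed (simp add: lc_def)

lemma lc_append:
  "lc n f V k + lc n g W l = lc n (\<lambda>i. if i < k then f i else g (i - k)) (\<lambda>i. if i < k then V i else W (i - k)) (k + l)"
proof (induction l)
  case 0
  show ?case by (intro eq_vecI) (auto simp: lc_def)
next
  case (Suc l)
  show ?case
  proof (rule eq_vecI)
    fix j assume "j < dim_vec (lc n (\<lambda>i. if i < k then f i else g (i - k)) (\<lambda>i. if i < k then V i else W (i - k)) (k + Suc l))"
    then have j: "j < n" by (simp add: lc_def)
    have "(lc n f V k + lc n g W l) $ j = lc n (\<lambda>i. if i < k then f i else g (i - k)) (\<lambda>i. if i < k then V i else W (i - k)) (k + l) $ j"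
      using Suc by simp
    then show "(lc n f V k + lc n g W (Suc l)) $ j = lc n (\<lambda>i. if i < k then f i else g (i - k)) (\<lambda>i. if i < k then V i else W (i - k)) (k + Suc l) $ j"
      using j by (simp add: lc_def add.assoc[symmetric])
  qed (simp add: lc_def)
qed

lemma spans_lc:
  assumes "spans n (V ` {..<k})" "v \<in> carrier_vec n"
  obtains c where "v = lc n c V k"
proof -
  have V: "V i \<in> carrier_vec n" if "i < k" for i using assms(1) that by (auto simp: spans_def)
  have "v \<in> (*\<^sub>v) (cols_mat n k V) ` carrier_vec k"
  proof (rule spansD[OF assms(1) subsp_image[OF cols_mat_carrier subsp_carrier] _ assms(2)], rule subsetI)
    fix x assume "x \<in> V ` {..<k}"
    then obtain i where "i < k" "x = V i" by auto
    then show "x \<in> (*\<^sub>v) (cols_mat n k V) ` carrier_vec k"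
      using cols_mat_unit[of i k V n] V by (intro image_eqI[of _ _ "unit_vec k i"]) auto
  qed
  then show ?thesis using that cols_mat_mult[of _ k n V] by auto
qed

text \<open>The n spanning vectors are the columns of a surjective square matrix, which is
  invertible.\<close>

lemma spans_square_independent:
  assumes "spans n (V ` {..<n})" "lc n f V n = 0\<^sub>v n" "i < n"
  shows "f i = 0"
proof -
  have "carrier_vec n \<subseteq> (*\<^sub>v) (cols_mat n n V) ` carrier_vec n"
  proof
    fix v :: "'a vec" assume "v \<in> carrier_vec n"
    then obtain c where "v = lc n c V n" by (rule spans_lc[OF assms(1)])
    moreover have "lc n c V n = cols_mat n n V *\<^sub>v vec n c"
      by (subst cols_mat_mult) (auto intro!: lc_cong)
    ultimately show "v \<in> (*\<^sub>v) (cols_mat n n V) ` carrier_vec n" by auto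
  qed
  then obtain G where G: "G \<in> carrier_mat n n" "G * cols_mat n n V = 1\<^sub>m n"
    by (rule surj_square_invertible[OF cols_mat_carrier])
  have "cols_mat n n V *\<^sub>v vec n f = 0\<^sub>v n"
    using assms(2) lc_cong[of n "\<lambda>i. vec n f $ i" f V V n] by (subst cols_mat_mult) auto
  then have "vec n f = 0\<^sub>v n"
    using inj_on_kernelD[OF cols_mat_carrier left_inverse_inj[OF cols_mat_carrier G], of "vec n f"] by simp
  then have "vec n f $ i = 0" using assms(3) by simp
  then show ?thesis using assms(3) by simp
qed

lemma spans_independent_dim:
  assumes sp: "spans n (V ` {..<k})" and ind: "\<And>f i. lc n f V k = 0\<^sub>v n \<Longrightarrow> i < k \<Longrightarrow> f i = 0"
  shows "n = k"
proof (rule inj_surj_dim_eq[OF cols_mat_carrier[of n k V]])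
  show "inj_on ((*\<^sub>v) (cols_mat n k V)) (carrier_vec k)"
  proof (rule inj_onI_kernel[OF cols_mat_carrier])
    fix v :: "'a vec" assume v: "v \<in> carrier_vec k" "cols_mat n k V *\<^sub>v v = 0\<^sub>v n"
    then have "lc n (\<lambda>i. v $ i) V k = 0\<^sub>v n" using cols_mat_mult[OF v(1)] by simp
    then show "v = 0\<^sub>v k" using ind[of "\<lambda>i. v $ i"] v(1) by (intro eq_vecI) auto
  qed
  show "carrier_vec n \<subseteq> (*\<^sub>v) (cols_mat n k V) ` carrier_vec k"
  proof
    fix v :: "'a vec" assume "v \<in> carrier_vec n"
    then obtain c where "v = lc n c V k" by (rule spans_lc[OF sp])
    moreover have "lc n c V k = cols_mat n k V *\<^sub>v vec k c"
      by (subst cols_mat_mult) (auto intro!: lc_cong)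
    ultimately show "v \<in> (*\<^sub>v) (cols_mat n k V) ` carrier_vec k" by auto
  qed
qed

text \<open>The parameter e is the sign of b on the lower row w, which has one vector more than the
  upper row u. For s = 0 only w_0 is left, the simple module.\<close>

definition omega_chain :: "('k :: field) d4_rep \<Rightarrow> nat \<Rightarrow> 'k \<Rightarrow> (nat \<Rightarrow> 'k vec) \<Rightarrow> (nat \<Rightarrow> 'k vec) \<Rightarrow> bool" where
  "omega_chain W s e u w \<longleftrightarrow> bc_trivial W \<and> rdim W = s + Suc s \<and>
     (\<forall>i<s. u i \<in> space W \<and> act_b W *\<^sub>v u i = (- e) \<cdot>\<^sub>v u i \<and> act_a W *\<^sub>v u i = w i \<and> act_d W *\<^sub>v u i = w (Suc i)) \<and>
     (\<forall>i\<le>s. w i \<in> space W \<and> act_b W *\<^sub>v w i = e \<cdot>\<^sub>v w i \<and>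
        act_a W *\<^sub>v w i = 0\<^sub>v (rdim W) \<and> act_d W *\<^sub>v w i = 0\<^sub>v (rdim W)) \<and>
     spans (rdim W) (u ` {..<s} \<union> w ` {..<Suc s})"

lemma append_image:
  "(\<lambda>i. if i < k then V i else W (i - k)) ` {..<k + l} = V ` {..<k} \<union> W ` {..<l :: nat}"
proof (intro equalityI subsetI)
  fix x assume "x \<in> (\<lambda>i. if i < k then V i else W (i - k)) ` {..<k + l}"
  then obtain i where "x = (if i < k then V i else W (i - k))" "i \<in> {..<k + l}" by (rule imageE)
  then show "x \<in> V ` {..<k} \<union> W ` {..<l}" by (cases "i < k") auto
next
  fix x assume "x \<in> V ` {..<k} \<union> W ` {..<l}"
  then show "x \<in> (\<lambda>i. if i < k then V i else W (i - k)) ` {..<k + l}"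
  proof
    assume "x \<in> V ` {..<k}"
    then obtain i where "x = V i" "i \<in> {..<k}" by (rule imageE)
    then show ?thesis by (intro image_eqI[of _ _ i]) auto
  next
    assume "x \<in> W ` {..<l}"
    then obtain i where "x = W i" "i \<in> {..<l}" by (rule imageE)
    then show ?thesis by (intro image_eqI[of _ _ "i + k"]) auto
  qed
qed

lemma omega_chain_lc:
  assumes W: "omega_chain W s e u w" and v: "v \<in> space W"
  obtains f g where "v = lc (rdim W) f u s + lc (rdim W) g w (Suc s)"
proof -
  have "spans (rdim W) ((\<lambda>i. if i < s then u i else w (i - s)) ` {..<s + Suc s})"
    using W unfolding append_image omega_chain_def by blast
  then obtain c where c: "v = lc (rdim W) c (\<lambda>i. if i < s then u i else w (i - s)) (s + Suc s)"
    by (rule spans_lc[OF _ v])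
  have "lc (rdim W) c u s + lc (rdim W) (\<lambda>i. c (i + s)) w (Suc s) = v"
    unfolding lc_append c by (intro lc_cong) auto
  then show ?thesis using that by metis
qed

lemma omega_chain_independent:
  assumes W: "omega_chain W s e u w" and z: "lc (rdim W) f u s + lc (rdim W) g w (Suc s) = 0\<^sub>v (rdim W)"
  shows "i < s \<Longrightarrow> f i = 0" "i \<le> s \<Longrightarrow> g i = 0"
proof -
  have n: "rdim W = s + Suc s" using W by (simp add: omega_chain_def)
  have "spans (rdim W) ((\<lambda>i. if i < s then u i else w (i - s)) ` {..<s + Suc s})"
    using W unfolding append_image omega_chain_def by blast
  then have sp: "spans (rdim W) ((\<lambda>i. if i < s then u i else w (i - s)) ` {..<rdim W})" using n by simp
  have *: "(if j < s then f j else g (j - s)) = 0" if "j < s + Suc s" for j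
    using spans_square_independent[OF sp, of "\<lambda>i. if i < s then f i else g (i - s)" j] z that
    unfolding lc_append n by simp
  show "i < s \<Longrightarrow> f i = 0" "i \<le> s \<Longrightarrow> g i = 0" using *[of i] *[of "i + s"] by auto
qed

lemma minus_vec_eq_zero:
  fixes u v :: "'k :: field vec"
  assumes "u \<in> carrier_vec n" "v \<in> carrier_vec n" "u - v = 0\<^sub>v n"
  shows "u = v"
proof (rule eq_vecI)
  fix j assume j: "j < dim_vec v"
  have "(u - v) $ j = 0" unfolding assms(3) using assms(2) j by simp
  then show "u $ j = v $ j" using assms(1,2) j by simp
qed (use assms in auto)

text \<open>The (-1)-eigenspace of bc is a submodule of I because bc is central. As bc acts as 1 on
  X and 2 is nonzero, it meets X trivially, so essentiality makes it zero; but it contains every v -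
  b c v.\<close>

lemma essential_bc_trivial:
  fixes X I :: "'k :: field d4_rep"
  assumes two: "(2 :: 'k) \<noteq> 0" and X: "bc_trivial X" and I: "d4_module I" and i: "is_mono X I i"
    and ess: "\<And>U. is_submodule I U \<Longrightarrow> U \<inter> (*\<^sub>v) i ` space X = zero_sub I \<Longrightarrow> U = zero_sub I"
  shows "bc_trivial I"
proof -
  define n b c where "n = rdim I" and "b = act_b I" and "c = act_c I"
  note wI = d4_moduleD(1)[OF I] and wX = bc_trivial_well_formed[OF X]
  note car = well_formedD[OF wI, folded n_def b_def c_def]
  have hi: "is_hom X I i" using i by (simp add: is_mono_def)
  note h = is_homD[OF hi wX wI]
  define m where "m = (- 1) \<cdot>\<^sub>m (1\<^sub>m n :: 'k mat)"
  have mc: "m \<in> carrier_mat n n" by (simp add: m_def)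
  have mv: "m *\<^sub>v v = (- 1) \<cdot>\<^sub>v v" if "v \<in> carrier_vec n" for v
    unfolding m_def using smult_mat_mult_vec[OF one_carrier_mat that] that by simp
  have bc: "b * c \<in> carrier_mat n n" using car by simp
  have bcv: "b * c *\<^sub>v v = b *\<^sub>v (c *\<^sub>v v)" if "v \<in> carrier_vec n" for v
    using assoc_mult_mat_vec[OF car(2,3) that] .
  define U where "U = {v \<in> carrier_vec n. b * c *\<^sub>v v = m *\<^sub>v v}"
  have sU: "subsp n U" unfolding U_def by (rule subsp_eq_image[OF bc mc])
  have UI: "v \<in> U" if "v \<in> carrier_vec n" "b *\<^sub>v (c *\<^sub>v v) = (- 1) \<cdot>\<^sub>v v" for v
    using that bcv mv by (simp add: U_def)
  have UD: "v \<in> carrier_vec n" "b *\<^sub>v (c *\<^sub>v v) = (- 1) \<cdot>\<^sub>v v" if "v \<in> U" for v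
    using that bcv[of v] mv[of v] by (auto simp: U_def)
  have "is_submodule I U"
    unfolding is_submodule_iff
  proof (intro conjI ballI)
    show "subsp (rdim I) U" using sU n_def by simp
    fix v assume v: "v \<in> U"
    have vs: "v \<in> space I" using UD(1)[OF v] by (simp add: n_def)
    note C = bc_central[OF I vs, folded b_def c_def] and cl = act_closed[OF wI vs, folded n_def b_def c_def]
    show "act_a I *\<^sub>v v \<in> U" by (rule UI[OF cl(1)]) (simp only: C UD(2)[OF v] mult_mat_smult_vec[OF car(1) UD(1)[OF v]])
    show "act_b I *\<^sub>v v \<in> U" unfolding b_def[symmetric]
      by (rule UI[OF cl(2)]) (simp only: C UD(2)[OF v] mult_mat_smult_vec[OF car(2) UD(1)[OF v]])
    show "act_c I *\<^sub>v v \<in> U" unfolding c_def[symmetric]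
      by (rule UI[OF cl(3)]) (simp only: C UD(2)[OF v] mult_mat_smult_vec[OF car(3) UD(1)[OF v]])
    show "act_d I *\<^sub>v v \<in> U" by (rule UI[OF cl(4)]) (simp only: C UD(2)[OF v] mult_mat_smult_vec[OF car(4) UD(1)[OF v]])
  qed
  moreover have "U \<inter> (*\<^sub>v) i ` space X = {0\<^sub>v n}"
  proof (intro equalityI subsetI)
    fix v :: "'k vec" assume "v \<in> U \<inter> (*\<^sub>v) i ` space X"
    then obtain x where x: "x \<in> space X" "v = i *\<^sub>v x" and vU: "v \<in> U" by blast
    have "act_b X *\<^sub>v (act_c X *\<^sub>v x) = x" using bc_trivialD(1,2)[OF X x(1)] by simp
    moreover have "i *\<^sub>v (act_b X *\<^sub>v (act_c X *\<^sub>v x)) = b *\<^sub>v (c *\<^sub>v v)"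
      using h(4)[OF act_closed(3)[OF wX x(1)]] h(5)[OF x(1)] x(2) by (simp add: b_def c_def)
    ultimately have eq: "v = (- 1) \<cdot>\<^sub>v v" using UD(2)[OF vU] x(2) by simp
    have "v = 0\<^sub>v n"
    proof (rule eq_vecI)
      fix j assume j: "j < dim_vec (0\<^sub>v n :: 'k vec)"
      then have "v $ j = - (v $ j)" using arg_cong[OF eq, of "\<lambda>v. v $ j"] UD(1)[OF vU] by simp
      then have "2 * v $ j = 0" by (metis add.right_inverse mult_2)
      then show "v $ j = 0\<^sub>v n $ j" using two j by simp
    qed (use UD(1)[OF vU] in auto)
    then show "v \<in> {0\<^sub>v n}" by simp
  next
    fix v :: "'k vec" assume "v \<in> {0\<^sub>v n}"
    then have "v = i *\<^sub>v 0\<^sub>v (rdim X)" using mult_mat_zero_vec[OF h(1)[of "0\<^sub>v (rdim X)"]] by (simp add: n_def)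
    then have "v \<in> (*\<^sub>v) i ` space X" by (rule image_eqI) simp
    then show "v \<in> U \<inter> (*\<^sub>v) i ` space X" using \<open>v \<in> {0\<^sub>v n}\<close> subspD(2)[OF sU] by auto
  qed
  ultimately have U0: "U = {0\<^sub>v n}" using ess[of U] by (simp add: n_def)
  have "c *\<^sub>v v = b *\<^sub>v v" if v: "v \<in> carrier_vec n" for v
  proof -
    have vs: "v \<in> space I" using v by (simp add: n_def)
    note L = d4_moduleD(2)[OF I vs, unfolded d4_laws_def, folded b_def c_def]
    have cv: "c *\<^sub>v v \<in> carrier_vec n" "b *\<^sub>v (c *\<^sub>v v) \<in> carrier_vec n" using car v by auto
    have "b *\<^sub>v (c *\<^sub>v (b *\<^sub>v (c *\<^sub>v v))) = v"
    proof -
      have cs: "c *\<^sub>v v \<in> space I" using cv by (simp add: n_def)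
      note L2 = d4_moduleD(2)[OF I cs, unfolded d4_laws_def, folded b_def c_def]
      have "c *\<^sub>v (b *\<^sub>v (c *\<^sub>v v)) = b *\<^sub>v v" using L L2 by simp
      then show ?thesis using L by simp
    qed
    then have "v - b *\<^sub>v (c *\<^sub>v v) \<in> U"
      using v cv car by (intro UI)
        (auto simp: mult_mat_minus_vec[OF car(2)] mult_mat_minus_vec[OF car(3)] intro!: eq_vecI)
    then have z: "v - b *\<^sub>v (c *\<^sub>v v) = 0\<^sub>v n" using U0 by simp
    have "b *\<^sub>v (c *\<^sub>v v) = v" using minus_vec_eq_zero[OF v cv(2) z] by simp
    then have "b *\<^sub>v (b *\<^sub>v (c *\<^sub>v v)) = b *\<^sub>v v" by simp
    moreover have "c *\<^sub>v v \<in> space I" using cv by (simp add: n_def)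
    note d4_moduleD(2)[OF I this, unfolded d4_laws_def, folded b_def c_def]
    ultimately show ?thesis by simp
  qed
  then show ?thesis using I by (simp add: bc_trivial_def b_def c_def n_def)
qed

lemma omega_chainD:
  assumes "omega_chain W s e u w"
  shows "bc_trivial W" "rdim W = s + Suc s"
    "\<And>i. i < s \<Longrightarrow> u i \<in> space W" "\<And>i. i < s \<Longrightarrow> act_b W *\<^sub>v u i = (- e) \<cdot>\<^sub>v u i"
    "\<And>i. i < s \<Longrightarrow> act_a W *\<^sub>v u i = w i" "\<And>i. i < s \<Longrightarrow> act_d W *\<^sub>v u i = w (Suc i)"
    "\<And>i. i \<le> s \<Longrightarrow> w i \<in> space W" "\<And>i. i \<le> s \<Longrightarrow> act_b W *\<^sub>v w i = e \<cdot>\<^sub>v w i"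
    "\<And>i. i \<le> s \<Longrightarrow> act_a W *\<^sub>v w i = 0\<^sub>v (rdim W)" "\<And>i. i \<le> s \<Longrightarrow> act_d W *\<^sub>v w i = 0\<^sub>v (rdim W)"
    "spans (rdim W) (u ` {..<s} \<union> w ` {..<Suc s})"
  using assms unfolding omega_chain_def by blast+

text \<open>Applying a turns the u-part of a combination into the same combination of w_0, ...,
  w_(s-1). These are independent, so the u-part vanishes.\<close>

lemma killed_omega_chain:
  assumes W: "omega_chain W s e u w" and x: "x \<in> killed W"
  obtains g where "x = lc (rdim W) g w (Suc s)"
proof -
  define n where "n = rdim W"
  have tW: "bc_trivial W" using W by (simp add: omega_chain_def)
  note car = well_formedD[OF bc_trivial_well_formed[OF tW], folded n_def]
  have xs: "x \<in> space W" using x by (simp add: killed_def)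
  obtain f g where fg: "x = lc n f u s + lc n g w (Suc s)" unfolding n_def by (rule omega_chain_lc[OF W xs])
  note D = omega_chainD[OF W, folded n_def]
  have uc: "u i \<in> carrier_vec n" if "i < s" for i using D(3) that .
  have wc: "w i \<in> carrier_vec n" if "i < Suc s" for i using D(7) that by simp
  have "act_a W *\<^sub>v x = act_a W *\<^sub>v lc n f u s + act_a W *\<^sub>v lc n g w (Suc s)"
    unfolding fg by (rule mult_add_distrib_mat_vec[OF car(1)]) auto
  also have "act_a W *\<^sub>v lc n f u s = lc n f (\<lambda>i. act_a W *\<^sub>v u i) s" by (rule mult_lc[OF car(1) uc])
  also have "\<dots> = lc n f w s" using D(5) by (intro lc_cong) auto
  also have "act_a W *\<^sub>v lc n g w (Suc s) = lc n g (\<lambda>i. act_a W *\<^sub>v w i) (Suc s)" by (rule mult_lc[OF car(1) wc])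
  also have "\<dots> = 0\<^sub>v n" using D(9) by (intro lc_zero) auto
  finally have fw: "lc n f w s = 0\<^sub>v n" using x by (simp add: killed_def n_def)
  \<comment> \<open>The coefficients are padded by 0 at w_s to match the length s + 1 of the lower
    row.\<close>
  have "lc n (\<lambda>_. 0) u s + lc n (\<lambda>i. if i < s then f i else 0) w (Suc s) = 0\<^sub>v n"
  proof -
    have "lc n (\<lambda>_. 0) u s = 0\<^sub>v n" by (rule lc_zero) simp
    moreover have "lc n (\<lambda>i. if i < s then f i else 0) w s = lc n f w s" by (rule lc_cong) auto
    moreover have "0 \<cdot>\<^sub>v w s = 0\<^sub>v n" using wc[of s] by (intro eq_vecI) auto
    ultimately show ?thesis using fw wc[of s] by (simp add: lc_Suc)
  qed
  from omega_chain_independent(2)[OF W this[unfolded n_def]]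
  have "f i = 0" if "i < s" for i using that by (metis less_imp_le)
  then have "lc n f u s = 0\<^sub>v n" by (intro lc_zero) simp
  then have "x = lc n g w (Suc s)" using fg by simp
  then show ?thesis using that n_def by blast
qed

text \<open>An essential extension has no new socle: the line through a b-eigenvector of the socle
  of I is a submodule, hence meets the image of X.\<close>

lemma killed_essential:
  fixes X I :: "'k :: field d4_rep"
  assumes two: "(2 :: 'k) \<noteq> 0" and X: "bc_trivial X" and I: "bc_trivial I" and i: "is_mono X I i"
    and ess: "\<And>U. is_submodule I U \<Longrightarrow> U \<inter> (*\<^sub>v) i ` space X = zero_sub I \<Longrightarrow> U = zero_sub I"
    and v: "v \<in> killed I"
  shows "v \<in> (*\<^sub>v) i ` killed X"
proof -
  define n where "n = rdim I"
  note wI = bc_trivial_well_formed[OF I] and wX = bc_trivial_well_formed[OF X]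
  note car = well_formedD[OF wI, folded n_def]
  have hi: "is_hom X I i" and ii: "inj_on ((*\<^sub>v) i) (space X)" using i by (auto simp: is_mono_def)
  note h = is_homD[OF hi wX wI]
  have ic: "i \<in> carrier_mat n (rdim X)" using hi by (simp add: is_hom_def n_def)
  have sZ: "subsp n ((*\<^sub>v) i ` killed X)" by (rule subsp_image[OF ic subsp_killed[OF wX]])
  have Z: "z \<in> (*\<^sub>v) i ` killed X" if z: "z \<in> killed I" "act_b I *\<^sub>v z = f \<cdot>\<^sub>v z" for z f
  proof (cases "z = 0\<^sub>v n")
    case True
    then show ?thesis using subspD(2)[OF sZ] by simp
  next
    case False
    have zc: "z \<in> carrier_vec n" using z(1) by (simp add: killed_def n_def)
    let ?L = "{x \<cdot>\<^sub>v z | x. True}"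
    have zL: "z \<in> ?L" by (auto intro: exI[of _ 1])
    have sub: "is_submodule I ?L" by (rule line_submodule[OF I z])
    have "?L \<noteq> zero_sub I" using zL False n_def by blast
    then have "?L \<inter> (*\<^sub>v) i ` space X \<noteq> zero_sub I" using ess[OF sub] by blast
    moreover have "0\<^sub>v n \<in> ?L \<inter> (*\<^sub>v) i ` space X"
    proof -
      have "0\<^sub>v n \<in> ?L" using sub subspD(2) by (auto simp: is_submodule_iff n_def)
      moreover have "0\<^sub>v n \<in> (*\<^sub>v) i ` space X" using subspD(2)[OF subsp_image[OF ic subsp_carrier]] .
      ultimately show ?thesis by blast
    qed
    ultimately obtain y where y: "y \<in> ?L" "y \<in> (*\<^sub>v) i ` space X" "y \<noteq> 0\<^sub>v n" unfolding n_def by blast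
    then obtain c x where c: "y = c \<cdot>\<^sub>v z" and x: "x \<in> space X" "y = i *\<^sub>v x" by blast
    have "c \<noteq> 0" using y(3) c zc by (auto intro!: eq_vecI)
    have "act_a I *\<^sub>v y = 0\<^sub>v n" "act_d I *\<^sub>v y = 0\<^sub>v n"
      using z(1) zc unfolding c by (simp_all add: mult_mat_smult_vec[OF car(1)] mult_mat_smult_vec[OF car(4)] killed_def smult_zero_vec n_def)
    then have "i *\<^sub>v (act_a X *\<^sub>v x) = 0\<^sub>v n" "i *\<^sub>v (act_d X *\<^sub>v x) = 0\<^sub>v n" using h(3,6)[OF x(1)] x(2) by simp_all
    then have "act_a X *\<^sub>v x = 0\<^sub>v (rdim X)" "act_d X *\<^sub>v x = 0\<^sub>v (rdim X)"
      using inj_on_kernelD[OF ic ii] act_closed[OF wX x(1)] by blast+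
    then have "x \<in> killed X" using x(1) by (simp add: killed_def)
    then have "c \<cdot>\<^sub>v z \<in> (*\<^sub>v) i ` killed X" unfolding c[symmetric] x(2) by (rule imageI)
    then show ?thesis using subsp_smult_cancel[OF sZ \<open>c \<noteq> 0\<close>] by blast
  qed
  have vs: "v \<in> carrier_vec n" using v by (simp add: killed_def n_def)
  have bb: "act_b I *\<^sub>v (act_b I *\<^sub>v v) = v" using bc_trivialD(2)[OF I] vs by (simp add: n_def)
  have kb: "act_b I *\<^sub>v v \<in> killed I" using killed_submodule[OF I] v by (simp add: is_submodule_iff)
  have "eigen_proj f (act_b I) *\<^sub>v v \<in> (*\<^sub>v) i ` killed X" if f: "f * f = 1" for f
  proof (rule Z)
    show "eigen_proj f (act_b I) *\<^sub>v v \<in> killed I" unfolding eigen_proj_mult[OF car(2) vs]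
      using v kb subspD(3,4)[OF subsp_killed[OF wI]] by blast
    show "act_b I *\<^sub>v (eigen_proj f (act_b I) *\<^sub>v v) = f \<cdot>\<^sub>v (eigen_proj f (act_b I) *\<^sub>v v)"
      by (rule eigen_proj_eigen[OF car(2) vs bb f])
  qed
  from this[of 1] this[of "- 1"]
  have "eigen_proj 1 (act_b I) *\<^sub>v v + eigen_proj (- 1) (act_b I) *\<^sub>v v \<in> (*\<^sub>v) i ` killed X"
    using subspD(3)[OF sZ] by simp
  then show ?thesis using eigen_proj_sum[OF two car(2) vs, of 1] by simp
qed

text \<open>V(r) embeds as the socle of \<open>rep_P r\<close>. By injectivity the map from V(r)
  onto the line of z extends to \<open>rep_P r\<close>, and the image y of the generator satisfies a
  d y = z.\<close>

lemma injective_lift_socle: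
  fixes I :: "'k :: field d4_rep"
  assumes I: "is_injective I" and z: "z \<in> killed I" "act_b I *\<^sub>v z = bsign r \<cdot>\<^sub>v z" "act_c I *\<^sub>v z = bsign r \<cdot>\<^sub>v z"
  shows "\<exists>y. y \<in> space I \<and> act_b I *\<^sub>v y = bsign r \<cdot>\<^sub>v y \<and> act_a I *\<^sub>v (act_d I *\<^sub>v y) = z"
proof -
  have dI: "d4_module I" using I by (simp add: is_injective_def)
  note wI = d4_moduleD(1)[OF dI]
  note V = rep_V_act[where r = r and ?'k = 'k] and P = rep_P_basis[of r, where ?'k = 'k]
  have dP: "d4_module (rep_P r :: 'k d4_rep)" and dV: "d4_module (rep_V r :: 'k d4_rep)"
    using rep_P_module rep_V_module by (auto simp: bc_trivial_def)
  have zs: "z \<in> space I" and z0: "act_a I *\<^sub>v z = 0\<^sub>v (rdim I)" "act_d I *\<^sub>v z = 0\<^sub>v (rdim I)" using z(1) by (auto simp: killed_def)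
  have line: "is_hom (rep_V r) N (cols_mat (rdim N) 1 (\<lambda>_. x))"
    if N: "well_formed N" and x: "x \<in> space N" "act_a N *\<^sub>v x = 0\<^sub>v (rdim N)" "act_d N *\<^sub>v x = 0\<^sub>v (rdim N)"
      "act_b N *\<^sub>v x = bsign r \<cdot>\<^sub>v x" "act_c N *\<^sub>v x = bsign r \<cdot>\<^sub>v x" for N :: "'k d4_rep" and x
  proof (rule is_homI_spans[OF V(1) N _ spans_carrier])
    let ?F = "cols_mat (rdim N) 1 (\<lambda>_. x)"
    show "?F \<in> carrier_mat (rdim N) (rdim (rep_V r :: 'k d4_rep))" unfolding V(2) by (rule cols_mat_carrier)
    fix v :: "'k vec" assume "v \<in> space (rep_V r :: 'k d4_rep)"
    then have v: "v \<in> carrier_vec 1" by (simp add: V(2))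
    have F: "?F *\<^sub>v y = y $ 0 \<cdot>\<^sub>v x" if "y \<in> carrier_vec 1" for y
      using that x(1) by (intro eq_vecI) (auto simp: cols_mat_def scalar_prod_def)
    note nc = well_formedD[OF N]
    have sv: "bsign r \<cdot>\<^sub>v v \<in> carrier_vec 1" using v by simp
    have F0: "?F *\<^sub>v 0\<^sub>v 1 = 0\<^sub>v (rdim N)" by (rule mult_mat_zero_vec) simp
    have Fb: "?F *\<^sub>v (bsign r \<cdot>\<^sub>v v) = v $ 0 \<cdot>\<^sub>v (bsign r \<cdot>\<^sub>v x)"
      unfolding F[OF sv] using v by (simp add: smult_smult_assoc mult.commute)
    show "?F *\<^sub>v (act_a (rep_V r) *\<^sub>v v) = act_a N *\<^sub>v (?F *\<^sub>v v) \<and> ?F *\<^sub>v (act_b (rep_V r) *\<^sub>v v) = act_b N *\<^sub>v (?F *\<^sub>v v) \<and>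
        ?F *\<^sub>v (act_c (rep_V r) *\<^sub>v v) = act_c N *\<^sub>v (?F *\<^sub>v v) \<and> ?F *\<^sub>v (act_d (rep_V r) *\<^sub>v v) = act_d N *\<^sub>v (?F *\<^sub>v v)"
      unfolding V(3-6)[OF v] F0 Fb F[OF v]
      unfolding mult_mat_smult_vec[OF nc(1) x(1)] mult_mat_smult_vec[OF nc(2) x(1)] mult_mat_smult_vec[OF nc(3) x(1)]
        mult_mat_smult_vec[OF nc(4) x(1)] x(2-5) by (simp add: smult_zero_vec)
  qed
  define f where "f = cols_mat 4 1 (\<lambda>_. unit_vec 4 3 :: 'k vec)"
  define g where "g = cols_mat (rdim I) 1 (\<lambda>_. z)"
  have fh: "is_hom (rep_V r) (rep_P r) f"
    using line[of "rep_P r" "unit_vec 4 3"] P by (simp add: f_def)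
  have fv: "f *\<^sub>v v = v $ 0 \<cdot>\<^sub>v unit_vec 4 3" if "v \<in> carrier_vec 1" for v
    using that by (intro eq_vecI) (auto simp: f_def cols_mat_def scalar_prod_def)
  have "inj_on ((*\<^sub>v) f) (carrier_vec 1)"
  proof (rule inj_onI_kernel)
    show "f \<in> carrier_mat 4 1" by (simp add: f_def)
    fix v :: "'k vec" assume v: "v \<in> carrier_vec 1" "f *\<^sub>v v = 0\<^sub>v 4"
    then have "(v $ 0 \<cdot>\<^sub>v unit_vec 4 3) $ 3 = (0\<^sub>v 4 :: 'k vec) $ 3" using fv by simp
    then show "v = 0\<^sub>v 1" using v(1) by (intro eq_vecI) auto
  qed
  then have fm: "is_mono (rep_V r) (rep_P r) f" using fh by (simp add: is_mono_def V(2))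
  have gh: "is_hom (rep_V r) I g" unfolding g_def by (rule line[OF wI zs z0 z(2,3)])
  obtain H where H: "is_hom (rep_P r) I H" "H * f = g"
    using I dV dP fm gh unfolding is_injective_def by blast
  have Hc: "H \<in> carrier_mat (rdim I) 4" using H(1) by (simp add: is_hom_def P(2))
  have e0: "unit_vec 4 0 \<in> space (rep_P r :: 'k d4_rep)" "unit_vec 4 2 \<in> space (rep_P r :: 'k d4_rep)" by (simp_all add: P(2))
  note hH = is_homD[OF H(1) P(1) wI]
  have f0: "f *\<^sub>v unit_vec 1 0 = unit_vec 4 3" unfolding f_def by (rule cols_mat_unit) auto
  have g0: "g *\<^sub>v unit_vec 1 0 = z" unfolding g_def by (rule cols_mat_unit) (use zs in auto)
  have fc: "f \<in> carrier_mat 4 1" by (simp add: f_def)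
  have H3: "H *\<^sub>v unit_vec 4 3 = z"
    using assoc_mult_mat_vec[OF Hc fc, of "unit_vec 1 0"] f0 g0 H(2) by simp
  show ?thesis
  proof (intro exI conjI)
    show "H *\<^sub>v unit_vec 4 0 \<in> space I" using hH(2)[OF e0(1)] .
    show "act_b I *\<^sub>v (H *\<^sub>v unit_vec 4 0) = bsign r \<cdot>\<^sub>v (H *\<^sub>v unit_vec 4 0)"
      unfolding hH(4)[OF e0(1), symmetric] P(11) by (rule mult_mat_smult_vec[OF Hc]) simp
    show "act_a I *\<^sub>v (act_d I *\<^sub>v (H *\<^sub>v unit_vec 4 0)) = z"
      unfolding hH(6)[OF e0(1), symmetric] P(7) hH(3)[OF e0(2), symmetric] P(5) by (rule H3)
  qed
qed

lemma mult_lc_eq: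
  assumes "\<And>i. i < k \<Longrightarrow> V i \<in> carrier_vec n" "A \<in> carrier_mat n n" "\<And>i. i < k \<Longrightarrow> A *\<^sub>v V i = W i"
  shows "A *\<^sub>v lc n f V k = lc n f W k"
proof -
  have "A *\<^sub>v lc n f V k = lc n f (\<lambda>i. A *\<^sub>v V i) k" using assms(1) by (intro mult_lc[OF assms(2)])
  also have "\<dots> = lc n f W k" using assms(3) by (intro lc_cong) auto
  finally show ?thesis .
qed

lemma lc_cong_index:
  assumes "\<And>i l. i < k \<Longrightarrow> l < n \<Longrightarrow> f i * V i $ l = g i * W i $ l"
  shows "lc n f V k = lc n g W k"
  unfolding lc_def using assms by (intro eq_vecI) (simp_all cong: sum.cong_simp)

lemma smult_lc: "c \<cdot>\<^sub>v lc n f V k = lc n (\<lambda>i. c * f i) V k"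
  by (intro eq_vecI) (simp_all add: lc_def sum_distrib_left mult.assoc)

text \<open>Above each socle vector z_j of X in I there is some y_j with a d y_j = z_j, and the y_j,
  a y_j, d y_j, z_j span I. In I/X the z_j disappear and d y_j is identified with a y_(j+1), since
  they differ by the image of u_j. So the classes of the y_j are the upper row of a zigzag one step
  longer, whose lower row has the opposite sign.\<close>

lemma cosyzygy_omega_chain:
  fixes X C :: "'k :: field d4_rep"
  assumes two: "(2 :: 'k) \<noteq> 0" and X: "omega_chain X s (bsign r) u w" and C: "cosyzygy X C"
  shows "\<exists>u' w'. omega_chain C (Suc s) (- bsign r) u' w'"
proof -
  from C obtain I i where env: "injective_envelope X I i" and quo: "is_quotient I ((*\<^sub>v) i ` space X) C"
    by (auto simp: cosyzygy_def)
  have inj: "is_injective I" and i: "is_mono X I i"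
    and ess: "\<And>U. is_submodule I U \<Longrightarrow> U \<inter> (*\<^sub>v) i ` space X = zero_sub I \<Longrightarrow> U = zero_sub I"
    using env by (auto simp: injective_envelope_def)
  have dI: "d4_module I" using inj by (simp add: is_injective_def)
  obtain q where dC: "d4_module C" and q: "is_epi I C q" "mat_kernel q = (*\<^sub>v) i ` space X" using quo by (auto simp: is_quotient_def)
  note D = omega_chainD[OF X]
  have I: "bc_trivial I" by (rule essential_bc_trivial[OF two D(1) dI i ess])
  have tC: "bc_trivial C" by (rule bc_trivial_quotient[OF I dC q(1)])
  define n m a b d where "n = rdim I" and "m = rdim C" and "a = act_a I" and "b = act_b I" and "d = act_d I"
  define e where "e = (bsign r :: 'k)"
  have ee: "e * e = 1" by (simp add: e_def bsign_square)
  note wI = d4_moduleD(1)[OF dI] and wC = d4_moduleD(1)[OF dC] and wX = bc_trivial_well_formed[OF D(1)]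
  note car = well_formedD[OF wI, folded n_def a_def b_def d_def]
  have hi: "is_hom X I i" and ii: "inj_on ((*\<^sub>v) i) (space X)" using i by (auto simp: is_mono_def)
  have hq: "is_hom I C q" and sq: "(*\<^sub>v) q ` space I = space C" using q(1) by (auto simp: is_epi_def)
  note h = is_homD[OF hi wX wI, folded n_def a_def b_def d_def] and hC = is_homD[OF hq wI wC, folded n_def m_def a_def b_def d_def]
  have ic: "i \<in> carrier_mat n (rdim X)" and qc: "q \<in> carrier_mat m n"
    using hi hq by (auto simp: is_hom_def n_def m_def)
  define z where "z j = i *\<^sub>v w j" for j
  have zk: "z j \<in> carrier_vec n" "b *\<^sub>v z j = e \<cdot>\<^sub>v z j" "a *\<^sub>v z j = 0\<^sub>v n" "d *\<^sub>v z j = 0\<^sub>v n" if "j \<le> s" for j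
  proof -
    note wj = D(7)[OF that]
    show "z j \<in> carrier_vec n" using h(2)[OF wj] by (simp add: z_def n_def)
    show "b *\<^sub>v z j = e \<cdot>\<^sub>v z j" unfolding z_def h(4)[OF wj, symmetric] D(8)[OF that] e_def by (rule mult_mat_smult_vec[OF ic wj])
    show "a *\<^sub>v z j = 0\<^sub>v n" "d *\<^sub>v z j = 0\<^sub>v n"
      unfolding z_def h(3)[OF wj, symmetric] h(6)[OF wj, symmetric] D(9)[OF that] D(10)[OF that] by (rule mult_mat_zero_vec[OF ic])+
  qed
  have zind: "f j = 0" if "lc n f z (Suc s) = 0\<^sub>v n" "j \<le> s" for f j
  proof -
    have "i *\<^sub>v lc (rdim X) f w (Suc s) = lc n f z (Suc s)" unfolding z_def using D(7) by (intro mult_lc[OF ic]) simp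
    then have "lc (rdim X) f w (Suc s) = 0\<^sub>v (rdim X)" using inj_on_kernelD[OF ic ii] that(1) by simp
    moreover have "lc (rdim X) (\<lambda>_. 0) u s = 0\<^sub>v (rdim X)" by (rule lc_zero) simp
    ultimately show ?thesis using omega_chain_independent(2)[OF X, of "\<lambda>_. 0" f j] that(2) by simp
  qed
  have kz: "\<exists>f. v = lc n f z (Suc s)" if v: "v \<in> carrier_vec n" "a *\<^sub>v v = 0\<^sub>v n" "d *\<^sub>v v = 0\<^sub>v n" for v
  proof -
    have "v \<in> killed I" using v by (simp add: killed_def n_def a_def d_def)
    then obtain x where x: "x \<in> killed X" "v = i *\<^sub>v x" using killed_essential[OF two D(1) I i ess] by blast
    obtain f where f: "x = lc (rdim X) f w (Suc s)" by (rule killed_omega_chain[OF X x(1)])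
    have "v = lc n f z (Suc s)" unfolding x(2) f z_def using D(7) by (intro mult_lc[OF ic]) simp
    then show ?thesis by blast
  qed
  have "\<exists>y. y \<in> carrier_vec n \<and> b *\<^sub>v y = e \<cdot>\<^sub>v y \<and> a *\<^sub>v (d *\<^sub>v y) = z j" if "j \<le> s" for j
    using injective_lift_socle[OF inj, of "z j" r] zk[OF that] bc_trivialD(1)[OF I, of "z j"]
    by (simp add: killed_def n_def a_def b_def d_def e_def)
  then obtain y where y: "\<And>j. j \<le> s \<Longrightarrow> y j \<in> carrier_vec n" "\<And>j. j \<le> s \<Longrightarrow> b *\<^sub>v y j = e \<cdot>\<^sub>v y j"
    "\<And>j. j \<le> s \<Longrightarrow> a *\<^sub>v (d *\<^sub>v y j) = z j" by metis
  have ac: "a *\<^sub>v v \<in> carrier_vec n" "d *\<^sub>v v \<in> carrier_vec n" "b *\<^sub>v v \<in> carrier_vec n" if "v \<in> carrier_vec n" for v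
    using car that by auto
  note T = bc_trivialD[OF I, folded n_def a_def b_def d_def]
  have day: "d *\<^sub>v (a *\<^sub>v y j) = (- 1) \<cdot>\<^sub>v z j" if "j \<le> s" for j using T(7)[OF y(1)[OF that]] y(3)[OF that] by simp
  have bay: "b *\<^sub>v (a *\<^sub>v y j) = (- e) \<cdot>\<^sub>v (a *\<^sub>v y j)" "b *\<^sub>v (d *\<^sub>v y j) = (- e) \<cdot>\<^sub>v (d *\<^sub>v y j)" if "j \<le> s" for j
    using T(3,4)[OF y(1)[OF that]] y(1,2)[OF that]
    by (simp_all add: mult_mat_smult_vec[OF car(1)] mult_mat_smult_vec[OF car(4)] smult_smult_assoc)
  \<comment> \<open>Peeling off v: a combination of the y_j removes a d v, one of the d y_j removes
    a v, one of the a y_j removes d v. What is left is killed by a and d, so it is a combination of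
    the z_j.\<close>
  have gen: "v \<in> U" if U: "subsp n U" "\<And>j. j \<le> s \<Longrightarrow> y j \<in> U \<and> a *\<^sub>v y j \<in> U \<and> d *\<^sub>v y j \<in> U \<and> z j \<in> U" and v: "v \<in> carrier_vec n" for U v
  proof -
    have lcU: "lc n f V (Suc s) \<in> U" if "\<And>j. j \<le> s \<Longrightarrow> V j \<in> U" for f V
      by (rule lc_in_subsp[OF U(1)]) (use that in auto)
    have lcz: "lc n f z (Suc s) = a *\<^sub>v lc n f (\<lambda>j. d *\<^sub>v y j) (Suc s)" "lc n f (\<lambda>j. d *\<^sub>v y j) (Suc s) = d *\<^sub>v lc n f y (Suc s)" for f
      using mult_lc_eq[of "Suc s" "\<lambda>j. d *\<^sub>v y j" n a z f] mult_lc_eq[of "Suc s" y n d "\<lambda>j. d *\<^sub>v y j" f] y(1,3) ac car by (auto simp: less_Suc_eq_le)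
    have sub: "v \<in> U" if "x \<in> U" "v \<in> carrier_vec n" "v - x \<in> U" for v x
    proof -
      have "x + (v - x) = v" using subspD(5)[OF U(1) that(1)] that(2) by (intro eq_vecI) auto
      then show ?thesis using subspD(3)[OF U(1) that(1,3)] by simp
    qed
    have adv: "a *\<^sub>v (d *\<^sub>v v) \<in> carrier_vec n" using ac v by blast
    have "d *\<^sub>v (a *\<^sub>v (d *\<^sub>v v)) = 0\<^sub>v n"
      using T(7)[of "d *\<^sub>v v"] T(6)[OF v] ac[OF v] mult_mat_zero_vec[OF car(1)] by (simp add: smult_zero_vec)
    then obtain f where f: "a *\<^sub>v (d *\<^sub>v v) = lc n f z (Suc s)" using kz[OF adv] T(5)[OF ac(2)[OF v]] by blast
    define v1 where "v1 = v - lc n f y (Suc s)"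
    have v1: "v1 \<in> carrier_vec n" using v by (simp add: v1_def)
    have "a *\<^sub>v (d *\<^sub>v v1) = 0\<^sub>v n"
      unfolding v1_def using v ac[OF v] ac f lcz[of f]
      by (simp add: mult_mat_minus_vec[OF car(4)] mult_mat_minus_vec[OF car(1)])
    then have "d *\<^sub>v (a *\<^sub>v v1) = 0\<^sub>v n" using T(7)[OF v1] by (simp add: smult_zero_vec)
    then obtain g where g: "a *\<^sub>v v1 = lc n g z (Suc s)" using kz[OF ac(1)[OF v1] T(5)[OF v1]] by blast
    define v2 where "v2 = v1 - lc n g (\<lambda>j. d *\<^sub>v y j) (Suc s)"
    have v2: "v2 \<in> carrier_vec n" using v1 by (simp add: v2_def)
    have av2: "a *\<^sub>v v2 = 0\<^sub>v n" unfolding v2_def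
      using v1 g lcz(1)[of g] ac(1)[OF lc_carrier] by (simp add: mult_mat_minus_vec[OF car(1)])
    then have "a *\<^sub>v (d *\<^sub>v v2) = 0\<^sub>v n"
      using T(7)[OF v2] mult_mat_zero_vec[OF car(4)] ac[OF v2] ac
      by (metis smult_zero_vec smult_smult_assoc one_smult_vec square_eq_1_iff power2_eq_square mult_minus1_right minus_minus)
    then obtain k where k: "d *\<^sub>v v2 = lc n k z (Suc s)" using kz[OF ac(2)[OF v2]] T(6)[OF v2] by blast
    \<comment> \<open>The coefficients are negated because d a y_j = - z_j.\<close>
    define v3 where "v3 = v2 - lc n (\<lambda>j. - k j) (\<lambda>j. a *\<^sub>v y j) (Suc s)"
    have v3: "v3 \<in> carrier_vec n" using v2 by (simp add: v3_def)
    have "d *\<^sub>v lc n (\<lambda>j. - k j) (\<lambda>j. a *\<^sub>v y j) (Suc s) = lc n (\<lambda>j. - k j) (\<lambda>j. (- 1) \<cdot>\<^sub>v z j) (Suc s)"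
      by (rule mult_lc_eq) (use ac y(1) car day in auto)
    also have "\<dots> = lc n k z (Suc s)"
    proof (rule lc_cong_index)
      fix j l assume "j < Suc s" "l < n"
      then show "- k j * ((- 1) \<cdot>\<^sub>v z j) $ l = k j * z j $ l" using zk(1)[of j] by simp
    qed
    finally have dv3: "d *\<^sub>v v3 = 0\<^sub>v n" unfolding v3_def using v2 k by (simp add: mult_mat_minus_vec[OF car(4)])
    have "a *\<^sub>v lc n (\<lambda>j. - k j) (\<lambda>j. a *\<^sub>v y j) (Suc s) = lc n (\<lambda>j. - k j) (\<lambda>j. 0\<^sub>v n) (Suc s)"
      by (rule mult_lc_eq) (use ac y(1) car T(5) in auto)
    also have "\<dots> = 0\<^sub>v n" by (rule lc_zero) simp
    finally have "a *\<^sub>v v3 = 0\<^sub>v n" unfolding v3_def using v2 av2 by (simp add: mult_mat_minus_vec[OF car(1)])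
    then obtain l where "v3 = lc n l z (Suc s)" using kz[OF v3 _ dv3] by blast
    moreover have lcy: "lc n f y (Suc s) \<in> U" "lc n f (\<lambda>j. a *\<^sub>v y j) (Suc s) \<in> U"
      "lc n f (\<lambda>j. d *\<^sub>v y j) (Suc s) \<in> U" "lc n f z (Suc s) \<in> U" for f
      by (rule lcU; use U(2) in simp)+
    ultimately have "v3 \<in> U" by simp
    then have "v2 \<in> U" unfolding v3_def by (rule sub[OF lcy(2) v2])
    then have "v1 \<in> U" unfolding v2_def by (rule sub[OF lcy(3) v1])
    then show "v \<in> U" unfolding v1_def by (rule sub[OF lcy(1) v])
  qed
  have ker: "q *\<^sub>v v = 0\<^sub>v m \<longleftrightarrow> v \<in> (*\<^sub>v) i ` space X" if "v \<in> carrier_vec n" for v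
    using q(2) qc that by (auto simp: mat_kernel_def)
  have qz: "q *\<^sub>v z j = 0\<^sub>v m" if "j \<le> s" for j
    using ker[OF zk(1)[OF that]] D(7)[OF that] by (auto simp: z_def)
  \<comment> \<open>The difference of i u_k and d y_k - a y_(k+1) is killed by a and d, so it is a
    combination of the z_j and has sign e. It also has sign -e and is therefore zero.\<close>
  have link: "q *\<^sub>v (d *\<^sub>v y k) = q *\<^sub>v (a *\<^sub>v y (Suc k))" if k: "k < s" for k
  proof -
    define t where "t = i *\<^sub>v u k"
    define v where "v = t - (d *\<^sub>v y k - a *\<^sub>v y (Suc k))"
    note uk = D(3)[OF k]
    have ks: "k \<le> s" "Suc k \<le> s" using k by auto
    have tc: "t \<in> carrier_vec n" using h(2)[OF uk] by (simp add: t_def n_def)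
    have yc: "d *\<^sub>v y k \<in> carrier_vec n" "a *\<^sub>v y (Suc k) \<in> carrier_vec n" using ac y(1) ks by auto
    have vc: "v \<in> carrier_vec n" using tc yc by (simp add: v_def)
    have at: "a *\<^sub>v t = z k" unfolding t_def h(3)[OF uk, symmetric] D(5)[OF k] z_def ..
    have dt: "d *\<^sub>v t = z (Suc k)" unfolding t_def h(6)[OF uk, symmetric] D(6)[OF k] z_def ..
    have bt: "b *\<^sub>v t = (- e) \<cdot>\<^sub>v t" unfolding t_def h(4)[OF uk, symmetric] D(4)[OF k] e_def by (rule mult_mat_smult_vec[OF ic uk])
    have av: "a *\<^sub>v v = 0\<^sub>v n" unfolding v_def
      using tc yc at y(3)[OF ks(1)] T(5)[OF y(1)[OF ks(2)]] zk(1)[OF ks(1)] by (simp add: mult_mat_minus_vec[OF car(1)])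
    have dv: "d *\<^sub>v v = 0\<^sub>v n" unfolding v_def
      using tc yc dt day[OF ks(2)] T(6)[OF y(1)[OF ks(1)]] zk(1)[OF ks(2)]
      by (simp add: mult_mat_minus_vec[OF car(4)]) (intro eq_vecI; auto)
    have bv: "b *\<^sub>v v = (- e) \<cdot>\<^sub>v v" unfolding v_def
      using tc yc bt bay[OF ks(1)] bay[OF ks(2)]
      by (simp add: mult_mat_minus_vec[OF car(2)] smult_minus_distrib_vec[of _ n])
    obtain f where f: "v = lc n f z (Suc s)" using kz[OF vc av dv] by blast
    have "b *\<^sub>v v = e \<cdot>\<^sub>v v"
    proof -
      have "b *\<^sub>v v = lc n f (\<lambda>j. e \<cdot>\<^sub>v z j) (Suc s)" unfolding f by (rule mult_lc_eq) (use zk car in auto)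
      also have "\<dots> = e \<cdot>\<^sub>v v" unfolding f smult_lc
      proof (rule lc_cong_index)
        fix j l assume "j < Suc s" "l < n"
        then show "f j * (e \<cdot>\<^sub>v z j) $ l = e * f j * z j $ l" using zk(1)[of j] by simp
      qed
      finally show ?thesis .
    qed
    then have "v = 0\<^sub>v n"
      using eigen_proj_kill[OF car(2) vc bv ee] eigen_proj_fix[OF two car(2) vc _ ee] by simp
    then have "t = d *\<^sub>v y k - a *\<^sub>v y (Suc k)" using minus_vec_eq_zero[OF tc] yc unfolding v_def by simp
    moreover have "q *\<^sub>v t = 0\<^sub>v m" using ker[OF tc] uk by (auto simp: t_def)
    ultimately have "q *\<^sub>v (d *\<^sub>v y k) - q *\<^sub>v (a *\<^sub>v y (Suc k)) = 0\<^sub>v m" using mult_mat_minus_vec[OF qc yc] by simp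
    from minus_vec_eq_zero[OF mult_mat_vec_carrier[OF qc yc(1)] mult_mat_vec_carrier[OF qc yc(2)] this]
    show ?thesis .
  qed
  define u' where "u' j = q *\<^sub>v y j" for j
  \<comment> \<open>Representatives of the new lower row: all a y_j and, at the far end, d y_s,
    which is not linked to a further y.\<close>
  define ww where "ww j = (if j \<le> s then a *\<^sub>v y j else d *\<^sub>v y s)" for j
  define w' where "w' j = q *\<^sub>v ww j" for j
  have wwc: "ww j \<in> carrier_vec n" for j using ac y(1) by (simp add: ww_def)
  have q0: "q *\<^sub>v 0\<^sub>v n = 0\<^sub>v m" by (rule mult_mat_zero_vec[OF qc])
  have sp: "spans m (u' ` {..<Suc s} \<union> w' ` {..<Suc (Suc s)})"
    unfolding spans_def
  proof (intro conjI allI impI subsetI)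
    fix v assume "v \<in> u' ` {..<Suc s} \<union> w' ` {..<Suc (Suc s)}"
    then show "v \<in> carrier_vec m" using qc y(1) wwc by (auto simp: u'_def w'_def)
  next
    fix U and v :: "'k vec"
    assume U: "subsp m U \<and> u' ` {..<Suc s} \<union> w' ` {..<Suc (Suc s)} \<subseteq> U" and v: "v \<in> carrier_vec m"
    let ?U = "{x \<in> carrier_vec n. q *\<^sub>v x \<in> U}"
    have sU: "subsp n ?U" using subsp_vimage[OF qc] U by blast
    have w'U: "w' j \<in> U" if "j \<le> Suc s" for j using U that by auto
    have "y j \<in> ?U \<and> a *\<^sub>v y j \<in> ?U \<and> d *\<^sub>v y j \<in> ?U \<and> z j \<in> ?U" if j: "j \<le> s" for j
    proof -
      have "q *\<^sub>v y j \<in> U" using U j by (auto simp: u'_def)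
      moreover have "q *\<^sub>v (a *\<^sub>v y j) \<in> U" using w'U[of j] j by (simp add: w'_def ww_def)
      moreover have "q *\<^sub>v (d *\<^sub>v y j) \<in> U"
      proof (cases "j = s")
        case True
        then show ?thesis using w'U[of "Suc s"] by (simp add: w'_def ww_def)
      next
        case False
        then show ?thesis using w'U[of "Suc j"] link[of j] j by (simp add: w'_def ww_def)
      qed
      moreover have "q *\<^sub>v z j \<in> U" using qz[OF j] subspD(2)[of m U] U by simp
      ultimately show ?thesis using y(1)[OF j] ac zk(1)[OF j] by simp
    qed
    note all = gen[OF sU this]
    obtain x where "x \<in> carrier_vec n" "v = q *\<^sub>v x" using v sq unfolding n_def m_def by blast
    then show "v \<in> U" using all[of x] by simp
  qed
  \<comment> \<open>A relation in I/X lifts to t1 + t2 = i x. Applying a d makes all f vanish;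
    comparing a on both sides makes the coefficient of d y_s and those of the u in x vanish;
    comparing d takes care of the other g.\<close>
  have ind: "(if j < Suc s then f j else g (j - Suc s)) = 0"
    if z0: "lc m f u' (Suc s) + lc m g w' (Suc (Suc s)) = 0\<^sub>v m" and j: "j < Suc s + Suc (Suc s)" for f g j
  proof -
    define t1 where "t1 = lc n f y (Suc s)"
    define t2 where "t2 = lc n g ww (Suc (Suc s))"
    have tc: "t1 \<in> carrier_vec n" "t2 \<in> carrier_vec n" by (simp_all add: t1_def t2_def)
    have "q *\<^sub>v (t1 + t2) = q *\<^sub>v t1 + q *\<^sub>v t2" by (rule mult_add_distrib_mat_vec[OF qc tc])
    also have "q *\<^sub>v t1 = lc m f u' (Suc s)" unfolding t1_def u'_def using y(1) by (intro mult_lc[OF qc]) simp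
    also have "q *\<^sub>v t2 = lc m g w' (Suc (Suc s))" unfolding t2_def w'_def using wwc by (intro mult_lc[OF qc]) simp
    finally have "q *\<^sub>v (t1 + t2) = 0\<^sub>v m" using z0 by simp
    then obtain x where x: "x \<in> space X" "t1 + t2 = i *\<^sub>v x" using ker[of "t1 + t2"] tc by auto
    obtain k l where kl: "x = lc (rdim X) k u s + lc (rdim X) l w (Suc s)" by (rule omega_chain_lc[OF X x(1)])
    have ix: "i *\<^sub>v x = lc n k (\<lambda>j. i *\<^sub>v u j) s + lc n l z (Suc s)"
    proof -
      have "i *\<^sub>v x = i *\<^sub>v lc (rdim X) k u s + i *\<^sub>v lc (rdim X) l w (Suc s)"
        unfolding kl by (rule mult_add_distrib_mat_vec[OF ic]) auto
      moreover have "i *\<^sub>v lc (rdim X) k u s = lc n k (\<lambda>j. i *\<^sub>v u j) s" using D(3) by (intro mult_lc[OF ic]) auto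
      moreover have "i *\<^sub>v lc (rdim X) l w (Suc s) = lc n l z (Suc s)" unfolding z_def using D(7) by (intro mult_lc[OF ic]) auto
      ultimately show ?thesis by simp
    qed
    have iu: "i *\<^sub>v u j \<in> carrier_vec n" "a *\<^sub>v (i *\<^sub>v u j) = z j" "d *\<^sub>v (i *\<^sub>v u j) = z (Suc j)" if "j < s" for j
      using h(2,3,6)[OF D(3)[OF that]] D(5,6)[OF that] by (simp_all add: z_def n_def)
    have ax: "a *\<^sub>v (i *\<^sub>v x) = lc n k z s" "d *\<^sub>v (i *\<^sub>v x) = lc n k (\<lambda>j. z (Suc j)) s"
    proof -
      have 1: "lc n k (\<lambda>j. i *\<^sub>v u j) s \<in> carrier_vec n" "lc n l z (Suc s) \<in> carrier_vec n" by auto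
      have "a *\<^sub>v lc n k (\<lambda>j. i *\<^sub>v u j) s = lc n k z s" "d *\<^sub>v lc n k (\<lambda>j. i *\<^sub>v u j) s = lc n k (\<lambda>j. z (Suc j)) s"
        by (rule mult_lc_eq; use iu car in auto)+
      moreover have "a *\<^sub>v lc n l z (Suc s) = lc n l (\<lambda>_. 0\<^sub>v n) (Suc s)" "d *\<^sub>v lc n l z (Suc s) = lc n l (\<lambda>_. 0\<^sub>v n) (Suc s)"
        by (rule mult_lc_eq; use zk car in auto)+
      moreover have "lc n l (\<lambda>_. 0\<^sub>v n) (Suc s) = 0\<^sub>v n" by (rule lc_zero) simp
      ultimately show "a *\<^sub>v (i *\<^sub>v x) = lc n k z s" "d *\<^sub>v (i *\<^sub>v x) = lc n k (\<lambda>j. z (Suc j)) s"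
        unfolding ix mult_add_distrib_mat_vec[OF car(1) 1] mult_add_distrib_mat_vec[OF car(4) 1] by simp_all
    qed
    have f0: "f j = 0" if "j \<le> s" for j
    proof -
      have "d *\<^sub>v t1 = lc n f (\<lambda>j. d *\<^sub>v y j) (Suc s)" unfolding t1_def by (rule mult_lc_eq) (use y(1) car in auto)
      moreover have "a *\<^sub>v lc n f (\<lambda>j. d *\<^sub>v y j) (Suc s) = lc n f z (Suc s)" by (rule mult_lc_eq) (use y(1,3) ac car in auto)
      moreover have "d *\<^sub>v t2 = lc n g (\<lambda>j. d *\<^sub>v ww j) (Suc (Suc s))" unfolding t2_def by (rule mult_lc_eq) (use wwc car in auto)
      moreover have "a *\<^sub>v lc n g (\<lambda>j. d *\<^sub>v ww j) (Suc (Suc s)) = lc n g (\<lambda>j. 0\<^sub>v n) (Suc (Suc s))"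
      proof (rule mult_lc_eq)
        fix j show "a *\<^sub>v (d *\<^sub>v ww j) = 0\<^sub>v n"
          using day zk(1,3) T(6)[OF y(1)[of s]] mult_mat_zero_vec[OF car(1)]
          by (auto simp: ww_def mult_mat_smult_vec[OF car(1)] smult_zero_vec)
      qed (use wwc ac car in auto)
      moreover have "lc n g (\<lambda>j. 0\<^sub>v n) (Suc (Suc s)) = 0\<^sub>v n" by (rule lc_zero) simp
      moreover have "a *\<^sub>v (d *\<^sub>v (i *\<^sub>v x)) = 0\<^sub>v n"
      proof -
        have "a *\<^sub>v lc n k (\<lambda>j. z (Suc j)) s = lc n k (\<lambda>_. 0\<^sub>v n) s" by (rule mult_lc_eq) (use zk car in auto)
        also have "\<dots> = 0\<^sub>v n" by (rule lc_zero) simp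
        finally show ?thesis unfolding ax .
      qed
      moreover have "a *\<^sub>v (d *\<^sub>v (t1 + t2)) = a *\<^sub>v (d *\<^sub>v t1) + a *\<^sub>v (d *\<^sub>v t2)"
        using tc ac by (simp add: mult_add_distrib_mat_vec[OF car(4)] mult_add_distrib_mat_vec[OF car(1)])
      ultimately have "lc n f z (Suc s) = 0\<^sub>v n" using x(2) by simp
      then show ?thesis using zind that by blast
    qed
    have "t1 = 0\<^sub>v n" unfolding t1_def by (rule lc_zero) (use f0 in auto)
    then have t2: "t2 = i *\<^sub>v x" using x(2) tc by simp
    have last: "lc n g V (Suc (Suc s)) = lc n g V (Suc s) + g (Suc s) \<cdot>\<^sub>v V (Suc s)" if "V (Suc s) \<in> carrier_vec n" for V
      by (rule lc_Suc[where V = V and k = "Suc s"]) (rule that)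
    have at2: "a *\<^sub>v t2 = g (Suc s) \<cdot>\<^sub>v z s"
    proof -
      have "a *\<^sub>v t2 = lc n g (\<lambda>j. a *\<^sub>v ww j) (Suc (Suc s))" unfolding t2_def by (rule mult_lc_eq) (use wwc car in auto)
      also have "\<dots> = lc n g (\<lambda>j. a *\<^sub>v ww j) (Suc s) + g (Suc s) \<cdot>\<^sub>v (a *\<^sub>v ww (Suc s))" by (rule last) (rule ac(1)[OF wwc])
      also have "lc n g (\<lambda>j. a *\<^sub>v ww j) (Suc s) = 0\<^sub>v n" by (rule lc_zero) (use T(5) y(1) in \<open>auto simp: ww_def\<close>)
      finally show ?thesis using y(3)[of s] zk(1)[of s] by (simp add: ww_def)
    qed
    have "lc n (\<lambda>j. if j < s then k j else - g (Suc s)) z (Suc s) = 0\<^sub>v n"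
    proof -
      have "lc n (\<lambda>j. if j < s then k j else - g (Suc s)) z (Suc s) = lc n (\<lambda>j. if j < s then k j else - g (Suc s)) z s + (- g (Suc s)) \<cdot>\<^sub>v z s"
        using lc_Suc[where V = z and k = s and n = n] zk(1)[of s] by simp
      also have "lc n (\<lambda>j. if j < s then k j else - g (Suc s)) z s = lc n k z s" by (rule lc_cong) auto
      also have "lc n k z s = g (Suc s) \<cdot>\<^sub>v z s" using at2 ax(1) t2 by simp
      finally show ?thesis using zk(1)[of s] by (auto intro!: eq_vecI)
    qed
    from zind[OF this] have k0: "k j = 0" if "j < s" for j using that by (metis less_imp_le)
    from zind[OF \<open>lc n (\<lambda>j. if j < s then k j else - g (Suc s)) z (Suc s) = 0\<^sub>v n\<close>, of s] have gs: "g (Suc s) = 0" by simp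
    have "lc n (\<lambda>j. - g j) z (Suc s) = 0\<^sub>v n"
    proof -
      have "d *\<^sub>v t2 = lc n g (\<lambda>j. d *\<^sub>v ww j) (Suc (Suc s))" unfolding t2_def by (rule mult_lc_eq) (use wwc car in auto)
      also have "\<dots> = lc n g (\<lambda>j. d *\<^sub>v ww j) (Suc s) + g (Suc s) \<cdot>\<^sub>v (d *\<^sub>v ww (Suc s))" by (rule last) (rule ac(2)[OF wwc])
      also have "g (Suc s) \<cdot>\<^sub>v (d *\<^sub>v ww (Suc s)) = 0\<^sub>v n"
        using T(6)[OF y(1)[of s]] by (simp add: ww_def smult_zero_vec)
      also have "lc n g (\<lambda>j. d *\<^sub>v ww j) (Suc s) = lc n (\<lambda>j. - g j) z (Suc s)"
      proof (rule lc_cong_index)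
        fix j l assume "j < Suc s" "l < n"
        then show "g j * (d *\<^sub>v ww j) $ l = - g j * z j $ l"
          using day[of j] zk(1)[of j] by (simp add: ww_def del: index_mult_mat_vec)
      qed
      finally have "d *\<^sub>v t2 = lc n (\<lambda>j. - g j) z (Suc s)" by simp
      moreover have "d *\<^sub>v t2 = 0\<^sub>v n" unfolding t2 ax by (rule lc_zero) (use k0 in auto)
      ultimately show ?thesis by simp
    qed
    from zind[OF this] have g0: "g j = 0" if "j \<le> s" for j using that by fastforce
    show ?thesis
    proof (cases "j < Suc s")
      case True
      then show ?thesis using f0[of j] by simp
    next
      case False
      then show ?thesis using g0[of "j - Suc s"] gs j by (cases "j - Suc s = Suc s") auto
    qed
  qed
  have "m = Suc s + Suc (Suc s)"
  proof (rule spans_independent_dim)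
    let ?V = "\<lambda>i. if i < Suc s then u' i else w' (i - Suc s)"
    show "spans m (?V ` {..<Suc s + Suc (Suc s)})" unfolding append_image by (rule sp)
    fix f j assume f: "lc m f ?V (Suc s + Suc (Suc s)) = 0\<^sub>v m" and j: "j < Suc s + Suc (Suc s)"
    have "lc m f u' (Suc s) + lc m (\<lambda>i. f (i + Suc s)) w' (Suc (Suc s)) = lc m f ?V (Suc s + Suc (Suc s))"
      unfolding lc_append by (rule lc_cong) auto
    then have "lc m f u' (Suc s) + lc m (\<lambda>i. f (i + Suc s)) w' (Suc (Suc s)) = 0\<^sub>v m" using f by simp
    from ind[OF this j] show "f j = 0" by (auto split: if_splits)
  qed
  moreover have "act_b C *\<^sub>v u' j = e \<cdot>\<^sub>v u' j \<and> act_a C *\<^sub>v u' j = w' j \<and> act_d C *\<^sub>v u' j = w' (Suc j) \<and> u' j \<in> carrier_vec m" if j: "j < Suc s" for j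
  proof -
    have js: "j \<le> s" using j by simp
    note hy = hC[OF y(1)[OF js]]
    have "act_d C *\<^sub>v u' j = w' (Suc j)"
    proof (cases "j = s")
      case True
      then show ?thesis using hy(6) by (simp add: u'_def w'_def ww_def)
    next
      case False
      then show ?thesis using hy(6) link[of j] js by (simp add: u'_def w'_def ww_def)
    qed
    moreover have "act_a C *\<^sub>v u' j = w' j" using hy(3) js by (simp add: u'_def w'_def ww_def)
    moreover have "act_b C *\<^sub>v u' j = e \<cdot>\<^sub>v u' j" using hy(4) y(2)[OF js] mult_mat_smult_vec[OF qc y(1)[OF js]] by (simp add: u'_def)
    ultimately show ?thesis using qc y(1)[OF js] by (simp add: u'_def)
  qed
  moreover have "act_b C *\<^sub>v w' j = (- e) \<cdot>\<^sub>v w' j \<and> act_a C *\<^sub>v w' j = 0\<^sub>v m \<and> act_d C *\<^sub>v w' j = 0\<^sub>v m \<and> w' j \<in> carrier_vec m" for j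
  proof -
    note hw = hC[OF wwc[of j]]
    have "b *\<^sub>v ww j = (- e) \<cdot>\<^sub>v ww j" using bay by (simp add: ww_def)
    moreover have "q *\<^sub>v (a *\<^sub>v ww j) = 0\<^sub>v m" using T(5) y(1,3) qz q0 by (simp add: ww_def)
    moreover have "q *\<^sub>v (d *\<^sub>v ww j) = 0\<^sub>v m"
      using T(6) y(1) day qz q0 zk(1) by (simp add: ww_def mult_mat_smult_vec[OF qc] smult_zero_vec)
    ultimately show ?thesis
      using hw(3,4,6) mult_mat_smult_vec[OF qc wwc, of "- e"] qc wwc by (simp add: w'_def)
  qed
  ultimately have "omega_chain C (Suc s) (- e) u' w'"
    using tC sp unfolding omega_chain_def m_def by simp
  then show ?thesis unfolding e_def by blast
qed

lemma cosyzygy_pow_omega_chain: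
  fixes W :: "'k :: field d4_rep"
  assumes two: "(2 :: 'k) \<noteq> 0" and W: "cosyzygy_pow s (rep_V r) W"
  shows "\<exists>u w. omega_chain W s (if even s then bsign r else - bsign r) u w"
  using W
proof (induction s arbitrary: W)
  case 0
  then have W: "W = rep_V r" by simp
  note V = rep_V_act[where r = r and ?'k = 'k]
  have "spans 1 ((unit_vec 1 :: nat \<Rightarrow> 'k vec) ` {..<1})" by (rule spans_unit_vecs)
  \<comment> \<open>For s = 0 the upper row is empty, so the function given for u is
    arbitrary.\<close>
  then have "omega_chain W 0 (bsign r) (unit_vec 1) (unit_vec 1)"
    unfolding omega_chain_def W using V rep_V_module[of r] by simp
  then show ?case by auto
next
  case (Suc s)
  then obtain X where X: "cosyzygy_pow s (rep_V r) X" "cosyzygy X W" by auto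
  from Suc.IH[OF X(1)] obtain u w where uw: "omega_chain X s (if even s then bsign r else - bsign r) u w" by blast
  show ?case
  proof (cases "even s")
    case True
    then show ?thesis using cosyzygy_omega_chain[OF two _ X(2), of s r u w] uw by simp
  next
    case False
    \<comment> \<open>The sign is rewritten as (-1)^(r+1), because the step tests injectivity
      against \<open>rep_P\<close> and so expects a sign of the form \<open>bsign r\<close>.\<close>
    then have "omega_chain X s (bsign (r + 1)) u w" using uw unfolding bsign_add_one by simp
    from cosyzygy_omega_chain[OF two this X(2)] show ?thesis unfolding bsign_add_one using False by simp
  qed
qed

section \<open>The projective modules \<open>P(r)\<close>\<close>

lemma linear_on_basis:
  fixes V :: "nat \<Rightarrow> 'k :: field vec"
  assumes sp: "spans n (V ` {..<n})" and W: "\<And>j. j < n \<Longrightarrow> W j \<in> carrier_vec m"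
  shows "\<exists>F. F \<in> carrier_mat m n \<and> (\<forall>j<n. F *\<^sub>v V j = W j)"
proof -
  have V: "V j \<in> carrier_vec n" if "j < n" for j using sp that by (auto simp: spans_def)
  let ?A = "cols_mat n n V"
  have "carrier_vec n \<subseteq> (*\<^sub>v) ?A ` carrier_vec n"
  proof
    fix v :: "'k vec" assume "v \<in> carrier_vec n"
    then show "v \<in> (*\<^sub>v) ?A ` carrier_vec n"
    proof (rule spansD[OF sp subsp_image[OF cols_mat_carrier subsp_carrier], rotated], intro subsetI)
      fix x assume "x \<in> V ` {..<n}"
      then obtain i where "x = V i" "i \<in> {..<n}" by (rule imageE)
      then show "x \<in> (*\<^sub>v) ?A ` carrier_vec n"
        using cols_mat_unit[of i n V n] V by (intro image_eqI[of _ _ "unit_vec n i"]) auto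
    qed
  qed
  then obtain G where G: "G \<in> carrier_mat n n" "G * ?A = 1\<^sub>m n" by (rule surj_square_invertible[OF cols_mat_carrier])
  have "(cols_mat m n W * G) *\<^sub>v V j = W j" if j: "j < n" for j
  proof -
    have "G *\<^sub>v V j = unit_vec n j"
      using mult_inverse_vec[OF cols_mat_carrier G, of "unit_vec n j"] cols_mat_unit[of j n V n, OF j V[OF j]] by simp
    then show ?thesis
      using assoc_mult_mat_vec[OF cols_mat_carrier G(1) V[OF j]] cols_mat_unit[of j n W m, OF j W[OF j]] by simp
  qed
  then show ?thesis using mult_carrier_mat[OF cols_mat_carrier G(1)] by blast
qed

text \<open>The form in which P(r) enters the decomposition: four spanning vectors in dimension 4
  are a basis, so P is free on v as a module generated by a common eigenvector of b and c for
  e.\<close>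

definition free_generator :: "('k :: field) d4_rep \<Rightarrow> 'k \<Rightarrow> 'k vec \<Rightarrow> bool" where
  "free_generator P e v \<longleftrightarrow> d4_module P \<and> rdim P = 4 \<and> v \<in> space P \<and>
     act_b P *\<^sub>v v = e \<cdot>\<^sub>v v \<and> act_c P *\<^sub>v v = e \<cdot>\<^sub>v v \<and>
     spans 4 ((\<lambda>j. [v, act_a P *\<^sub>v v, act_d P *\<^sub>v v, act_a P *\<^sub>v (act_d P *\<^sub>v v)] ! j) ` {..<4})"

text \<open>Because bc v = v, the relations express the action on v, a v, d v, a d v in terms of
  these vectors, by a table that is the same in every module.\<close>

lemma generator_relations:
  assumes P: "d4_module P" and v: "v \<in> space P" "act_b P *\<^sub>v v = e \<cdot>\<^sub>v v" "act_c P *\<^sub>v v = e \<cdot>\<^sub>v v" and ee: "e * e = 1"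
  defines "x \<equiv> act_a P *\<^sub>v v" and "y \<equiv> act_d P *\<^sub>v v"
  shows "act_a P *\<^sub>v x = 0\<^sub>v (rdim P)" "act_d P *\<^sub>v y = 0\<^sub>v (rdim P)" "act_d P *\<^sub>v x = (- 1) \<cdot>\<^sub>v (act_a P *\<^sub>v y)"
    "act_a P *\<^sub>v (act_a P *\<^sub>v y) = 0\<^sub>v (rdim P)" "act_d P *\<^sub>v (act_a P *\<^sub>v y) = 0\<^sub>v (rdim P)"
    "act_b P *\<^sub>v x = (- e) \<cdot>\<^sub>v x" "act_c P *\<^sub>v x = (- e) \<cdot>\<^sub>v x" "act_b P *\<^sub>v y = (- e) \<cdot>\<^sub>v y" "act_c P *\<^sub>v y = (- e) \<cdot>\<^sub>v y"
    "act_b P *\<^sub>v (act_a P *\<^sub>v y) = e \<cdot>\<^sub>v (act_a P *\<^sub>v y)" "act_c P *\<^sub>v (act_a P *\<^sub>v y) = e \<cdot>\<^sub>v (act_a P *\<^sub>v y)"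
proof -
  define n a b c d where "n = rdim P" and "a = act_a P" and "b = act_b P" and "c = act_c P" and "d = act_d P"
  note wP = d4_moduleD(1)[OF P]
  note car = well_formedD[OF wP, folded n_def a_def b_def c_def d_def]
  have L: "d4_laws P u" if "u \<in> carrier_vec n" for u using d4_moduleD(2)[OF P] that by (simp add: n_def)
  note L' = L[unfolded d4_laws_def, folded n_def a_def b_def c_def d_def]
  note v = v[folded n_def b_def c_def]
  have xc: "x \<in> carrier_vec n" "y \<in> carrier_vec n" "a *\<^sub>v y \<in> carrier_vec n" using v(1) car by (auto simp: x_def y_def a_def d_def)
  have ax: "a *\<^sub>v x = 0\<^sub>v n" and dy: "d *\<^sub>v y = 0\<^sub>v n" using L'[OF v(1)] by (auto simp: x_def y_def a_def d_def)
  have bcv: "b *\<^sub>v (c *\<^sub>v v) = v" using v by (simp add: mult_mat_smult_vec[OF car(2)] smult_smult_assoc ee)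
  have dx: "d *\<^sub>v x = (- 1) \<cdot>\<^sub>v (a *\<^sub>v y)"
  proof -
    have s: "d *\<^sub>v x + a *\<^sub>v y = 0\<^sub>v n" using L'[OF v(1)] bcv v(1) by (simp add: x_def y_def a_def d_def)
    have c: "d *\<^sub>v x \<in> carrier_vec n" using car xc by simp
    show ?thesis
    proof (rule eq_vecI)
      fix i assume "i < dim_vec ((- 1) \<cdot>\<^sub>v (a *\<^sub>v y))"
      then have i: "i < n" using xc by (simp del: dim_mult_mat_vec)
      have "(d *\<^sub>v x + a *\<^sub>v y) $ i = 0" unfolding s using i by simp
      then show "(d *\<^sub>v x) $ i = ((- 1) \<cdot>\<^sub>v (a *\<^sub>v y)) $ i"
        using i xc c by (simp add: eq_neg_iff_add_eq_0 del: index_mult_mat_vec dim_mult_mat_vec)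
    qed (use xc c in \<open>simp del: dim_mult_mat_vec\<close>)
  qed
  have bx: "b *\<^sub>v x = (- e) \<cdot>\<^sub>v x" "c *\<^sub>v x = (- e) \<cdot>\<^sub>v x"
    using L'[OF v(1)] v by (simp_all add: x_def a_def[symmetric] mult_mat_smult_vec[OF car(1)] smult_smult_assoc)
  have swap: "u = (- 1) \<cdot>\<^sub>v w" if "w = (- 1) \<cdot>\<^sub>v u" for u w :: "'a vec" using that by (simp add: smult_smult_assoc)
  have by': "b *\<^sub>v y = (- e) \<cdot>\<^sub>v y" "c *\<^sub>v y = (- e) \<cdot>\<^sub>v y"
  proof -
    have "d *\<^sub>v (b *\<^sub>v v) = e \<cdot>\<^sub>v y" "d *\<^sub>v (c *\<^sub>v v) = e \<cdot>\<^sub>v y"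
      unfolding v(2,3) using mult_mat_smult_vec[OF car(4) v(1)] by (simp_all add: y_def d_def)
    moreover have "b *\<^sub>v y = (- 1) \<cdot>\<^sub>v (d *\<^sub>v (b *\<^sub>v v))" "c *\<^sub>v y = (- 1) \<cdot>\<^sub>v (d *\<^sub>v (c *\<^sub>v v))"
      using swap L'[OF v(1)] by (auto simp: y_def d_def)
    ultimately show "b *\<^sub>v y = (- e) \<cdot>\<^sub>v y" "c *\<^sub>v y = (- e) \<cdot>\<^sub>v y" by (simp_all add: smult_smult_assoc)
  qed
  have bay: "b *\<^sub>v (a *\<^sub>v y) = e \<cdot>\<^sub>v (a *\<^sub>v y)" "c *\<^sub>v (a *\<^sub>v y) = e \<cdot>\<^sub>v (a *\<^sub>v y)"
    using L'[OF xc(2)] by' xc(2) by (simp_all add: mult_mat_smult_vec[OF car(1)] smult_smult_assoc)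
  have bcy: "b *\<^sub>v (c *\<^sub>v y) = y" using by' xc(2) by (simp add: mult_mat_smult_vec[OF car(2)] smult_smult_assoc ee)
  have "d *\<^sub>v (a *\<^sub>v y) + a *\<^sub>v (d *\<^sub>v y) = 0\<^sub>v n" using L'[OF xc(2)] bcy xc(2) by simp
  then have "d *\<^sub>v (a *\<^sub>v y) = 0\<^sub>v n" unfolding dy mult_mat_zero_vec[OF car(1)] using car(4) xc(3) by simp
  then show "act_a P *\<^sub>v x = 0\<^sub>v (rdim P)" "act_d P *\<^sub>v y = 0\<^sub>v (rdim P)" "act_d P *\<^sub>v x = (- 1) \<cdot>\<^sub>v (act_a P *\<^sub>v y)"
    "act_a P *\<^sub>v (act_a P *\<^sub>v y) = 0\<^sub>v (rdim P)" "act_d P *\<^sub>v (act_a P *\<^sub>v y) = 0\<^sub>v (rdim P)"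
    "act_b P *\<^sub>v x = (- e) \<cdot>\<^sub>v x" "act_c P *\<^sub>v x = (- e) \<cdot>\<^sub>v x" "act_b P *\<^sub>v y = (- e) \<cdot>\<^sub>v y" "act_c P *\<^sub>v y = (- e) \<cdot>\<^sub>v y"
    "act_b P *\<^sub>v (act_a P *\<^sub>v y) = e \<cdot>\<^sub>v (act_a P *\<^sub>v y)" "act_c P *\<^sub>v (act_a P *\<^sub>v y) = e \<cdot>\<^sub>v (act_a P *\<^sub>v y)"
    using ax dy dx bx by' bay L'[OF xc(2)] by (simp_all add: n_def a_def b_def c_def d_def)
qed

text \<open>By the table of \<open>generator_relations\<close>, each generator sends each of the
  four vectors to zero or to a multiple of one of them.\<close>

lemma generator_act_closed:
  fixes P :: "'k :: field d4_rep"
  assumes P: "d4_module P" and v: "v \<in> space P" "act_b P *\<^sub>v v = e \<cdot>\<^sub>v v" "act_c P *\<^sub>v v = e \<cdot>\<^sub>v v" and ee: "e * e = 1"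
    and U: "subsp (rdim P) U"
    and V: "V = (\<lambda>j. [v, act_a P *\<^sub>v v, act_d P *\<^sub>v v, act_a P *\<^sub>v (act_d P *\<^sub>v v)] ! j)" and VU: "\<And>j. j < 4 \<Longrightarrow> V j \<in> U" and j: "j < 4"
  shows "act_a P *\<^sub>v V j \<in> U \<and> act_b P *\<^sub>v V j \<in> U \<and> act_c P *\<^sub>v V j \<in> U \<and> act_d P *\<^sub>v V j \<in> U"
proof -
  note R = generator_relations[OF P v ee]
  note D = subspD[OF U]
  have vU: "v \<in> U" "act_a P *\<^sub>v v \<in> U" "act_d P *\<^sub>v v \<in> U" "act_a P *\<^sub>v (act_d P *\<^sub>v v) \<in> U"
    using VU[of 0] VU[of 1] VU[of 2] VU[of 3] by (auto simp: V)
  have "j \<in> {..<4}" using j by simp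
  then consider "j = 0" | "j = 1" | "j = 2" | "j = 3" unfolding lessThan_four by auto
  then show ?thesis
    by cases (use vU D(2,4) in \<open>simp_all add: V R v\<close>)
qed

lemma half_fix:
  fixes v :: "'k :: field vec"
  assumes "(2 :: 'k) \<noteq> 0" "e * e = 1"
  shows "inverse 2 \<cdot>\<^sub>v (v + e \<cdot>\<^sub>v (e \<cdot>\<^sub>v v)) = v"
proof -
  have "e \<cdot>\<^sub>v (e \<cdot>\<^sub>v v) = v" using assms(2) by (simp add: smult_smult_assoc)
  moreover have "inverse 2 * (x + x) = x" for x :: 'k using assms(1) by (simp add: field_simps)
  ultimately show ?thesis by (intro eq_vecI) (auto simp del: inverse_eq_divide)
qed

text \<open>Upper bound on the dimension: a common eigenvector v above the generator of V(r)
  generates a submodule spanned by four vectors that maps onto V(r), so by minimality it is P. Lower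
  bound: by projectivity the cover lifts to a map from P to \<open>rep_P r\<close>, and this lift is
  onto.\<close>

lemma projective_cover_generator:
  fixes P :: "'k :: field d4_rep"
  assumes two: "(2 :: 'k) \<noteq> 0" and pc: "projective_cover (rep_V r) P"
  shows "\<exists>v. free_generator P (bsign r) v"
proof -
  define e where "e = (bsign r :: 'k)"
  have ee: "e * e = 1" by (simp add: e_def bsign_square)
  let ?V = "rep_V r :: 'k d4_rep" and ?Q = "rep_P r :: 'k d4_rep"
  note V = rep_V_act[where r = r and ?'k = 'k] and Q = rep_P_basis[of r, where ?'k = 'k]
  have dV: "d4_module ?V" and dQ: "d4_module ?Q" using rep_V_module rep_P_module by (auto simp: bc_trivial_def)
  have pr: "is_projective P" using pc by (simp add: projective_cover_def)
  have dP: "d4_module P" using pr by (simp add: is_projective_def)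
  obtain p where p: "is_epi P ?V p" and min: "\<And>U. is_submodule P U \<Longrightarrow> (*\<^sub>v) p ` U = space ?V \<Longrightarrow> U = space P"
    using pc by (auto simp: projective_cover_def)
  define n where "n = rdim P"
  note wP = d4_moduleD(1)[OF dP]
  note car = well_formedD[OF wP, folded n_def]
  have hp: "is_hom P ?V p" and sp: "(*\<^sub>v) p ` carrier_vec n = carrier_vec 1" using p V(2) by (auto simp: is_epi_def n_def)
  note hp' = is_homD[OF hp wP V(1), folded n_def]
  have pcar: "p \<in> carrier_mat 1 n" using hp V(2) by (simp add: is_hom_def n_def)
  obtain x where x: "x \<in> carrier_vec n" "p *\<^sub>v x = unit_vec 1 0" using sp unit_vec_carrier by (metis imageE)
  \<comment> \<open>Projecting to eigenspaces of c and of b does not change the image in V(r), since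
    both act on V(r) as e.\<close>
  define x' where "x' = eigen_proj e (act_c P) *\<^sub>v x"
  define v where "v = eigen_proj e (act_b P) *\<^sub>v x'"
  have x'c: "x' \<in> carrier_vec n" unfolding x'_def by (rule mult_mat_vec_carrier[OF eigen_proj_carrier[OF car(3)] x(1)])
  have vc: "v \<in> carrier_vec n" unfolding v_def by (rule mult_mat_vec_carrier[OF eigen_proj_carrier[OF car(2)] x'c])
  have L: "d4_laws P u" if "u \<in> carrier_vec n" for u using d4_moduleD(2)[OF dP] that by (simp add: n_def)
  note L' = L[unfolded d4_laws_def, folded n_def]
  have bv: "act_b P *\<^sub>v v = e \<cdot>\<^sub>v v" unfolding v_def using L'[OF x'c] by (intro eigen_proj_eigen[OF car(2) x'c _ ee]) simp
  have cx': "act_c P *\<^sub>v x' = e \<cdot>\<^sub>v x'" unfolding x'_def using L'[OF x(1)] by (intro eigen_proj_eigen[OF car(3) x(1) _ ee]) simp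
  have cv: "act_c P *\<^sub>v v = e \<cdot>\<^sub>v v"
  proof -
    have bx': "act_b P *\<^sub>v x' \<in> carrier_vec n" using car x'c by simp
    have "act_c P *\<^sub>v (act_b P *\<^sub>v x') = e \<cdot>\<^sub>v (act_b P *\<^sub>v x')"
      using L'[OF x'c] cx' mult_mat_smult_vec[OF car(2) x'c] by simp
    then show ?thesis unfolding v_def eigen_proj_mult[OF car(2) x'c] using bx' x'c cx'
      by (simp add: mult_mat_smult_vec[OF car(3)] mult_add_distrib_mat_vec[OF car(3)] smult_add_distrib_vec[of _ n] smult_smult_assoc mult.commute)
  qed
  have px': "p *\<^sub>v x' = unit_vec 1 0"
  proof -
    have 1: "p *\<^sub>v (act_c P *\<^sub>v x) = e \<cdot>\<^sub>v unit_vec 1 0" unfolding hp'(5)[OF x(1)] x(2) using V(6)[of "unit_vec 1 0"] by (simp add: e_def)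
    have "p *\<^sub>v x' = inverse 2 \<cdot>\<^sub>v (p *\<^sub>v x + e \<cdot>\<^sub>v (p *\<^sub>v (act_c P *\<^sub>v x)))"
      unfolding x'_def eigen_proj_mult[OF car(3) x(1)] using x(1) car(3)
      by (simp add: mult_mat_smult_vec[OF pcar] mult_add_distrib_mat_vec[OF pcar])
    then show ?thesis unfolding 1 x(2) half_fix[OF two ee] .
  qed
  have pv: "p *\<^sub>v v = unit_vec 1 0"
  proof -
    have 1: "p *\<^sub>v (act_b P *\<^sub>v x') = e \<cdot>\<^sub>v unit_vec 1 0" unfolding hp'(4)[OF x'c] px' using V(5)[of "unit_vec 1 0"] by (simp add: e_def)
    have "p *\<^sub>v v = inverse 2 \<cdot>\<^sub>v (p *\<^sub>v x' + e \<cdot>\<^sub>v (p *\<^sub>v (act_b P *\<^sub>v x')))"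
      unfolding v_def eigen_proj_mult[OF car(2) x'c] using x'c car(2)
      by (simp add: mult_mat_smult_vec[OF pcar] mult_add_distrib_mat_vec[OF pcar])
    then show ?thesis unfolding 1 px' half_fix[OF two ee] .
  qed
  define B where "B = (\<lambda>j. [v, act_a P *\<^sub>v v, act_d P *\<^sub>v v, act_a P *\<^sub>v (act_d P *\<^sub>v v)] ! j)"
  have Bc: "B j \<in> carrier_vec n" if "j < 4" for j
  proof -
    have "j \<in> {..<4}" using that by simp
    then show ?thesis unfolding lessThan_four using vc car by (auto simp: B_def)
  qed
  define A where "A = cols_mat n 4 B"
  have Ac: "A \<in> carrier_mat n 4" by (simp add: A_def)
  have Au: "A *\<^sub>v unit_vec 4 j = B j" if "j < 4" for j unfolding A_def by (rule cols_mat_unit[of _ 4 B n, OF that Bc[OF that]])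
  let ?U = "(*\<^sub>v) A ` carrier_vec 4"
  have sU: "subsp n ?U" by (rule subsp_image[OF Ac subsp_carrier])
  have BU: "B j \<in> ?U" if "j < 4" for j using Au[OF that] by (intro image_eqI[of _ _ "unit_vec 4 j"]) auto
  have U: "is_submodule P ?U"
    unfolding is_submodule_iff
  proof (intro conjI ballI)
    show "subsp (rdim P) ?U" using sU n_def by simp
    fix u assume "u \<in> ?U"
    then obtain y where y: "y \<in> carrier_vec 4" "u = A *\<^sub>v y" by blast
    note cl = generator_act_closed[OF dP vc[unfolded n_def] bv cv ee sU[unfolded n_def] B_def BU]
    have *: "m *\<^sub>v u \<in> ?U" if m: "m \<in> carrier_mat n n" and mB: "\<And>j. j < 4 \<Longrightarrow> m *\<^sub>v B j \<in> ?U" for m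
    proof -
      have mA: "m * A \<in> carrier_mat n 4" using m Ac by simp
      have mAv: "(m * A) *\<^sub>v z = m *\<^sub>v (A *\<^sub>v z)" if "z \<in> carrier_vec 4" for z by (rule assoc_mult_mat_vec[OF m Ac that])
      have "y \<in> {y \<in> carrier_vec 4. (m * A) *\<^sub>v y \<in> ?U}"
      proof (rule spansD[OF spans_unit_vecs subsp_vimage[OF mA sU] _ y(1)], rule subsetI)
        fix z :: "'k vec" assume "z \<in> unit_vec 4 ` {..<4}"
        then obtain j where "z = unit_vec 4 j" "j \<in> {..<4}" by (rule imageE)
        then show "z \<in> {y \<in> carrier_vec 4. (m * A) *\<^sub>v y \<in> ?U}" using mAv[of z] Au[of j] mB[of j] by simp
      qed
      then show ?thesis using mAv[OF y(1)] y(2) by simp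
    qed
    show "act_a P *\<^sub>v u \<in> ?U" "act_b P *\<^sub>v u \<in> ?U" "act_c P *\<^sub>v u \<in> ?U" "act_d P *\<^sub>v u \<in> ?U"
      using *[OF car(1)] *[OF car(2)] *[OF car(3)] *[OF car(4)] cl by blast+
  qed
  have "(*\<^sub>v) p ` ?U = space ?V"
  proof
    show "(*\<^sub>v) p ` ?U \<subseteq> space ?V" using pcar V(2) Ac by auto
    have "subsp 1 ((*\<^sub>v) p ` ?U)" by (rule subsp_image[OF pcar sU])
    moreover have "unit_vec 1 ` {..<1} \<subseteq> (*\<^sub>v) p ` ?U"
    proof -
      have "v \<in> ?U" using BU[of 0] by (simp add: B_def)
      then have "unit_vec 1 0 \<in> (*\<^sub>v) p ` ?U" using imageI[of v ?U "(*\<^sub>v) p"] unfolding pv by blast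
      then show ?thesis by (intro image_subsetI) (metis less_one lessThan_iff)
    qed
    ultimately have "carrier_vec 1 \<subseteq> (*\<^sub>v) p ` ?U" using spansD[OF spans_unit_vecs] by blast
    then show "space ?V \<subseteq> (*\<^sub>v) p ` ?U" using V(2) by simp
  qed
  then have UP: "?U = carrier_vec n" using min[OF U] by (simp add: n_def)
  then have n4: "n \<le> 4" using surj_dim_ge[OF Ac] by simp
  \<comment> \<open>The projection of \<open>rep_P r\<close> onto its top, the coordinate with index
    0.\<close>
  define f where "f = (mat 1 4 (\<lambda>(i, j). if j = 0 then 1 else 0) :: 'k mat)"
  have fc: "f \<in> carrier_mat 1 4" by (simp add: f_def)
  have fv: "f *\<^sub>v y = y $ 0 \<cdot>\<^sub>v unit_vec 1 0" if "y \<in> carrier_vec 4" for y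
  proof (rule eq_vecI)
    fix i assume "i < dim_vec (y $ 0 \<cdot>\<^sub>v unit_vec 1 0)"
    then have i: "i = 0" by simp
    have "row f 0 = unit_vec 4 0" by (intro eq_vecI) (auto simp: f_def)
    then show "(f *\<^sub>v y) $ i = (y $ 0 \<cdot>\<^sub>v unit_vec 1 0) $ i" using that i fc by simp
  qed (simp add: f_def)
  have fu: "f *\<^sub>v unit_vec 4 0 = unit_vec 1 0" "f *\<^sub>v unit_vec 4 (Suc 0) = 0\<^sub>v 1" "f *\<^sub>v unit_vec 4 2 = 0\<^sub>v 1" "f *\<^sub>v unit_vec 4 3 = 0\<^sub>v 1"
    by (subst fv; auto intro!: eq_vecI)+
  have f0: "f *\<^sub>v 0\<^sub>v 4 = 0\<^sub>v 1" by (rule mult_mat_zero_vec[OF fc])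
  have fh: "is_hom ?Q ?V f"
  proof (rule is_homI_spans[OF Q(1) V(1)])
    show "f \<in> carrier_mat (rdim ?V) (rdim ?Q)" using fc Q(2) V(2) by simp
    show "spans (rdim ?Q) (unit_vec 4 ` {..<4})" unfolding Q(2) by (rule spans_unit_vecs)
    fix y :: "'k vec" assume "y \<in> unit_vec 4 ` {..<4}"
    then consider "y = unit_vec 4 0" | "y = unit_vec 4 (Suc 0)" | "y = unit_vec 4 2" | "y = unit_vec 4 3"
      unfolding lessThan_four by auto
    then show "f *\<^sub>v (act_a ?Q *\<^sub>v y) = act_a ?V *\<^sub>v (f *\<^sub>v y) \<and> f *\<^sub>v (act_b ?Q *\<^sub>v y) = act_b ?V *\<^sub>v (f *\<^sub>v y) \<and>
        f *\<^sub>v (act_c ?Q *\<^sub>v y) = act_c ?V *\<^sub>v (f *\<^sub>v y) \<and> f *\<^sub>v (act_d ?Q *\<^sub>v y) = act_d ?V *\<^sub>v (f *\<^sub>v y)"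
      by cases (simp_all only: Q(3-15) fu f0 mult_mat_smult_vec[OF fc unit_vec_carrier]
          V(3)[OF unit_vec_carrier] V(4)[OF unit_vec_carrier] V(5)[OF unit_vec_carrier] V(6)[OF unit_vec_carrier]
          V(3)[OF zero_carrier_vec] V(4)[OF zero_carrier_vec] V(5)[OF zero_carrier_vec] V(6)[OF zero_carrier_vec] smult_zero_vec simp_thms)
  qed
  have fe: "is_epi ?Q ?V f"
    unfolding is_epi_def
  proof (intro conjI fh equalityI subsetI)
    fix y :: "'k vec" assume "y \<in> (*\<^sub>v) f ` space ?Q" then show "y \<in> space ?V" using fc Q(2) V(2) by auto
  next
    fix y :: "'k vec" assume "y \<in> space ?V"
    then have y: "y \<in> carrier_vec 1" using V(2) by simp
    have "f *\<^sub>v (y $ 0 \<cdot>\<^sub>v unit_vec 4 0) = y" unfolding mult_mat_smult_vec[OF fc unit_vec_carrier] fu using y by (intro eq_vecI) auto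
    then show "y \<in> (*\<^sub>v) f ` space ?Q" using Q(2) by (intro image_eqI[of _ _ "y $ 0 \<cdot>\<^sub>v unit_vec 4 0"]) auto
  qed
  obtain h where h: "is_hom P ?Q h" "f * h = p" using pr dQ dV fe hp unfolding is_projective_def by blast
  have hc: "h \<in> carrier_mat 4 n" using h(1) Q(2) by (simp add: is_hom_def n_def)
  note hh = is_homD[OF h(1) wP Q(1), folded n_def]
  note carQ = well_formedD[OF Q(1), unfolded Q(2)]
  define z where "z = h *\<^sub>v v"
  have zc: "z \<in> carrier_vec 4" using hc vc by (simp add: z_def)
  have z0: "z $ 0 = 1"
  proof -
    have "f *\<^sub>v z = unit_vec 1 0" using assoc_mult_mat_vec[OF fc hc vc] h(2) pv by (simp add: z_def)
    then have "(z $ 0 \<cdot>\<^sub>v unit_vec 1 0) $ 0 = (unit_vec 1 0 :: 'k vec) $ 0" using fv[OF zc] by simp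
    then show ?thesis by simp
  qed
  have bz: "act_b ?Q *\<^sub>v z = e \<cdot>\<^sub>v z" unfolding z_def hh(4)[OF vc, symmetric] bv by (rule mult_mat_smult_vec[OF hc vc])
  have zdec: "y = y $ 0 \<cdot>\<^sub>v unit_vec 4 0 + y $ 1 \<cdot>\<^sub>v unit_vec 4 (Suc 0) + y $ 2 \<cdot>\<^sub>v unit_vec 4 2 + y $ 3 \<cdot>\<^sub>v unit_vec 4 3"
    if "y \<in> carrier_vec 4" for y :: "'k vec"
  proof (rule eq_vecI)
    fix i assume "i < dim_vec (y $ 0 \<cdot>\<^sub>v unit_vec 4 0 + y $ 1 \<cdot>\<^sub>v unit_vec 4 (Suc 0) + y $ 2 \<cdot>\<^sub>v unit_vec 4 2 + y $ 3 \<cdot>\<^sub>v unit_vec 4 3)"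
    then have "i \<in> {..<4}" by simp
    then show "y $ i = (y $ 0 \<cdot>\<^sub>v unit_vec 4 0 + y $ 1 \<cdot>\<^sub>v unit_vec 4 (Suc 0) + y $ 2 \<cdot>\<^sub>v unit_vec 4 2 + y $ 3 \<cdot>\<^sub>v unit_vec 4 3) $ i"
      unfolding lessThan_four by auto
  qed (use that in auto)
  have act4: "m *\<^sub>v y = y $ 0 \<cdot>\<^sub>v (m *\<^sub>v unit_vec 4 0) + y $ 1 \<cdot>\<^sub>v (m *\<^sub>v unit_vec 4 (Suc 0)) + y $ 2 \<cdot>\<^sub>v (m *\<^sub>v unit_vec 4 2) + y $ 3 \<cdot>\<^sub>v (m *\<^sub>v unit_vec 4 3)"
    if "m \<in> carrier_mat 4 4" "y \<in> carrier_vec 4" for m :: "'k mat" and y :: "'k vec"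
    by (subst zdec[OF that(2)]) (simp add: mult_add_distrib_mat_vec[OF that(1)] mult_mat_smult_vec[OF that(1)])
  \<comment> \<open>z has sign e under b, while the unit vectors with index 1 and 2 have sign
    -e.\<close>
  have z12: "z $ j = 0" if j: "j = 1 \<or> j = 2" for j
  proof -
    have "(act_b ?Q *\<^sub>v z) $ j = - e * z $ j" unfolding act4[OF carQ(2) zc] Q(11-14) using j by (auto simp: e_def)
    moreover have "(act_b ?Q *\<^sub>v z) $ j = e * z $ j" unfolding bz using j zc by auto
    ultimately have "2 * (e * z $ j) = 0" by (metis add.right_inverse mult_2 mult_minus_left)
    moreover have "e \<noteq> 0" using ee by auto
    ultimately show ?thesis using two by simp
  qed
  have az: "act_a ?Q *\<^sub>v z = unit_vec 4 (Suc 0)"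
    unfolding act4[OF carQ(1) zc] Q(3-6) using z0 z12 by (intro eq_vecI) auto
  have dz: "act_d ?Q *\<^sub>v z = unit_vec 4 2"
    unfolding act4[OF carQ(4) zc] Q(7-10) using z0 z12 by (intro eq_vecI) auto
  have im: "subsp 4 ((*\<^sub>v) h ` carrier_vec n)" by (rule subsp_image[OF hc subsp_carrier])
  have avc: "act_a P *\<^sub>v v \<in> carrier_vec n" "act_d P *\<^sub>v v \<in> carrier_vec n" "act_a P *\<^sub>v (act_d P *\<^sub>v v) \<in> carrier_vec n" using car vc by auto
  have i1: "unit_vec 4 (Suc 0) \<in> (*\<^sub>v) h ` carrier_vec n"
    using avc(1) hh(3)[OF vc] az by (intro image_eqI[of _ _ "act_a P *\<^sub>v v"]) (auto simp: z_def)
  have i2: "unit_vec 4 2 \<in> (*\<^sub>v) h ` carrier_vec n"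
    using avc(2) hh(6)[OF vc] dz by (intro image_eqI[of _ _ "act_d P *\<^sub>v v"]) (auto simp: z_def)
  have i3: "unit_vec 4 3 \<in> (*\<^sub>v) h ` carrier_vec n"
    using avc(2,3) hh(3)[OF avc(2)] hh(6)[OF vc] dz Q(5) by (intro image_eqI[of _ _ "act_a P *\<^sub>v (act_d P *\<^sub>v v)"]) (auto simp: z_def)
  have i0: "unit_vec 4 0 \<in> (*\<^sub>v) h ` carrier_vec n"
  proof -
    have zi: "z \<in> (*\<^sub>v) h ` carrier_vec n" using vc by (auto simp: z_def)
    \<comment> \<open>So z differs from the generator by a multiple of the last unit vector, which
      is a d z and lies in the image too.\<close>
    have "unit_vec 4 0 = z - z $ 3 \<cdot>\<^sub>v unit_vec 4 3"
    proof (rule eq_vecI)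
      fix i assume "i < dim_vec (z - z $ 3 \<cdot>\<^sub>v unit_vec 4 3)"
      then have "i \<in> {..<4}" by simp
      then show "(unit_vec 4 0 :: 'k vec) $ i = (z - z $ 3 \<cdot>\<^sub>v unit_vec 4 3) $ i"
        unfolding lessThan_four using z0 z12 zc by auto
    qed simp
    then show ?thesis using subsp_minus[OF im zi subspD(4)[OF im i3]] by simp
  qed
  have "carrier_vec 4 \<subseteq> (*\<^sub>v) h ` carrier_vec n"
  proof
    fix y :: "'k vec" assume "y \<in> carrier_vec 4"
    then show "y \<in> (*\<^sub>v) h ` carrier_vec n"
      by (rule spansD[OF spans_unit_vecs im, rotated]) (use i0 i1 i2 i3 in \<open>auto simp: lessThan_four\<close>)
  qed
  then have "4 \<le> n" by (rule surj_dim_ge[OF hc])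
  then have n: "n = 4" using n4 by simp
  have "spans 4 (B ` {..<4})"
    unfolding spans_def
  proof (intro conjI allI impI subsetI)
    fix y assume "y \<in> B ` {..<4}" then show "y \<in> carrier_vec 4" using Bc n by auto
  next
    fix W and y :: "'k vec" assume W: "subsp 4 W \<and> B ` {..<4} \<subseteq> W" and y: "y \<in> carrier_vec 4"
    then have "y \<in> (*\<^sub>v) A ` carrier_vec 4" using UP n by simp
    then obtain c where c: "c \<in> carrier_vec 4" "y = A *\<^sub>v c" by blast
    have "y = lc n (\<lambda>i. c $ i) B 4" using cols_mat_mult[OF c(1), of n B] c(2) by (simp add: A_def)
    then show "y \<in> W" using lc_in_subsp[of n W 4 B] W n by auto
  qed
  then have "free_generator P e v"
    unfolding free_generator_def using dP n vc bv cv by (simp add: n_def B_def)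
  then show ?thesis unfolding e_def by blast
qed

text \<open>The map is prescribed on the basis v, a v, d v, a d v. It commutes with the action
  because \<open>generator_relations\<close> gives the same formulas on both sides.\<close>

lemma free_generator_hom:
  fixes P N :: "'k :: field d4_rep"
  assumes P: "free_generator P e v" and ee: "e * e = 1" and N: "d4_module N"
    and w: "w \<in> space N" "act_b N *\<^sub>v w = e \<cdot>\<^sub>v w" "act_c N *\<^sub>v w = e \<cdot>\<^sub>v w"
  shows "\<exists>F. is_hom P N F \<and> F *\<^sub>v v = w"
proof -
  have dP: "d4_module P" and n: "rdim P = 4" and v: "v \<in> space P" "act_b P *\<^sub>v v = e \<cdot>\<^sub>v v" "act_c P *\<^sub>v v = e \<cdot>\<^sub>v v"
    using P by (auto simp: free_generator_def)
  define V where "V = (\<lambda>j. [v, act_a P *\<^sub>v v, act_d P *\<^sub>v v, act_a P *\<^sub>v (act_d P *\<^sub>v v)] ! j)"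
  define W where "W = (\<lambda>j. [w, act_a N *\<^sub>v w, act_d N *\<^sub>v w, act_a N *\<^sub>v (act_d N *\<^sub>v w)] ! j)"
  have sp: "spans 4 (V ` {..<4})" using P by (simp add: free_generator_def V_def)
  note wP = d4_moduleD(1)[OF dP] and wN = d4_moduleD(1)[OF N]
  note RP = generator_relations[OF dP v ee] and RN = generator_relations[OF N w ee]
  note clN = act_closed[OF wN]
  have Wc: "W j \<in> carrier_vec (rdim N)" if "j < 4" for j
  proof -
    have "j \<in> {..<4}" using that by simp
    then show ?thesis unfolding lessThan_four using clN w(1) by (auto simp: W_def)
  qed
  have "\<exists>F. F \<in> carrier_mat (rdim N) 4 \<and> (\<forall>j<4. F *\<^sub>v V j = W j)"
    by (rule linear_on_basis[OF sp]) (rule Wc)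
  then obtain F where F: "F \<in> carrier_mat (rdim N) 4" "\<forall>j<4. F *\<^sub>v V j = W j" by (elim exE conjE)
  have Fv: "F *\<^sub>v v = w" "F *\<^sub>v (act_a P *\<^sub>v v) = act_a N *\<^sub>v w" "F *\<^sub>v (act_d P *\<^sub>v v) = act_d N *\<^sub>v w"
    "F *\<^sub>v (act_a P *\<^sub>v (act_d P *\<^sub>v v)) = act_a N *\<^sub>v (act_d N *\<^sub>v w)"
    using F(2)[rule_format, of 0] F(2)[rule_format, of 1] F(2)[rule_format, of 2] F(2)[rule_format, of 3]
    by (auto simp: V_def W_def)
  have vc: "v \<in> carrier_vec 4" "act_a P *\<^sub>v v \<in> carrier_vec 4" "act_d P *\<^sub>v v \<in> carrier_vec 4" "act_a P *\<^sub>v (act_d P *\<^sub>v v) \<in> carrier_vec 4"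
    using act_closed[OF wP] v(1) n by auto
  have "is_hom P N F"
  proof (rule is_homI_spans[OF wP wN _ sp[folded n]])
    show "F \<in> carrier_mat (rdim N) (rdim P)" using F(1) n by simp
    fix x assume "x \<in> V ` {..<rdim P}"
    then have "x = v \<or> x = act_a P *\<^sub>v v \<or> x = act_d P *\<^sub>v v \<or> x = act_a P *\<^sub>v (act_d P *\<^sub>v v)"
      unfolding n lessThan_four by (auto simp: V_def)
    then show "F *\<^sub>v (act_a P *\<^sub>v x) = act_a N *\<^sub>v (F *\<^sub>v x) \<and> F *\<^sub>v (act_b P *\<^sub>v x) = act_b N *\<^sub>v (F *\<^sub>v x) \<and>
        F *\<^sub>v (act_c P *\<^sub>v x) = act_c N *\<^sub>v (F *\<^sub>v x) \<and> F *\<^sub>v (act_d P *\<^sub>v x) = act_d N *\<^sub>v (F *\<^sub>v x)"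
      by (elim disjE) (simp_all only: RP RN v w Fv n mult_mat_smult_vec[OF F(1) vc(1)] mult_mat_smult_vec[OF F(1) vc(2)]
          mult_mat_smult_vec[OF F(1) vc(3)] mult_mat_smult_vec[OF F(1) vc(4)] mult_mat_zero_vec[OF F(1)] simp_thms)
  qed
  then show ?thesis using Fv(1) by blast
qed

section \<open>The tensor product\<close>

text \<open>The pure tensor of v and w in the indexing of \<open>kron\<close>; actions on tensor
  products are evaluated on these vectors.\<close>

definition tv :: "'k :: field vec \<Rightarrow> 'k vec \<Rightarrow> 'k vec" where
  "tv v w = vec (dim_vec v * dim_vec w) (\<lambda>i. v $ (i div dim_vec w) * w $ (i mod dim_vec w))"

lemma dim_tv [simp]: "dim_vec (tv v w) = dim_vec v * dim_vec w"
  by (simp add: tv_def)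

lemma tv_carrier [simp]: "v \<in> carrier_vec m \<Longrightarrow> w \<in> carrier_vec n \<Longrightarrow> tv v w \<in> carrier_vec (m * n)"
  by (intro carrier_vecI) auto

lemma div_mod_bounds:
  fixes i m n :: nat
  assumes "i < m * n"
  shows "i div n < m" "i mod n < n"
proof -
  have "n \<noteq> 0" using assms by (cases n) auto
  then show "i div n < m" "i mod n < n" using assms by (auto simp: less_mult_imp_div_less)
qed

lemma tv_linear:
  assumes "v \<in> carrier_vec m" "v' \<in> carrier_vec m" "w \<in> carrier_vec n" "w' \<in> carrier_vec n"
  shows "tv (v + v') w = tv v w + tv v' w" "tv v (w + w') = tv v w + tv v w'"
    "tv (c \<cdot>\<^sub>v v) w = c \<cdot>\<^sub>v tv v w" "tv v (c \<cdot>\<^sub>v w) = c \<cdot>\<^sub>v tv v w"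
    "tv (0\<^sub>v m) w = 0\<^sub>v (m * n)" "tv v (0\<^sub>v n) = 0\<^sub>v (m * n)"
  by (cases "n = 0"; use assms in \<open>auto intro!: eq_vecI simp: tv_def algebra_simps div_mod_bounds\<close>)+

lemma sum_div_mod:
  fixes f g :: "nat \<Rightarrow> 'a :: comm_semiring_0"
  shows "(\<Sum>j<k * l. f (j div l) * g (j mod l)) = (\<Sum>p<k. f p) * (\<Sum>q<l. g q)"
proof -
  have "(\<Sum>j<k * l. f (j div l) * g (j mod l)) = (\<Sum>p<k. \<Sum>j = p * l..<p * l + l. f (j div l) * g (j mod l))"
    by (rule sum.nat_group[symmetric])
  also have "\<dots> = (\<Sum>p<k. \<Sum>q<l. f p * g q)"
  proof (rule sum.cong[OF refl])
    fix p
    have "(\<Sum>j = p * l..<p * l + l. f (j div l) * g (j mod l)) = (\<Sum>q = 0..<l. f ((q + p * l) div l) * g ((q + p * l) mod l))"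
      using sum.shift_bounds_nat_ivl[of "\<lambda>j. f (j div l) * g (j mod l)" 0 "p * l" l] by (simp add: add.commute)
    also have "\<dots> = (\<Sum>q<l. f p * g q)" unfolding lessThan_atLeast0 by (rule sum.cong) auto
    finally show "(\<Sum>j = p * l..<p * l + l. f (j div l) * g (j mod l)) = (\<Sum>q<l. f p * g q)" .
  qed
  finally show ?thesis by (simp add: sum_product)
qed

lemma kron_carrier: "A \<in> carrier_mat m k \<Longrightarrow> B \<in> carrier_mat n l \<Longrightarrow> kron A B \<in> carrier_mat (m * n) (k * l)"
  by (auto simp: kron_def)

lemma kron_mult_tv:
  assumes A: "A \<in> carrier_mat m k" and B: "B \<in> carrier_mat n l" and v: "v \<in> carrier_vec k" and w: "w \<in> carrier_vec l"
  shows "kron A B *\<^sub>v tv v w = tv (A *\<^sub>v v) (B *\<^sub>v w)"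
proof (rule eq_vecI)
  fix i assume "i < dim_vec (tv (A *\<^sub>v v) (B *\<^sub>v w))"
  then have i: "i < m * n" using A B by simp
  note b = div_mod_bounds[OF i]
  have "(kron A B *\<^sub>v tv v w) $ i =
      (\<Sum>j<k * l. A $$ (i div n, j div l) * B $$ (i mod n, j mod l) * (v $ (j div l) * w $ (j mod l)))"
    using A B v w i by (auto simp: kron_def tv_def scalar_prod_def lessThan_atLeast0 intro!: sum.cong)
  also have "\<dots> = (\<Sum>j<k * l. (A $$ (i div n, j div l) * v $ (j div l)) * (B $$ (i mod n, j mod l) * w $ (j mod l)))"
    by (simp add: ac_simps)
  also have "\<dots> = (\<Sum>p<k. A $$ (i div n, p) * v $ p) * (\<Sum>q<l. B $$ (i mod n, q) * w $ q)"
    by (rule sum_div_mod[where f = "\<lambda>p. A $$ (i div n, p) * v $ p" and g = "\<lambda>q. B $$ (i mod n, q) * w $ q"])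
  also have "\<dots> = (A *\<^sub>v v) $ (i div n) * (B *\<^sub>v w) $ (i mod n)"
    using A B v w b by (simp add: scalar_prod_def lessThan_atLeast0)
  also have "\<dots> = tv (A *\<^sub>v v) (B *\<^sub>v w) $ i" using A B i by (simp add: tv_def)
  finally show "(kron A B *\<^sub>v tv v w) $ i = tv (A *\<^sub>v v) (B *\<^sub>v w) $ i" .
qed (use kron_carrier[OF A B] A B in auto)

text \<open>Bilinearity, one factor at a time: with the other factor fixed, membership in U cuts out
  a subspace.\<close>

lemma tv_subsp:
  assumes U: "subsp (m * n) U" and X: "spans m X" and Y: "spans n Y"
    and XY: "\<And>x y. x \<in> X \<Longrightarrow> y \<in> Y \<Longrightarrow> tv x y \<in> U" and v: "v \<in> carrier_vec m" and w: "w \<in> carrier_vec n"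
  shows "tv v w \<in> U"
proof -
  note D = subspD[OF U]
  have Xc: "x \<in> carrier_vec m" if "x \<in> X" for x using X that by (auto simp: spans_def)
  have xw: "tv x w \<in> U" if x: "x \<in> X" for x
  proof -
    have "subsp n {y \<in> carrier_vec n. tv x y \<in> U}"
      unfolding subsp_def using D(2-4) Xc[OF x] tv_linear[of x m x] tv_linear(6)[OF Xc[OF x] Xc[OF x] w w] by auto
    then have "w \<in> {y \<in> carrier_vec n. tv x y \<in> U}"
      by (rule spansD[OF Y _ _ w]) (use XY[OF x] Y in \<open>auto simp: spans_def\<close>)
    then show ?thesis by simp
  qed
  have "subsp m {x \<in> carrier_vec m. tv x w \<in> U}"
    unfolding subsp_def using D(2-4) tv_linear[OF _ _ w w] tv_linear(5)[OF v v w w] by auto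
  then have "v \<in> {x \<in> carrier_vec m. tv x w \<in> U}"
    by (rule spansD[OF X _ _ v]) (use xw Xc in auto)
  then show ?thesis by simp
qed

lemma spans_tv:
  "spans (m * n) {tv x y | x y. x \<in> carrier_vec m \<and> y \<in> carrier_vec n}"
  unfolding spans_def
proof (intro conjI allI impI)
  show "{tv x y | x y. x \<in> carrier_vec m \<and> y \<in> carrier_vec n} \<subseteq> (carrier_vec (m * n) :: 'a vec set)"
    by auto
  fix U :: "'a vec set" assume U: "subsp (m * n) U \<and> {tv x y | x y. x \<in> carrier_vec m \<and> y \<in> carrier_vec n} \<subseteq> U"
  show "carrier_vec (m * n) \<subseteq> U"
  proof
    fix v :: "'a vec" assume v: "v \<in> carrier_vec (m * n)"
    show "v \<in> U"
    proof (rule spansD[OF spans_unit_vecs _ _ v], goal_cases)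
      case 1 show ?case using U by blast
    next
      case 2
      show ?case
      proof
        fix z :: "'a vec" assume "z \<in> unit_vec (m * n) ` {..<m * n}"
        then obtain k where z: "z = unit_vec (m * n) k" "k \<in> {..<m * n}" by (rule imageE)
        then have k: "k < m * n" by simp
        note b = div_mod_bounds[OF k]
        \<comment> \<open>A unit vector of the product is the tensor of the unit vectors with
          indices k div n and k mod n.\<close>
        have "z = tv (unit_vec m (k div n)) (unit_vec n (k mod n))"
          unfolding z(1)
        proof (rule eq_vecI)
          fix i assume "i < dim_vec (tv (unit_vec m (k div n)) (unit_vec n (k mod n)) :: 'a vec)"
          then have i: "i < m * n" by simp
          note b' = div_mod_bounds[OF i]
          have "i div n = k div n \<Longrightarrow> i mod n = k mod n \<Longrightarrow> i = k" by (metis div_mult_mod_eq)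
          then show "unit_vec (m * n) k $ i = (tv (unit_vec m (k div n)) (unit_vec n (k mod n)) :: 'a vec) $ i"
            using i k b b' by (auto simp: tv_def)
        qed simp
        moreover have "tv (unit_vec m (k div n)) (unit_vec n (k mod n)) \<in> {tv x y | x y. x \<in> carrier_vec m \<and> y \<in> carrier_vec n}"
          using unit_vec_carrier by blast
        ultimately show "z \<in> U" using U by auto
      qed
    qed
  qed
qed

lemma well_formed_tensor:
  assumes "well_formed M" "well_formed N"
  shows "well_formed (M \<otimes>\<^sub>D N)"
  using well_formedD[OF assms(1)] well_formedD[OF assms(2)]
  by (auto simp: well_formed_def d4_tensor_def intro!: add_carrier_mat kron_carrier)

lemma rdim_tensor [simp]: "rdim (M \<otimes>\<^sub>D N) = rdim M * rdim N"
  by (simp add: d4_tensor_def)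

lemma tensor_act:
  assumes M: "well_formed M" and N: "well_formed N" and v: "v \<in> space M" and w: "w \<in> space N"
  shows "act_a (M \<otimes>\<^sub>D N) *\<^sub>v tv v w = tv (act_a M *\<^sub>v v) (act_b N *\<^sub>v w) + tv v (act_a N *\<^sub>v w)"
    "act_b (M \<otimes>\<^sub>D N) *\<^sub>v tv v w = tv (act_b M *\<^sub>v v) (act_b N *\<^sub>v w)"
    "act_c (M \<otimes>\<^sub>D N) *\<^sub>v tv v w = tv (act_c M *\<^sub>v v) (act_c N *\<^sub>v w)"
    "act_d (M \<otimes>\<^sub>D N) *\<^sub>v tv v w = tv (act_d M *\<^sub>v v) (act_c N *\<^sub>v w) + tv v (act_d N *\<^sub>v w)"
proof -
  note cM = well_formedD[OF M] and cN = well_formedD[OF N]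
  note k = kron_mult_tv[OF _ _ v w]
  note kc = kron_carrier[OF cM(1) cN(2)] kron_carrier[OF cM(4) cN(3)] kron_carrier[OF one_carrier_mat cN(1)] kron_carrier[OF one_carrier_mat cN(4)]
  note t = tv_carrier[OF v w]
  show "act_b (M \<otimes>\<^sub>D N) *\<^sub>v tv v w = tv (act_b M *\<^sub>v v) (act_b N *\<^sub>v w)"
    "act_c (M \<otimes>\<^sub>D N) *\<^sub>v tv v w = tv (act_c M *\<^sub>v v) (act_c N *\<^sub>v w)"
    using k[OF cM(2) cN(2)] k[OF cM(3) cN(3)] by (simp_all add: d4_tensor_def)
  show "act_a (M \<otimes>\<^sub>D N) *\<^sub>v tv v w = tv (act_a M *\<^sub>v v) (act_b N *\<^sub>v w) + tv v (act_a N *\<^sub>v w)"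
    using add_mult_distrib_mat_vec[OF kc(1,3) t] k[OF cM(1) cN(2)] k[OF one_carrier_mat cN(1)] v by (simp add: d4_tensor_def)
  show "act_d (M \<otimes>\<^sub>D N) *\<^sub>v tv v w = tv (act_d M *\<^sub>v v) (act_c N *\<^sub>v w) + tv v (act_d N *\<^sub>v w)"
    using add_mult_distrib_mat_vec[OF kc(2,4) t] k[OF cM(4) cN(3)] k[OF one_carrier_mat cN(4)] v by (simp add: d4_tensor_def)
qed

text \<open>On pure tensors c acts like b. The mixed terms in the squares of a and d and in d a + a
  d cancel, because a and d anticommute with b on each factor.\<close>

lemma d4_module_tensor:
  fixes M N :: "'k :: field d4_rep"
  assumes M: "bc_trivial M" and N: "bc_trivial N"
  shows "d4_module (M \<otimes>\<^sub>D N)"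
proof (rule d4_module_spansI)
  note wM = bc_trivial_well_formed[OF M] and wN = bc_trivial_well_formed[OF N]
  show wT: "well_formed (M \<otimes>\<^sub>D N)" by (rule well_formed_tensor[OF wM wN])
  show "spans (rdim (M \<otimes>\<^sub>D N)) {tv x y | x y. x \<in> space M \<and> y \<in> space N}" unfolding rdim_tensor by (rule spans_tv)
  fix z assume "z \<in> {tv x y | x y. x \<in> space M \<and> y \<in> space N}"
  then obtain v w where z: "z = tv v w" and v: "v \<in> space M" and w: "w \<in> space N" by blast
  note clM = act_closed[OF wM] and clN = act_closed[OF wN]
  note act = tensor_act[OF wM wN]
  note BM = bc_trivialD[OF M] and BN = bc_trivialD[OF N]
  note carT = well_formedD[OF wT, unfolded rdim_tensor]
  let ?n = "rdim M * rdim N"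
  note cs = v w clM[OF v] clN[OF w] clM[OF clM(1)[OF v]] clM[OF clM(2)[OF v]] clM[OF clM(4)[OF v]]
    clN[OF clN(1)[OF w]] clN[OF clN(2)[OF w]] clN[OF clN(4)[OF w]]
  have sm: "tv (c \<cdot>\<^sub>v x) y = c \<cdot>\<^sub>v tv x y" "tv x (c \<cdot>\<^sub>v y) = c \<cdot>\<^sub>v tv x y" "tv (0\<^sub>v (rdim M)) y = 0\<^sub>v ?n" "tv x (0\<^sub>v (rdim N)) = 0\<^sub>v ?n"
    if "x \<in> space M" "y \<in> space N" for x y c using tv_linear[OF that(1,1,2,2)] by auto
  have tz: "tv (0\<^sub>v (rdim M)) y = 0\<^sub>v ?n" if "y \<in> space N" for y using sm(3)[OF v that] .
  have tz': "tv x (0\<^sub>v (rdim N)) = 0\<^sub>v ?n" if "x \<in> space M" for x using sm(4)[OF that w] .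
  have cv: "act_c (M \<otimes>\<^sub>D N) *\<^sub>v tv x y = act_b (M \<otimes>\<^sub>D N) *\<^sub>v tv x y" if "x \<in> space M" "y \<in> space N" for x y
    using act[OF that] BM[OF that(1)] BN[OF that(2)] by simp
  have da: "act_d (M \<otimes>\<^sub>D N) *\<^sub>v tv x y = tv (act_d M *\<^sub>v x) (act_b N *\<^sub>v y) + tv x (act_d N *\<^sub>v y)"
    if "x \<in> space M" "y \<in> space N" for x y
    using act[OF that] BN[OF that(2)] by simp
  have tc: "tv x y \<in> carrier_vec ?n" if "x \<in> space M" "y \<in> space N" for x y using that by simp
  note addT = mult_add_distrib_mat_vec[OF carT(1) tc tc] mult_add_distrib_mat_vec[OF carT(2) tc tc]
    mult_add_distrib_mat_vec[OF carT(3) tc tc] mult_add_distrib_mat_vec[OF carT(4) tc tc]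
  note rules = act(1,2) cv da addT cs sm(1,2) tz tz' BM[OF v] BN[OF w] BM(2)[OF clM(1)[OF v]] BN(2)[OF clN(1)[OF w]] BM(2)[OF clM(4)[OF v]] BN(2)[OF clN(4)[OF w]]
  show "d4_laws (M \<otimes>\<^sub>D N) z"
    unfolding d4_laws_def z rdim_tensor
  proof (intro conjI)
    show "act_b (M \<otimes>\<^sub>D N) *\<^sub>v (act_a (M \<otimes>\<^sub>D N) *\<^sub>v tv v w) = (- 1) \<cdot>\<^sub>v (act_a (M \<otimes>\<^sub>D N) *\<^sub>v (act_b (M \<otimes>\<^sub>D N) *\<^sub>v tv v w))"
      by (simp add: rules smult_add_distrib_vec[of _ ?n])
    show "act_d (M \<otimes>\<^sub>D N) *\<^sub>v (act_b (M \<otimes>\<^sub>D N) *\<^sub>v tv v w) = (- 1) \<cdot>\<^sub>v (act_b (M \<otimes>\<^sub>D N) *\<^sub>v (act_d (M \<otimes>\<^sub>D N) *\<^sub>v tv v w))"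
      by (simp add: rules smult_add_distrib_vec[of _ ?n] smult_smult_assoc)
    show "act_c (M \<otimes>\<^sub>D N) *\<^sub>v (act_a (M \<otimes>\<^sub>D N) *\<^sub>v tv v w) = (- 1) \<cdot>\<^sub>v (act_a (M \<otimes>\<^sub>D N) *\<^sub>v (act_c (M \<otimes>\<^sub>D N) *\<^sub>v tv v w))"
      by (simp add: rules smult_add_distrib_vec[of _ ?n])
    show "act_d (M \<otimes>\<^sub>D N) *\<^sub>v (act_c (M \<otimes>\<^sub>D N) *\<^sub>v tv v w) = (- 1) \<cdot>\<^sub>v (act_c (M \<otimes>\<^sub>D N) *\<^sub>v (act_d (M \<otimes>\<^sub>D N) *\<^sub>v tv v w))"
      by (simp add: rules smult_add_distrib_vec[of _ ?n] smult_smult_assoc)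
    show "act_b (M \<otimes>\<^sub>D N) *\<^sub>v (act_c (M \<otimes>\<^sub>D N) *\<^sub>v tv v w) = act_c (M \<otimes>\<^sub>D N) *\<^sub>v (act_b (M \<otimes>\<^sub>D N) *\<^sub>v tv v w)"
      by (simp add: rules)
    show "act_b (M \<otimes>\<^sub>D N) *\<^sub>v (act_b (M \<otimes>\<^sub>D N) *\<^sub>v tv v w) = tv v w" "act_c (M \<otimes>\<^sub>D N) *\<^sub>v (act_c (M \<otimes>\<^sub>D N) *\<^sub>v tv v w) = tv v w"
      by (simp_all add: rules)
    have cancel: "(- 1) \<cdot>\<^sub>v u + u = 0\<^sub>v ?n" "u + (- 1) \<cdot>\<^sub>v u = 0\<^sub>v ?n" if "u \<in> carrier_vec ?n" for u :: "'k vec"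
      using that by (auto intro!: eq_vecI)
    show "act_a (M \<otimes>\<^sub>D N) *\<^sub>v (act_a (M \<otimes>\<^sub>D N) *\<^sub>v tv v w) = 0\<^sub>v ?n"
      by (simp add: rules cancel)
    show "act_d (M \<otimes>\<^sub>D N) *\<^sub>v (act_d (M \<otimes>\<^sub>D N) *\<^sub>v tv v w) = 0\<^sub>v ?n"
      by (simp add: rules cancel)
    have "act_d (M \<otimes>\<^sub>D N) *\<^sub>v (act_a (M \<otimes>\<^sub>D N) *\<^sub>v tv v w) + act_a (M \<otimes>\<^sub>D N) *\<^sub>v (act_d (M \<otimes>\<^sub>D N) *\<^sub>v tv v w) = 0\<^sub>v ?n"
    proof -
      \<comment> \<open>The eight terms of d a + a d cancel in four pairs.\<close>
      define p q p' q' where "p = tv (act_a M *\<^sub>v (act_d M *\<^sub>v v)) w" and "q = tv (act_a M *\<^sub>v v) (act_d N *\<^sub>v (act_b N *\<^sub>v w))"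
        and "p' = tv (act_d M *\<^sub>v v) (act_a N *\<^sub>v (act_b N *\<^sub>v w))" and "q' = tv v (act_a N *\<^sub>v (act_d N *\<^sub>v w))"
      have pq: "p \<in> carrier_vec ?n" "q \<in> carrier_vec ?n" "p' \<in> carrier_vec ?n" "q' \<in> carrier_vec ?n"
        using cs by (auto simp: p_def q_def p'_def q'_def)
      have "act_d (M \<otimes>\<^sub>D N) *\<^sub>v (act_a (M \<otimes>\<^sub>D N) *\<^sub>v tv v w) = (- 1) \<cdot>\<^sub>v p + q + ((- 1) \<cdot>\<^sub>v p' + (- 1) \<cdot>\<^sub>v q')"
        by (simp add: rules p_def q_def p'_def q'_def)
      moreover have "act_a (M \<otimes>\<^sub>D N) *\<^sub>v (act_d (M \<otimes>\<^sub>D N) *\<^sub>v tv v w) = p + p' + ((- 1) \<cdot>\<^sub>v q + q')"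
        by (simp add: rules p_def q_def p'_def q'_def)
      ultimately show ?thesis using pq by (auto intro!: eq_vecI)
    qed
    moreover have "act_b (M \<otimes>\<^sub>D N) *\<^sub>v (act_c (M \<otimes>\<^sub>D N) *\<^sub>v tv v w) = tv v w"
      by (simp add: rules)
    ultimately show "act_d (M \<otimes>\<^sub>D N) *\<^sub>v (act_a (M \<otimes>\<^sub>D N) *\<^sub>v tv v w) + act_a (M \<otimes>\<^sub>D N) *\<^sub>v (act_d (M \<otimes>\<^sub>D N) *\<^sub>v tv v w) =
        tv v w - act_b (M \<otimes>\<^sub>D N) *\<^sub>v (act_c (M \<otimes>\<^sub>D N) *\<^sub>v tv v w)"
      using tc[OF v w] by simp
  qed
qed

section \<open>Generation along the zigzag and the decomposition\<close>

lemma prev_in_subsp: "subsp n U \<Longrightarrow> (\<And>i. i < t \<Longrightarrow> y i \<in> U) \<Longrightarrow> i < t \<Longrightarrow> prev n y i \<in> U"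
  by (auto simp: prev_def subsp_def)

lemma jordan_basisD:
  assumes "jordan_basis M t e \<eta> x y"
  shows "bc_trivial M" "rdim M = t + t" "spans (rdim M) (x ` {..<t} \<union> y ` {..<t})"
    "\<And>i. i < t \<Longrightarrow> x i \<in> space M" "\<And>i. i < t \<Longrightarrow> y i \<in> space M"
    "\<And>i. i < t \<Longrightarrow> act_b M *\<^sub>v x i = (- e) \<cdot>\<^sub>v x i" "\<And>i. i < t \<Longrightarrow> act_b M *\<^sub>v y i = e \<cdot>\<^sub>v y i"
    "\<And>i. i < t \<Longrightarrow> act_a M *\<^sub>v y i = 0\<^sub>v (rdim M)" "\<And>i. i < t \<Longrightarrow> act_d M *\<^sub>v y i = 0\<^sub>v (rdim M)"
    "\<And>i. i < t \<Longrightarrow> act_a M *\<^sub>v x i = coeff_a \<eta> \<cdot>\<^sub>v y i + coeff_a' \<eta> \<cdot>\<^sub>v prev (rdim M) y i"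
    "\<And>i. i < t \<Longrightarrow> act_d M *\<^sub>v x i = coeff_d \<eta> \<cdot>\<^sub>v y i + coeff_d' \<eta> \<cdot>\<^sub>v prev (rdim M) y i"
  using assms unfolding jordan_basis_def by blast+

text \<open>The action on a Jordan basis is fixed by e and \<eta>, so every family in N that obeys
  the same formulas receives a homomorphism, be it independent or not.\<close>

lemma jordan_hom:
  fixes M N :: "'k :: field d4_rep"
  assumes M: "jordan_basis M t e \<eta> x y" and N: "well_formed N"
    and X: "\<And>i. i < t \<Longrightarrow> X i \<in> space N" and Y: "\<And>i. i < t \<Longrightarrow> Y i \<in> space N"
    and bX: "\<And>i. i < t \<Longrightarrow> act_b N *\<^sub>v X i = (- e) \<cdot>\<^sub>v X i" and bY: "\<And>i. i < t \<Longrightarrow> act_b N *\<^sub>v Y i = e \<cdot>\<^sub>v Y i"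
    and cX: "\<And>i. i < t \<Longrightarrow> act_c N *\<^sub>v X i = (- e) \<cdot>\<^sub>v X i" and cY: "\<And>i. i < t \<Longrightarrow> act_c N *\<^sub>v Y i = e \<cdot>\<^sub>v Y i"
    and aY: "\<And>i. i < t \<Longrightarrow> act_a N *\<^sub>v Y i = 0\<^sub>v (rdim N)" and dY: "\<And>i. i < t \<Longrightarrow> act_d N *\<^sub>v Y i = 0\<^sub>v (rdim N)"
    and aX: "\<And>i. i < t \<Longrightarrow> act_a N *\<^sub>v X i = coeff_a \<eta> \<cdot>\<^sub>v Y i + coeff_a' \<eta> \<cdot>\<^sub>v prev (rdim N) Y i"
    and dX: "\<And>i. i < t \<Longrightarrow> act_d N *\<^sub>v X i = coeff_d \<eta> \<cdot>\<^sub>v Y i + coeff_d' \<eta> \<cdot>\<^sub>v prev (rdim N) Y i"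
  shows "\<exists>F. is_hom M N F \<and> (\<forall>i<t. F *\<^sub>v x i = X i \<and> F *\<^sub>v y i = Y i)"
proof -
  note J = jordan_basisD[OF M]
  define m n where "m = rdim M" and "n = rdim N"
  note J = J[folded m_def] and X = X[folded n_def] and Y = Y[folded n_def]
  let ?V = "\<lambda>k. if k < t then x k else y (k - t)" and ?W = "\<lambda>k. if k < t then X k else Y (k - t)"
  have sp: "spans m (?V ` {..<m})" using J(2,3) append_image[of t x y t] by simp
  have Wc: "?W k \<in> carrier_vec n" if "k < m" for k using X[of k] Y[of "k - t"] that J(2) by auto
  have "\<exists>F. F \<in> carrier_mat n m \<and> (\<forall>k<m. F *\<^sub>v ?V k = ?W k)"
    by (rule linear_on_basis[OF sp]) (rule Wc)
  then obtain F where F: "F \<in> carrier_mat n m" "\<forall>k<m. F *\<^sub>v ?V k = ?W k" by (elim exE conjE)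
  have Fx: "F *\<^sub>v x i = X i" if "i < t" for i using F(2)[rule_format, of i] that J(2) by simp
  have Fy: "F *\<^sub>v y i = Y i" if "i < t" for i using F(2)[rule_format, of "i + t"] that J(2) by simp
  have F0: "F *\<^sub>v 0\<^sub>v m = 0\<^sub>v n" by (rule mult_mat_zero_vec[OF F(1)])
  have pc: "prev m y i \<in> carrier_vec m" if "i < t" for i
    by (rule prev_in_subsp[OF subsp_carrier J(5) that])
  have Fp: "F *\<^sub>v prev m y i = prev n Y i" if "i < t" for i
    using Fy[of "i - 1"] that F0 by (auto simp: prev_def)
  have lin: "F *\<^sub>v (p \<cdot>\<^sub>v y i + q \<cdot>\<^sub>v prev m y i) = p \<cdot>\<^sub>v Y i + q \<cdot>\<^sub>v prev n Y i" if i: "i < t" for p q i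
    using J(5)[OF i] pc[OF i] Fy[OF i] Fp[OF i]
    by (simp add: mult_add_distrib_mat_vec[OF F(1)] mult_mat_smult_vec[OF F(1)])
  note c = bc_trivialD(1)[OF J(1), folded m_def]
  have "is_hom M N F"
  proof (rule is_homI_spans[OF bc_trivial_well_formed[OF J(1)] N _ J(3)[unfolded m_def]])
    show "F \<in> carrier_mat (rdim N) (rdim M)" using F(1) by (simp add: m_def n_def)
    fix v assume "v \<in> x ` {..<t} \<union> y ` {..<t}"
    then consider i where "v = x i" "i < t" | i where "v = y i" "i < t" by blast
    then show "F *\<^sub>v (act_a M *\<^sub>v v) = act_a N *\<^sub>v (F *\<^sub>v v) \<and> F *\<^sub>v (act_b M *\<^sub>v v) = act_b N *\<^sub>v (F *\<^sub>v v) \<and>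
        F *\<^sub>v (act_c M *\<^sub>v v) = act_c N *\<^sub>v (F *\<^sub>v v) \<and> F *\<^sub>v (act_d M *\<^sub>v v) = act_d N *\<^sub>v (F *\<^sub>v v)"
    proof cases
      case (1 i)
      note i = 1(2)
      show ?thesis unfolding 1(1) Fx[OF i] aX[OF i] bX[OF i] cX[OF i] dX[OF i] c[OF J(4)[OF i]] J(6)[OF i] J(10)[OF i] J(11)[OF i]
          lin[OF i] mult_mat_smult_vec[OF F(1) J(4)[OF i]] n_def by simp
    next
      case (2 i)
      note i = 2(2)
      show ?thesis unfolding 2(1) Fy[OF i] aY[OF i] bY[OF i] cY[OF i] dY[OF i] c[OF J(5)[OF i]] J(7)[OF i] J(8)[OF i] J(9)[OF i]
          F0 mult_mat_smult_vec[OF F(1) J(5)[OF i]] n_def by simp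
    qed
  qed
  then show ?thesis using Fx Fy by blast
qed

text \<open>Formulated for abstract operators to cover both ends of the zigzag: A is the one with A
  x_i = y_i, that is a for finite \<eta> and d for \<eta> = \<infinity>. G is the action of b on W,
  and A', B' are the actions on W that go with A and B.\<close>

lemma tensor_generation:
  fixes U :: "'k :: field vec set"
  assumes U: "subsp (m * n) U"
    and A: "A \<in> carrier_mat m m" and B: "B \<in> carrier_mat m m"
    and clA: "\<And>v z. v \<in> carrier_vec m \<Longrightarrow> z \<in> carrier_vec n \<Longrightarrow> tv v z \<in> U \<Longrightarrow> tv (A *\<^sub>v v) (G *\<^sub>v z) + tv v (A' *\<^sub>v z) \<in> U"
    and clB: "\<And>v z. v \<in> carrier_vec m \<Longrightarrow> z \<in> carrier_vec n \<Longrightarrow> tv v z \<in> U \<Longrightarrow> tv (B *\<^sub>v v) (G *\<^sub>v z) + tv v (B' *\<^sub>v z) \<in> U"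
    and x: "\<And>i. i < t \<Longrightarrow> x i \<in> carrier_vec m" and y: "\<And>i. i < t \<Longrightarrow> y i \<in> carrier_vec m"
    and Ax: "\<And>i. i < t \<Longrightarrow> A *\<^sub>v x i = y i"
    and Bx: "\<And>i. i < t \<Longrightarrow> B *\<^sub>v x i = p \<cdot>\<^sub>v y i + q \<cdot>\<^sub>v prev m y i"
    and u: "\<And>j. j < s \<Longrightarrow> u j \<in> carrier_vec n" and w: "\<And>j. j \<le> s \<Longrightarrow> w j \<in> carrier_vec n"
    and f: "f \<noteq> 0" and Gu: "\<And>j. j < s \<Longrightarrow> G *\<^sub>v u j = (- f) \<cdot>\<^sub>v u j" and Gw: "\<And>j. j \<le> s \<Longrightarrow> G *\<^sub>v w j = f \<cdot>\<^sub>v w j"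
    and A'u: "\<And>j. j < s \<Longrightarrow> A' *\<^sub>v u j = w j" and B'u: "\<And>j. j < s \<Longrightarrow> B' *\<^sub>v u j = w (Suc j)"
    and A'w: "\<And>j. j \<le> s \<Longrightarrow> A' *\<^sub>v w j = 0\<^sub>v n"
    and xu: "\<And>i j. i < t \<Longrightarrow> j < s \<Longrightarrow> tv (x i) (u j) \<in> U"
    and xw: "\<And>i. i < t \<Longrightarrow> tv (x i) (w 0) \<in> U" and yw: "\<And>i. i < t \<Longrightarrow> tv (y i) (w 0) \<in> U"
    and M: "spans m (x ` {..<t} \<union> y ` {..<t})" and W: "spans n (u ` {..<s} \<union> w ` {..<Suc s})"
  shows "carrier_vec (m * n) \<subseteq> U"
proof -
  note D = subspD[OF U]
  \<comment> \<open>The operator of A sends x_i \<otimes> u_j to - f (y_i \<otimes> u_j) + x_i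
    \<otimes> w_j.\<close>
  have yu: "tv (y i) (u j) \<in> U" if w': "tv (x i) (w j) \<in> U" and ij: "i < t" "j < s" for i j
  proof -
    have "(- f) \<cdot>\<^sub>v tv (y i) (u j) + tv (x i) (w j) \<in> U"
      using clA[OF x[OF ij(1)] u[OF ij(2)] xu[OF ij]] ij x y u tv_linear(4)[OF y[OF ij(1)] y[OF ij(1)] u[OF ij(2)] u[OF ij(2)]]
      by (simp add: Ax Gu A'u)
    moreover have c: "(- f) \<cdot>\<^sub>v tv (y i) (u j) \<in> carrier_vec (m * n)" using ij y u by simp
    ultimately have "tv (x i) (w j) + (- f) \<cdot>\<^sub>v tv (y i) (u j) \<in> U" using comm_add_vec[OF c D(5)[OF w']] by simp
    then have "(- f) \<cdot>\<^sub>v tv (y i) (u j) \<in> U" by (rule subsp_add_cancel[OF U w' c])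
    then show ?thesis using subsp_smult_cancel[OF U, of "- f"] f by simp
  qed
  have step: "\<forall>i<t. tv (x i) (w j) \<in> U \<and> tv (y i) (w j) \<in> U" if "j \<le> s" for j
    using that
  proof (induction j)
    case 0
    then show ?case using xw yw by simp
  next
    case (Suc j)
    then have j: "j < s" and IH: "\<And>i. i < t \<Longrightarrow> tv (x i) (w j) \<in> U" by auto
    note uj = u[OF j]
    show ?case
    proof (intro allI impI)
      fix i assume i: "i < t"
      \<comment> \<open>All y_k \<otimes> u_j are in U, hence so is (B x_i) \<otimes> u_j. The
        operator of B applied to x_i \<otimes> u_j then yields x_i \<otimes> w_(j+1).\<close>
      have "subsp m {v \<in> carrier_vec m. tv v (u j) \<in> U}"
        unfolding subsp_def using D(2-4) tv_linear[OF _ _ uj uj] tv_linear(5)[OF x[OF i] x[OF i] uj uj] by auto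
      note S = subspD[OF this]
      have yS: "y k \<in> {v \<in> carrier_vec m. tv v (u j) \<in> U}" if "k < t" for k using yu[OF IH[OF that] that j] y that by simp
      have "prev m y i \<in> {v \<in> carrier_vec m. tv v (u j) \<in> U}"
        by (rule prev_in_subsp[OF \<open>subsp m _\<close> yS i])
      then have "B *\<^sub>v x i \<in> {v \<in> carrier_vec m. tv v (u j) \<in> U}"
        unfolding Bx[OF i] using S(3)[OF S(4)[OF yS[OF i], of p] S(4), of "prev m y i" q] by blast
      then have b: "B *\<^sub>v x i \<in> carrier_vec m" "tv (B *\<^sub>v x i) (u j) \<in> U" by auto
      have "(- f) \<cdot>\<^sub>v tv (B *\<^sub>v x i) (u j) + tv (x i) (w (Suc j)) \<in> U"
        using clB[OF x[OF i] uj xu[OF i j]] j tv_linear(4)[OF b(1) b(1) uj uj] by (simp add: Gu B'u)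
      then have 1: "tv (x i) (w (Suc j)) \<in> U"
        by (rule subsp_add_cancel[OF U D(4)[OF b(2)], rotated]) (use x[OF i] w[of "Suc j"] j in simp)
      have wj: "w (Suc j) \<in> carrier_vec n" using w j by simp
      \<comment> \<open>Since A' kills the lower row, the operator of A sends x_i \<otimes> w_(j+1)
        to f (y_i \<otimes> w_(j+1)).\<close>
      have "f \<cdot>\<^sub>v tv (y i) (w (Suc j)) \<in> U"
        using clA[OF x[OF i] wj 1] j tv_linear(4)[OF y[OF i] y[OF i] wj wj] tv_linear(6)[OF x[OF i] x[OF i] wj wj]
          tv_carrier[OF y[OF i] wj] i by (simp add: Ax Gw A'w)
      then show "tv (x i) (w (Suc j)) \<in> U \<and> tv (y i) (w (Suc j)) \<in> U" using 1 subsp_smult_cancel[OF U f] by blast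
    qed
  qed
  have all: "tv v z \<in> U" if "v \<in> x ` {..<t} \<union> y ` {..<t}" "z \<in> u ` {..<s} \<union> w ` {..<Suc s}" for v z
    using that
  proof (elim UnE imageE)
    fix i j assume "v = x i" "i \<in> {..<t}" "z = u j" "j \<in> {..<s}" then show ?thesis using xu by simp
  next
    fix i j assume "v = x i" "i \<in> {..<t}" "z = w j" "j \<in> {..<Suc s}" then show ?thesis using step[of j] by simp
  next
    fix i j assume "v = y i" "i \<in> {..<t}" "z = u j" "j \<in> {..<s}" then show ?thesis using step[of j] yu[of i j] by simp
  next
    fix i j assume "v = y i" "i \<in> {..<t}" "z = w j" "j \<in> {..<Suc s}" then show ?thesis using step[of j] by simp
  qed
  have "{tv v z | v z. v \<in> carrier_vec m \<and> z \<in> carrier_vec n} \<subseteq> U"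
    using tv_subsp[OF U M W all] by blast
  then show ?thesis using spans_tv[of m n] U unfolding spans_def by blast
qed

text \<open>Reading the zigzag from its other end exchanges a and d and permutes the spanning
  vectors.\<close>

lemma omega_chain_reverse_span:
  "(\<lambda>j. u (s - Suc j)) ` {..<s} = u ` {..<s}" "(\<lambda>j. w (s - j)) ` {..<Suc s} = w ` {..<Suc s}"
proof -
  have "(\<lambda>j. s - Suc j) ` {..<s} = {..<s}"
    by (rule endo_inj_surj) (auto intro!: inj_onI)
  then show "(\<lambda>j. u (s - Suc j)) ` {..<s} = u ` {..<s}" by (metis image_image)
  have "(\<lambda>j. s - j) ` {..<Suc s} = {..<Suc s}"
    by (rule endo_inj_surj) (auto intro!: inj_onI)
  then show "(\<lambda>j. w (s - j)) ` {..<Suc s} = w ` {..<Suc s}" by (metis image_image)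
qed

text \<open>The sign e f belongs both to y_i \<otimes> w_j, a product of e and f, and to x_i
  \<otimes> u_j, a product of -e and -f. This is why P and M' carry the same index.\<close>

lemma tensor_decomposition:
  fixes M M' W P :: "'k :: field d4_rep"
  assumes M: "jordan_basis M t e \<eta> x y" and M': "jordan_basis M' t (e * f) \<eta> x' y'"
    and W: "omega_chain W s f u w" and P: "free_generator P (e * f) g"
    and ee: "e * e = 1" and ff: "f * f = 1"
  shows "M \<otimes>\<^sub>D W \<cong>\<^sub>D copies (s * t) P \<oplus>\<^sub>D M'"
proof -
  note J = jordan_basisD[OF M] and J' = jordan_basisD[OF M'] and O = omega_chainD[OF W]
  note wM = bc_trivial_well_formed[OF J(1)] and wM' = bc_trivial_well_formed[OF J'(1)] and wW = bc_trivial_well_formed[OF O(1)]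
  have dP: "d4_module P" and rP: "rdim P = 4" and gP: "g \<in> space P" using P by (auto simp: free_generator_def)
  note wP = d4_moduleD(1)[OF dP]
  define N where "N = M \<otimes>\<^sub>D W"
  define m n where "m = rdim M" and "n = rdim W"
  have dN: "d4_module N" unfolding N_def by (rule d4_module_tensor[OF J(1) O(1)])
  note wN = d4_moduleD(1)[OF dN]
  have rN: "rdim N = m * n" by (simp add: N_def m_def n_def)
  note act = tensor_act[OF wM wW, folded N_def m_def n_def]
  note J = J[folded m_def] and O = O[folded n_def]
  have cM: "act_c M *\<^sub>v v = act_b M *\<^sub>v v" if "v \<in> carrier_vec m" for v using bc_trivialD(1)[OF J(1)] that by (simp add: m_def)
  have cW: "act_c W *\<^sub>v v = act_b W *\<^sub>v v" if "v \<in> carrier_vec n" for v using bc_trivialD(1)[OF O(1)] that by (simp add: n_def)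
  have f0: "f \<noteq> 0" using ff by auto
  have sm: "tv (p \<cdot>\<^sub>v v) z = p \<cdot>\<^sub>v tv v z" "tv v (p \<cdot>\<^sub>v z) = p \<cdot>\<^sub>v tv v z" "tv (0\<^sub>v m) z = 0\<^sub>v (m * n)" "tv v (0\<^sub>v n) = 0\<^sub>v (m * n)"
    "tv (v + v') z = tv v z + tv v' z"
    if "v \<in> carrier_vec m" "v' \<in> carrier_vec m" "z \<in> carrier_vec n" for v v' z p
    using tv_linear[OF that that(3)] by auto
  note car = well_formedD[OF wM, folded m_def] well_formedD[OF wW, folded n_def]
  have ef: "(e * f) * (e * f) = 1" using ee ff by (metis mult.left_commute mult.right_neutral mult.assoc)

  \<comment> \<open>The end of the zigzag from which \<open>tensor_generation\<close> will
    walk.\<close>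
  define h where "h = (case \<eta> of Fin _ \<Rightarrow> 0 | Infty \<Rightarrow> s)"
  have h: "h \<le> s" by (cases \<eta>) (auto simp: h_def)
  note wh = O(7)[OF h]
  have pc: "prev m y i \<in> carrier_vec m" if "i < t" for i by (rule prev_in_subsp[OF subsp_carrier J(5) that])
  \<comment> \<open>The factor f in Y absorbs the b in the coproduct of a: as a w_h = 0, the vector
    x_i \<otimes> w_h goes to (a x_i) \<otimes> (b w_h) = f (a x_i) \<otimes> w_h; likewise for
    d.\<close>
  define X Y where "X = (\<lambda>i. tv (x i) (w h))" and "Y = (\<lambda>i. f \<cdot>\<^sub>v tv (y i) (w h))"
  have XY: "X i \<in> carrier_vec (m * n)" "Y i \<in> carrier_vec (m * n)" if "i < t" for i
    using J(4,5)[OF that] wh by (auto simp: X_def Y_def)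
  have pY: "prev (m * n) Y i = f \<cdot>\<^sub>v tv (prev m y i) (w h)" if "i < t" for i
    using sm(3)[OF J(4)[OF that] J(4)[OF that] wh] by (auto simp: prev_def Y_def smult_zero_vec)
  have "\<exists>F. is_hom M' N F \<and> (\<forall>i<t. F *\<^sub>v x' i = X i \<and> F *\<^sub>v y' i = Y i)"
  proof (rule jordan_hom[OF M' wN], unfold rN)
    fix i assume i: "i < t"
    note xi = J(4)[OF i] and yi = J(5)[OF i] and pi = pc[OF i]
    note actm = mult_mat_smult_vec[OF well_formedD(1)[OF wN, unfolded rN] tv_carrier[OF yi wh]]
      mult_mat_smult_vec[OF well_formedD(2)[OF wN, unfolded rN] tv_carrier[OF yi wh]]
      mult_mat_smult_vec[OF well_formedD(3)[OF wN, unfolded rN] tv_carrier[OF yi wh]]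
      mult_mat_smult_vec[OF well_formedD(4)[OF wN, unfolded rN] tv_carrier[OF yi wh]]
    show "X i \<in> carrier_vec (m * n)" "Y i \<in> carrier_vec (m * n)" using XY[OF i] .
    have bx: "act_b N *\<^sub>v X i = (- (e * f)) \<cdot>\<^sub>v X i"
      unfolding X_def act(2)[OF xi wh] J(6)[OF i] O(8)[OF h] using sm[OF xi xi wh] sm[OF xi xi smult_carrier_vec[THEN iffD2, OF wh]]
      by (simp add: smult_smult_assoc mult.commute)
    then show "act_b N *\<^sub>v X i = (- (e * f)) \<cdot>\<^sub>v X i" .
    show "act_c N *\<^sub>v X i = (- (e * f)) \<cdot>\<^sub>v X i"
      using bx unfolding X_def act(2,3)[OF xi wh] cM[OF xi] cW[OF wh] .
    have by': "act_b N *\<^sub>v Y i = (e * f) \<cdot>\<^sub>v Y i"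
      unfolding Y_def actm act(2)[OF yi wh] J(7)[OF i] O(8)[OF h] using sm[OF yi yi wh] sm[OF yi yi smult_carrier_vec[THEN iffD2, OF wh]]
      by (simp add: smult_smult_assoc mult.commute mult.left_commute)
    then show "act_b N *\<^sub>v Y i = (e * f) \<cdot>\<^sub>v Y i" .
    show "act_c N *\<^sub>v Y i = (e * f) \<cdot>\<^sub>v Y i"
      using by' unfolding Y_def actm act(2,3)[OF yi wh] cM[OF yi] cW[OF wh] .
    have z: "tv (0\<^sub>v m) (f \<cdot>\<^sub>v w h) = 0\<^sub>v (m * n)" using sm(3)[OF yi yi smult_carrier_vec[THEN iffD2, OF wh]] .
    show "act_a N *\<^sub>v Y i = 0\<^sub>v (m * n)"
      unfolding Y_def actm act(1)[OF yi wh] J(8)[OF i] O(8,9)[OF h] z sm(4)[OF yi yi wh] by (simp add: smult_zero_vec)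
    show "act_d N *\<^sub>v Y i = 0\<^sub>v (m * n)"
      unfolding Y_def actm act(4)[OF yi wh] J(9)[OF i] cW[OF wh] O(8,10)[OF h] z sm(4)[OF yi yi wh] by (simp add: smult_zero_vec)
    have lin: "tv (p \<cdot>\<^sub>v y i + q \<cdot>\<^sub>v prev m y i) (f \<cdot>\<^sub>v w h) + tv (x i) (0\<^sub>v n) = p \<cdot>\<^sub>v Y i + q \<cdot>\<^sub>v prev (m * n) Y i" for p q
    proof -
      have fw: "f \<cdot>\<^sub>v w h \<in> carrier_vec n" using wh by simp
      have Yi: "Y i = f \<cdot>\<^sub>v tv (y i) (w h)" by (simp add: Y_def)
      have "tv (p \<cdot>\<^sub>v y i + q \<cdot>\<^sub>v prev m y i) (f \<cdot>\<^sub>v w h) = p \<cdot>\<^sub>v Y i + q \<cdot>\<^sub>v prev (m * n) Y i"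
        unfolding pY[OF i] Yi
        using yi pi fw tv_linear(1)[of "p \<cdot>\<^sub>v y i" m "q \<cdot>\<^sub>v prev m y i" "f \<cdot>\<^sub>v w h" n "f \<cdot>\<^sub>v w h"]
          tv_linear(3,4)[OF yi yi fw fw] tv_linear(3,4)[OF pi pi fw fw] tv_linear(4)[OF yi yi wh wh] tv_linear(4)[OF pi pi wh wh]
        by simp
      then show ?thesis using sm(4)[OF xi xi wh] XY(2)[OF i] pY[OF i] tv_carrier[OF pi wh] by simp
    qed
    show "act_a N *\<^sub>v X i = coeff_a \<eta> \<cdot>\<^sub>v Y i + coeff_a' \<eta> \<cdot>\<^sub>v prev (m * n) Y i"
      unfolding X_def act(1)[OF xi wh] J(10)[OF i] O(8,9)[OF h] lin ..
    show "act_d N *\<^sub>v X i = coeff_d \<eta> \<cdot>\<^sub>v Y i + coeff_d' \<eta> \<cdot>\<^sub>v prev (m * n) Y i"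
      unfolding X_def act(4)[OF xi wh] J(11)[OF i] cW[OF wh] O(8,10)[OF h] lin ..
  qed
  then obtain F where F: "is_hom M' N F" and FX: "\<forall>i<t. F *\<^sub>v x' i = X i \<and> F *\<^sub>v y' i = Y i" by (elim exE conjE)

  \<comment> \<open>The pairs (i, j) are numbered as k = j t + i, one copy of P for each x_i
    \<otimes> u_j.\<close>
  have "\<forall>k. \<exists>K. k < s * t \<longrightarrow> is_hom P N K \<and> K *\<^sub>v g = tv (x (k mod t)) (u (k div t))"
  proof
    fix k
    show "\<exists>K. k < s * t \<longrightarrow> is_hom P N K \<and> K *\<^sub>v g = tv (x (k mod t)) (u (k div t))"
    proof (cases "k < s * t")
      case True
      note b = div_mod_bounds[OF True]
      note xk = J(4)[OF b(2)] and uk = O(3)[OF b(1)]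
      have "act_b N *\<^sub>v tv (x (k mod t)) (u (k div t)) = (e * f) \<cdot>\<^sub>v tv (x (k mod t)) (u (k div t))"
        unfolding act(2)[OF xk uk] J(6)[OF b(2)] O(4)[OF b(1)] using sm[OF xk xk uk] sm[OF xk xk smult_carrier_vec[THEN iffD2, OF uk]]
        by (simp add: smult_smult_assoc mult.commute)
      moreover from this have "act_c N *\<^sub>v tv (x (k mod t)) (u (k div t)) = (e * f) \<cdot>\<^sub>v tv (x (k mod t)) (u (k div t))"
        unfolding act(2,3)[OF xk uk] cM[OF xk] cW[OF uk] .
      moreover have "tv (x (k mod t)) (u (k div t)) \<in> space N" unfolding rN using xk uk by simp
      ultimately have "\<exists>K. is_hom P N K \<and> K *\<^sub>v g = tv (x (k mod t)) (u (k div t))"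
        by (intro free_generator_hom[OF P ef dN])
      then show ?thesis by blast
    qed simp
  qed
  from choice[OF this] obtain K where K: "\<forall>k. k < s * t \<longrightarrow> is_hom P N (K k) \<and> K k *\<^sub>v g = tv (x (k mod t)) (u (k div t))" by (elim exE)
  obtain Hc where Hc: "is_hom (copies (s * t) P) N Hc"
    "\<And>k. k < s * t \<Longrightarrow> (*\<^sub>v) (K k) ` space P \<subseteq> (*\<^sub>v) Hc ` space (copies (s * t) P)"
    by (rule is_hom_copies[OF wP wN, of "s * t" K]) (use K in blast)+
  note wC = well_formed_copies[OF wP, of "s * t"]
  define H where "H = hcat Hc F"
  have H: "is_hom (copies (s * t) P \<oplus>\<^sub>D M') N H"
    "(*\<^sub>v) Hc ` space (copies (s * t) P) \<union> (*\<^sub>v) F ` space M' \<subseteq> (*\<^sub>v) H ` space (copies (s * t) P \<oplus>\<^sub>D M')"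
    unfolding H_def using is_hom_hcat[OF wC wM' wN Hc(1) F] by blast+
  define S where "S = copies (s * t) P \<oplus>\<^sub>D M'"
  note H = H[folded S_def]
  have wS: "well_formed S" unfolding S_def by (rule well_formed_sum[OF wC wM'])
  define U where "U = (*\<^sub>v) H ` space S"
  have Hcar: "H \<in> carrier_mat (m * n) (rdim S)" using H(1) rN by (simp add: is_hom_def)
  have U: "subsp (m * n) U" unfolding U_def by (rule subsp_image[OF Hcar subsp_carrier])
  have cl: "act_a N *\<^sub>v v \<in> U \<and> act_d N *\<^sub>v v \<in> U" if v: "v \<in> U" for v
  proof -
    obtain z where z: "z \<in> space S" "v = H *\<^sub>v z" using v unfolding U_def by (elim imageE)
    note hz = is_homD[OF H(1) wS wN z(1)] and az = act_closed[OF wS z(1)]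
    show ?thesis unfolding z(2) hz(3,6)[symmetric] U_def using az(1,4) by blast
  qed
  have xu: "tv (x i) (u j) \<in> U" if "i < t" "j < s" for i j
  proof -
    have lt: "j * t + i < s * t"
    proof -
      have "j * t + i < Suc j * t" using that by simp
      also have "\<dots> \<le> s * t" using that by (intro mult_le_mono1) simp
      finally show ?thesis .
    qed
    have "K (j * t + i) *\<^sub>v g = tv (x i) (u j)" using K lt that by simp
    then have "tv (x i) (u j) \<in> (*\<^sub>v) (K (j * t + i)) ` space P" using gP by (metis imageI)
    then show ?thesis unfolding U_def using Hc(2)[OF lt] H(2) by blast
  qed
  have FU: "F *\<^sub>v v \<in> U" if "v \<in> space M'" for v
    unfolding U_def using H(2) that by blast
  have xw: "tv (x i) (w h) \<in> U" if "i < t" for i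
    using FU[OF J'(4)[OF that]] FX that by (simp add: X_def)
  have yw: "tv (y i) (w h) \<in> U" if "i < t" for i
    using FU[OF J'(5)[OF that]] FX that subsp_smult_cancel[OF U f0, of "tv (y i) (w h)"] by (simp add: Y_def)
  have clA: "tv (act_a M *\<^sub>v v) (act_b W *\<^sub>v z) + tv v (act_a W *\<^sub>v z) \<in> U"
    and clD: "tv (act_d M *\<^sub>v v) (act_b W *\<^sub>v z) + tv v (act_d W *\<^sub>v z) \<in> U"
    if "v \<in> carrier_vec m" "z \<in> carrier_vec n" "tv v z \<in> U" for v z
    using cl[OF that(3)] unfolding act(1,4)[OF that(1,2)] cW[OF that(2)] by auto
  have p0: "y i + 0 \<cdot>\<^sub>v prev m y i = y i" if "i < t" for i
    using J(5)[OF that] pc[OF that] by (intro eq_vecI) auto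
  have "carrier_vec (m * n) \<subseteq> U"
  proof (cases \<eta>)
    case (Fin c)
    have y0: "act_a M *\<^sub>v x i = y i" if "i < t" for i
      using J(10)[OF that] p0[OF that] by (simp add: Fin)
    show ?thesis
      by (rule tensor_generation[OF U car(1) car(4) clA clD J(4,5) y0 J(11) O(3,7) f0 O(4,8,5,6,9) xu _ _ J(3) O(11)])
        (use xw yw in \<open>simp_all add: h_def Fin\<close>)
  next
    case Infty
    have y0: "act_d M *\<^sub>v x i = y i" if "i < t" for i
      using J(11)[OF that] p0[OF that] by (simp add: Infty)
    \<comment> \<open>Both rows are reversed, so the walk starts at w_s, and a and d exchange their
      parts.\<close>
    show ?thesis
      by (rule tensor_generation[OF U car(4) car(1) clD clA J(4,5) y0 J(10), where u = "\<lambda>j. u (s - Suc j)" and w = "\<lambda>j. w (s - j)" and s = s and f = f])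
        (use xw yw xu f0 O J(3) in \<open>simp_all add: h_def Infty omega_chain_reverse_span Suc_diff_Suc\<close>)
  qed
  then have surj: "space N \<subseteq> (*\<^sub>v) H ` space S" using rN by (simp add: U_def)
  have "rdim S = s * t * 4 + (t + t)" using J'(2) rdim_copies[of "s * t" P] rP by (simp add: S_def d4_sum_def)
  also have "\<dots> = rdim N" unfolding rN J(2) O(2) by (simp add: algebra_simps)
  finally show ?thesis using d4_iso_of_surj_hom[OF H(1) surj _ wS wN] by (simp add: N_def S_def)
qed

theorem corollary2p24:
  fixes s t :: nat
    and r r' :: bit
    and \<eta> :: "('k :: alg_closed_field) proj_line"
    and P Mt :: "bit \<Rightarrow> 'k d4_rep"
    and W :: "'k d4_rep"
  assumes "CHAR('k) \<noteq> 2"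
    and "s \<ge> 1" and "t \<ge> 1"
    and "\<And>i. projective_cover (rep_V i) (P i)"
    and "\<And>i. is_rep_M t i \<eta> (Mt i)"
    and "cosyzygy_pow s (rep_V r') W"
  shows "(odd s \<longrightarrow> Mt r \<otimes>\<^sub>D W \<cong>\<^sub>D copies (s * t) (P (r + r' + 1)) \<oplus>\<^sub>D Mt (r + r' + 1)) \<and>
         (even s \<longrightarrow> Mt r \<otimes>\<^sub>D W \<cong>\<^sub>D copies (s * t) (P (r + r')) \<oplus>\<^sub>D Mt (r + r'))"
proof -
  note two = two_neq_zero[OF assms(1)]
  define f where "f = (if even s then bsign r' else - bsign r' :: 'k)"
  \<comment> \<open>The index with sign (-1)^r f, where f is the sign of b on the lower row of W; it
    merges the two parities of s into one case.\<close>
  define q where "q = (if even s then r + r' else r + r' + 1)"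
  have q: "bsign q = bsign r * f" unfolding q_def f_def
    by (cases "even s") (simp_all only: if_True if_False bsign_add_one bsign_mult[of r r'] mult_minus_right)
  have ff: "f * f = 1" by (simp add: f_def bsign_square)
  from cosyzygy_pow_omega_chain[OF two assms(6)] obtain u w where W: "omega_chain W s f u w"
    unfolding f_def by (elim exE)
  from rep_M_jordan_basis[OF two assms(5)[of r]] obtain x y where M: "jordan_basis (Mt r) t (bsign r) \<eta> x y" by (elim exE)
  from rep_M_jordan_basis[OF two assms(5)[of q]] obtain x' y' where M': "jordan_basis (Mt q) t (bsign r * f) \<eta> x' y'"
    unfolding q[symmetric] by (elim exE)
  from projective_cover_generator[OF two assms(4)[of q]] obtain g where P: "free_generator (P q) (bsign r * f) g"
    unfolding q[symmetric] by (elim exE)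
  have "Mt r \<otimes>\<^sub>D W \<cong>\<^sub>D copies (s * t) (P q) \<oplus>\<^sub>D Mt q"
    by (rule tensor_decomposition[OF M M' W P bsign_square ff])
  then show ?thesis
    unfolding q_def by (cases "even s") (simp_all only: if_True if_False simp_thms)
qed

end
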